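(* Let $\tilde{\mathbb P}^{n+1}$ be the space of real rays $[v]_+$ in $\mathbb R^{n+2}$. Let $[v]_+\in\tilde{\mathbb P}^{n+1}$ be any point and let $S\subset T_{[v]_+}\tilde{\mathbb P}^{n+1}$ be a compact, real-analytic hypersurface that is strictly convex towards the origin in $T_{[v]_+}\tilde{\mathbb P}^{n+1}$. Then there is an open neighborhood $U$ of $[v]_+$ in $\tilde{\mathbb P}^{n+1}$, together with a Finsler structure $(\Sigma,\iota)$ on $U$, so that $\iota(\Sigma)\subset TU$ contains $S$ and so that $(\Sigma,\iota)$ is rectilinear and has constant flag curvature $1$.
   Context: Indices $i,j,k$ run from $1$ to $n$; repeated indices are summed. Finsler structures. A (not necessarily reversible) Finsler structure on an $(n+1)$-manifold $M$ is given by its unit tangent bundle (tangent indicatrix) $\Sigma\subset TM$ with $\iota:\Sigma\to TM$ the inclusion, where for each $x\in M$ the set $\Sigma_x=\Sigma\cap T_xM$ is a smooth compact hypersurface of $T_xM$ transverse to the radial direction and strictly convex towards the origin. Let $\pi:TM\to M$ be the projection. Hilbert form, Reeb field, geodesics. For $u\in\Sigma_x$ let $u^*\in T_x^*M$ be the covector with $u^*(\iota(u))=1$ whose kernel is the hyperplane $\iota'(T_u\Sigma_x)\subset T_{\iota(u)}(T_xM)\simeq T_xM$. The Hilbert form is $(\omega_0)_u=(\pi\circ\iota)^*(u^* )$, a contact form on $\Sigma$; the Reeb field $E$ satisfies $\omega_0(E)=1$, $E\lrcorner d\omega_0=0$. Geodesics are the curves in $M$ whose velocities lift to $\Sigma$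 as integral curves of $E$. Flag curvature. Locally on $\Sigma$ there are coframings $(\omega_0,\omega_i,\theta_{0i})$, with $\omega_0$ the Hilbert form and $\omega_0,\dots,\omega_n$ vanishing on the $\Sigma_x$, unique up to a simultaneous $\mathrm O(n)$-rotation of $(\omega_i)$ and $(\theta_{0i})$, with $d\omega_0=-\theta_{0j}\wedge\omega_j$, $d\omega_i=\theta_{0i}\wedge\omega_0-\theta_{ij}\wedge\omega_j-I_{ijk}\theta_{0k}\wedge\omega_j$ for some $\theta_{ij}=-\theta_{ji}$ and fully symmetric $I_{ijk}$; then $d\theta_{0i}=-\theta_{0j}\wedge\theta_{ji}+R_{0i0j}\,\omega_0\wedge\omega_j+\tfrac12R_{0ijk}\,\omega_j\wedge\omega_k+J_{ijk}\,\theta_{0k}\wedge\omega_j$ with $R_{0i0j}=R_{0j0i}$, $R_{0ijk}=-R_{0ikj}$, $J_{ijk}=J_{jik}$. Constant flag curvature $1$ means $R_{0i0j}=\delta_{ij}$. Rectilinearity. Lines in $\tilde{\mathbb P}^{n+1}$ are the oriented circles parametrized by $s\mapsto[(\cos s)v+(\sin s)w]_+$ with $v,w\in\mathbb R^{n+2}$ linearly independent. A Finsler structure on an open set of $\tilde{\mathbb P}^{n+1}$ is rectilinear if each of its oriented geodesics is (an arc of) a line, up to reparametrization. *)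

theory Defs
  imports "HOL-Analysis.Analysis"
begin

section \<open>Smooth and real-analytic maps on open sets\<close>

text \<open>Of class C-k on an open set \<open>A\<close>: all iterated directional derivatives of order at most \<open>k\<close>
  exist and are continuous.\<close>

primrec Ck_on :: "nat \<Rightarrow> 'b::real_normed_vector set \<Rightarrow> ('b \<Rightarrow> 'c::real_normed_vector) \<Rightarrow> bool" where
  "Ck_on 0 A f \<longleftrightarrow> continuous_on A f"
| "Ck_on (Suc k) A f \<longleftrightarrow>
     (\<forall>x\<in>A. f differentiable (at x)) \<and> (\<forall>h. Ck_on k A (\<lambda>x. frechet_derivative f (at x) h))"

definition smooth_on :: "'b::real_normed_vector set \<Rightarrow> ('b \<Rightarrow> 'c::real_normed_vector) \<Rightarrow> bool" where
  "smooth_on A f \<longleftrightarrow> (\<forall>k. Ck_on k A f)"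

text \<open>Local expansion in a power series in the coordinates of \<open>h\<close>; the multi-indices \<open>m\<close> are the
  functions from the standard basis to the natural numbers.\<close>

definition real_analytic_on :: "'b::euclidean_space set \<Rightarrow> ('b \<Rightarrow> real) \<Rightarrow> bool" where
  "real_analytic_on A f \<longleftrightarrow>
     (\<forall>a\<in>A. \<exists>c :: ('b \<Rightarrow> nat) \<Rightarrow> real. \<exists>r>0. \<forall>h. norm h < r \<longrightarrow>
        ((\<lambda>m. c m * (\<Prod>b\<in>Basis. (h \<bullet> b) ^ m b)) has_sum f (a + h)) (Basis \<rightarrow>\<^sub>E UNIV))"


section \<open>The space of rays\<close>

text \<open>A ray is represented by the unit vector on it. This identifies the space of rays
  diffeomorphically with the unit sphere, and the tangent space at a ray with the orthogonal
  complement of its unit vector; the tangent bundle of the space of rays then consists of pairs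
  (unit vector, orthogonal vector).\<close>

definition ray :: "'a::euclidean_space \<Rightarrow> 'a" where
  "ray v = v /\<^sub>R norm v"

definition ray_space :: "'a::euclidean_space set" where
  "ray_space = ray ` (- {0})"

definition ray_tangent :: "'a::euclidean_space \<Rightarrow> 'a set" where
  "ray_tangent x = {y. x \<bullet> y = 0}"

definition tangent_bundle :: "'a::euclidean_space set \<Rightarrow> ('a \<times> 'a) set" where
  "tangent_bundle U = {(x, y). x \<in> U \<and> y \<in> ray_tangent x}"

lemma ray_eq_iff:
  assumes "v \<noteq> 0" "w \<noteq> 0"
  shows "ray v = ray w \<longleftrightarrow> (\<exists>c>0. w = c *\<^sub>R v)"
proof
  assume *: "ray v = ray w"
  have "w = norm w *\<^sub>R ray w"
    using assms by (simp add: ray_def)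
  also have "\<dots> = (norm w / norm v) *\<^sub>R v"
    by (simp only: * [symmetric]) (simp add: ray_def divide_inverse)
  finally have "w = (norm w / norm v) *\<^sub>R v" .
  then show "\<exists>c>0. w = c *\<^sub>R v"
    using assms by (intro exI [of _ "norm w / norm v"]) simp
next
  assume "\<exists>c>0. w = c *\<^sub>R v"
  then show "ray v = ray w"
    by (auto simp: ray_def)
qed

lemma ray_space_eq_sphere: "ray_space = sphere 0 1"
proof
  show "ray_space \<subseteq> sphere (0::'a) 1"
    by (auto simp: ray_space_def ray_def field_simps split: if_splits)
  show "sphere 0 1 \<subseteq> (ray_space :: 'a set)"
  proof
    fix x :: 'a
    assume "x \<in> sphere 0 1"
    then have "x = ray x" "x \<noteq> 0"
      by (auto simp: ray_def)
    then show "x \<in> ray_space"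
      unfolding ray_space_def by blast
  qed
qed


section \<open>Hypersurfaces\<close>

text \<open>On the neighbourhood \<open>W\<close> of \<open>p\<close>, the set \<open>S\<close> is the zero set of \<open>f\<close> in \<open>N\<close>. The regularity of
  the zero set is imposed separately, through the derivative of \<open>f\<close> along \<open>N\<close>.\<close>

definition defines_near :: "'b::real_normed_vector set \<Rightarrow> 'b set \<Rightarrow> 'b \<Rightarrow> 'b set \<Rightarrow> ('b \<Rightarrow> real) \<Rightarrow> bool" where
  "defines_near N S p W f \<longleftrightarrow> open W \<and> p \<in> W \<and> S \<inter> W = {z \<in> N \<inter> W. f z = 0}"

definition hypersurface ::
    "('a::euclidean_space set \<Rightarrow> ('a \<Rightarrow> real) \<Rightarrow> bool) \<Rightarrow> 'a set \<Rightarrow> 'a set \<Rightarrow> bool" where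
  "hypersurface regular T S \<longleftrightarrow> S \<noteq> {} \<and> S \<subseteq> T \<and>
     (\<forall>y\<in>S. \<exists>W f. regular W f \<and> defines_near T S y W f \<and>
        (\<exists>w\<in>T. frechet_derivative f (at y) w \<noteq> 0))"

text \<open>For a hypersurface \<open>S\<close> of a linear subspace \<open>T\<close>: at every point the radial direction is
  transverse to \<open>S\<close> and the second fundamental form, with respect to the side of \<open>S\<close> on which the
  origin lies, is positive definite. The condition on the Hessian does not depend on the defining
  function, once that is normalized to increase in the outward radial direction.\<close>

definition strictly_convex_towards_origin :: "'a::euclidean_space set \<Rightarrow> 'a set \<Rightarrow> bool" where
  "strictly_convex_towards_origin T S \<longleftrightarrow>
     (\<forall>y\<in>S. \<exists>W f. smooth_on W f \<and> defines_near T S y W f \<and>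
        frechet_derivative f (at y) y > 0 \<and>
        (\<forall>w\<in>T. w \<noteq> 0 \<and> frechet_derivative f (at y) w = 0 \<longrightarrow>
           frechet_derivative (\<lambda>z. frechet_derivative f (at z) w) (at y) w > 0))"

text \<open>The tangent space of an embedded submanifold, as the set of velocities of smooth curves in it.\<close>

definition tangent_vectors :: "'b::real_normed_vector set \<Rightarrow> 'b \<Rightarrow> 'b set" where
  "tangent_vectors S p =
     {X. \<exists>e>0. \<exists>\<gamma>. smooth_on {-e<..<e} \<gamma> \<and> \<gamma> ` {-e<..<e} \<subseteq> S \<and> \<gamma> 0 = p \<and>
        (\<gamma> has_vector_derivative X) (at (0::real))}"


section \<open>Finsler structures on open sets of rays\<close>

definition fibre :: "('a \<times> 'a) set \<Rightarrow> 'a \<Rightarrow> 'a set" where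
  "fibre \<Sigma> x = {y. (x, y) \<in> \<Sigma>}"

text \<open>The unit tangent bundle is a subset \<open>\<Sigma>\<close> of the tangent bundle, the map \<open>\<iota>\<close> being the inclusion.
  The vertical derivative in the second condition makes \<open>\<Sigma>\<close> a smooth hypersurface of the tangent
  bundle that submerses onto the base.\<close>

definition finsler_structure :: "'a::euclidean_space set \<Rightarrow> ('a \<times> 'a) set \<Rightarrow> bool" where
  "finsler_structure U \<Sigma> \<longleftrightarrow>
     \<Sigma> \<subseteq> tangent_bundle U \<and>
     (\<forall>(x, y)\<in>\<Sigma>. \<exists>W f. smooth_on W f \<and> defines_near (tangent_bundle U) \<Sigma> (x, y) W f \<and>
        (\<exists>w\<in>ray_tangent x. frechet_derivative f (at (x, y)) (0, w) \<noteq> 0)) \<and>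
     (\<forall>x\<in>U. compact (fibre \<Sigma> x) \<and> hypersurface smooth_on (ray_tangent x) (fibre \<Sigma> x) \<and>
        strictly_convex_towards_origin (ray_tangent x) (fibre \<Sigma> x))"

text \<open>The covector at \<open>x\<close> that is 1 at \<open>y\<close> and has the tangent hyperplane of the indicatrix as
  its kernel. It is extended by zero from the tangent space of the sphere at \<open>x\<close> to the ambient
  vector space.\<close>

definition dual_covector :: "('a::euclidean_space \<times> 'a) set \<Rightarrow> 'a \<times> 'a \<Rightarrow> 'a \<Rightarrow>\<^sub>L real" where
  "dual_covector \<Sigma> = (\<lambda>(x, y). THE \<xi> :: 'a \<Rightarrow>\<^sub>L real. \<xi> x = 0 \<and> \<xi> y = 1 \<and>
     {w \<in> ray_tangent x. \<xi> w = 0} = tangent_vectors (fibre \<Sigma> x) y)"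

definition hilbert_form :: "('a::euclidean_space \<times> 'a) set \<Rightarrow> 'a \<times> 'a \<Rightarrow> 'a \<times> 'a \<Rightarrow> real" where
  "hilbert_form \<Sigma> p X = dual_covector \<Sigma> p (fst X)"


section \<open>Differential forms\<close>

text \<open>A local 1-form on \<open>\<Sigma>\<close> is given by a smooth 1-form on an open subset of the ambient vector space,
  of which only the values at points of \<open>\<Sigma>\<close> on tangent vectors of \<open>\<Sigma>\<close> matter. Since the exterior
  derivative commutes with restriction, identities between exterior derivatives on \<open>\<Sigma>\<close> are
  identities between ambient ones, evaluated on tangent vectors of \<open>\<Sigma>\<close>.\<close>

type_synonym 'b one_form = "'b \<Rightarrow> 'b \<Rightarrow>\<^sub>L real"

definition ext_deriv :: "'b::real_normed_vector one_form \<Rightarrow> 'b \<Rightarrow> 'b \<Rightarrow> 'b \<Rightarrow> real" where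
  "ext_deriv \<alpha> p X Y =
     blinfun_apply (frechet_derivative \<alpha> (at p) X) Y - blinfun_apply (frechet_derivative \<alpha> (at p) Y) X"

definition wedge :: "'b::real_normed_vector \<Rightarrow>\<^sub>L real \<Rightarrow> 'b \<Rightarrow>\<^sub>L real \<Rightarrow> 'b \<Rightarrow> 'b \<Rightarrow> real" where
  "wedge \<alpha> \<beta> X Y = \<alpha> X * \<beta> Y - \<alpha> Y * \<beta> X"

definition represents_hilbert_form ::
    "('a::euclidean_space \<times> 'a) set \<Rightarrow> ('a \<times> 'a) set \<Rightarrow> ('a \<times> 'a) one_form \<Rightarrow> bool" where
  "represents_hilbert_form \<Sigma> W \<alpha> \<longleftrightarrow> open W \<and> smooth_on W \<alpha> \<and>
     (\<forall>p\<in>\<Sigma> \<inter> W. \<forall>X\<in>tangent_vectors \<Sigma> p. \<alpha> p X = hilbert_form \<Sigma> p X)"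


section \<open>Geodesics and rectilinearity\<close>

text \<open>\<open>X\<close> is the value at \<open>p\<close> of the Reeb field of the Hilbert form.\<close>

definition reeb_vector :: "('a::euclidean_space \<times> 'a) set \<Rightarrow> 'a \<times> 'a \<Rightarrow> 'a \<times> 'a \<Rightarrow> bool" where
  "reeb_vector \<Sigma> p X \<longleftrightarrow> p \<in> \<Sigma> \<and> X \<in> tangent_vectors \<Sigma> p \<and> hilbert_form \<Sigma> p X = 1 \<and>
     (\<exists>W \<alpha>. p \<in> W \<and> represents_hilbert_form \<Sigma> W \<alpha> \<and>
        (\<forall>Y\<in>tangent_vectors \<Sigma> p. ext_deriv \<alpha> p X Y = 0))"

definition geodesic_on :: "('a::euclidean_space \<times> 'a) set \<Rightarrow> real set \<Rightarrow> (real \<Rightarrow> 'a) \<Rightarrow> bool" where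
  "geodesic_on \<Sigma> J \<gamma> \<longleftrightarrow> open J \<and> is_interval J \<and> J \<noteq> {} \<and>
     (\<exists>\<gamma>'. \<forall>t\<in>J. (\<gamma> has_vector_derivative \<gamma>' t) (at t) \<and>
        (\<exists>X. reeb_vector \<Sigma> (\<gamma> t, \<gamma>' t) X \<and>
           ((\<lambda>s. (\<gamma> s, \<gamma>' s)) has_vector_derivative X) (at t)))"

text \<open>Lines and geodesics are both oriented, so the reparametrization preserves orientation. The
  condition that \<open>v\<close> and \<open>w\<close> differ is needed because the set \<open>{v, v}\<close> is independent.\<close>

definition rectilinear :: "('a::euclidean_space \<times> 'a) set \<Rightarrow> bool" where
  "rectilinear \<Sigma> \<longleftrightarrow>
     (\<forall>J \<gamma>. geodesic_on \<Sigma> J \<gamma> \<longrightarrow>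
        (\<exists>v w. v \<noteq> w \<and> independent {v, w} \<and>
           (\<exists>\<sigma> :: real \<Rightarrow> real. smooth_on J \<sigma> \<and> (\<forall>t\<in>J. deriv \<sigma> t > 0) \<and>
              (\<forall>t\<in>J. \<gamma> t = ray (cos (\<sigma> t) *\<^sub>R v + sin (\<sigma> t) *\<^sub>R w)))))"


section \<open>Flag curvature\<close>

text \<open>The 1-forms \<open>\<omega> 0, \<omega> i, \<theta> 0 i\<close> with \<open>i = 1, ..., n\<close> restrict to a coframing of \<open>\<Sigma>\<close> on \<open>W\<close>, the
  form \<open>\<omega> 0\<close> being the Hilbert form, such that \<open>\<omega> 0, ..., \<omega> n\<close> vanish on the fibres of \<open>\<Sigma>\<close>. That
  2n+1 covectors form a basis of the cotangent space is expressed by saying that the tangent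
  vectors correspond bijectively to the tuples of values of these covectors.\<close>

definition finsler_coframing ::
    "nat \<Rightarrow> ('a::euclidean_space \<times> 'a) set \<Rightarrow> ('a \<times> 'a) set \<Rightarrow>
     (nat \<Rightarrow> ('a \<times> 'a) one_form) \<Rightarrow> (nat \<Rightarrow> nat \<Rightarrow> ('a \<times> 'a) one_form) \<Rightarrow> bool" where
  "finsler_coframing n \<Sigma> W \<omega> \<theta> \<longleftrightarrow>
     represents_hilbert_form \<Sigma> W (\<omega> 0) \<and>
     (\<forall>i\<in>{1..n}. smooth_on W (\<omega> i) \<and> smooth_on W (\<theta> 0 i)) \<and>
     (\<forall>p\<in>\<Sigma> \<inter> W. \<forall>a b c. \<exists>!X. X \<in> tangent_vectors \<Sigma> p \<and> \<omega> 0 p X = a \<and>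
        (\<forall>i\<in>{1..n}. \<omega> i p X = b i \<and> \<theta> 0 i p X = c i)) \<and>
     (\<forall>(x, y)\<in>\<Sigma> \<inter> W. \<forall>i\<in>{0..n}. \<forall>w\<in>tangent_vectors (fibre \<Sigma> x) y. \<omega> i (x, y) (0, w) = 0)"

text \<open>The structure equations for the differentials of \<open>\<omega> 0\<close> and \<open>\<omega> i\<close>; \<open>I p i j k\<close> is the value at
  \<open>p\<close> of the coefficient with indices \<open>i, j, k\<close>.\<close>

definition finsler_connection ::
    "nat \<Rightarrow> ('a::euclidean_space \<times> 'a) set \<Rightarrow> ('a \<times> 'a) set \<Rightarrow>
     (nat \<Rightarrow> ('a \<times> 'a) one_form) \<Rightarrow> (nat \<Rightarrow> nat \<Rightarrow> ('a \<times> 'a) one_form) \<Rightarrow>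
     ('a \<times> 'a \<Rightarrow> nat \<Rightarrow> nat \<Rightarrow> nat \<Rightarrow> real) \<Rightarrow> bool" where
  "finsler_connection n \<Sigma> W \<omega> \<theta> I \<longleftrightarrow>
     (\<forall>i\<in>{1..n}. \<forall>j\<in>{1..n}. smooth_on W (\<theta> i j)) \<and>
     (\<forall>p\<in>\<Sigma> \<inter> W.
        (\<forall>i\<in>{1..n}. \<forall>j\<in>{1..n}. \<forall>X\<in>tangent_vectors \<Sigma> p. \<theta> i j p X = - \<theta> j i p X) \<and>
        (\<forall>i\<in>{1..n}. \<forall>j\<in>{1..n}. \<forall>k\<in>{1..n}. I p i j k = I p j i k \<and> I p i j k = I p i k j) \<and>
        (\<forall>X\<in>tangent_vectors \<Sigma> p. \<forall>Y\<in>tangent_vectors \<Sigma> p.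
           ext_deriv (\<omega> 0) p X Y = - (\<Sum>j=1..n. wedge (\<theta> 0 j p) (\<omega> j p) X Y) \<and>
           (\<forall>i\<in>{1..n}. ext_deriv (\<omega> i) p X Y =
              wedge (\<theta> 0 i p) (\<omega> 0 p) X Y
              - (\<Sum>j=1..n. wedge (\<theta> i j p) (\<omega> j p) X Y)
              - (\<Sum>j=1..n. \<Sum>k=1..n. I p i j k * wedge (\<theta> 0 k p) (\<omega> j p) X Y))))"

text \<open>The structure equation for the differential of \<open>\<theta> 0 i\<close>, which determines the curvature
  coefficients \<open>R p 0 i 0 j\<close> and \<open>R p 0 i j k\<close> at \<open>p\<close>.\<close>

definition finsler_curvature ::
    "nat \<Rightarrow> ('a::euclidean_space \<times> 'a) set \<Rightarrow> ('a \<times> 'a) set \<Rightarrow>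
     (nat \<Rightarrow> ('a \<times> 'a) one_form) \<Rightarrow> (nat \<Rightarrow> nat \<Rightarrow> ('a \<times> 'a) one_form) \<Rightarrow>
     ('a \<times> 'a \<Rightarrow> nat \<Rightarrow> nat \<Rightarrow> nat \<Rightarrow> nat \<Rightarrow> real) \<Rightarrow>
     ('a \<times> 'a \<Rightarrow> nat \<Rightarrow> nat \<Rightarrow> nat \<Rightarrow> real) \<Rightarrow> bool" where
  "finsler_curvature n \<Sigma> W \<omega> \<theta> R J \<longleftrightarrow>
     (\<forall>p\<in>\<Sigma> \<inter> W.
        (\<forall>i\<in>{1..n}. \<forall>j\<in>{1..n}. R p 0 i 0 j = R p 0 j 0 i) \<and>
        (\<forall>i\<in>{1..n}. \<forall>j\<in>{1..n}. \<forall>k\<in>{1..n}. R p 0 i j k = - R p 0 i k j \<and> J p i j k = J p j i k) \<and>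
        (\<forall>X\<in>tangent_vectors \<Sigma> p. \<forall>Y\<in>tangent_vectors \<Sigma> p. \<forall>i\<in>{1..n}.
           ext_deriv (\<theta> 0 i) p X Y =
             - (\<Sum>j=1..n. wedge (\<theta> 0 j p) (\<theta> j i p) X Y)
             + (\<Sum>j=1..n. R p 0 i 0 j * wedge (\<omega> 0 p) (\<omega> j p) X Y)
             + 1/2 * (\<Sum>j=1..n. \<Sum>k=1..n. R p 0 i j k * wedge (\<omega> j p) (\<omega> k p) X Y)
             + (\<Sum>j=1..n. \<Sum>k=1..n. J p i j k * wedge (\<theta> 0 k p) (\<omega> j p) X Y)))"

text \<open>For a given coframing the connection forms and all coefficients are determined on \<open>\<Sigma>\<close> by the
  structure equations, and a change of coframing conjugates the matrix of the \<open>R p 0 i 0 j\<close> by an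
  orthogonal one. It is therefore enough to ask for one coframing near each point.\<close>

definition constant_flag_curvature :: "nat \<Rightarrow> ('a::euclidean_space \<times> 'a) set \<Rightarrow> real \<Rightarrow> bool" where
  "constant_flag_curvature n \<Sigma> \<kappa> \<longleftrightarrow>
     (\<forall>p\<in>\<Sigma>. \<exists>W \<omega> \<theta> I R J. p \<in> W \<and> finsler_coframing n \<Sigma> W \<omega> \<theta> \<and>
        finsler_connection n \<Sigma> W \<omega> \<theta> I \<and> finsler_curvature n \<Sigma> W \<omega> \<theta> R J \<and>
        (\<forall>q\<in>\<Sigma> \<inter> W. \<forall>i\<in>{1..n}. \<forall>j\<in>{1..n}. R q 0 i 0 j = (if i = j then \<kappa> else 0)))"

end

theory Submission
  imports Defs "HOL-Complex_Analysis.Complex_Analysis"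
begin

text \<open>The geodesics of a rectilinear structure of flag curvature 1 are the real parts of
  \<open>exp (- i s) z\<close>, where \<open>z\<close> runs through a complex hypersurface cone in the complexified vector
  space. Prescribing the indicatrix \<open>S\<close> at one point prescribes a totally real submanifold of the
  cone, namely the vectors \<open>x + i y\<close> with \<open>y\<close> in \<open>S\<close> (the projective factor is taken to vanish at the
  base point), and real-analyticity allows one to complexify it. Analytically, the cone is the zero
  set of a holomorphic function homogeneous of degree 1, and solving for \<open>c\<close> the condition that
  \<open>y + c x\<close> lies on it gives a solution \<open>c = P - i F\<close> of the complex Burgers equation
  \<open>D c (h, 0) = c D c (0, h)\<close>. The unit tangent bundle is \<open>F = 1\<close>. With \<open>\<mu> = - D c (0, \<cdot>)\<close> the Hilbert
  form is \<open>Im \<mu>\<close>, and with \<open>q = y + P x\<close> and a frame \<open>e i\<close> of \<open>ker \<mu>\<close>, orthonormal for the vertical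
  Hessian of \<open>F\<close>, the coefficients of \<open>dx\<close> and \<open>- dq\<close> along \<open>e i\<close> are the forms \<open>\<omega> i\<close> and \<open>\<theta> 0 i\<close>;
  up to the factor \<open>- 1/2\<close>, the coefficients \<open>I\<close> and \<open>J\<close> are the imaginary and real parts of the
  third vertical derivative of \<open>c\<close>.\<close>

section \<open>Calculus of smooth maps\<close>

text \<open>On the unit tangent bundle the vector \<open>y + c x\<close> equals
  \<open>q - i x\<close> and stays on the cone, whose complex tangent hyperplane is the kernel of
  \<mu>. Hence \<open>\<mu> (dq) = i \<mu> (dx)\<close> along the bundle. This one relation gives
  both conclusions: it produces the curvature term with coefficient 1 in the differential of
  \<theta> 0 i, and it makes \<open>x\<close> and \<open>q\<close> rotate into each other along the
  Reeb field. The Burgers equation converts horizontal derivatives into vertical ones, so only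
  vertical derivatives of \<open>c\<close> up to order three occur. The obstacles are global along
  \<open>S\<close>. Analytic defining functions exist only locally, and convexity may be witnessed
  by other functions. So the complex extension is glued as a germ along \<open>S\<close> from scale
  factors that are characterized by \<open>S\<close> alone at real points, and convexity is
  transferred between defining functions. Moreover \<open>c\<close> exists only near the base fibre,
  so nearby fibres have to be kept off the boundary of a tube around \<open>S\<close> to be
  compact.\<close>

abbreviation FD :: "('a::real_normed_vector \<Rightarrow> 'b::real_normed_vector) \<Rightarrow> 'a \<Rightarrow> 'a \<Rightarrow> 'b" where
  "FD f x \<equiv> frechet_derivative f (at x)"

lemma FD_eqI: "(f has_derivative f') (at x) \<Longrightarrow> FD f x = f'"
  by (metis frechet_derivative_at)

lemma FD_cong:
  assumes "open A" "x \<in> A" "\<And>z. z \<in> A \<Longrightarrow> f z = g z"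
  shows "FD f x = FD g x"
proof -
  have "(f has_derivative F) (at x) \<longleftrightarrow> (g has_derivative F) (at x)" for F
    using assms by (metis has_derivative_transform_within_open)
  then show ?thesis by (simp add: frechet_derivative_def)
qed

lemma differentiable_cong:
  assumes "open A" "x \<in> A" "\<And>z. z \<in> A \<Longrightarrow> f z = g z" "f differentiable (at x)"
  shows "g differentiable (at x)"
  using assms by (meson differentiable_def has_derivative_transform_within_open)

lemma Ck_on_cong:
  assumes "open A" "\<And>x. x \<in> A \<Longrightarrow> f x = g x" "Ck_on k A f"
  shows "Ck_on k A g"
  using assms(2,3)
proof (induction k arbitrary: f g)
  case 0
  then show ?case by (simp cong: continuous_on_cong)
next
  case (Suc k)
  have "FD f x = FD g x" if "x \<in> A" for x
    by (rule FD_cong [OF assms(1) that Suc.prems(1)])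
  then have "Ck_on k A (\<lambda>x. FD g x h)" for h
    using Suc.IH [of "\<lambda>x. FD f x h" "\<lambda>x. FD g x h"] Suc.prems(2) by simp
  moreover have "g differentiable (at x)" if "x \<in> A" for x
    using differentiable_cong [OF assms(1) that Suc.prems(1)] Suc.prems(2) that by simp
  ultimately show ?case by simp
qed

lemma Ck_on_subset: "Ck_on k A f \<Longrightarrow> B \<subseteq> A \<Longrightarrow> Ck_on k B f"
  by (induction k arbitrary: f) (auto intro: continuous_on_subset)

lemma Ck_on_SucD: "Ck_on (Suc k) A f \<Longrightarrow> Ck_on k A f"
proof (induction k arbitrary: f)
  case 0
  then show ?case
    by (auto intro!: continuous_at_imp_continuous_on differentiable_imp_continuous_within)
qed simp

lemma Ck_on_local:
  assumes "\<And>x. x \<in> A \<Longrightarrow> \<exists>B. open B \<and> x \<in> B \<and> Ck_on k B f"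
  shows "Ck_on k A f"
  using assms
proof (induction k arbitrary: f)
  case 0
  then show ?case
    by (simp add: continuous_at_imp_continuous_on) (metis continuous_at_imp_continuous_on continuous_on_eq_continuous_at)
next
  case (Suc k)
  then show ?case by (simp, metis)
qed

lemma Ck_on_const [simp]: "Ck_on k A (\<lambda>x. c)"
  by (induction k arbitrary: c) auto

lemma Ck_on_bounded_linear_fun:
  assumes "bounded_linear f"
  shows "Ck_on k A f"
proof (cases k)
  case 0
  then show ?thesis using assms by (simp add: linear_continuous_on)
next
  case (Suc m)
  have "(f has_derivative f) (at x)" for x
    using assms by (rule bounded_linear_imp_has_derivative)
  then have "FD f x = f" "f differentiable (at x)" for x
    by (auto simp: FD_eqI differentiable_def)
  then show ?thesis using Suc by simp
qed

lemma Ck_on_bounded_linear: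
  assumes "bounded_linear L" "open A" "Ck_on k A f"
  shows "Ck_on k A (\<lambda>x. L (f x))"
  using assms(3)
proof (induction k arbitrary: f)
  case 0
  then show ?case using assms(1) by (simp add: bounded_linear.continuous_on)
next
  case (Suc k)
  have d: "((\<lambda>x. L (f x)) has_derivative (\<lambda>h. L (FD f x h))) (at x)" if "x \<in> A" for x
    using Suc.prems that
    by (auto intro!: bounded_linear.has_derivative [OF assms(1)] simp: frechet_derivative_works)
  have "Ck_on k A (\<lambda>x. FD (\<lambda>x. L (f x)) x h)" for h
    using Suc.prems
    using Ck_on_cong [OF assms(2) _ Suc.IH [of "\<lambda>x. FD f x h"], of "\<lambda>x. FD (\<lambda>x. L (f x)) x h"]
    by (simp add: FD_eqI [OF d])
  then show ?case using d by (auto simp: differentiable_def)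
qed

lemma Ck_on_add:
  assumes "open A" "Ck_on k A f" "Ck_on k A g"
  shows "Ck_on k A (\<lambda>x. f x + g x)"
  using assms(2,3)
proof (induction k arbitrary: f g)
  case 0
  then show ?case by (simp add: continuous_on_add)
next
  case (Suc k)
  have d: "((\<lambda>x. f x + g x) has_derivative (\<lambda>h. FD f x h + FD g x h)) (at x)" if "x \<in> A" for x
    using Suc.prems that by (auto intro!: has_derivative_add simp: frechet_derivative_works)
  have "Ck_on k A (\<lambda>x. FD (\<lambda>x. f x + g x) x h)" for h
    using Suc.prems
    using Ck_on_cong [OF assms(1) _ Suc.IH [of "\<lambda>x. FD f x h" "\<lambda>x. FD g x h"],
        of "\<lambda>x. FD (\<lambda>x. f x + g x) x h"]
    by (simp add: FD_eqI [OF d])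
  then show ?case using d by (auto simp: differentiable_def)
qed

lemma Ck_on_bilinear:
  assumes "bounded_bilinear m" "open A" "Ck_on k A f" "Ck_on k A g"
  shows "Ck_on k A (\<lambda>x. m (f x) (g x))"
  using assms(3,4)
proof (induction k arbitrary: f g)
  case 0
  then show ?case using assms(1) by (simp add: bounded_bilinear.continuous_on)
next
  case (Suc k)
  have d: "((\<lambda>x. m (f x) (g x)) has_derivative (\<lambda>h. m (f x) (FD g x h) + m (FD f x h) (g x))) (at x)"
    if "x \<in> A" for x
    using Suc.prems that
    by (auto intro!: bounded_bilinear.FDERIV [OF assms(1)] simp: frechet_derivative_works)
  have "Ck_on k A (\<lambda>x. m (f x) (FD g x h) + m (FD f x h) (g x))" for h
    using Suc.prems by (intro Ck_on_add assms Suc.IH Ck_on_SucD [of k A f] Ck_on_SucD [of k A g]) auto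
  then have "Ck_on k A (\<lambda>x. FD (\<lambda>x. m (f x) (g x)) x h)" for h
    by (rule Ck_on_cong [OF assms(2), rotated]) (simp only: FD_eqI [OF d])
  then show ?case using d by (auto simp: differentiable_def)
qed

lemma Ck_on_sum:
  assumes "open A" "\<And>i. i \<in> I \<Longrightarrow> Ck_on k A (f i)"
  shows "Ck_on k A (\<lambda>x. \<Sum>i\<in>I. f i x)"
  using assms(2)
proof (induction I rule: infinite_finite_induct)
  case (insert i I)
  then show ?case by (simp add: Ck_on_add [OF assms(1)])
qed auto

lemma Ck_on_Pair:
  assumes "open A" "Ck_on k A f" "Ck_on k A g"
  shows "Ck_on k A (\<lambda>x. (f x, g x))"
proof -
  have "Ck_on k A (\<lambda>x. (f x, 0) + (0, g x))"
    by (intro Ck_on_add assms Ck_on_bounded_linear [of "\<lambda>x. (x, 0)"] Ck_on_bounded_linear [of "\<lambda>x. (0, x)"]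
          bounded_linear_Pair bounded_linear_zero bounded_linear_ident)
  then show ?thesis by simp
qed

lemma FD_linear:
  assumes "f differentiable (at x)"
  shows "FD f x (h + k) = FD f x h + FD f x k" "FD f x (h - k) = FD f x h - FD f x k"
    "FD f x (- h) = - FD f x h" "FD f x (c *\<^sub>R h) = c *\<^sub>R FD f x h" "FD f x 0 = 0"
    "FD f x (sum H I) = (\<Sum>i\<in>I. FD f x (H i))"
proof -
  interpret linear "FD f x" by (rule linear_frechet_derivative [OF assms])
  show "FD f x (h + k) = FD f x h + FD f x k" "FD f x (h - k) = FD f x h - FD f x k"
    "FD f x (- h) = - FD f x h" "FD f x (c *\<^sub>R h) = c *\<^sub>R FD f x h" "FD f x 0 = 0"
    "FD f x (sum H I) = (\<Sum>i\<in>I. FD f x (H i))"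
    by (simp_all add: add diff neg scaleR zero sum)
qed

lemma FD_expand:
  fixes f :: "'b::euclidean_space \<Rightarrow> 'c::real_normed_vector"
  assumes "f differentiable (at x)"
  shows "FD f x h = (\<Sum>b\<in>Basis. (h \<bullet> b) *\<^sub>R FD f x b)"
proof -
  have "FD f x h = FD f x (\<Sum>b\<in>Basis. (h \<bullet> b) *\<^sub>R b)" by (simp add: euclidean_representation)
  then show ?thesis by (simp add: FD_linear [OF assms])
qed

text \<open>The chain rule produces \<open>FD f (g x) (FD g x h)\<close>, whose direction varies
  with \<open>x\<close>, whereas \<open>Ck_on\<close> speaks of fixed directions. Expanding the
  direction in the basis leaves products of functions to which the induction applies.\<close>

lemma Ck_on_compose:
  fixes f :: "'b::euclidean_space \<Rightarrow> 'c::real_normed_vector"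
  assumes "open A" "Ck_on k B f" "Ck_on k A g" "g ` A \<subseteq> B"
  shows "Ck_on k A (\<lambda>x. f (g x))"
  using assms(2,3)
proof (induction k arbitrary: f)
  case 0
  then show ?case using assms(4) by (auto intro: continuous_on_compose2)
next
  case (Suc k)
  have df: "f differentiable (at (g x))" if "x \<in> A" for x
    using Suc.prems(1) assms(4) that by auto
  have d: "((\<lambda>x. f (g x)) has_derivative (\<lambda>h. FD f (g x) (FD g x h))) (at x)" if "x \<in> A" for x
    using has_derivative_compose [of g "FD g x" x UNIV f "FD f (g x)"] Suc.prems(2) df that
    by (auto simp: frechet_derivative_works)
  have "Ck_on k A (\<lambda>x. \<Sum>b\<in>Basis. (FD g x h \<bullet> b) *\<^sub>R FD f (g x) b)" for h
    using Suc.prems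
    by (intro Ck_on_sum assms Ck_on_bilinear [OF bounded_bilinear_scaleR] Suc.IH [of "\<lambda>y. FD f y _"]
          Ck_on_SucD [of k A g] Ck_on_bounded_linear [OF bounded_linear_inner_left]) auto
  then have "Ck_on k A (\<lambda>x. FD (\<lambda>x. f (g x)) x h)" for h
    by (rule Ck_on_cong [OF assms(1), rotated])
       (simp add: FD_eqI [OF d] FD_expand [OF df, of _ "FD g _ h"])
  then show ?case using d by (auto simp: differentiable_def)
qed

text \<open>The derivative of \<open>inverse f\<close> contains \<open>inverse f\<close> again but
  no derivative of it, so the induction on the order closes. The square root is handled in the same
  way.\<close>

lemma Ck_on_inverse:
  fixes f :: "'b::real_normed_vector \<Rightarrow> 'c::real_normed_field"
  assumes "open A" "Ck_on k A f" "\<And>x. x \<in> A \<Longrightarrow> f x \<noteq> 0"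
  shows "Ck_on k A (\<lambda>x. inverse (f x))"
  using assms(2)
proof (induction k)
  case 0
  then show ?case using assms(3) by (auto intro!: continuous_on_inverse)
next
  case (Suc k)
  have d: "((\<lambda>x. inverse (f x)) has_derivative (\<lambda>h. - (inverse (f x) * FD f x h * inverse (f x)))) (at x)"
    if "x \<in> A" for x
    using Suc.prems that assms(3) by (auto intro!: has_derivative_inverse simp: frechet_derivative_works)
  have "Ck_on k A (\<lambda>x. inverse (f x))"
    using Suc.prems by (intro Suc.IH) (rule Ck_on_SucD)
  then have "Ck_on k A (\<lambda>x. - (inverse (f x) * FD f x h * inverse (f x)))" for h
    using Suc.prems
    by (intro Ck_on_bounded_linear [of uminus] Ck_on_bilinear [OF bounded_bilinear_mult] assms
          bounded_linear_minus bounded_linear_ident) auto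
  then have "Ck_on k A (\<lambda>x. FD (\<lambda>x. inverse (f x)) x h)" for h
    by (rule Ck_on_cong [OF assms(1), rotated]) (simp only: FD_eqI [OF d])
  then show ?case using d by (auto simp: differentiable_def)
qed

lemma Ck_on_sqrt:
  fixes f :: "'b::real_normed_vector \<Rightarrow> real"
  assumes "open A" "Ck_on k A f" "\<And>x. x \<in> A \<Longrightarrow> f x > 0"
  shows "Ck_on k A (\<lambda>x. sqrt (f x))"
  using assms(2)
proof (induction k)
  case 0
  then show ?case by (auto intro!: continuous_on_real_sqrt)
next
  case (Suc k)
  have d: "((\<lambda>x. sqrt (f x)) has_derivative (\<lambda>h. inverse (sqrt (f x)) / 2 * FD f x h)) (at x)"
    if "x \<in> A" for x
  proof -
    have "DERIV sqrt (f x) :> inverse (sqrt (f x)) / 2"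
      using assms(3) [OF that] by (rule DERIV_real_sqrt)
    then have i: "(sqrt has_derivative (\<lambda>u. inverse (sqrt (f x)) / 2 * u)) (at (f x))"
      by (auto simp: has_field_derivative_def elim!: has_derivative_eq_rhs)
    show ?thesis using has_derivative_compose [of f "FD f x" x UNIV, OF _ i] Suc.prems that
      by (auto simp: frechet_derivative_works)
  qed
  have "Ck_on k A (\<lambda>x. inverse (sqrt (f x)))"
    using Suc.prems assms(3)
    by (intro Ck_on_inverse Suc.IH Ck_on_SucD [of k A f] assms) (auto dest!: assms(3))
  then have "Ck_on k A (\<lambda>x. inverse (sqrt (f x)) / 2 * FD f x h)" for h
    using Suc.prems
    by (intro Ck_on_bounded_linear [of "\<lambda>x. x / 2"] Ck_on_bilinear [OF bounded_bilinear_mult] assms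
          bounded_linear_divide) auto
  then have "Ck_on k A (\<lambda>x. FD (\<lambda>x. sqrt (f x)) x h)" for h
    by (rule Ck_on_cong [OF assms(1), rotated]) (simp only: FD_eqI [OF d])
  then show ?case using d by (auto simp: differentiable_def)
qed

lemma smooth_on_cong: "open A \<Longrightarrow> (\<And>x. x \<in> A \<Longrightarrow> f x = g x) \<Longrightarrow> smooth_on A f \<Longrightarrow> smooth_on A g"
  unfolding smooth_on_def using Ck_on_cong by blast

lemma smooth_on_subset: "smooth_on A f \<Longrightarrow> B \<subseteq> A \<Longrightarrow> smooth_on B f"
  unfolding smooth_on_def using Ck_on_subset by blast

lemma smooth_on_local:
  "(\<And>x. x \<in> A \<Longrightarrow> \<exists>B. open B \<and> x \<in> B \<and> smooth_on B f) \<Longrightarrow> smooth_on A f"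
  unfolding smooth_on_def by (intro allI Ck_on_local) metis

lemma smooth_on_FD: "smooth_on A f \<Longrightarrow> smooth_on A (\<lambda>x. FD f x h)"
  unfolding smooth_on_def using Ck_on.simps(2) by blast

lemma smooth_on_differentiable: "smooth_on A f \<Longrightarrow> x \<in> A \<Longrightarrow> f differentiable (at x)"
  unfolding smooth_on_def using Ck_on.simps(2) by blast

lemma smooth_on_has_derivative: "smooth_on A f \<Longrightarrow> x \<in> A \<Longrightarrow> (f has_derivative FD f x) (at x)"
  using smooth_on_differentiable frechet_derivative_works by blast

lemma smooth_on_continuous_on: "smooth_on A f \<Longrightarrow> continuous_on A f"
  unfolding smooth_on_def using Ck_on.simps(1) by blast

lemma smooth_on_FD_has_derivative:
  "smooth_on A f \<Longrightarrow> x \<in> A \<Longrightarrow> ((\<lambda>z. FD f z h) has_derivative (\<lambda>k. FD (\<lambda>z. FD f z h) x k)) (at x)"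
  using smooth_on_has_derivative [OF smooth_on_FD] by blast

lemma smooth_on_const: "smooth_on A (\<lambda>x. c)"
  by (simp add: smooth_on_def)

lemma smooth_on_ident: "smooth_on A (\<lambda>x. x)"
  by (simp add: smooth_on_def Ck_on_bounded_linear_fun bounded_linear_ident)

lemma smooth_on_fst: "smooth_on A fst"
  by (simp add: smooth_on_def Ck_on_bounded_linear_fun bounded_linear_fst)

lemma smooth_on_snd: "smooth_on A snd"
  by (simp add: smooth_on_def Ck_on_bounded_linear_fun bounded_linear_snd)

lemma smooth_on_bounded_linear:
  "bounded_linear L \<Longrightarrow> open A \<Longrightarrow> smooth_on A f \<Longrightarrow> smooth_on A (\<lambda>x. L (f x))"
  by (simp add: smooth_on_def Ck_on_bounded_linear)

lemma smooth_on_add: "open A \<Longrightarrow> smooth_on A f \<Longrightarrow> smooth_on A g \<Longrightarrow> smooth_on A (\<lambda>x. f x + g x)"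
  by (simp add: smooth_on_def Ck_on_add)

lemma smooth_on_minus: "open A \<Longrightarrow> smooth_on A f \<Longrightarrow> smooth_on A (\<lambda>x. - f x)"
  using smooth_on_bounded_linear bounded_linear_minus bounded_linear_ident by blast

lemma smooth_on_diff: "open A \<Longrightarrow> smooth_on A f \<Longrightarrow> smooth_on A g \<Longrightarrow> smooth_on A (\<lambda>x. f x - g x)"
  using smooth_on_add [of A f "\<lambda>x. - g x"] smooth_on_minus by force

lemma smooth_on_bilinear:
  "bounded_bilinear m \<Longrightarrow> open A \<Longrightarrow> smooth_on A f \<Longrightarrow> smooth_on A g \<Longrightarrow> smooth_on A (\<lambda>x. m (f x) (g x))"
  by (simp add: smooth_on_def Ck_on_bilinear)

lemmas smooth_on_mult = smooth_on_bilinear [OF bounded_bilinear_mult]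
lemmas smooth_on_scaleR = smooth_on_bilinear [OF bounded_bilinear_scaleR]
lemmas smooth_on_inner = smooth_on_bilinear [OF bounded_bilinear_inner]
lemmas smooth_on_of_real = smooth_on_bounded_linear [OF bounded_linear_of_real]
lemmas smooth_on_Re = smooth_on_bounded_linear [OF bounded_linear_Re]
lemmas smooth_on_Im = smooth_on_bounded_linear [OF bounded_linear_Im]

lemma smooth_on_sum: "open A \<Longrightarrow> (\<And>i. i \<in> I \<Longrightarrow> smooth_on A (f i)) \<Longrightarrow> smooth_on A (\<lambda>x. \<Sum>i\<in>I. f i x)"
  by (simp add: smooth_on_def Ck_on_sum)

lemma smooth_on_Pair: "open A \<Longrightarrow> smooth_on A f \<Longrightarrow> smooth_on A g \<Longrightarrow> smooth_on A (\<lambda>x. (f x, g x))"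
  by (simp add: smooth_on_def Ck_on_Pair)

lemma smooth_on_compose:
  fixes f :: "'b::euclidean_space \<Rightarrow> 'c::real_normed_vector"
  shows "open A \<Longrightarrow> smooth_on B f \<Longrightarrow> smooth_on A g \<Longrightarrow> g ` A \<subseteq> B \<Longrightarrow> smooth_on A (\<lambda>x. f (g x))"
  unfolding smooth_on_def by (blast intro: Ck_on_compose)

lemma smooth_on_inverse:
  fixes f :: "'b::real_normed_vector \<Rightarrow> 'c::real_normed_field"
  shows "open A \<Longrightarrow> smooth_on A f \<Longrightarrow> (\<And>x. x \<in> A \<Longrightarrow> f x \<noteq> 0) \<Longrightarrow> smooth_on A (\<lambda>x. inverse (f x))"
  by (simp add: smooth_on_def Ck_on_inverse)

lemma smooth_on_divide:
  fixes f :: "'b::real_normed_vector \<Rightarrow> 'c::real_normed_field"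
  shows "open A \<Longrightarrow> smooth_on A f \<Longrightarrow> smooth_on A g \<Longrightarrow> (\<And>x. x \<in> A \<Longrightarrow> g x \<noteq> 0)
    \<Longrightarrow> smooth_on A (\<lambda>x. f x / g x)"
  using smooth_on_mult [of A f "\<lambda>x. inverse (g x)"] smooth_on_inverse [of A g]
  by (simp add: divide_inverse)

lemma smooth_on_sqrt:
  "open A \<Longrightarrow> smooth_on A f \<Longrightarrow> (\<And>x. x \<in> A \<Longrightarrow> f x > (0::real)) \<Longrightarrow> smooth_on A (\<lambda>x. sqrt (f x))"
  by (simp add: smooth_on_def Ck_on_sqrt)

lemma smooth_on_norm:
  fixes f :: "'b::real_normed_vector \<Rightarrow> 'c::real_inner"
  assumes "open A" "smooth_on A f" "\<And>x. x \<in> A \<Longrightarrow> f x \<noteq> 0"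
  shows "smooth_on A (\<lambda>x. norm (f x))"
  unfolding norm_eq_sqrt_inner using assms by (intro smooth_on_sqrt smooth_on_inner) auto

lemmas smooth_on_intros =
  smooth_on_const smooth_on_ident smooth_on_fst smooth_on_snd smooth_on_add smooth_on_minus
  smooth_on_diff smooth_on_mult smooth_on_scaleR smooth_on_inner smooth_on_of_real smooth_on_Re
  smooth_on_Im smooth_on_sum smooth_on_Pair smooth_on_inverse smooth_on_divide smooth_on_sqrt
  smooth_on_norm

text \<open>The second difference of \<open>f\<close> over the parallelogram spanned by
  \<open>r h\<close> and \<open>r k\<close> is symmetric in \<open>h\<close> and \<open>k\<close>.
  Two applications of the mean value theorem write it as \<open>r * r\<close> times a mixed
  derivative at a nearby point, in either order; then \<open>r\<close> shrinks.\<close>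

lemma second_derivative_symmetric_real:
  fixes f :: "'b::real_normed_vector \<Rightarrow> real"
  assumes "open A" "smooth_on A f" "x \<in> A"
  shows "FD (\<lambda>z. FD f z h) x k = FD (\<lambda>z. FD f z k) x h"
proof -
  have *: "\<exists>s t. 0 < s \<and> s < r \<and> 0 < t \<and> t < r \<and>
      f (x + r *\<^sub>R h + r *\<^sub>R k) - f (x + r *\<^sub>R h) - f (x + r *\<^sub>R k) + f x
      = r * r * FD (\<lambda>z. FD f z h) (x + s *\<^sub>R h + t *\<^sub>R k) k"
    if r: "r > 0" and sub: "\<And>s t. 0 \<le> s \<Longrightarrow> s \<le> r \<Longrightarrow> 0 \<le> t \<Longrightarrow> t \<le> r \<Longrightarrow> x + s *\<^sub>R h + t *\<^sub>R k \<in> A"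
    for r h k
  proof -
    have df: "((\<lambda>s. f (x + s *\<^sub>R h + t *\<^sub>R k)) has_real_derivative FD f (x + s *\<^sub>R h + t *\<^sub>R k) h) (at s)"
      if "0 \<le> s" "s \<le> r" "0 \<le> t" "t \<le> r" for s t
    proof -
      have i: "((\<lambda>s. x + s *\<^sub>R h + t *\<^sub>R k) has_derivative (\<lambda>u. u *\<^sub>R h)) (at s)"
        by (auto intro!: derivative_eq_intros)
      have "((\<lambda>s. f (x + s *\<^sub>R h + t *\<^sub>R k)) has_derivative (\<lambda>u. FD f (x + s *\<^sub>R h + t *\<^sub>R k) (u *\<^sub>R h))) (at s)"
        by (rule has_derivative_compose [OF i smooth_on_has_derivative [OF assms(2) sub [OF that]]])
      then show ?thesis
        using smooth_on_differentiable [OF assms(2) sub [OF that]]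
        by (simp add: has_field_derivative_def FD_linear mult.commute [of _ "FD _ _ _"])
    qed
    have "\<exists>s. 0 < s \<and> s < r \<and> (f (x + r *\<^sub>R h + r *\<^sub>R k) - f (x + r *\<^sub>R h + 0 *\<^sub>R k)) -
         (f (x + 0 *\<^sub>R h + r *\<^sub>R k) - f (x + 0 *\<^sub>R h + 0 *\<^sub>R k)) =
        (r - 0) * (FD f (x + s *\<^sub>R h + r *\<^sub>R k) h - FD f (x + s *\<^sub>R h + 0 *\<^sub>R k) h)"
      using r df [of _ r] df [of _ 0]
      by (intro MVT2 [of 0 r "\<lambda>s. f (x + s *\<^sub>R h + r *\<^sub>R k) - f (x + s *\<^sub>R h + 0 *\<^sub>R k)"] DERIV_diff)
        (auto simp del: scaleR_zero_left)
    then obtain s where s: "0 < s" "s < r" and e1: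
      "f (x + r *\<^sub>R h + r *\<^sub>R k) - f (x + r *\<^sub>R h) - f (x + r *\<^sub>R k) + f x
       = r * (FD f (x + s *\<^sub>R h + r *\<^sub>R k) h - FD f (x + s *\<^sub>R h + 0 *\<^sub>R k) h)" by auto
    have dg: "((\<lambda>t. FD f (x + s *\<^sub>R h + t *\<^sub>R k) h) has_real_derivative
        FD (\<lambda>z. FD f z h) (x + s *\<^sub>R h + t *\<^sub>R k) k) (at t)"
      if "0 \<le> t" "t \<le> r" for t
    proof -
      have i: "((\<lambda>t. x + s *\<^sub>R h + t *\<^sub>R k) has_derivative (\<lambda>u. u *\<^sub>R k)) (at t)"
        by (auto intro!: derivative_eq_intros)
      have m: "x + s *\<^sub>R h + t *\<^sub>R k \<in> A" using sub s that by simp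
      have "((\<lambda>t. FD f (x + s *\<^sub>R h + t *\<^sub>R k) h) has_derivative
          (\<lambda>u. FD (\<lambda>z. FD f z h) (x + s *\<^sub>R h + t *\<^sub>R k) (u *\<^sub>R k))) (at t)"
        by (rule has_derivative_compose [OF i smooth_on_FD_has_derivative [OF assms(2) m]])
      then show ?thesis
        using smooth_on_differentiable [OF smooth_on_FD [OF assms(2)] m]
        by (simp add: has_field_derivative_def FD_linear mult.commute [of _ "FD _ _ _"])
    qed
    have "\<exists>t. 0 < t \<and> t < r \<and> FD f (x + s *\<^sub>R h + r *\<^sub>R k) h - FD f (x + s *\<^sub>R h + 0 *\<^sub>R k) h
        = (r - 0) * FD (\<lambda>z. FD f z h) (x + s *\<^sub>R h + t *\<^sub>R k) k"
      using r dg by (intro MVT2 [of 0 r "\<lambda>t. FD f (x + s *\<^sub>R h + t *\<^sub>R k) h"]) auto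
    then show ?thesis using s e1 by auto
  qed
  let ?a = "FD (\<lambda>z. FD f z h) x k" and ?b = "FD (\<lambda>z. FD f z k) x h"
  have "\<bar>?a - ?b\<bar> \<le> e" if "e > 0" for e :: real
  proof -
    have c: "isCont (\<lambda>z. FD (\<lambda>z. FD f z h) z k) x" for h k
      using smooth_on_continuous_on [OF smooth_on_FD [OF smooth_on_FD [OF assms(2)]]] assms
      by (simp add: continuous_on_eq_continuous_at)
    obtain d1 where d1: "d1 > 0" "\<And>z. dist z x < d1 \<Longrightarrow> dist (FD (\<lambda>z. FD f z h) z k) ?a < e/2"
      using c [of h k] half_gt_zero [OF \<open>e > 0\<close>] unfolding continuous_at_eps_delta by blast
    obtain d2 where d2: "d2 > 0" "\<And>z. dist z x < d2 \<Longrightarrow> dist (FD (\<lambda>z. FD f z k) z h) ?b < e/2"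
      using c [of k h] half_gt_zero [OF \<open>e > 0\<close>] unfolding continuous_at_eps_delta by blast
    obtain d3 where d3: "d3 > 0" "ball x d3 \<subseteq> A"
      using assms(1,3) open_contains_ball by blast
    define d where "d = min d1 (min d2 d3)"
    have "d > 0" using d1 d2 d3 by (simp add: d_def)
    \<comment> \<open>Small enough for the whole parallelogram to lie within distance
      \<open>d\<close> of \<open>x\<close>; the \<open>+ 1\<close> guards against
      \<open>h = k = 0\<close>.\<close>
    define r where "r = d / (2 * (norm h + norm k + 1))"
    have r: "r > 0" using \<open>d > 0\<close> unfolding r_def
      by (intro divide_pos_pos mult_pos_pos) (auto intro: add_nonneg_pos)
    have near: "dist (x + s *\<^sub>R h + t *\<^sub>R k) x < d" if "0 \<le> s" "s \<le> r" "0 \<le> t" "t \<le> r" for s t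
    proof -
      have "dist (x + s *\<^sub>R h + t *\<^sub>R k) x \<le> s * norm h + t * norm k"
        using norm_triangle_ineq [of "s *\<^sub>R h" "t *\<^sub>R k"] that by (simp add: dist_norm)
      also have "\<dots> \<le> r * norm h + r * norm k"
        using that by (intro add_mono mult_right_mono) auto
      also have "\<dots> < r * (2 * (norm h + norm k + 1))"
      proof -
        have "r * (2 * (norm h + norm k + 1)) - (r * norm h + r * norm k) = r * (norm h + norm k + 2)"
          by (simp add: algebra_simps)
        moreover have "r * (norm h + norm k + 2) > 0" using r by (intro mult_pos_pos) (auto intro: add_nonneg_pos)
        ultimately show ?thesis by linarith
      qed
      also have "\<dots> = d"
      proof -
        have "2 * (norm h + norm k + 1) \<noteq> 0"
          by (smt (verit) norm_ge_zero)
        then show ?thesis by (simp add: r_def)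
      qed
      finally show ?thesis .
    qed
    have sub: "x + s *\<^sub>R h + t *\<^sub>R k \<in> A" if "0 \<le> s" "s \<le> r" "0 \<le> t" "t \<le> r" for s t
      using near [OF that] d3(2) by (auto simp: d_def subset_iff dist_commute)
    have sub': "x + s *\<^sub>R k + t *\<^sub>R h \<in> A" if "0 \<le> s" "s \<le> r" "0 \<le> t" "t \<le> r" for s t
      using sub [of t s] that by (simp add: ac_simps)
    obtain s t where st: "0 < s" "s < r" "0 < t" "t < r" and e1:
      "f (x + r *\<^sub>R h + r *\<^sub>R k) - f (x + r *\<^sub>R h) - f (x + r *\<^sub>R k) + f x
      = r * r * FD (\<lambda>z. FD f z h) (x + s *\<^sub>R h + t *\<^sub>R k) k"
      using * [OF r sub] by blast
    obtain s' t' where st': "0 < s'" "s' < r" "0 < t'" "t' < r" and e2: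
      "f (x + r *\<^sub>R k + r *\<^sub>R h) - f (x + r *\<^sub>R k) - f (x + r *\<^sub>R h) + f x
      = r * r * FD (\<lambda>z. FD f z k) (x + s' *\<^sub>R k + t' *\<^sub>R h) h"
      using * [OF r sub'] by blast
    have "r * r * FD (\<lambda>z. FD f z h) (x + s *\<^sub>R h + t *\<^sub>R k) k = r * r * FD (\<lambda>z. FD f z k) (x + s' *\<^sub>R k + t' *\<^sub>R h) h"
      using e1 e2 by (simp add: algebra_simps)
    then have eq: "FD (\<lambda>z. FD f z h) (x + s *\<^sub>R h + t *\<^sub>R k) k = FD (\<lambda>z. FD f z k) (x + t' *\<^sub>R h + s' *\<^sub>R k) h"
      using r by (simp add: algebra_simps)
    have "dist (x + s *\<^sub>R h + t *\<^sub>R k) x < d1" "dist (x + t' *\<^sub>R h + s' *\<^sub>R k) x < d2"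
      using near [of s t] near [of t' s'] st st' by (auto simp: d_def)
    then show ?thesis using d1(2) d2(2) eq unfolding dist_real_def by (smt (verit) field_sum_of_halves)
  qed
  then have "\<bar>?a - ?b\<bar> \<le> 0" by (meson field_le_epsilon add_0 le_less_linear order.trans less_imp_le dense_ge)
  then show ?thesis by simp
qed

lemma second_derivative_symmetric:
  fixes f :: "'b::real_normed_vector \<Rightarrow> 'c::euclidean_space"
  assumes "open A" "smooth_on A f" "x \<in> A"
  shows "FD (\<lambda>z. FD f z h) x k = FD (\<lambda>z. FD f z k) x h"
proof (rule euclidean_eqI)
  fix b :: 'c assume "b \<in> Basis"
  have s: "smooth_on A (\<lambda>z. f z \<bullet> b)" using assms by (intro smooth_on_intros)
  have e: "FD (\<lambda>z. g z \<bullet> b) z = (\<lambda>k. FD g z k \<bullet> b)" if "smooth_on A g" "z \<in> A" for z and g :: "'b \<Rightarrow> 'c"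
    by (intro FD_eqI has_derivative_inner_left smooth_on_has_derivative [OF that])
  have "FD (\<lambda>z. FD f z h) x k \<bullet> b = FD (\<lambda>z. FD (\<lambda>z. f z \<bullet> b) z h) x k" for h k
    using FD_cong [OF assms(1,3), of "\<lambda>z. FD (\<lambda>z. f z \<bullet> b) z h" "\<lambda>z. FD f z h \<bullet> b"] e assms(2,3) smooth_on_FD
    by (simp add: smooth_on_FD)
  then show "FD (\<lambda>z. FD f z h) x k \<bullet> b = FD (\<lambda>z. FD f z k) x h \<bullet> b"
    using second_derivative_symmetric_real [OF assms(1) s assms(3)] by simp
qed

section \<open>Scalar implicit functions\<close>

text \<open>The unknown is a scalar, real or complex, and the derivative in it is multiplication by
  \<open>a p\<close>; in the complex case this is complex differentiability in the unknown. The
  derivative of the solution is then an explicit quotient, from which the differential equations of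
  the scale factor \<open>s\<close> and of \<open>c\<close> are read off later. Existence comes from
  the inverse function theorem for \<open>(x, t) \<mapsto> (x, F (x, t))\<close>.\<close>

lemma implicit_function_point:
  fixes F :: "'e::euclidean_space \<times> 'k::{real_normed_field,euclidean_space} \<Rightarrow> 'k"
  assumes A: "open A" and F: "smooth_on A F" and x0: "(x0, t0) \<in> A" "F (x0, t0) = 0"
    and lin: "\<And>p k. p \<in> A \<Longrightarrow> FD F p (0, k) = a p * k" and a0: "a (x0, t0) \<noteq> 0"
  obtains V d g where "open V" "x0 \<in> V" "d > 0" "smooth_on V g"
    "\<And>x. x \<in> V \<Longrightarrow> dist (g x) t0 < d \<and> F (x, g x) = 0 \<and> a (x, g x) \<noteq> 0"
    "\<And>x t. x \<in> V \<Longrightarrow> dist t t0 < d \<Longrightarrow> (x, t) \<in> A"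
    "\<And>x t. x \<in> V \<Longrightarrow> dist t t0 < d \<Longrightarrow> F (x, t) = 0 \<Longrightarrow> t = g x"
    "\<And>x h. x \<in> V \<Longrightarrow> FD g x h = - FD F (x, g x) (h, 0) / a (x, g x)"
proof -
  have a_eq: "a p = FD F p (0, 1)" if "p \<in> A" for p using lin [OF that, of 1] by simp
  \<comment> \<open>Shrinking to the points where \<open>a\<close> does not vanish makes the
    quotient formula valid along the whole solution and not only at the base point.\<close>
  define A' where "A' = {p \<in> A. FD F p (0, 1) \<noteq> 0}"
  have "continuous_on A (\<lambda>p. FD F p (0, 1))"
    by (intro smooth_on_continuous_on smooth_on_FD F)
  then have "open (A \<inter> (\<lambda>p. FD F p (0, 1)) -` (- {0}))"
    using A by (intro continuous_open_preimage) auto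
  moreover have "A' = A \<inter> (\<lambda>p. FD F p (0, 1)) -` (- {0})" by (auto simp: A'_def)
  ultimately have oA': "open A'" by simp
  have A'A: "A' \<subseteq> A" by (auto simp: A'_def)
  have p0: "(x0, t0) \<in> A'" using x0 a0 a_eq by (simp add: A'_def)
  have dF: "(F has_derivative FD F p) (at p)" if "p \<in> A" for p
    by (rule smooth_on_has_derivative [OF F that])
  define Ph where "Ph = (\<lambda>p. (fst p, F p))"
  define Ph' where "Ph' = (\<lambda>p. Blinfun (\<lambda>u. (fst u, FD F p u)))"
  have bl: "bounded_linear (\<lambda>u. (fst u, FD F p u))" if "p \<in> A" for p
    using dF [OF that] by (intro bounded_linear_Pair bounded_linear_fst) (rule has_derivative_bounded_linear)
  have Ph'_apply: "blinfun_apply (Ph' p) = (\<lambda>u. (fst u, FD F p u))" if "p \<in> A" for p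
    unfolding Ph'_def by (rule bounded_linear_Blinfun_apply [OF bl [OF that]])
  have derPh: "(Ph has_derivative blinfun_apply (Ph' p)) (at p)" if "p \<in> A'" for p
  proof -
    have "p \<in> A" using that A'A by blast
    from has_derivative_Pair [OF has_derivative_fst [OF has_derivative_ident] dF [OF this]]
    show ?thesis unfolding Ph_def Ph'_apply [OF \<open>p \<in> A\<close>] by simp
  qed
  have contPh: "continuous_on A' Ph'"
  proof (rule continuous_on_blinfun_componentwise)
    fix i :: "'e \<times> 'k"
    have "continuous_on A' (\<lambda>p. (fst i, FD F p i))"
      by (intro continuous_intros smooth_on_continuous_on smooth_on_subset [OF _ A'A] smooth_on_FD F)
    then show "continuous_on A' (\<lambda>p. blinfun_apply (Ph' p) i)"
      using A'A by (subst continuous_on_cong [OF refl]) (auto simp: Ph'_apply subset_iff)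
  qed
  have d0: "F differentiable (at (x0, t0))" using smooth_on_differentiable [OF F x0(1)] .
  \<comment> \<open>The inverse of the derivative \<open>Ph'\<close> at the base point, explicit
    because that derivative is block triangular.\<close>
  define invf where "invf = Blinfun (\<lambda>u. (fst u, (snd u - FD F (x0, t0) (fst u, 0)) / a (x0, t0)))"
  have blinv: "bounded_linear (\<lambda>u. (fst u, (snd u - FD F (x0, t0) (fst u, 0)) / a (x0, t0)))"
    by (intro bounded_linear_Pair bounded_linear_fst bounded_linear_sub bounded_linear_snd
          bounded_linear_compose [OF bounded_linear_divide]
          bounded_linear_compose [OF has_derivative_bounded_linear [OF dF [OF x0(1)]]] bounded_linear_zero)
  have "invf o\<^sub>L Ph' (x0, t0) = id_blinfun"
  proof (rule blinfun_eqI)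
    fix u :: "'e \<times> 'k"
    have "FD F (x0, t0) u = FD F (x0, t0) ((fst u, 0) + (0, snd u))" by simp
    also have "\<dots> = FD F (x0, t0) (fst u, 0) + a (x0, t0) * snd u"
      using lin [OF x0(1)] by (simp only: FD_linear [OF d0])
    finally show "blinfun_apply (invf o\<^sub>L Ph' (x0, t0)) u = blinfun_apply id_blinfun u"
      using a0 unfolding invf_def
      by (simp add: Ph'_apply x0 bounded_linear_Blinfun_apply [OF blinv] prod_eq_iff)
  qed
  note inv = this
  obtain U' V' g0 g' where U': "open U'" "U' \<subseteq> A'" "(x0, t0) \<in> U'" and V': "open V'" "Ph (x0, t0) \<in> V'"
    and hom: "homeomorphism U' V' Ph g0"
    and derg: "\<And>y. y \<in> V' \<Longrightarrow> (g0 has_derivative g' y) (at y)"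
  proof (rule inverse_function_theorem [OF oA' _ contPh p0 inv])
    show "(Ph has_derivative blinfun_apply (Ph' p)) (at p)" if "p \<in> A'" for p by (rule derPh [OF that])
  next
    fix U' V g g'
    assume *: "open U'" "U' \<subseteq> A'" "(x0, t0) \<in> U'" "open V" "Ph (x0, t0) \<in> V" "homeomorphism U' V Ph g"
      "\<And>y. y \<in> V \<Longrightarrow> (g has_derivative g' y) (at y)"
    show thesis by (rule that [OF *])
  qed
  obtain B1 B2 where B: "open B1" "open B2" "(x0, t0) \<in> B1 \<times> B2" "B1 \<times> B2 \<subseteq> U'"
    using U' by (metis open_prod_elim)
  then obtain d where d: "d > 0" "ball t0 d \<subseteq> B2" by (auto simp: open_contains_ball)
  have x0V': "(x0, 0) \<in> V'" using V' x0 by (simp add: Ph_def)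
  have cg0: "continuous_on V' g0" using hom by (simp add: homeomorphism_def)
  define V where "V = {x \<in> B1. (x, 0) \<in> V' \<and> g0 (x, 0) \<in> UNIV \<times> ball t0 d}"
  define g where "g = (\<lambda>x. snd (g0 (x, 0)))"
  have "open (V' \<inter> g0 -` (UNIV \<times> ball t0 d))"
    by (intro continuous_open_preimage [OF cg0 V'(1)] open_Times) auto
  moreover have "continuous_on UNIV (\<lambda>x::'e. (x, 0::'k))" by (intro continuous_intros)
  ultimately have "open ((\<lambda>x::'e. (x, 0::'k)) -` (V' \<inter> g0 -` (UNIV \<times> ball t0 d)))"
    by (rule open_vimage)
  then have oV: "open V"
    using B(1) open_Int [of B1 "(\<lambda>x::'e. (x, 0::'k)) -` (V' \<inter> g0 -` (UNIV \<times> ball t0 d))"]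
    by (simp add: V_def vimage_def Int_def)
  have sol: "(x, g x) \<in> U' \<and> F (x, g x) = 0 \<and> dist (g x) t0 < d" if "x \<in> V" for x
  proof -
    have x: "x \<in> B1" "(x, 0) \<in> V'" "g0 (x, 0) \<in> UNIV \<times> ball t0 d" using that by (auto simp: V_def)
    have "Ph (g0 (x, 0)) = (x, 0)" "g0 (x, 0) \<in> U'"
      using hom x(2) by (auto simp: homeomorphism_def)
    then show ?thesis using x(3) by (cases "g0 (x, 0)") (auto simp: Ph_def g_def dist_commute)
  qed
  have uniq: "t = g x" if "x \<in> B1" "dist t t0 < d" "F (x, t) = 0" for x t
  proof -
    have "(x, t) \<in> U'" using that B d by (auto simp: subset_iff dist_commute)
    then have "g0 (Ph (x, t)) = (x, t)" using hom by (auto simp: homeomorphism_def)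
    then show ?thesis using that by (simp add: Ph_def g_def)
  qed
  have x0V: "x0 \<in> V"
  proof -
    have "g0 (Ph (x0, t0)) = (x0, t0)" using hom U' by (auto simp: homeomorphism_def)
    then show ?thesis using x0V' B d x0 by (auto simp: V_def Ph_def)
  qed
  have dg: "g differentiable (at x)" if "x \<in> V" for x
  proof -
    have "(x, 0) \<in> V'" using that by (simp add: V_def)
    note 1 = derg [OF this]
    have "((\<lambda>x. (x, 0::'k)) has_derivative (\<lambda>h. (h, 0))) (at x)" by (auto intro!: derivative_eq_intros)
    from has_derivative_snd [OF has_derivative_compose [OF this 1]]
    show ?thesis unfolding g_def by (rule differentiableI)
  qed
  have UA: "U' \<subseteq> A" using U' A'A by blast
  have a_nz: "a (x, g x) \<noteq> 0" if "x \<in> V" for x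
    using sol [OF that] U'(2) a_eq [of "(x, g x)"] by (auto simp: A'_def)
  have FDg: "FD g x h = - FD F (x, g x) (h, 0) / a (x, g x)" if "x \<in> V" for x h
  proof -
    have m: "(x, g x) \<in> A" using sol [OF that] UA by auto
    have "((\<lambda>x. (x, g x)) has_derivative (\<lambda>h. (h, FD g x h))) (at x)"
      using dg [OF that] by (auto intro!: derivative_eq_intros simp: frechet_derivative_works)
    then have "((\<lambda>x. F (x, g x)) has_derivative (\<lambda>h. FD F (x, g x) (h, FD g x h))) (at x)"
      by (rule has_derivative_compose) (rule dF [OF m])
    moreover have "((\<lambda>x. F (x, g x)) has_derivative (\<lambda>h. 0)) (at x)"
      by (rule has_derivative_transform_within_open [OF has_derivative_const [of 0] oV that]) (use sol in auto)
    ultimately have "(\<lambda>h. FD F (x, g x) (h, FD g x h)) = (\<lambda>h. 0)" by (rule has_derivative_unique)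
    from fun_cong [OF this] have "FD F (x, g x) (h, FD g x h) = 0" .
    moreover have "FD F (x, g x) (h, FD g x h) = FD F (x, g x) ((h, 0) + (0, FD g x h))" by simp
    ultimately have "FD F (x, g x) (h, 0) + a (x, g x) * FD g x h = 0"
      by (simp only: FD_linear [OF smooth_on_differentiable [OF F m]] lin [OF m])
    then show ?thesis using a_nz [OF that] by (simp add: field_simps eq_neg_iff_add_eq_0 add.commute)
  qed
  \<comment> \<open>Bootstrapping: the formula for the derivative of \<open>g\<close> involves no
    derivative of \<open>g\<close>, so order \<open>k\<close> of \<open>g\<close> gives order
    \<open>k\<close> of its derivative.\<close>
  have "Ck_on k V g" for k
  proof (induction k)
    case 0
    show ?case using dg
      by (auto intro!: continuous_at_imp_continuous_on differentiable_imp_continuous_within)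
  next
    case (Suc k)
    have img: "(\<lambda>x. (x, g x)) ` V \<subseteq> A" using sol UA by auto
    have P: "Ck_on k V (\<lambda>x. (x, g x))"
      by (intro Ck_on_Pair oV Suc.IH Ck_on_bounded_linear_fun bounded_linear_ident)
    have C: "Ck_on k V (\<lambda>x. FD F (x, g x) u)" for u
      using smooth_on_FD [OF F, of u] by (intro Ck_on_compose [OF oV _ P img]) (auto simp: smooth_on_def)
    have nz: "FD F (x, g x) (0, 1) \<noteq> 0" if "x \<in> V" for x
      using a_nz [OF that] a_eq img that by auto
    have "Ck_on k V (\<lambda>x. FD F (x, g x) (h, 0) * inverse (FD F (x, g x) (0, 1)))" for h
      by (intro Ck_on_bilinear [OF bounded_bilinear_mult] oV C Ck_on_inverse nz)
    then have C: "Ck_on k V (\<lambda>x. - (FD F (x, g x) (h, 0) * inverse (FD F (x, g x) (0, 1))))" for h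
      by (rule Ck_on_bounded_linear [OF bounded_linear_minus [OF bounded_linear_ident] oV])
    have e: "- (FD F (x, g x) (h, 0) * inverse (FD F (x, g x) (0, 1))) = FD g x h" if "x \<in> V" for x h
      using a_eq [of "(x, g x)"] img that FDg [OF that, of h] by (auto simp: divide_inverse)
    have "Ck_on k V (\<lambda>x. FD g x h)" for h
      by (rule Ck_on_cong [OF oV e C])
    then show ?case using dg by simp
  qed
  then have sg: "smooth_on V g" by (simp add: smooth_on_def)
  show thesis
  proof (rule that [of V d g])
    show "(x, t) \<in> A" if "x \<in> V" "dist t t0 < d" for x t
    proof -
      have "x \<in> B1" "t \<in> B2" using that d by (auto simp: V_def dist_commute)
      then show ?thesis using B(4) UA by blast
    qed
    show "t = g x" if "x \<in> V" "dist t t0 < d" "F (x, t) = 0" for x t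
      using uniq that by (simp add: V_def)
  qed (use oV x0V d(1) sg sol a_nz FDg in blast)+
qed

text \<open>Uniqueness within a common radius \<open>D\<close> of \<open>t0\<close> forces the local
  solutions over a finite cover of \<open>K\<close> to agree on overlaps, so they glue.\<close>

lemma implicit_function_compact:
  fixes F :: "'e::euclidean_space \<times> 'k::{real_normed_field,euclidean_space} \<Rightarrow> 'k"
  assumes K: "compact K" and A: "open A" and F: "smooth_on A F"
    and x0: "\<And>x. x \<in> K \<Longrightarrow> (x, t0) \<in> A \<and> F (x, t0) = 0 \<and> a (x, t0) \<noteq> 0"
    and lin: "\<And>p k. p \<in> A \<Longrightarrow> FD F p (0, k) = a p * k"
  obtains V d g where "open V" "K \<subseteq> V" "d > 0" "smooth_on V g" "\<And>x. x \<in> K \<Longrightarrow> g x = t0"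
    "\<And>x. x \<in> V \<Longrightarrow> dist (g x) t0 < d \<and> F (x, g x) = 0 \<and> a (x, g x) \<noteq> 0"
    "\<And>x t. x \<in> V \<Longrightarrow> dist t t0 < d \<Longrightarrow> (x, t) \<in> A"
    "\<And>x t. x \<in> V \<Longrightarrow> dist t t0 < d \<Longrightarrow> F (x, t) = 0 \<Longrightarrow> t = g x"
    "\<And>x h. x \<in> V \<Longrightarrow> FD g x h = - FD F (x, g x) (h, 0) / a (x, g x)"
proof -
  define ok where "ok = (\<lambda>V d g. open V \<and> d > 0 \<and> smooth_on V g \<and>
    (\<forall>x\<in>V. dist (g x) t0 < d \<and> F (x, g x) = 0 \<and> a (x, g x) \<noteq> 0) \<and>
    (\<forall>x\<in>V. \<forall>t. dist t t0 < d \<longrightarrow> (x, t) \<in> A \<and> (F (x, t) = 0 \<longrightarrow> t = g x)) \<and>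
    (\<forall>x\<in>V. \<forall>h. FD g x h = - FD F (x, g x) (h, 0) / a (x, g x)))"
  have okD: "open V" "d > 0" "smooth_on V g"
    "\<And>x. x \<in> V \<Longrightarrow> dist (g x) t0 < d" "\<And>x. x \<in> V \<Longrightarrow> F (x, g x) = 0"
    "\<And>x. x \<in> V \<Longrightarrow> a (x, g x) \<noteq> 0"
    "\<And>x t. x \<in> V \<Longrightarrow> dist t t0 < d \<Longrightarrow> (x, t) \<in> A"
    "\<And>x t. x \<in> V \<Longrightarrow> dist t t0 < d \<Longrightarrow> F (x, t) = 0 \<Longrightarrow> t = g x"
    "\<And>x h. x \<in> V \<Longrightarrow> FD g x h = - FD F (x, g x) (h, 0) / a (x, g x)"
    if "ok V d g" for V d g
    using that unfolding ok_def by blast+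
  have "\<exists>V d g. x \<in> V \<and> ok V d g" if "x \<in> K" for x
  proof -
    have "(x, t0) \<in> A" "F (x, t0) = 0" "a (x, t0) \<noteq> 0" using x0 [OF that] by auto
    show ?thesis
    proof (rule implicit_function_point [OF A F, of x t0 a])
      show "(x, t0) \<in> A" "F (x, t0) = 0" "a (x, t0) \<noteq> 0" by fact+
      show "FD F p (0, k) = a p * k" if "p \<in> A" for p k by (rule lin [OF that])
    next
      fix V d g assume "open V" "x \<in> V" "d > 0" "smooth_on V g"
        "\<And>x. x \<in> V \<Longrightarrow> dist (g x) t0 < d \<and> F (x, g x) = 0 \<and> a (x, g x) \<noteq> 0"
        "\<And>x t. x \<in> V \<Longrightarrow> dist t t0 < d \<Longrightarrow> (x, t) \<in> A"
        "\<And>x t. x \<in> V \<Longrightarrow> dist t t0 < d \<Longrightarrow> F (x, t) = 0 \<Longrightarrow> t = g x"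
        "\<And>x h. x \<in> V \<Longrightarrow> FD g x h = - FD F (x, g x) (h, 0) / a (x, g x)"
      then show ?thesis unfolding ok_def by (intro exI [of _ V] exI [of _ d] exI [of _ g]) simp
    qed
  qed
  then obtain V d g where ok: "\<And>x. x \<in> K \<Longrightarrow> x \<in> V x \<and> ok (V x) (d x) (g x)"
    by metis
  have oV: "open (V x)" if "x \<in> K" for x
    by (rule okD(1)) (use ok [OF that] in blast)
  have KV: "K \<subseteq> (\<Union>i\<in>K. V i)" using ok by blast
  obtain I where I: "I \<subseteq> K" "finite I" "K \<subseteq> (\<Union>i\<in>I. V i)"
  proof (rule compactE_image [OF K _ KV])
    show "open (V x)" if "x \<in> K" for x by (rule oV [OF that])
  qed
  \<comment> \<open>The inserted 1 keeps \<open>Min\<close> meaningful when the cover is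
    empty.\<close>
  define D where "D = Min (insert 1 (d ` I))"
  have D: "D > 0"
  proof -
    have "d i > 0" if "i \<in> I" for i by (rule okD(2) [of "V i" _ "g i"]) (use ok [of i] that I in blast)
    then show ?thesis unfolding D_def using I(2) by simp
  qed
  have Dle: "D \<le> d i" if "i \<in> I" for i unfolding D_def using I that by auto
  define V' where "V' = (\<lambda>i. {z \<in> V i. dist (g i z) t0 < D})"
  have oV': "open (V' i)" if "i \<in> I" for i
  proof -
    have "open (V i)" "continuous_on (V i) (g i)"
      using okD(1) okD(3) [THEN smooth_on_continuous_on] ok [of i] I that by blast+
    then have "open (V i \<inter> g i -` ball t0 D)" by (intro continuous_open_preimage) auto
    then show ?thesis by (simp add: V'_def vimage_def Int_def dist_commute)
  qed
  define W where "W = (\<Union>i\<in>I. V' i)"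
  define G where "G = (\<lambda>z. g (SOME i. i \<in> I \<and> z \<in> V' i) z)"
  have okI: "ok (V i) (d i) (g i)" if "i \<in> I" for i using ok [of i] I that by auto
  have uniq: "t = g i z" if "i \<in> I" "z \<in> V' i" "dist t t0 < D" "F (z, t) = 0" for i z t
    using okD(8) [OF okI [OF that(1)], of z t] that Dle [OF that(1)] by (simp add: V'_def)
  have G: "G z = g i z" if "i \<in> I" "z \<in> V' i" for i z
  proof -
    define j where "j = (SOME i. i \<in> I \<and> z \<in> V' i)"
    have j: "j \<in> I" "z \<in> V' j" using someI [of "\<lambda>i. i \<in> I \<and> z \<in> V' i" i] that by (auto simp: j_def)
    have "g j z = g i z"
      using okD(5) [OF okI [OF j(1)], of z] j by (intro uniq [OF that]) (simp_all add: V'_def)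
    then show ?thesis by (simp add: G_def j_def)
  qed
  show thesis
  proof (rule that [of W D G])
    show "open W" using oV' by (auto simp: W_def)
    show KW: "K \<subseteq> W"
    proof
      fix x assume x: "x \<in> K"
      then obtain i where i: "i \<in> I" "x \<in> V i" using I by auto
      have "g i x = t0" using okD(8) [OF okI [OF i(1)], of x t0] okD(2) [OF okI [OF i(1)]] i x0 [OF x] by simp
      then show "x \<in> W" using i D by (auto simp: W_def V'_def)
    qed
    show "D > 0" by fact
    show "smooth_on W G"
    proof (rule smooth_on_local)
      fix x assume "x \<in> W"
      then obtain i where i: "i \<in> I" "x \<in> V' i" by (auto simp: W_def)
      have "smooth_on (V' i) (g i)"
        by (rule smooth_on_subset [OF okD(3) [OF okI [OF i(1)]]]) (auto simp: V'_def)
      then have "smooth_on (V' i) G" using smooth_on_cong [OF oV' [OF i(1)], of "g i" G] G i by auto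
      then show "\<exists>B. open B \<and> x \<in> B \<and> smooth_on B G" using i oV' by blast
    qed
    show "G x = t0" if "x \<in> K" for x
    proof -
      from subsetD [OF KW that] obtain i where i: "i \<in> I" "x \<in> V' i" by (auto simp: W_def)
      then show ?thesis using uniq [OF i, of t0] x0 [OF that] G [OF i] D by simp
    qed
    fix x assume "x \<in> W"
    then obtain i where i: "i \<in> I" "x \<in> V' i" by (auto simp: W_def)
    have xV: "x \<in> V i" using i by (simp add: V'_def)
    show "dist (G x) t0 < D \<and> F (x, G x) = 0 \<and> a (x, G x) \<noteq> 0"
      using okD(5,6) [OF okI [OF i(1)], of x] i xV by (simp add: G [OF i] V'_def)
    show "(x, t) \<in> A" if "dist t t0 < D" for t
      using okD(7) [OF okI [OF i(1)], of x t] xV that Dle [OF i(1)] by simp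
    show "t = G x" if "dist t t0 < D" "F (x, t) = 0" for t
      using uniq [OF i that] G [OF i] by simp
    show "FD G x h = - FD F (x, G x) (h, 0) / a (x, G x)" for h
    proof -
      have "FD G x = FD (g i) x" by (rule FD_cong [OF oV' [OF i(1)] i(2)]) (rule G [OF i(1)])
      then show ?thesis using okD(9) [OF okI [OF i(1)], of x h] xV by (simp add: G [OF i])
    qed
  qed
qed

text \<open>On an overlap of two neighbourhoods the pieces may disagree away from \<open>K\<close>;
  only their germs at points of \<open>K\<close> coincide. Choose finitely many closed balls inside
  the sets \<open>N p\<close>. A point close enough to \<open>r\<close> lies in the open ball
  \<open>i\<close> only if \<open>r\<close> lies in the closed ball \<open>i\<close>, where the
  germs at \<open>r\<close> agree, so any choice of the index gives the right germ.\<close>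

lemma glue_near_compact:
  fixes K :: "'a::metric_space set" and s :: "'a \<Rightarrow> 'a \<Rightarrow> 'b"
  assumes "compact K" and N: "\<And>p. p \<in> K \<Longrightarrow> open (N p) \<and> p \<in> N p"
    and agree: "\<And>p q r. p \<in> K \<Longrightarrow> q \<in> K \<Longrightarrow> r \<in> K \<Longrightarrow> r \<in> N p \<Longrightarrow> r \<in> N q
      \<Longrightarrow> \<forall>\<^sub>F x in nhds r. s p x = s q x"
  obtains S where "\<And>p r. p \<in> K \<Longrightarrow> r \<in> K \<Longrightarrow> r \<in> N p \<Longrightarrow> \<forall>\<^sub>F x in nhds r. S x = s p x"
proof -
  have "\<exists>e>0. cball p e \<subseteq> N p" if "p \<in> K" for p
    using N [OF that] open_contains_cball by blast
  then obtain e where e: "\<And>p. p \<in> K \<Longrightarrow> e p > 0 \<and> cball p (e p) \<subseteq> N p" by metis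
  obtain I where I: "finite I" "I \<subseteq> K" "K \<subseteq> (\<Union>i\<in>I. ball i (e i))"
    using compactE_image [OF \<open>compact K\<close>, of K "\<lambda>i. ball i (e i)"] e by (metis (no_types, lifting) UN_iff centre_in_ball open_ball subsetI)
  define S where "S = (\<lambda>x. s (SOME i. i \<in> I \<and> x \<in> ball i (e i)) x)"
  show thesis
  proof (rule that [of S])
    fix p r assume p: "p \<in> K" "r \<in> K" "r \<in> N p"
    have 1: "\<forall>\<^sub>F x in nhds r. \<forall>i\<in>I. x \<in> ball i (e i) \<longrightarrow> r \<in> cball i (e i)"
    proof (subst eventually_ball_finite_distrib [OF I(1)], rule ballI)
      fix i assume "i \<in> I"
      show "\<forall>\<^sub>F x in nhds r. x \<in> ball i (e i) \<longrightarrow> r \<in> cball i (e i)"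
      proof (cases "r \<in> cball i (e i)")
        case False
        then have "\<forall>\<^sub>F x in nhds r. x \<in> - cball i (e i)"
          by (intro eventually_nhds_in_open) auto
        then show ?thesis by (rule eventually_mono) auto
      qed auto
    qed
    have 2: "\<forall>\<^sub>F x in nhds r. \<forall>i\<in>I. r \<in> cball i (e i) \<longrightarrow> s i x = s p x"
    proof (subst eventually_ball_finite_distrib [OF I(1)], rule ballI)
      fix i assume i: "i \<in> I"
      show "\<forall>\<^sub>F x in nhds r. r \<in> cball i (e i) \<longrightarrow> s i x = s p x"
      proof (cases "r \<in> cball i (e i)")
        case True
        then have "r \<in> N i" "i \<in> K" using e i I by blast+
        then show ?thesis using agree [of i p r] p by (auto elim: eventually_mono)
      qed auto
    qed
    have 3: "\<forall>\<^sub>F x in nhds r. x \<in> (\<Union>i\<in>I. ball i (e i))"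
      using subsetD [OF I(3) p(2)] by (intro eventually_nhds_in_open open_UN) auto
    from 1 2 3 show "\<forall>\<^sub>F x in nhds r. S x = s p x"
    proof eventually_elim
      case (elim x)
      then have "\<exists>i. i \<in> I \<and> x \<in> ball i (e i)" by auto
      from someI_ex [OF this] show ?case using elim unfolding S_def by blast
    qed
  qed
qed

section \<open>Tangent vectors of smooth retracts\<close>

text \<open>A retraction takes the place of charts: it maps straight segments to curves in \<Sigma>,
  and its derivative at a fixed point is a projection onto the tangent space, which thereby becomes
  the solution set of a linear equation.\<close>

locale smooth_retract =
  fixes \<Sigma> N :: "'b::euclidean_space set" and R :: "'b \<Rightarrow> 'b"
  assumes open_N: "open N" and smooth_R: "smooth_on N R" and R_into: "R ` N \<subseteq> \<Sigma>"
    and R_fix: "\<And>z. z \<in> \<Sigma> \<inter> N \<Longrightarrow> R z = z"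
begin

lemma FD_R_tangent:
  assumes "u \<in> N"
  shows "FD R u V \<in> tangent_vectors \<Sigma> (R u)"
proof -
  obtain r where r: "r > 0" "ball u r \<subseteq> N" using open_N assms open_contains_ball by blast
  define e where "e = r / (norm V + 1)"
  have e: "e > 0" using r by (simp add: e_def add_nonneg_pos)
  have inN: "u + t *\<^sub>R V \<in> N" if "t \<in> {-e<..<e}" for t
  proof -
    have "\<bar>t\<bar> * norm V \<le> \<bar>t\<bar> * (norm V + 1)" by (intro mult_left_mono) auto
    also have "\<dots> < e * (norm V + 1)"
      using that by (intro mult_strict_right_mono) (auto intro: add_nonneg_pos)
    also have "\<dots> = r" by (simp add: e_def) (smt (verit) norm_ge_zero)
    finally show ?thesis using r by (auto simp: subset_iff dist_norm)
  qed
  define c where "c = (\<lambda>t::real. R (u + t *\<^sub>R V))"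
  have "smooth_on {-e<..<e} c"
    unfolding c_def using inN
    by (intro smooth_on_compose [OF _ smooth_R] smooth_on_intros) auto
  moreover have "c ` {-e<..<e} \<subseteq> \<Sigma>" using inN R_into by (auto simp: c_def)
  moreover have "(c has_vector_derivative FD R u V) (at 0)"
  proof -
    have i: "((\<lambda>t. u + t *\<^sub>R V) has_derivative (\<lambda>t. t *\<^sub>R V)) (at 0)" by (auto intro!: derivative_eq_intros)
    have "(c has_derivative (\<lambda>t. FD R u (t *\<^sub>R V))) (at 0)"
      unfolding c_def
      by (rule has_derivative_compose [OF i]) (simp add: smooth_on_has_derivative [OF smooth_R assms])
    then show ?thesis
      by (simp add: has_vector_derivative_def FD_linear smooth_on_differentiable [OF smooth_R assms])
  qed
  ultimately show ?thesis
    unfolding tangent_vectors_def using e by (intro CollectI exI [of _ e] conjI exI [of _ c]) (auto simp: c_def)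
qed

lemma tangent_vectors_eq:
  assumes "p \<in> \<Sigma> \<inter> N"
  shows "tangent_vectors \<Sigma> p = {X. FD R p X = X}"
proof
  show "{X. FD R p X = X} \<subseteq> tangent_vectors \<Sigma> p"
    using FD_R_tangent [of p] R_fix [OF assms] assms by auto (metis)
  show "tangent_vectors \<Sigma> p \<subseteq> {X. FD R p X = X}"
  proof
    fix X assume "X \<in> tangent_vectors \<Sigma> p"
    then obtain e \<gamma> where e: "e > 0" "smooth_on {-e<..<e} \<gamma>" "\<gamma> ` {-e<..<e} \<subseteq> \<Sigma>" "\<gamma> 0 = p"
      and d: "(\<gamma> has_vector_derivative X) (at (0::real))"
      unfolding tangent_vectors_def by blast
    have "open ({-e<..<e} \<inter> \<gamma> -` N)"
      using smooth_on_continuous_on [OF e(2)] open_N by (intro continuous_open_preimage) auto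
    moreover have "0 \<in> {-e<..<e} \<inter> \<gamma> -` N" using e assms by auto
    moreover have "R (\<gamma> t) = \<gamma> t" if "t \<in> {-e<..<e} \<inter> \<gamma> -` N" for t
      using that e(3) by (intro R_fix) auto
    moreover have "((\<lambda>t. R (\<gamma> t)) has_derivative (\<lambda>t. FD R p (t *\<^sub>R X))) (at 0)"
      using has_derivative_compose [OF d [unfolded has_vector_derivative_def], of R "FD R p"]
        smooth_on_has_derivative [OF smooth_R, of p] assms e(4) by auto
    ultimately have "(\<gamma> has_derivative (\<lambda>t. FD R p (t *\<^sub>R X))) (at 0)"
      by (blast intro: has_derivative_transform_within_open)
    with d have "(\<lambda>t. FD R p (t *\<^sub>R X)) = (\<lambda>t. t *\<^sub>R X)"
      unfolding has_vector_derivative_def by (metis has_derivative_unique)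
    from fun_cong [OF this, of 1] show "X \<in> {X. FD R p X = X}" by simp
  qed
qed

text \<open>Pulling the difference of the two forms back along \<open>R\<close> gives 0, and the second derivatives
  of \<open>R\<close> cancel in the antisymmetrization.\<close>

lemma ext_deriv_cong:
  assumes p: "p \<in> \<Sigma> \<inter> N" and W: "open W" "p \<in> W"
    and sm: "smooth_on W \<alpha>" "smooth_on W \<beta>"
    and eq: "\<And>z X. z \<in> \<Sigma> \<inter> W \<Longrightarrow> X \<in> tangent_vectors \<Sigma> z \<Longrightarrow> blinfun_apply (\<alpha> z) X = blinfun_apply (\<beta> z) X"
    and X: "X \<in> tangent_vectors \<Sigma> p" and Y: "Y \<in> tangent_vectors \<Sigma> p"
  shows "ext_deriv \<alpha> p X Y = ext_deriv \<beta> p X Y"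
proof -
  have Rp: "R p = p" using R_fix p by simp
  have "open (N \<inter> R -` W)"
    using smooth_on_continuous_on [OF smooth_R] open_N W by (intro continuous_open_preimage) auto
  moreover have pN: "p \<in> N \<inter> R -` W" using p W Rp by auto
  moreover have zero: "blinfun_apply (\<alpha> (R u)) (FD R u V) - blinfun_apply (\<beta> (R u)) (FD R u V) = 0"
    if "u \<in> N \<inter> R -` W" for u V
    using eq [of "R u" "FD R u V"] FD_R_tangent [of u V] that R_into by auto
  have dR: "(R has_derivative FD R p) (at p)" using smooth_on_has_derivative [OF smooth_R] p by blast
  have *: "blinfun_apply (FD \<alpha> p X) Y - blinfun_apply (FD \<beta> p X) Y
     = blinfun_apply (\<beta> p) (FD (\<lambda>u. FD R u Y) p X) - blinfun_apply (\<alpha> p) (FD (\<lambda>u. FD R u Y) p X)"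
    if "FD R p X = X" "FD R p Y = Y" for X Y
  proof -
    have g: "((\<lambda>u. blinfun_apply (\<gamma> (R u)) (FD R u Y)) has_derivative
        (\<lambda>h. blinfun_apply (\<gamma> p) (FD (\<lambda>u. FD R u Y) p h) + blinfun_apply (FD \<gamma> p (FD R p h)) Y)) (at p)"
      if "smooth_on W \<gamma>" for \<gamma> :: "'b \<Rightarrow> 'b \<Rightarrow>\<^sub>L real"
    proof -
      have "((\<lambda>u. \<gamma> (R u)) has_derivative (\<lambda>h. FD \<gamma> p (FD R p h))) (at p)"
        using has_derivative_compose [OF dR, of \<gamma> "FD \<gamma> p"] smooth_on_has_derivative [OF that W(2)] Rp by simp
      moreover have "((\<lambda>u. FD R u Y) has_derivative (\<lambda>k. FD (\<lambda>z. FD R z Y) p k)) (at p)"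
        using smooth_on_FD_has_derivative [OF smooth_R] p by blast
      ultimately show ?thesis
        using bounded_bilinear.FDERIV [OF bounded_bilinear_blinfun_apply] Rp \<open>FD R p Y = Y\<close> by fastforce
    qed
    have "((\<lambda>u. blinfun_apply (\<alpha> (R u)) (FD R u Y) - blinfun_apply (\<beta> (R u)) (FD R u Y)) has_derivative (\<lambda>h. 0)) (at p)"
      by (rule has_derivative_transform_within_open [OF has_derivative_const [of 0] \<open>open (N \<inter> R -` W)\<close> pN])
         (simp only: zero)
    from has_derivative_unique [OF this has_derivative_diff [OF g [OF sm(1)] g [OF sm(2)]]]
    have "0 = blinfun_apply (\<alpha> p) (FD (\<lambda>u. FD R u Y) p X) + blinfun_apply (FD \<alpha> p (FD R p X)) Y -
        (blinfun_apply (\<beta> p) (FD (\<lambda>u. FD R u Y) p X) + blinfun_apply (FD \<beta> p (FD R p X)) Y)"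
      by (rule fun_cong)
    then show ?thesis using that by simp
  qed
  have s: "FD (\<lambda>u. FD R u Y) p X = FD (\<lambda>u. FD R u X) p Y"
    using second_derivative_symmetric [OF open_N smooth_R] p by blast
  have "FD R p X = X" "FD R p Y = Y" using X Y tangent_vectors_eq [OF p] by auto
  from * [OF this] * [OF this(2,1)] s show ?thesis unfolding ext_deriv_def by simp
qed

end

section \<open>Complexification of real-analytic functions\<close>

text \<open>The complexification of a Euclidean space is represented by the pairs of real and imaginary
  parts.\<close>

definition Jc :: "'a::real_vector \<times> 'a \<Rightarrow> 'a \<times> 'a" where
  "Jc z = (- snd z, fst z)"

text \<open>Holomorphy is expressed as complex linearity of the real derivative, so that the real
  calculus and the real implicit function theorem apply directly.\<close>

definition holo_on :: "('a::real_normed_vector \<times> 'a) set \<Rightarrow> ('a \<times> 'a \<Rightarrow> complex) \<Rightarrow> bool" where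
  "holo_on A f \<longleftrightarrow> smooth_on A f \<and> (\<forall>z\<in>A. \<forall>h. FD f z (Jc h) = \<i> * FD f z h)"

lemma holo_on_smooth: "holo_on A f \<Longrightarrow> smooth_on A f"
  by (simp add: holo_on_def)

lemma holo_on_Jc: "holo_on A f \<Longrightarrow> z \<in> A \<Longrightarrow> FD f z (Jc h) = \<i> * FD f z h"
  unfolding holo_on_def by blast

lemma holo_onI: "smooth_on A f \<Longrightarrow> (\<And>z h. z \<in> A \<Longrightarrow> FD f z (Jc h) = \<i> * FD f z h) \<Longrightarrow> holo_on A f"
  unfolding holo_on_def by blast

lemma holo_on_subset: "holo_on A f \<Longrightarrow> B \<subseteq> A \<Longrightarrow> holo_on B f"
  unfolding holo_on_def using smooth_on_subset by blast

lemma holo_on_cong: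
  assumes "open A" "\<And>z. z \<in> A \<Longrightarrow> f z = g z" "holo_on A f"
  shows "holo_on A g"
proof -
  have e: "FD f z = FD g z" if "z \<in> A" for z by (rule FD_cong [OF assms(1) that assms(2)])
  show ?thesis
    by (intro holo_onI smooth_on_cong [OF assms(1,2) holo_on_smooth [OF assms(3)]])
       (simp_all add: e [symmetric] holo_on_Jc [OF assms(3)])
qed

lemma holo_on_local:
  assumes "\<And>z. z \<in> A \<Longrightarrow> \<exists>B. open B \<and> z \<in> B \<and> holo_on B f"
  shows "holo_on A f"
proof (rule holo_onI)
  show "smooth_on A f"
    by (rule smooth_on_local) (use assms holo_on_smooth in blast)
  show "FD f z (Jc h) = \<i> * FD f z h" if "z \<in> A" for z h
    using assms [OF that] holo_on_Jc by blast
qed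

lemma FD_compose:
  assumes "f differentiable (at (g x))" "g differentiable (at x)"
  shows "FD (\<lambda>x. f (g x)) x h = FD f (g x) (FD g x h)"
  using fun_cong [OF frechet_derivative_compose [OF assms(2,1)], of h] by (simp add: o_def)

lemma FD_mult:
  fixes f :: "'b::real_normed_vector \<Rightarrow> 'c::real_normed_algebra"
  assumes "f differentiable (at x)" "g differentiable (at x)"
  shows "FD (\<lambda>x. f x * g x) x h = f x * FD g x h + FD f x h * g x"
proof -
  have "((\<lambda>x. f x * g x) has_derivative (\<lambda>h. f x * FD g x h + FD f x h * g x)) (at x)"
    using assms by (intro has_derivative_mult) (simp_all add: frechet_derivative_works)
  then show ?thesis by (simp add: FD_eqI)
qed

lemma FD_add:
  assumes "f differentiable (at x)" "g differentiable (at x)"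
  shows "FD (\<lambda>x. f x + g x) x h = FD f x h + FD g x h"
proof -
  have "((\<lambda>x. f x + g x) has_derivative (\<lambda>h. FD f x h + FD g x h)) (at x)"
    using assms by (intro has_derivative_add) (simp_all add: frechet_derivative_works)
  then show ?thesis by (simp add: FD_eqI)
qed

lemma FD_bounded_linear:
  assumes "bounded_linear L" "f differentiable (at x)"
  shows "FD (\<lambda>x. L (f x)) x h = L (FD f x h)"
  using FD_eqI [OF bounded_linear.has_derivative [OF assms(1), of f "FD f x" "at x"]] assms(2)
  by (simp add: frechet_derivative_works)

section \<open>Estimates for iterated directional derivatives\<close>

primrec Dlist :: "'b::real_normed_vector list \<Rightarrow> ('b \<Rightarrow> 'c::real_normed_vector) \<Rightarrow> 'b \<Rightarrow> 'c" where
  "Dlist [] f = f"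
| "Dlist (h # hs) f = Dlist hs (\<lambda>x. FD f x h)"

lemma Dlist_const [simp]: "Dlist (h # hs) (\<lambda>x. c) = (\<lambda>x. 0)"
  by (induction hs arbitrary: c h) simp_all

lemma Dlist_cong:
  assumes "open A" "\<And>z. z \<in> A \<Longrightarrow> f z = g z" "z \<in> A"
  shows "Dlist hs f z = Dlist hs g z"
  using assms(2)
proof (induction hs arbitrary: f g)
  case (Cons h hs)
  have "FD f z h = FD g z h" if "z \<in> A" for z
    using FD_cong [OF assms(1) that Cons.prems] by simp
  then show ?case using Cons.IH [of "\<lambda>x. FD f x h" "\<lambda>x. FD g x h"] by simp
qed (simp add: assms)

lemma Dlist_add:
  assumes "open A" "smooth_on A f" "smooth_on A g" "z \<in> A"
  shows "Dlist hs (\<lambda>x. f x + g x) z = Dlist hs f z + Dlist hs g z"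
  using assms(2,3)
proof (induction hs arbitrary: f g)
  case (Cons h hs)
  have "FD (\<lambda>x. f x + g x) z h = FD f z h + FD g z h" if "z \<in> A" for z
    by (intro FD_add smooth_on_differentiable [OF _ that] Cons.prems)
  then have "Dlist hs (\<lambda>x. FD (\<lambda>x. f x + g x) x h) z = Dlist hs (\<lambda>x. FD f x h + FD g x h) z"
    by (rule Dlist_cong [OF assms(1) _ assms(4)])
  then show ?case using Cons by (simp add: smooth_on_FD)
qed simp

text \<open>The shape of the bound is chosen to be stable under products: by the Leibniz rule and
  the binomial theorem the constants \<open>B\<close> multiply and the rates \<open>q\<close> add. A
  monomial of degree \<open>k\<close> on a ball of radius \<open>r\<close> therefore gets the
  constant \<open>r ^ k\<close> and the rate \<open>k / r\<close>.\<close>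

definition Dbound :: "'b::real_normed_vector set \<Rightarrow> ('b \<Rightarrow> 'c::real_normed_vector) \<Rightarrow> real \<Rightarrow> real \<Rightarrow> bool" where
  "Dbound A f B q \<longleftrightarrow> smooth_on A f \<and>
     (\<forall>hs. \<forall>z\<in>A. norm (Dlist hs f z) \<le> B * q ^ length hs * (\<Prod>h\<leftarrow>hs. norm h))"

lemma Dbound_FD:
  assumes "Dbound A f B q"
  shows "Dbound A (\<lambda>x. FD f x h) (B * q * norm h) q"
  unfolding Dbound_def
proof (intro conjI allI ballI)
  show "smooth_on A (\<lambda>x. FD f x h)" using assms smooth_on_FD by (auto simp: Dbound_def)
  fix hs z assume "z \<in> A"
  then have "norm (Dlist (h # hs) f z) \<le> B * q ^ length (h # hs) * (\<Prod>h\<leftarrow>h # hs. norm h)"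
    using assms unfolding Dbound_def by blast
  then show "norm (Dlist hs (\<lambda>x. FD f x h) z) \<le> B * q * norm h * q ^ length hs * (\<Prod>h\<leftarrow>hs. norm h)"
    by (simp add: mult_ac)
qed

lemma Dbound_mult:
  fixes f g :: "'b::real_normed_vector \<Rightarrow> complex"
  assumes "open A" "Dbound A f B p" "Dbound A g C q"
  shows "Dbound A (\<lambda>x. f x * g x) (B * C) (p + q)"
proof -
  have sm: "smooth_on A f" "smooth_on A g" using assms by (auto simp: Dbound_def)
  have "norm (Dlist hs (\<lambda>x. f x * g x) z) \<le> B * C * (p + q) ^ length hs * (\<Prod>h\<leftarrow>hs. norm h)"
    if "z \<in> A" for hs z
    using assms(2,3)
  proof (induction hs arbitrary: f g B C)
    case Nil
    have "norm (f z) \<le> B" "norm (g z) \<le> C"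
      using Nil that unfolding Dbound_def by (auto dest!: spec [of _ "[]"])
    then show ?case using order.trans [OF norm_ge_zero [of "f z"]] by (auto simp: norm_mult intro!: mult_mono)
  next
    case (Cons h hs)
    have s: "smooth_on A f" "smooth_on A g" using Cons.prems by (auto simp: Dbound_def)
    have "FD (\<lambda>x. f x * g x) z h = f z * FD g z h + FD f z h * g z" if "z \<in> A" for z
      by (intro FD_mult smooth_on_differentiable [OF _ that] s)
    then have "Dlist (h # hs) (\<lambda>x. f x * g x) z = Dlist hs (\<lambda>z. f z * FD g z h + FD f z h * g z) z"
      using Dlist_cong [OF assms(1) _ that, of "\<lambda>z. FD (\<lambda>x. f x * g x) z h"] by simp
    also have "\<dots> = Dlist hs (\<lambda>z. f z * FD g z h) z + Dlist hs (\<lambda>z. FD f z h * g z) z"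
      using s by (intro Dlist_add [OF assms(1) _ _ that] smooth_on_mult assms(1) smooth_on_FD)
    also have "norm \<dots> \<le> B * (C * q * norm h) * (p + q) ^ length hs * (\<Prod>h\<leftarrow>hs. norm h)
        + B * p * norm h * C * (p + q) ^ length hs * (\<Prod>h\<leftarrow>hs. norm h)"
      by (intro order.trans [OF norm_triangle_ineq] add_mono Cons.IH Dbound_FD Cons.prems)
    also have "\<dots> = B * C * (p + q) ^ length (h # hs) * (\<Prod>h\<leftarrow>h # hs. norm h)"
      by (simp add: algebra_simps)
    finally show ?case .
  qed
  then show ?thesis using sm assms(1) by (auto simp: Dbound_def intro: smooth_on_mult)
qed

lemma Dbound_const: "Dbound A (\<lambda>x. c) (norm c) 0"
proof -
  have "norm (Dlist hs (\<lambda>x. c) z) \<le> norm c * 0 ^ length hs * (\<Prod>h\<leftarrow>hs. norm h)" for hs z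
    by (cases hs) (simp_all del: Dlist.simps(2))
  then show ?thesis by (auto simp: Dbound_def smooth_on_const)
qed

lemma Dbound_power:
  fixes f :: "'b::real_normed_vector \<Rightarrow> complex"
  assumes "open A" "Dbound A f B p"
  shows "Dbound A (\<lambda>x. f x ^ k) (B ^ k) (real k * p)"
proof (induction k)
  case 0
  then show ?case using Dbound_const [of A "1::complex"] by simp
next
  case (Suc k)
  then show ?case using Dbound_mult [OF assms Suc.IH] by (simp add: algebra_simps)
qed

lemma Dbound_prod:
  fixes f :: "'i \<Rightarrow> 'b::real_normed_vector \<Rightarrow> complex"
  assumes "open A" "finite I" "\<And>i. i \<in> I \<Longrightarrow> Dbound A (f i) (B i) (p i)"
  shows "Dbound A (\<lambda>x. \<Prod>i\<in>I. f i x) (\<Prod>i\<in>I. B i) (\<Sum>i\<in>I. p i)"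
  using assms(2,3)
proof (induction I rule: finite_induct)
  case empty
  then show ?case using Dbound_const [of A "1::complex"] by simp
next
  case (insert i I)
  then show ?case using Dbound_mult [OF assms(1), of "f i" "B i" "p i" "\<lambda>x. \<Prod>i\<in>I. f i x"] by simp
qed

lemma Dbound_linear:
  assumes "bounded_linear L" "\<And>h. norm (L h) \<le> norm h" "r > 0"
  shows "Dbound (ball 0 r) L r (1 / r)"
proof -
  have FDL: "FD L x = L" for x by (rule FD_eqI [OF bounded_linear_imp_has_derivative [OF assms(1)]])
  have "norm (Dlist hs L z) \<le> r * (1 / r) ^ length hs * (\<Prod>h\<leftarrow>hs. norm h)" if "z \<in> ball 0 r" for hs z
  proof (cases hs)
    case Nil
    then show ?thesis using assms(2) [of z] that by simp
  next
    case (Cons h hs')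
    then show ?thesis
    proof (cases hs')
      case Nil
      then show ?thesis using Cons assms FDL by simp
    next
      case (Cons h' hs'')
      then show ?thesis using assms(3) FDL \<open>hs = h # hs'\<close>
        by (auto simp del: Dlist.simps(2) simp: Dlist.simps(2) [of h]
            intro!: mult_nonneg_nonneg divide_nonneg_nonneg prod_list_nonneg)
    qed
  qed
  then show ?thesis using assms(1) by (auto simp: Dbound_def smooth_on_def Ck_on_bounded_linear_fun)
qed

lemma holo_on_const: "holo_on A (\<lambda>z. c)"
  by (simp add: holo_on_def smooth_on_const)

lemma holo_on_mult:
  assumes "open A" "holo_on A f" "holo_on A g"
  shows "holo_on A (\<lambda>z. f z * g z)"
proof (rule holo_onI)
  show "smooth_on A (\<lambda>z. f z * g z)" using assms by (intro smooth_on_mult holo_on_smooth)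
  fix z h assume z: "z \<in> A"
  have "f differentiable (at z)" "g differentiable (at z)"
    using assms z by (auto intro: smooth_on_differentiable holo_on_smooth)
  then show "FD (\<lambda>z. f z * g z) z (Jc h) = \<i> * FD (\<lambda>z. f z * g z) z h"
    by (simp add: FD_mult holo_on_Jc [OF assms(2) z] holo_on_Jc [OF assms(3) z] algebra_simps)
qed

lemma holo_on_power: "open A \<Longrightarrow> holo_on A f \<Longrightarrow> holo_on A (\<lambda>z. f z ^ k)"
  by (induction k) (auto simp: holo_on_const holo_on_mult)

lemma holo_on_prod:
  assumes "open A" "finite I" "\<And>i. i \<in> I \<Longrightarrow> holo_on A (f i)"
  shows "holo_on A (\<lambda>z. \<Prod>i\<in>I. f i z)"
  using assms(2,3) by (induction I rule: finite_induct) (auto simp: holo_on_const holo_on_mult assms(1))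

lemma holo_on_linear:
  assumes "bounded_linear L" "\<And>h. L (Jc h) = \<i> * L h"
  shows "holo_on A L"
proof -
  have "FD L z = L" for z using FD_eqI [OF bounded_linear_imp_has_derivative [OF assms(1)]] .
  then show ?thesis using assms by (simp add: holo_on_def smooth_on_def Ck_on_bounded_linear_fun)
qed

lemma series_differentiable:
  fixes a :: "nat \<Rightarrow> 'b::euclidean_space \<Rightarrow> complex"
  assumes A: "open A" "convex A" and sm: "\<And>n. smooth_on A (a n)"
    and b0: "summable M0" "\<And>n z. z \<in> A \<Longrightarrow> norm (a n z) \<le> M0 n"
    and b1: "\<And>h. h \<in> Basis \<Longrightarrow> summable (M h)"
      "\<And>h n z. h \<in> Basis \<Longrightarrow> z \<in> A \<Longrightarrow> norm (FD (a n) z h) \<le> M h n"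
    and z: "z \<in> A"
  shows "((\<lambda>z. \<Sum>n. a n z) has_derivative (\<lambda>h. \<Sum>n. FD (a n) z h)) (at z)"
    and "summable (\<lambda>n. FD (a n) z h)"
proof -
  have sum1: "summable (\<lambda>n. FD (a n) z h)" if "z \<in> A" "h \<in> Basis" for z h
    by (rule summable_comparison_test' [OF b1(1) [OF that(2)], of 0]) (use b1(2) that in auto)
  have ex: "FD (a n) z h = (\<Sum>b\<in>Basis. (h \<bullet> b) *\<^sub>R FD (a n) z b)" if "z \<in> A" for z h n
    by (rule FD_expand [OF smooth_on_differentiable [OF sm that]])
  have sum2: "summable (\<lambda>n. FD (a n) z h)" if "z \<in> A" for z h
    unfolding ex [OF that, of _ h] by (intro summable_sum summable_scaleR_right sum1 that)
  then show "summable (\<lambda>n. FD (a n) z h)" using z .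
  \<comment> \<open>\<open>T n\<close> bounds the operator norm of the \<open>n\<close>-th remainder
    of the derivative series: expansion in the basis reduces every direction to the tails of
    finitely many majorants.\<close>
  define T where "T = (\<lambda>n. \<Sum>b\<in>Basis. (\<Sum>i. M b (i + n)))"
  have T0: "T \<longlonglongrightarrow> 0"
    unfolding T_def
  proof (rule tendsto_null_sum)
    fix b :: 'b assume "b \<in> Basis"
    then have "(\<lambda>n. suminf (M b) - sum (M b) {..<n}) \<longlonglongrightarrow> suminf (M b) - suminf (M b)"
      using b1(1) by (intro tendsto_diff tendsto_const summable_LIMSEQ)
    then show "(\<lambda>n. \<Sum>i. M b (i + n)) \<longlonglongrightarrow> 0"
      using suminf_minus_initial_segment [OF b1(1) [OF \<open>b \<in> Basis\<close>]] by simp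
  qed
  have tail: "norm (sum (\<lambda>i. FD (a i) z h) {..<n} - (\<Sum>n. FD (a n) z h)) \<le> T n * norm h"
    if "z \<in> A" for n z h
  proof -
    have "norm (sum (\<lambda>i. FD (a i) z h) {..<n} - (\<Sum>n. FD (a n) z h)) = norm (\<Sum>i. FD (a (i + n)) z h)"
      using suminf_minus_initial_segment [OF sum2 [OF that, of h], of n] by (simp add: norm_minus_commute)
    also have "(\<Sum>i. FD (a (i + n)) z h) = (\<Sum>b\<in>Basis. (h \<bullet> b) *\<^sub>R (\<Sum>i. FD (a (i + n)) z b))"
    proof -
      have s: "summable (\<lambda>i. FD (a (i + n)) z b)" if "b \<in> Basis" for b
        using sum1 [OF \<open>z \<in> A\<close> that] by (rule summable_ignore_initial_segment)
      have "(\<Sum>i. \<Sum>b\<in>Basis. (h \<bullet> b) *\<^sub>R FD (a (i + n)) z b)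
          = (\<Sum>b\<in>Basis. \<Sum>i. (h \<bullet> b) *\<^sub>R FD (a (i + n)) z b)"
        by (intro suminf_sum summable_scaleR_right s)
      also have "\<dots> = (\<Sum>b\<in>Basis. (h \<bullet> b) *\<^sub>R (\<Sum>i. FD (a (i + n)) z b))"
        by (intro sum.cong refl suminf_scaleR_right [symmetric] s)
      finally show ?thesis unfolding ex [OF \<open>z \<in> A\<close>, of _ h] .
    qed
    also have "norm \<dots> \<le> (\<Sum>b\<in>Basis. norm h * (\<Sum>i. M b (i + n)))"
    proof (rule sum_norm_le)
      fix b :: 'b assume b: "b \<in> Basis"
      have "norm (\<Sum>i. FD (a (i + n)) z b) \<le> (\<Sum>i. M b (i + n))"
        using b1 b that by (intro norm_suminf_le summable_ignore_initial_segment) auto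
      moreover have "\<bar>h \<bullet> b\<bar> \<le> norm h" using b by (simp add: Basis_le_norm)
      ultimately show "norm ((h \<bullet> b) *\<^sub>R (\<Sum>i. FD (a (i + n)) z b)) \<le> norm h * (\<Sum>i. M b (i + n))"
        by (simp add: mult_mono)
    qed
    finally show ?thesis by (simp add: T_def sum_distrib_left mult.commute)
  qed
  have "\<exists>g. \<forall>x\<in>A. (\<lambda>n. a n x) sums g x \<and> (g has_derivative (\<lambda>h. \<Sum>n. FD (a n) x h)) (at x within A)"
  proof (rule has_derivative_series [OF A(2) _ _ z, where f' = "\<lambda>n. FD (a n)"])
    show "(a n has_derivative FD (a n) x) (at x within A)" if "x \<in> A" for n x
      using smooth_on_has_derivative [OF sm that] by (rule has_derivative_at_withinI)
    show "\<forall>\<^sub>F n in sequentially. \<forall>x\<in>A. \<forall>h. norm ((\<Sum>i<n. FD (a i) x h) - (\<Sum>n. FD (a n) x h)) \<le> e * norm h"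
      if "e > 0" for e
    proof -
      have "\<forall>\<^sub>F n in sequentially. T n < e" using order_tendstoD(2) [OF T0 that] .
      then show ?thesis
      proof (rule eventually_mono, intro ballI allI)
        fix n x and h :: 'b assume "T n < e" "x \<in> A"
        have "T n * norm h \<le> e * norm h" using \<open>T n < e\<close> by (intro mult_right_mono) auto
        then show "norm ((\<Sum>i<n. FD (a i) x h) - (\<Sum>n. FD (a n) x h)) \<le> e * norm h"
          using tail [OF \<open>x \<in> A\<close>, of h n] by linarith
      qed
    qed
    show "(\<lambda>n. a n z) sums (\<Sum>n. a n z)"
      by (intro summable_sums summable_comparison_test' [OF b0(1), of 0]) (use b0 z in auto)
  qed
  then obtain g where g: "\<And>x. x \<in> A \<Longrightarrow> (\<lambda>n. a n x) sums g x"
    "\<And>x. x \<in> A \<Longrightarrow> (g has_derivative (\<lambda>h. \<Sum>n. FD (a n) x h)) (at x within A)" by blast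
  have "(g has_derivative (\<lambda>h. \<Sum>n. FD (a n) z h)) (at z)"
    using g(2) [OF z] at_within_open [OF z A(1)] by simp
  then show "((\<lambda>z. \<Sum>n. a n z) has_derivative (\<lambda>h. \<Sum>n. FD (a n) z h)) (at z)"
    by (rule has_derivative_transform_within_open [OF _ A(1) z]) (use g(1) sums_unique in blast)
qed

text \<open>The majorant condition ranges over all lists of directions, so it passes from the terms
  to their directional derivatives, and the induction on the order just repeats the first-order
  case.\<close>

lemma series_smooth:
  fixes a :: "nat \<Rightarrow> 'b::euclidean_space \<Rightarrow> complex"
  assumes A: "open A" "convex A" and sm: "\<And>n. smooth_on A (a n)"
    and bd: "\<And>hs. \<exists>M. summable M \<and> (\<forall>n. \<forall>z\<in>A. norm (Dlist hs (a n) z) \<le> M n)"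
  shows "smooth_on A (\<lambda>z. \<Sum>n. a n z)"
    and "z \<in> A \<Longrightarrow> FD (\<lambda>z. \<Sum>n. a n z) z h = (\<Sum>n. FD (a n) z h)"
    and "z \<in> A \<Longrightarrow> summable (\<lambda>n. FD (a n) z h)"
proof -
  have *: "((\<lambda>z. \<Sum>n. a n z) has_derivative (\<lambda>h. \<Sum>n. FD (a n) z h)) (at z) \<and> summable (\<lambda>n. FD (a n) z h)"
    if sm: "\<And>n. smooth_on A (a n)"
      and bd: "\<And>hs. \<exists>M. summable M \<and> (\<forall>n. \<forall>z\<in>A. norm (Dlist hs (a n) z) \<le> M n)"
      and z: "z \<in> A" for a :: "nat \<Rightarrow> 'b \<Rightarrow> complex" and z h
  proof -
    obtain M0 where M0: "summable M0" "\<And>n z. z \<in> A \<Longrightarrow> norm (a n z) \<le> M0 n"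
      using bd [of "[]"] by auto
    have "\<forall>h. \<exists>M. summable M \<and> (\<forall>n. \<forall>z\<in>A. norm (FD (a n) z h) \<le> M n)"
      using bd [of "[_]"] by simp
    then obtain M where M: "\<And>h. summable (M h)" "\<And>h n z. z \<in> A \<Longrightarrow> norm (FD (a n) z h) \<le> M h n"
      by metis
    show ?thesis
    proof
      show "((\<lambda>z. \<Sum>n. a n z) has_derivative (\<lambda>h. \<Sum>n. FD (a n) z h)) (at z)"
        by (rule series_differentiable(1) [of A a M0 M]) (use A sm M0 M z in blast)+
      show "summable (\<lambda>n. FD (a n) z h)"
        by (rule series_differentiable(2) [of A a M0 M]) (use A sm M0 M z in blast)+
    qed
  qed
  have ds: "((\<lambda>z. \<Sum>n. a n z) has_derivative (\<lambda>h. \<Sum>n. FD (a n) z h)) (at z)"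
    "summable (\<lambda>n. FD (a n) z h)" if "z \<in> A" for z h
    using * [of a z h] sm bd that by blast+
  show "z \<in> A \<Longrightarrow> FD (\<lambda>z. \<Sum>n. a n z) z h = (\<Sum>n. FD (a n) z h)"
    by (rule fun_cong [OF FD_eqI [OF ds(1)]])
  show "z \<in> A \<Longrightarrow> summable (\<lambda>n. FD (a n) z h)"
    by (rule ds(2))
  have "Ck_on k A (\<lambda>z. \<Sum>n. a n z)" for k
    using sm bd
  proof (induction k arbitrary: a)
    case 0
    have "(\<lambda>z. \<Sum>n. a n z) differentiable (at z)" if "z \<in> A" for z
      using * [of a z] 0 that by (blast intro: differentiableI)
    then show ?case
      by (auto intro!: continuous_at_imp_continuous_on differentiable_imp_continuous_within)
  next
    case (Suc k)
    have d: "((\<lambda>z. \<Sum>n. a n z) has_derivative (\<lambda>h. \<Sum>n. FD (a n) z h)) (at z)" if "z \<in> A" for z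
      using * [of a z] Suc.prems that by blast
    have "(\<lambda>z. \<Sum>n. a n z) differentiable (at z)" if "z \<in> A" for z
      by (rule differentiableI [OF d [OF that]])
    moreover have "Ck_on k A (\<lambda>z. FD (\<lambda>z. \<Sum>n. a n z) z h)" for h
    proof (rule Ck_on_cong [OF A(1)])
      show "(\<Sum>n. FD (a n) z h) = FD (\<lambda>z. \<Sum>n. a n z) z h" if "z \<in> A" for z
        by (simp add: FD_eqI [OF d [OF that]])
      show "Ck_on k A (\<lambda>z. \<Sum>n. FD (a n) z h)"
      proof (rule Suc.IH)
        show "smooth_on A (\<lambda>z. FD (a n) z h)" for n using Suc.prems(1) by (rule smooth_on_FD)
        show "\<exists>M. summable M \<and> (\<forall>n. \<forall>z\<in>A. norm (Dlist hs (\<lambda>z. FD (a n) z h) z) \<le> M n)" for hs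
          using Suc.prems(2) [of "h # hs"] by simp
      qed
    qed
    ultimately show ?case by simp
  qed
  then show "smooth_on A (\<lambda>z. \<Sum>n. a n z)" by (simp add: smooth_on_def)
qed

definition zcoord :: "'a::euclidean_space \<Rightarrow> 'a \<times> 'a \<Rightarrow> complex" where
  "zcoord b z = Complex (fst z \<bullet> b) (snd z \<bullet> b)"

lemma bounded_linear_zcoord: "bounded_linear (zcoord b)"
proof -
  have "zcoord b = (\<lambda>z. of_real (fst z \<bullet> b) + \<i> * of_real (snd z \<bullet> b))"
    by (auto simp: zcoord_def complex_eq_iff)
  then show ?thesis
    by (auto intro!: bounded_linear_add bounded_linear_compose [OF bounded_linear_of_real]
        bounded_linear_compose [OF bounded_linear_mult_right] bounded_linear_compose [OF bounded_linear_inner_left]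
        bounded_linear_fst bounded_linear_snd)
qed

lemma norm_zcoord: "b \<in> Basis \<Longrightarrow> norm (zcoord b z) \<le> norm z"
proof -
  assume b: "b \<in> Basis"
  have "(fst z \<bullet> b)\<^sup>2 \<le> (norm (fst z))\<^sup>2" "(snd z \<bullet> b)\<^sup>2 \<le> (norm (snd z))\<^sup>2"
    using Basis_le_norm [OF b] by (simp_all add: abs_le_square_iff [symmetric])
  then have "sqrt ((fst z \<bullet> b)\<^sup>2 + (snd z \<bullet> b)\<^sup>2) \<le> sqrt ((norm (fst z))\<^sup>2 + (norm (snd z))\<^sup>2)"
    by (intro real_sqrt_le_mono add_mono)
  then show ?thesis by (simp add: zcoord_def cmod_def norm_prod_def)
qed

lemma zcoord_Jc: "zcoord b (Jc h) = \<i> * zcoord b h"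
  by (simp add: zcoord_def Jc_def complex_eq_iff)

text \<open>A single term of the exponential series. It absorbs the polynomial factor caused by
  differentiating a monomial of large degree into a geometric one.\<close>

lemma power_le_fact_exp:
  assumes "x \<ge> (0::real)"
  shows "x ^ k \<le> fact k * exp x"
proof -
  have "(\<lambda>n. x^n /\<^sub>R fact n) sums exp x" by (rule exp_converges)
  then have "x ^ k /\<^sub>R fact k \<le> exp x"
    using sum_le_suminf [of "\<lambda>n. x^n /\<^sub>R fact n" "{k}"] assms by (auto simp: sums_iff)
  then show ?thesis by (simp add: field_simps)
qed

theorem complexify:
  fixes f :: "'b::euclidean_space \<Rightarrow> real"
  assumes "real_analytic_on W f" "p \<in> W"
  obtains r g where "r > 0" "holo_on (ball (p, 0) r) g"
    "\<And>u. u \<in> ball p r \<Longrightarrow> g (u, 0) = of_real (f u)"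
    "\<And>u w. (u, w) \<in> ball (p, 0) r \<Longrightarrow> g (u, - w) = cnj (g (u, w))"
proof -
  define I where "I = ((Basis :: 'b set) \<rightarrow>\<^sub>E (UNIV :: nat set))"
  obtain c r0 where r0: "r0 > 0" and hs: "\<And>h. norm h < r0 \<Longrightarrow>
      ((\<lambda>m. c m * (\<Prod>b\<in>Basis. (h \<bullet> b) ^ m b)) has_sum f (p + h)) I"
    using assms unfolding real_analytic_on_def I_def by blast
  \<comment> \<open>The point \<open>h0\<close> with all coordinates \<rho> has norm at most
    \<open>DIM('b) * \<rho> = r0 / 2\<close>, so the series converges there.\<close>
  define \<rho> where "\<rho> = r0 / (2 * real DIM('b))"
  have \<rho>: "\<rho> > 0" using r0 by (simp add: \<rho>_def)
  define h0 :: 'b where "h0 = (\<Sum>b\<in>Basis. \<rho> *\<^sub>R b)"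
  have h0b: "h0 \<bullet> b = \<rho>" if "b \<in> Basis" for b using that by (simp add: h0_def)
  have "norm h0 \<le> (\<Sum>b\<in>(Basis::'b set). \<bar>h0 \<bullet> b\<bar>)" by (rule norm_le_l1)
  also have "\<dots> = real DIM('b) * \<rho>" using \<rho> by (simp add: h0b)
  also have "\<dots> < r0" using r0 by (simp add: \<rho>_def)
  finally have "norm h0 < r0" .
  from hs [OF this] have s1: "((\<lambda>m. c m * \<rho> ^ (\<Sum>b\<in>Basis. m b)) has_sum f (p + h0)) I"
    by (simp add: h0b power_sum)
  have ctI: "countable I" unfolding I_def by (intro countable_PiE) auto
  have infI: "infinite I"
  proof
    assume "finite I"
    moreover have "inj (\<lambda>n::nat. restrict (\<lambda>b::'b. n) Basis)"
    proof (rule injI)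
      fix n m :: nat assume *: "restrict (\<lambda>b::'b. n) Basis = restrict (\<lambda>b. m) Basis"
      obtain b :: 'b where "b \<in> Basis" using nonempty_Basis by blast
      then show "n = m" using fun_cong [OF *, of b] by simp
    qed
    moreover have "range (\<lambda>n::nat. restrict (\<lambda>b::'b. n) Basis) \<subseteq> I" by (auto simp: I_def)
    ultimately show False by (meson finite_imageD finite_subset infinite_UNIV_nat)
  qed
  define e where "e = from_nat_into I"
  have bij: "bij_betw e UNIV I" unfolding e_def using bij_betw_from_nat_into [OF ctI infI] .
  define N where "N = (\<lambda>n. \<Sum>b\<in>Basis. e n b)"
  \<comment> \<open>For real families unconditional convergence is absolute, so the value at the
    single point \<open>h0\<close> majorizes the series on a whole polydisc.\<close>
  have "(\<lambda>m. norm (c m * \<rho> ^ (\<Sum>b\<in>Basis. m b))) summable_on I"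
    by (rule iffD1 [OF summable_on_iff_abs_summable_on_real has_sum_imp_summable [OF s1]])
  then have "(\<lambda>n. norm (c (e n) * \<rho> ^ N n)) summable_on UNIV"
    using summable_on_reindex_bij_betw [OF bij, of "\<lambda>m. norm (c m * \<rho> ^ (\<Sum>b\<in>Basis. m b))"] by (simp add: N_def)
  then have sumc: "summable (\<lambda>n. \<bar>c (e n)\<bar> * \<rho> ^ N n)"
    using \<rho> by (simp add: summable_on_imp_summable abs_mult)
  \<comment> \<open>A third of \<rho> leaves room for all derivatives: \<open>k\<close> of them cost
    a factor \<open>N ^ k / r ^ k\<close>, and
    \<open>N ^ k \<le> fact k * exp N \<le> fact k * 3 ^ N\<close>, where
    \<open>3 ^ N * r ^ N = \<rho> ^ N\<close>.\<close>
  define r where "r = \<rho> / 3"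
  have r: "r > 0" using \<rho> by (simp add: r_def)
  define mon where "mon = (\<lambda>n z. \<Prod>b\<in>Basis. zcoord b z ^ e n b)"
  define a where "a = (\<lambda>n z. of_real (c (e n)) * mon n z :: complex)"
  let ?A = "ball (0 :: 'b \<times> 'b) r"
  have Dz: "Dbound ?A (zcoord b) r (1 / r)" if "b \<in> Basis" for b
    by (intro Dbound_linear bounded_linear_zcoord norm_zcoord that r)
  have Dmon: "Dbound ?A (mon n) (r ^ N n) (real (N n) / r)" for n
  proof -
    have "Dbound ?A (mon n) (\<Prod>b\<in>Basis. r ^ e n b) (\<Sum>b\<in>Basis. real (e n b) * (1 / r))"
      unfolding mon_def by (intro Dbound_prod Dbound_power Dz) auto
    then show ?thesis by (simp add: N_def power_sum sum_divide_distrib)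
  qed
  have Da: "Dbound ?A (a n) (\<bar>c (e n)\<bar> * r ^ N n) (real (N n) / r)" for n
    using Dbound_mult [OF open_ball Dbound_const Dmon, of "of_real (c (e n))" n] by (simp add: a_def)
  have bd: "\<exists>M. summable M \<and> (\<forall>n. \<forall>z\<in>?A. norm (Dlist hs (a n) z) \<le> M n)" for hs
  proof (intro exI conjI allI ballI)
    let ?C = "(fact (length hs) / r ^ length hs) * (\<Prod>h\<leftarrow>hs. norm h)"
    show "summable (\<lambda>n. ?C * (\<bar>c (e n)\<bar> * \<rho> ^ N n))" by (intro summable_mult sumc)
    fix n z assume z: "z \<in> ?A"
    have "norm (Dlist hs (a n) z) \<le> \<bar>c (e n)\<bar> * r ^ N n * (real (N n) / r) ^ length hs * (\<Prod>h\<leftarrow>hs. norm h)"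
      using Da [of n] z unfolding Dbound_def by blast
    also have "\<dots> = (r ^ N n * real (N n) ^ length hs) * (\<bar>c (e n)\<bar> / r ^ length hs * (\<Prod>h\<leftarrow>hs. norm h))"
      by (simp add: power_divide mult_ac)
    also have "\<dots> \<le> (fact (length hs) * \<rho> ^ N n) * (\<bar>c (e n)\<bar> / r ^ length hs * (\<Prod>h\<leftarrow>hs. norm h))"
    proof (rule mult_right_mono)
      have "exp (real (N n)) \<le> 3 ^ N n"
        using power_mono [OF exp_le, of "N n"] by (simp add: exp_of_nat_mult [symmetric])
      then have "real (N n) ^ length hs \<le> fact (length hs) * 3 ^ N n"
        using power_le_fact_exp [of "real (N n)" "length hs"] by (smt (verit) fact_gt_zero mult_left_mono of_nat_0_le_iff)
      then have "r ^ N n * real (N n) ^ length hs \<le> r ^ N n * (fact (length hs) * 3 ^ N n)"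
        using r by (intro mult_left_mono) auto
      also have "\<dots> = fact (length hs) * \<rho> ^ N n"
        by (simp add: r_def power_divide)
      finally show "r ^ N n * real (N n) ^ length hs \<le> fact (length hs) * \<rho> ^ N n" .
      show "0 \<le> \<bar>c (e n)\<bar> / r ^ length hs * (\<Prod>h\<leftarrow>hs. norm h)"
        using r by (intro mult_nonneg_nonneg divide_nonneg_nonneg prod_list_nonneg) auto
    qed
    finally show "norm (Dlist hs (a n) z) \<le> ?C * (\<bar>c (e n)\<bar> * \<rho> ^ N n)" by (simp add: mult_ac)
  qed
  have sma: "smooth_on ?A (a n)" for n using Da by (simp add: Dbound_def)
  note ser = series_smooth [OF open_ball convex_ball sma bd]
  have holoa: "holo_on ?A (a n)" for n
    unfolding a_def mon_def
    by (intro holo_on_mult holo_on_const holo_on_prod holo_on_power holo_on_linear bounded_linear_zcoord zcoord_Jc) auto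
  define s where "s = (\<lambda>z. \<Sum>n. a n z)"
  have holos: "holo_on ?A s"
    unfolding s_def
  proof (rule holo_onI)
    show "smooth_on ?A (\<lambda>z. \<Sum>n. a n z)" by (rule ser(1))
    fix z h assume z: "z \<in> ?A"
    have "FD (\<lambda>z. \<Sum>n. a n z) z (Jc h) = (\<Sum>n. FD (a n) z (Jc h))" by (rule ser(2) [OF z])
    also have "\<dots> = (\<Sum>n. \<i> * FD (a n) z h)" by (simp only: holo_on_Jc [OF holoa z])
    also have "\<dots> = \<i> * (\<Sum>n. FD (a n) z h)" by (rule suminf_mult [OF ser(3) [OF z]])
    also have "\<dots> = \<i> * FD (\<lambda>z. \<Sum>n. a n z) z h" using ser(2) [OF z] by simp
    finally show "FD (\<lambda>z. \<Sum>n. a n z) z (Jc h) = \<i> * FD (\<lambda>z. \<Sum>n. a n z) z h" .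
  qed
  have sums: "(\<lambda>n. a n z) sums s z" if "z \<in> ?A" for z
  proof -
    obtain M where M: "summable M" "\<forall>n. \<forall>z\<in>?A. norm (Dlist [] (a n) z) \<le> M n" using bd [of "[]"] by blast
    then have "norm (a n z) \<le> M n" for n using that by (simp only: Dlist.simps(1))
    then show ?thesis unfolding s_def
      by (intro summable_sums) (rule summable_comparison_test' [OF M(1), of 0])
  qed
  define g where "g = (\<lambda>z. s (z - (p, 0)))"
  show thesis
  proof (rule that [of r g])
    show "r > 0" by fact
    have d: "((\<lambda>z. z - (p, 0)) has_derivative (\<lambda>h. h)) (at z)" for z :: "'b \<times> 'b"
      by (auto intro!: derivative_eq_intros)
    have in_A: "z - (p, 0) \<in> ?A" if "z \<in> ball (p, 0) r" for z :: "'b \<times> 'b"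
      using that by (simp add: dist_norm norm_minus_commute)
    show "holo_on (ball (p, 0) r) g"
    proof (rule holo_onI)
      show "smooth_on (ball (p, 0) r) g"
        unfolding g_def using in_A
        by (intro smooth_on_compose [OF _ holo_on_smooth [OF holos]] smooth_on_diff smooth_on_const smooth_on_ident) auto
      fix z h :: "'b \<times> 'b" assume z: "z \<in> ball (p, 0) r"
      have ds: "s differentiable (at (z - (p, 0)))"
        by (rule smooth_on_differentiable [OF holo_on_smooth [OF holos] in_A [OF z]])
      have "FD g z h = FD s (z - (p, 0)) h" for h
        using FD_compose [OF ds differentiableI [OF d]] by (simp add: g_def FD_eqI [OF d])
      then show "FD g z (Jc h) = \<i> * FD g z h" by (simp add: holo_on_Jc [OF holos in_A [OF z]])
    qed
    show "g (u, 0) = of_real (f u)" if "u \<in> ball p r" for u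
    proof -
      define h where "h = u - p"
      have "norm h < r" using that by (simp add: h_def dist_norm norm_minus_commute)
      moreover have "r \<le> r0"
      proof -
        have "\<rho> \<le> r0 / 2" unfolding \<rho>_def using r0 by (simp add: field_simps)
        then show ?thesis using r0 by (simp add: r_def)
      qed
      ultimately have hr: "norm h < r0" "(h, 0) \<in> ?A" by auto
      have "((\<lambda>n. c (e n) * (\<Prod>b\<in>Basis. (h \<bullet> b) ^ e n b)) has_sum f (p + h)) UNIV"
        using hs [OF hr(1)] has_sum_reindex_bij_betw [OF bij, of "\<lambda>m. c m * (\<Prod>b\<in>Basis. (h \<bullet> b) ^ m b)"] by simp
      then have "(\<lambda>n. c (e n) * (\<Prod>b\<in>Basis. (h \<bullet> b) ^ e n b)) sums f (p + h)"
        by (rule has_sum_imp_sums)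
      then have "(\<lambda>n. of_real (c (e n) * (\<Prod>b\<in>Basis. (h \<bullet> b) ^ e n b))) sums (of_real (f (p + h)) :: complex)"
        by (rule sums_of_real)
      moreover have "of_real (c (e n) * (\<Prod>b\<in>Basis. (h \<bullet> b) ^ e n b)) = a n (h, 0)" for n
        by (simp add: a_def mon_def zcoord_def complex_of_real_def [symmetric])
      ultimately have "s (h, 0) = of_real (f (p + h))"
        using sums [OF hr(2)] by (simp add: sums_unique2)
      then show ?thesis by (simp add: g_def h_def)
    qed
    \<comment> \<open>The coefficients are real. This symmetry later forces the scale factor to be
      real at real points.\<close>
    show "g (u, - w) = cnj (g (u, w))" if "(u, w) \<in> ball (p, 0) r" for u w
    proof -
      define h where "h = u - p"
      have 1: "(h, w) \<in> ?A" "(h, - w) \<in> ?A"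
        using that by (simp_all add: h_def dist_norm norm_minus_commute norm_prod_def)
      have "(\<lambda>n. cnj (a n (h, w))) sums cnj (s (h, w))" using sums [OF 1(1)] by (simp add: sums_cnj)
      moreover have "cnj (a n (h, w)) = a n (h, - w)" for n
        by (simp add: a_def mon_def zcoord_def complex_cnj)
      ultimately have "s (h, - w) = cnj (s (h, w))" using sums [OF 1(2)] by (simp add: sums_unique2)
      then show ?thesis by (simp add: g_def h_def)
    qed
  qed
qed

section \<open>Hypersurfaces near a point\<close>

text \<open>Both functions vanish near \<open>t = 0\<close> along a curve
  \<open>y + t w + s(t) w0\<close> in \<open>S\<close> with vanishing first derivative of
  \<open>s\<close> at 0. Differentiating twice shows, for each of them, that the Hessian at
  \<open>(w, w)\<close> plus the second derivative of \<open>s\<close> times the derivative along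
  \<open>w0\<close> is 0. So the factor \<kappa> found for the derivatives along \<open>w0\<close>
  is also the factor for the Hessians. This makes convexity witnessed by one defining function
  usable for another.\<close>

lemma defining_function_transfer:
  fixes T S :: "'a::euclidean_space set"
  assumes T: "subspace T" and y: "y \<in> S"
    and f: "smooth_on W f" "defines_near T S y W f"
    and g: "smooth_on W' g" "defines_near T S y W' g"
    and w0: "w0 \<in> T" "FD f y w0 \<noteq> 0"
  obtains \<kappa> where "\<And>w. w \<in> T \<Longrightarrow> FD g y w = \<kappa> * FD f y w"
    "\<And>w. w \<in> T \<Longrightarrow> FD f y w = 0 \<Longrightarrow> FD (\<lambda>z. FD g z w) y w = \<kappa> * FD (\<lambda>z. FD f z w) y w"
proof -
  define \<kappa> where "\<kappa> = FD g y w0 / FD f y w0"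
  have oW: "open W" "y \<in> W" and oW': "open W'" "y \<in> W'"
    and SW: "S \<inter> W = {z \<in> T \<inter> W. f z = 0}" and SW': "S \<inter> W' = {z \<in> T \<inter> W'. g z = 0}"
    using f(2) g(2) by (auto simp: defines_near_def)
  have yT: "y \<in> T" "f y = 0" using y oW SW by auto
  have main: "FD g y w = 0 \<and> FD (\<lambda>z. FD g z w) y w = \<kappa> * FD (\<lambda>z. FD f z w) y w"
    if w: "w \<in> T" "FD f y w = 0" for w
  proof -
    define P where "P = (\<lambda>p::real \<times> real. y + fst p *\<^sub>R w + snd p *\<^sub>R w0)"
    have dP: "(P has_derivative (\<lambda>q. fst q *\<^sub>R w + snd q *\<^sub>R w0)) (at p)" for p
      unfolding P_def by (auto intro!: derivative_eq_intros)
    have smP: "smooth_on A P" if "open A" for A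
      unfolding P_def using that by (intro smooth_on_intros)
    define A where "A = P -` W"
    have oA: "open A" unfolding A_def
      by (rule open_vimage [OF oW(1) smooth_on_continuous_on [OF smP [OF open_UNIV]]])
    define F where "F = (\<lambda>p. f (P p))"
    have smF: "smooth_on A F" unfolding F_def
      by (rule smooth_on_compose [OF oA f(1) smP [OF oA]]) (auto simp: A_def)
    have FDF: "FD F p q = fst q * FD f (P p) w + snd q * FD f (P p) w0" if "p \<in> A" for p q
    proof -
      have df: "f differentiable (at (P p))" using that smooth_on_differentiable [OF f(1)] by (auto simp: A_def)
      show ?thesis unfolding F_def
        by (subst FD_compose [OF df differentiableI [OF dP]]) (simp add: FD_eqI [OF dP] FD_linear [OF df])
    qed
    have P0: "P (0, 0) = y" by (simp add: P_def)
    have A0: "(0, 0) \<in> A" "F (0, 0) = 0" using P0 oW yT by (auto simp: A_def F_def)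
    obtain V d s where V: "open V" "0 \<in> V" "d > 0" "smooth_on V s"
      and s: "\<And>x. x \<in> V \<Longrightarrow> dist (s x) 0 < d \<and> F (x, s x) = 0 \<and> FD f (P (x, s x)) w0 \<noteq> 0"
        "\<And>x t. x \<in> V \<Longrightarrow> dist t 0 < d \<Longrightarrow> (x, t) \<in> A"
        "\<And>x t. x \<in> V \<Longrightarrow> dist t 0 < d \<Longrightarrow> F (x, t) = 0 \<Longrightarrow> t = s x"
        "\<And>x h. x \<in> V \<Longrightarrow> FD s x h = - FD F (x, s x) (h, 0) / FD f (P (x, s x)) w0"
    proof (rule implicit_function_point [OF oA smF A0, of "\<lambda>p. FD f (P p) w0"])
      show "FD F p (0, k) = FD f (P p) w0 * k" if "p \<in> A" for p k using FDF [OF that] by simp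
      show "FD f (P (0, 0)) w0 \<noteq> 0" using w0 P0 by simp
    qed (rule that)
    have s0: "s 0 = 0" using s(3) [OF V(2), of 0] A0 V(3) by simp
    have ds0: "FD s 0 h = 0" for h
      using s(4) [OF V(2), of h] FDF [OF A0(1), of "(h, 0)"] w(2) P0 s0 by simp
    define \<gamma> where "\<gamma> = (\<lambda>t. P (t, s t))"
    have \<gamma>0: "\<gamma> 0 = y" using s0 P0 by (simp add: \<gamma>_def)
    have sm\<gamma>: "smooth_on V \<gamma>" unfolding \<gamma>_def P_def fst_conv snd_conv
      by (intro smooth_on_intros V)
    have in_S: "\<gamma> t \<in> S \<inter> W" if "t \<in> V" for t
    proof -
      have "(t, s t) \<in> A" "F (t, s t) = 0" using s(1,2) [OF that] by auto
      moreover have "\<gamma> t \<in> T" unfolding \<gamma>_def P_def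
        using T yT w w0 by (simp add: subspace_add subspace_scale)
      ultimately show ?thesis unfolding SW by (simp add: A_def F_def \<gamma>_def)
    qed
    define V' where "V' = V \<inter> \<gamma> -` W'"
    have V': "open V'" "0 \<in> V'"
      unfolding V'_def using continuous_open_preimage [OF smooth_on_continuous_on [OF sm\<gamma>] V(1) oW'(1)] V \<gamma>0 oW'
      by auto
    have second: "FD k y w = 0 \<and> FD (\<lambda>z. FD k z w) y w + FD (\<lambda>t. FD s t 1) 0 1 * FD k y w0 = 0"
      if k: "smooth_on U k" "open U" and U: "\<And>t. t \<in> V' \<Longrightarrow> \<gamma> t \<in> U \<and> k (\<gamma> t) = 0" for U k
    proof -
      have d\<gamma>: "(\<gamma> has_derivative (\<lambda>u. u *\<^sub>R w + FD s t u *\<^sub>R w0)) (at t)" if "t \<in> V'" for t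
      proof -
        have "(s has_derivative FD s t) (at t)"
          using that by (intro smooth_on_has_derivative [OF V(4)]) (simp add: V'_def)
        then show ?thesis unfolding \<gamma>_def P_def fst_conv snd_conv
          by (auto intro!: derivative_eq_intros)
      qed
      have kd: "k differentiable (at (\<gamma> t))" if "t \<in> V'" for t
        using smooth_on_differentiable [OF k(1)] U that by blast
      have z: "FD k (\<gamma> t) w + FD s t 1 * FD k (\<gamma> t) w0 = 0" if t: "t \<in> V'" for t
      proof -
        have "((\<lambda>t. k (\<gamma> t)) has_derivative (\<lambda>u. FD k (\<gamma> t) (u *\<^sub>R w + FD s t u *\<^sub>R w0))) (at t)"
          using kd [OF t] by (intro has_derivative_compose [OF d\<gamma> [OF t]]) (simp add: frechet_derivative_works)
        moreover have "((\<lambda>t. k (\<gamma> t)) has_derivative (\<lambda>u. 0)) (at t)"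
          by (rule has_derivative_transform_within_open [OF has_derivative_const [of 0] V'(1) t]) (use U in auto)
        ultimately have "(\<lambda>u. FD k (\<gamma> t) (u *\<^sub>R w + FD s t u *\<^sub>R w0)) = (\<lambda>u. 0)"
          by (rule has_derivative_unique)
        from fun_cong [OF this, of 1] show ?thesis by (simp add: FD_linear [OF kd [OF t]])
      qed
      have yU: "y \<in> U" using U [OF V'(2)] \<gamma>0 by simp
      have dk: "((\<lambda>t. FD k (\<gamma> t) v) has_derivative (\<lambda>u. FD (\<lambda>z. FD k z v) y (u *\<^sub>R w))) (at 0)" for v
      proof -
        have "((\<lambda>z. FD k z v) has_derivative (\<lambda>h. FD (\<lambda>z. FD k z v) y h)) (at (\<gamma> 0))"
          using smooth_on_FD_has_derivative [OF k(1) yU] \<gamma>0 by simp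
        from has_derivative_compose [OF d\<gamma> [OF V'(2)] this] show ?thesis by (simp add: ds0)
      qed
      have ds: "((\<lambda>t. FD s t 1) has_derivative (\<lambda>u. FD (\<lambda>t. FD s t 1) 0 u)) (at 0)"
        by (rule smooth_on_FD_has_derivative [OF V(4) V(2)])
      have "((\<lambda>t. FD k (\<gamma> t) w + FD s t 1 * FD k (\<gamma> t) w0) has_derivative
          (\<lambda>u. FD (\<lambda>z. FD k z w) y (u *\<^sub>R w) + (FD s 0 1 * FD (\<lambda>z. FD k z w0) y (u *\<^sub>R w) +
             FD (\<lambda>t. FD s t 1) 0 u * FD k (\<gamma> 0) w0))) (at 0)"
        by (intro has_derivative_add has_derivative_mult dk ds)
      moreover have "((\<lambda>t. FD k (\<gamma> t) w + FD s t 1 * FD k (\<gamma> t) w0) has_derivative (\<lambda>u. 0)) (at 0)"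
        by (rule has_derivative_transform_within_open [OF has_derivative_const [of 0] V'(1,2)]) (use z in auto)
      ultimately have "(\<lambda>u. FD (\<lambda>z. FD k z w) y (u *\<^sub>R w) + (FD s 0 1 * FD (\<lambda>z. FD k z w0) y (u *\<^sub>R w) +
             FD (\<lambda>t. FD s t 1) 0 u * FD k (\<gamma> 0) w0)) = (\<lambda>u. 0)"
        by (rule has_derivative_unique)
      from fun_cong [OF this, of 1] z [OF V'(2)] show ?thesis by (simp add: ds0 \<gamma>0)
    qed
    have "FD g y w = 0 \<and> FD (\<lambda>z. FD g z w) y w + FD (\<lambda>t. FD s t 1) 0 1 * FD g y w0 = 0"
    proof (rule second [OF g(1) oW'(1)])
      fix t assume "t \<in> V'"
      then have "\<gamma> t \<in> S \<inter> W'" using in_S [of t] by (auto simp: V'_def)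
      then show "\<gamma> t \<in> W' \<and> g (\<gamma> t) = 0" unfolding SW' by simp
    qed
    moreover have "FD f y w = 0 \<and> FD (\<lambda>z. FD f z w) y w + FD (\<lambda>t. FD s t 1) 0 1 * FD f y w0 = 0"
    proof (rule second [OF f(1) oW(1)])
      fix t assume "t \<in> V'"
      then have "\<gamma> t \<in> S \<inter> W" using in_S [of t] by (auto simp: V'_def)
      then show "\<gamma> t \<in> W \<and> f (\<gamma> t) = 0" unfolding SW by simp
    qed
    moreover have "FD g y w0 = \<kappa> * FD f y w0" using w0 by (simp add: \<kappa>_def)
    ultimately show ?thesis by (auto simp: eq_neg_iff_add_eq_0 [symmetric] algebra_simps)
  qed
  have df: "f differentiable (at y)" "g differentiable (at y)"
    using smooth_on_differentiable f(1) g(1) oW oW' by blast+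
  show thesis
  proof (rule that [of \<kappa>])
    show "FD g y w = \<kappa> * FD f y w" if w: "w \<in> T" for w
    proof -
      define l where "l = FD f y w / FD f y w0"
      have "w - l *\<^sub>R w0 \<in> T" using T w w0 by (simp add: subspace_diff subspace_scale)
      moreover have "FD f y (w - l *\<^sub>R w0) = 0" using w0 by (simp add: FD_linear [OF df(1)] l_def)
      ultimately have "FD g y (w - l *\<^sub>R w0) = 0" using main by blast
      then show ?thesis using w0 by (simp add: FD_linear [OF df(2)] l_def \<kappa>_def field_simps)
    qed
  qed (use main in blast)
qed

section \<open>Complex scaling\<close>

definition csc :: "complex \<Rightarrow> 'a::real_vector \<times> 'a \<Rightarrow> 'a \<times> 'a" where
  "csc k z = Re k *\<^sub>R z + Im k *\<^sub>R Jc z"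

lemma norm_Jc: "norm (Jc z) = norm (z :: 'a::real_normed_vector \<times> 'a)"
  by (simp add: Jc_def norm_prod_def add.commute)

lemma bounded_bilinear_csc: "bounded_bilinear (csc :: complex \<Rightarrow> 'a::real_normed_vector \<times> 'a \<Rightarrow> 'a \<times> 'a)"
proof
  show "\<exists>K. \<forall>a b. norm (csc a (b :: 'a \<times> 'a)) \<le> norm a * norm b * K"
  proof (intro exI allI)
    fix a :: complex and b :: "'a \<times> 'a"
    have "norm (csc a b) \<le> norm (Re a *\<^sub>R b) + norm (Im a *\<^sub>R Jc b)"
      unfolding csc_def by (rule norm_triangle_ineq)
    also have "\<dots> \<le> norm a * norm b + norm a * norm b"
      unfolding norm_scaleR norm_Jc
      by (intro add_mono mult_right_mono abs_Re_le_cmod abs_Im_le_cmod) auto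
    finally show "norm (csc a b) \<le> norm a * norm b * 2" by simp
  qed
qed (auto simp: csc_def Jc_def algebra_simps)

lemma FD_csc:
  assumes "holo_on A f" "z \<in> A"
  shows "FD f z (csc k h) = k * FD f z h"
proof -
  have d: "f differentiable (at z)" using smooth_on_differentiable [OF holo_on_smooth [OF assms(1)] assms(2)] .
  have "FD f z (csc k h) = (of_real (Re k) + \<i> * of_real (Im k)) * FD f z h"
    by (simp add: csc_def FD_linear [OF d] holo_on_Jc [OF assms] scaleR_conv_of_real algebra_simps)
  then show ?thesis using complex_eq [of k] by simp
qed

lemma zcoord_csc: "zcoord b (csc k z) = k * zcoord b z"
  by (simp add: zcoord_def csc_def Jc_def complex_eq_iff inner_simps)

lemma csc_1 [simp]: "csc 1 z = z"
  by (simp add: csc_def)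

text \<open>Along the complex line \<open>t \<mapsto> u + t w\<close> real parameters give real
  points and \<open>t = \<i>\<close> gives \<open>(u, w)\<close>. The parameter region is convex, so
  the identity theorem in one variable suffices.\<close>

lemma holo_on_identity:
  fixes r :: "'a::euclidean_space"
  assumes "holo_on (ball (r, 0) e) f" "holo_on (ball (r, 0) e) g"
    and eq: "\<And>u. (u, 0 :: 'a) \<in> ball (r, 0) e \<Longrightarrow> f (u, 0) = g (u, 0)" and uw: "(u, w) \<in> ball (r, 0) e"
  shows "f (u, w) = g (u, w)"
proof -
  define L where "L = (\<lambda>t::complex. (u, 0) + csc t (w, 0))"
  have L: "L t = (u + Re t *\<^sub>R w, Im t *\<^sub>R w)" for t by (simp add: L_def csc_def Jc_def)
  have dL: "(L has_derivative (\<lambda>h. csc h (w, 0))) (at t)" for t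
  proof -
    have "((\<lambda>t. csc t (w, 0)) has_derivative (\<lambda>h. csc h (w, 0))) (at t)"
      by (rule bounded_linear_imp_has_derivative [OF bounded_bilinear.bounded_linear_left [OF bounded_bilinear_csc]])
    from has_derivative_add [OF has_derivative_const this, of "(u, 0)"]
    show ?thesis unfolding L_def by simp
  qed
  define \<Omega> where "\<Omega> = L -` ball (r, 0) e"
  have "isCont L t" for t by (rule has_derivative_continuous [OF dL])
  then have "continuous_on UNIV L" by (simp add: continuous_at_imp_continuous_on)
  then have oO: "open \<Omega>" unfolding \<Omega>_def by (rule open_vimage [OF open_ball])
  have "convex \<Omega>"
  proof (rule convexI)
    fix a b :: complex and s t :: real assume *: "a \<in> \<Omega>" "b \<in> \<Omega>" "0 \<le> s" "0 \<le> t" "s + t = 1"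
    have "L (s *\<^sub>R a + t *\<^sub>R b) = s *\<^sub>R L a + t *\<^sub>R L b"
    proof -
      have "s *\<^sub>R u + t *\<^sub>R u = u" using *(5) by (metis scaleR_add_left scaleR_one)
      then show ?thesis by (simp add: L scaleR_add_right scaleR_add_left add.assoc add.left_commute)
    qed
    then show "s *\<^sub>R a + t *\<^sub>R b \<in> \<Omega>"
      using convexD [OF convex_ball _ _ *(3,4,5), of "L a" "(r, 0)" e "L b"] * by (simp add: \<Omega>_def)
  qed
  then have cO: "connected \<Omega>" by (rule convex_connected)
  define \<phi> where "\<phi> = (\<lambda>t. f (L t) - g (L t))"
  have hd: "((\<lambda>t. k (L t)) has_field_derivative FD k (L t) (w, 0)) (at t)"
    if "holo_on (ball (r, 0) e) k" "t \<in> \<Omega>" for k t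
  proof -
    have Lt: "L t \<in> ball (r, 0) e" using that by (simp add: \<Omega>_def)
    have "((\<lambda>t. k (L t)) has_derivative (\<lambda>h. FD k (L t) (csc h (w, 0)))) (at t)"
      by (rule has_derivative_compose [OF dL smooth_on_has_derivative [OF holo_on_smooth [OF that(1)] Lt]])
    then show ?thesis
      by (simp add: has_field_derivative_def FD_csc [OF that(1) Lt] mult.commute [of _ "FD _ _ _"])
  qed
  have hol: "\<phi> holomorphic_on \<Omega>"
    unfolding \<phi>_def holomorphic_on_open [OF oO]
  proof (intro ballI exI)
    show "((\<lambda>t. f (L t) - g (L t)) has_field_derivative FD f (L t) (w, 0) - FD g (L t) (w, 0)) (at t)"
      if "t \<in> \<Omega>" for t
      by (rule DERIV_diff [OF hd [OF assms(1) that] hd [OF assms(2) that]])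
  qed
  have sq: "(norm (u - r))\<^sup>2 + (norm w)\<^sup>2 < e\<^sup>2" "e > 0"
  proof -
    have n: "norm (u - r, w) < e" using uw by (simp add: dist_norm norm_prod_def norm_minus_commute)
    then show "e > 0" using norm_ge_zero order.strict_trans1 by blast
    then show "(norm (u - r))\<^sup>2 + (norm w)\<^sup>2 < e\<^sup>2"
      using power_strict_mono [OF n norm_ge_zero, of 2] by (simp add: norm_prod_def)
  qed
  have "(norm (u - r))\<^sup>2 < e\<^sup>2" using sq(1) zero_le_power2 [of "norm w"] by linarith
  then have "norm (u - r) < e" using sq(2) by (meson less_imp_le power_less_imp_less_base)
  then have O0: "0 \<in> \<Omega>" by (simp add: \<Omega>_def L dist_norm norm_minus_commute)
  have Oi: "\<i> \<in> \<Omega>" using uw by (simp add: \<Omega>_def L)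
  have "\<phi> \<i> = 0"
  proof (rule analytic_continuation [OF hol oO cO, of "\<Omega> \<inter> \<real>" 0])
    show "0 islimpt \<Omega> \<inter> \<real>"
    proof -
      obtain d where d: "d > 0" "ball 0 d \<subseteq> \<Omega>" using oO O0 open_contains_ball by blast
      show ?thesis unfolding islimpt_approachable
      proof (intro allI impI)
        fix e' :: real assume "e' > 0"
        define x where "x = min d e' / 2"
        have "x > 0" "x < d" "x < e'" using d \<open>e' > 0\<close> by (auto simp: x_def)
        then show "\<exists>x'\<in>\<Omega> \<inter> \<real>. x' \<noteq> 0 \<and> dist x' 0 < e'"
          using d by (intro bexI [of _ "of_real x"]) (auto simp: subset_iff dist_norm)
      qed
    qed
    show "\<phi> z = 0" if z: "z \<in> \<Omega> \<inter> \<real>" for z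
    proof -
      obtain x where x: "z = of_real x" using z by (auto elim: Reals_cases)
      then have "(u + x *\<^sub>R w, 0 :: 'a) \<in> ball (r, 0) e" using z unfolding \<Omega>_def by (auto simp: L)
      from eq [OF this] show ?thesis by (simp add: \<phi>_def L x)
    qed
  qed (use O0 Oi in auto)
  then show ?thesis by (simp add: \<phi>_def L)
qed

section \<open>The complex homogeneous function of the hypersurface\<close>

definition projo :: "'a::real_inner \<Rightarrow> 'a \<Rightarrow> 'a" where
  "projo e y = y - (e \<bullet> y) *\<^sub>R e"

definition projoc :: "'a::real_inner \<Rightarrow> 'a \<times> 'a \<Rightarrow> 'a \<times> 'a" where
  "projoc e z = (projo e (fst z), projo e (snd z))"

lemma bounded_linear_projo: "bounded_linear (projo e)"
  unfolding projo_def
  by (intro bounded_linear_sub bounded_linear_ident bounded_linear_scaleR_const bounded_linear_inner_right)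

lemma bounded_linear_projoc: "bounded_linear (projoc e)"
  unfolding projoc_def
  by (intro bounded_linear_Pair bounded_linear_compose [OF bounded_linear_projo] bounded_linear_fst
      bounded_linear_snd)

lemma projoc_csc: "projoc e (csc k z) = csc k (projoc e z)"
  by (simp add: projoc_def projo_def csc_def Jc_def algebra_simps)

lemma projoc_Jc: "projoc e (Jc z) = Jc (projoc e z)"
  by (simp add: projoc_def projo_def Jc_def algebra_simps)

lemma projo_tangent: "norm e = 1 \<Longrightarrow> projo e y \<in> ray_tangent e"
  by (simp add: projo_def ray_tangent_def inner_simps dot_square_norm)

lemma projo_id: "y \<in> ray_tangent e \<Longrightarrow> projo e y = y"
  by (simp add: projo_def ray_tangent_def)

lemma subspace_ray_tangent: "subspace (ray_tangent x)"
  by (auto simp: subspace_def ray_tangent_def inner_simps)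

lemma smooth_on_csc: "open A \<Longrightarrow> smooth_on A f \<Longrightarrow> smooth_on A g \<Longrightarrow> smooth_on A (\<lambda>x. csc (f x) (g x))"
  by (rule smooth_on_bilinear [OF bounded_bilinear_csc])

text \<open>Near \<open>p\<close>, \<open>s\<close> is the complex number that scales a vector into the complexified hypersurface.\<close>

lemma local_scale:
  fixes e :: "'a::euclidean_space"
  assumes e: "norm e = 1" and p: "p \<in> S"
    and f: "real_analytic_on W f" "defines_near (ray_tangent e) S p W f"
    and f0: "FD f p p \<noteq> 0"
  obtains V d s where "open V" "(p, 0) \<in> V" "d > 0" "holo_on V s"
    "\<And>z. z \<in> V \<Longrightarrow> s z \<noteq> 0" "\<And>z. z \<in> V \<Longrightarrow> FD s z z = - s z"
    "\<And>u. (u, 0) \<in> V \<Longrightarrow> s (u, 0) \<in> \<real> \<and> Re (s (u, 0)) *\<^sub>R projo e u \<in> S"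
    "\<And>u \<sigma>. (u, 0) \<in> V \<Longrightarrow> \<bar>\<sigma> - 1\<bar> < d \<Longrightarrow> \<sigma> *\<^sub>R projo e u \<in> S \<Longrightarrow> s (u, 0) = of_real \<sigma>"
proof -
  let ?T = "ray_tangent e"
  have W: "open W" "p \<in> W" "S \<inter> W = {z \<in> ?T \<inter> W. f z = 0}"
    using f(2) by (auto simp: defines_near_def)
  have pT: "p \<in> ?T" "f p = 0" using p W by auto
  obtain r1 g where r1: "r1 > 0" "holo_on (ball (p, 0) r1) g"
    and gf: "\<And>u. u \<in> ball p r1 \<Longrightarrow> g (u, 0) = of_real (f u)"
    and gcnj: "\<And>u w. (u, w) \<in> ball (p, 0) r1 \<Longrightarrow> g (u, - w) = cnj (g (u, w))"
    by (rule complexify [OF f(1) W(2)]) (rule that; assumption)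
  obtain r2 where r2: "r2 > 0" "ball p r2 \<subseteq> W" using W open_contains_ball by blast
  define r where "r = min r1 r2"
  let ?B = "ball (p, 0 :: 'a) r"
  have r: "r > 0" using r1 r2 by (simp add: r_def)
  have B1: "?B \<subseteq> ball (p, 0) r1" by (auto simp: r_def)
  have holog: "holo_on ?B g" by (rule holo_on_subset [OF r1(2) B1])
  have gB: "g (u, 0) = of_real (f u)" "u \<in> W" if "(u, 0) \<in> ?B" for u
  proof -
    have "dist p u < r" using that by (simp add: dist_Pair_Pair)
    then show "g (u, 0) = of_real (f u)" "u \<in> W" using gf [of u] r2 by (auto simp: r_def subset_iff)
  qed
  \<comment> \<open>The complexified projection of a vector, multiplied by a scalar. Including the
    projection lets \<open>s\<close> be defined on an open set of the full complexified space and
    not only over the tangent space.\<close>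
  define Q where "Q = (\<lambda>p :: ('a \<times> 'a) \<times> complex. csc (snd p) (projoc e (fst p)))"
  have dQ: "(Q has_derivative (\<lambda>q. csc (snd p) (projoc e (fst q)) + csc (snd q) (projoc e (fst p)))) (at p)" for p
    unfolding Q_def
    by (intro bounded_bilinear.FDERIV [OF bounded_bilinear_csc] bounded_linear_imp_has_derivative
        bounded_linear_snd bounded_linear_compose [OF bounded_linear_projoc] bounded_linear_fst)
  have smQ: "smooth_on A Q" if "open A" for A
    unfolding Q_def using that
    by (intro smooth_on_csc smooth_on_snd smooth_on_bounded_linear [OF bounded_linear_projoc] smooth_on_fst)
  define A where "A = Q -` ?B"
  have oA: "open A" unfolding A_def
    by (rule open_vimage [OF open_ball smooth_on_continuous_on [OF smQ [OF open_UNIV]]])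
  define F where "F = (\<lambda>p. g (Q p))"
  have smF: "smooth_on A F" unfolding F_def
    by (rule smooth_on_compose [OF oA holo_on_smooth [OF holog] smQ [OF oA]]) (auto simp: A_def)
  have gd: "g differentiable (at z)" if "z \<in> ?B" for z
    by (rule smooth_on_differentiable [OF holo_on_smooth [OF holog] that])
  have FDF: "FD F p q = snd p * FD g (Q p) (projoc e (fst q)) + snd q * FD g (Q p) (projoc e (fst p))"
    if "p \<in> A" for p q
  proof -
    have m: "Q p \<in> ?B" using that by (simp add: A_def)
    show ?thesis unfolding F_def
      by (subst FD_compose [OF gd [OF m] differentiableI [OF dQ]])
         (simp add: FD_eqI [OF dQ] FD_linear [OF gd [OF m]] FD_csc [OF holog m])
  qed
  have Qp: "Q ((p, 0), 1) = (p, 0)" by (simp add: Q_def projoc_def projo_id [OF pT(1)] projo_def [of _ 0])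
  have pB: "(p, 0) \<in> ?B" using r by simp
  have A0: "((p, 0), 1) \<in> A" "F ((p, 0), 1) = 0"
    using Qp pB gB pT by (auto simp: A_def F_def)
  \<comment> \<open>Radial transversality of \<open>S\<close> is exactly what makes the equation
    solvable for the scale factor.\<close>
  have FDg: "FD g (p, 0) (p, 0) \<noteq> 0"
  proof -
    have "((\<lambda>u. (u, 0)) has_derivative (\<lambda>h. (h, 0))) (at p)" by (auto intro!: derivative_eq_intros)
    from has_derivative_compose [OF this, of g "FD g (p, 0)"]
    have 1: "((\<lambda>u. g (u, 0)) has_derivative (\<lambda>h. FD g (p, 0) (h, 0))) (at p)"
      using gd [OF pB] by (simp add: frechet_derivative_works)
    have "((\<lambda>u. Re (g (u, 0))) has_derivative (\<lambda>h. Re (FD g (p, 0) (h, 0)))) (at p)"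
      by (rule bounded_linear.has_derivative [OF bounded_linear_Re 1])
    then have "(f has_derivative (\<lambda>h. Re (FD g (p, 0) (h, 0)))) (at p)"
      by (rule has_derivative_transform_within_open [of _ _ _ _ "ball p r1"]) (use r1 gf in auto)
    from FD_eqI [OF this] f0 show ?thesis by auto
  qed
  let ?a = "\<lambda>p. FD g (Q p) (projoc e (fst p))"
  obtain V d s where V: "open V" "(p, 0) \<in> V" "d > 0" "smooth_on V s"
    and s: "\<And>x. x \<in> V \<Longrightarrow> dist (s x) 1 < d \<and> F (x, s x) = 0 \<and> ?a (x, s x) \<noteq> 0"
      "\<And>x t. x \<in> V \<Longrightarrow> dist t 1 < d \<Longrightarrow> (x, t) \<in> A"
      "\<And>x t. x \<in> V \<Longrightarrow> dist t 1 < d \<Longrightarrow> F (x, t) = 0 \<Longrightarrow> t = s x"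
      "\<And>x h. x \<in> V \<Longrightarrow> FD s x h = - FD F (x, s x) (h, 0) / ?a (x, s x)"
  proof (rule implicit_function_point [OF oA smF A0, of ?a])
    show "FD F p (0, k) = ?a p * k" if "p \<in> A" for p k
    proof -
      have m: "Q p \<in> ?B" using that by (simp add: A_def)
      show ?thesis using FDF [OF that, of "(0, k)"]
        by (simp add: projoc_def projo_def FD_linear [OF gd [OF m]] zero_prod_def [symmetric])
    qed
    show "?a ((p, 0), 1) \<noteq> 0"
      using FDg Qp by (simp add: projoc_def projo_id [OF pT(1)] projo_def [of _ 0])
  qed (rule that)
  define V' where "V' = V \<inter> s -` (- {0})"
  have V': "open V'" "(p, 0) \<in> V'"
  proof -
    show "open V'" unfolding V'_def
      by (rule continuous_open_preimage [OF smooth_on_continuous_on [OF V(4)] V(1)]) auto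
    have "s (p, 0) = 1" using s(3) [OF V(2), of 1] A0 V(3) by simp
    then show "(p, 0) \<in> V'" using V by (simp add: V'_def)
  qed
  have FDs: "FD s z h = - s z * FD g (Q (z, s z)) (projoc e h) / FD g (Q (z, s z)) (projoc e z)" if "z \<in> V" for z h
    using s(4) [OF that, of h] FDF [of "(z, s z)" "(h, 0)"] s(1,2) [OF that] by simp
  show thesis
  proof (rule that [of V' d s])
    show "open V'" "(p, 0) \<in> V'" "d > 0" by fact+
    show "holo_on V' s"
    proof (rule holo_onI)
      show "smooth_on V' s" by (rule smooth_on_subset [OF V(4)]) (simp add: V'_def)
      fix z h assume "z \<in> V'"
      then have z: "z \<in> V" by (simp add: V'_def)
      have "Q (z, s z) \<in> ?B" using s(1,2) [OF z] by (auto simp: A_def)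
      then show "FD s z (Jc h) = \<i> * FD s z h"
        by (simp add: FDs [OF z] projoc_Jc holo_on_Jc [OF holog])
    qed
    show "s z \<noteq> 0" if "z \<in> V'" for z using that by (simp add: V'_def)
    \<comment> \<open>Homogeneity of degree -1 in infinitesimal form: for the direction
      \<open>h = z\<close> numerator and denominator of the quotient formula cancel.\<close>
    show "FD s z z = - s z" if "z \<in> V'" for z
    proof -
      have z: "z \<in> V" using that by (simp add: V'_def)
      then show ?thesis using FDs [OF z, of z] s(1) [OF z] by simp
    qed
    have Qr: "Q ((u, 0), t) = (Re t *\<^sub>R projo e u, Im t *\<^sub>R projo e u)" for u t
      by (simp add: Q_def csc_def Jc_def projoc_def projo_def [of _ 0])
    show "s (u, 0) \<in> \<real> \<and> Re (s (u, 0)) *\<^sub>R projo e u \<in> S" if "(u, 0) \<in> V'" for u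
    proof -
      have u: "(u, 0) \<in> V" using that by (simp add: V'_def)
      let ?t = "s (u, 0)"
      have t: "dist ?t 1 < d" "g (Q ((u, 0), ?t)) = 0" "Q ((u, 0), ?t) \<in> ?B"
        using s(1,2) [OF u] by (auto simp: F_def A_def)
      \<comment> \<open>The conjugate of \<open>s (u, 0)\<close> is as close to 1 and, by the
        conjugation symmetry of \<open>g\<close>, solves the same equation; uniqueness makes it
        equal to \<open>s (u, 0)\<close>.\<close>
      have ct: "dist (cnj ?t) 1 < d"
      proof -
        have "dist (cnj ?t) 1 = norm (cnj (?t - 1))" by (simp add: dist_norm)
        also have "\<dots> = dist ?t 1" by (simp only: complex_mod_cnj dist_norm)
        finally show ?thesis using t by simp
      qed
      have "g (Re ?t *\<^sub>R projo e u, - (Im ?t *\<^sub>R projo e u)) = cnj (g (Re ?t *\<^sub>R projo e u, Im ?t *\<^sub>R projo e u))"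
        using t(3) B1 by (intro gcnj) (auto simp: Qr)
      then have "F ((u, 0), cnj ?t) = 0" using t(2) by (simp add: F_def Qr)
      from s(3) [OF u ct this] have re: "?t \<in> \<real>" by (metis Reals_cnj_iff)
      then have i0: "Im ?t = 0" by (simp add: complex_is_Real_iff)
      let ?v = "Re ?t *\<^sub>R projo e u"
      have "(?v, 0) \<in> ?B" "g (?v, 0) = 0" using t i0 by (simp_all add: Qr)
      then have "?v \<in> W" "f ?v = 0" using gB [of ?v] by auto
      moreover have "?v \<in> ?T" by (intro subspace_scale subspace_ray_tangent projo_tangent e)
      ultimately have "?v \<in> S \<inter> W" unfolding W(3) by simp
      with re show ?thesis by simp
    qed
    \<comment> \<open>A description of \<open>s\<close> at real points by \<open>S\<close> alone; it
      makes scale factors from different defining functions comparable.\<close>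
    show "s (u, 0) = of_real \<sigma>" if "(u, 0) \<in> V'" "\<bar>\<sigma> - 1\<bar> < d" "\<sigma> *\<^sub>R projo e u \<in> S" for u \<sigma>
    proof -
      have u: "(u, 0) \<in> V" using that by (simp add: V'_def)
      have d: "dist (of_real \<sigma> :: complex) 1 < d"
        using that(2) by (metis dist_norm norm_of_real of_real_1 of_real_diff real_norm_def)
      have "Q ((u, 0), of_real \<sigma>) \<in> ?B" using s(2) [OF u d] by (simp add: A_def)
      then have m: "(\<sigma> *\<^sub>R projo e u, 0) \<in> ?B" by (simp add: Qr)
      then have "\<sigma> *\<^sub>R projo e u \<in> S \<inter> W" using gB(2) [OF m] that by simp
      then have "f (\<sigma> *\<^sub>R projo e u) = 0" unfolding W(3) by simp
      then have "F ((u, 0), of_real \<sigma>) = 0" using gB(1) [OF m] by (simp add: F_def Qr)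
      from s(3) [OF u d this] show ?thesis by simp
    qed
  qed
qed

text \<open>Two local scale factors come from unrelated defining functions. At real points near
  \<open>S\<close>, however, both are the real factor close to 1 that moves the projected vector
  into \<open>S\<close>, so they agree there, and the identity theorem extends this to a complex
  ball. Their germs along \<open>S\<close> therefore glue.\<close>

lemma global_scale:
  fixes e :: "'a::euclidean_space"
  assumes e: "norm e = 1" and S: "compact S" "S \<subseteq> ray_tangent e"
    and f: "\<And>p. p \<in> S \<Longrightarrow> \<exists>W f. real_analytic_on W f \<and> defines_near (ray_tangent e) S p W f \<and> FD f p p \<noteq> 0"
  obtains D s where "open D" "S \<times> {0} \<subseteq> D" "holo_on D s" "\<And>z. z \<in> D \<Longrightarrow> s z \<noteq> 0"
    "\<And>z. z \<in> D \<Longrightarrow> FD s z z = - s z"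
    "\<And>u. (u, 0) \<in> D \<Longrightarrow> s (u, 0) \<in> \<real> \<and> Re (s (u, 0)) *\<^sub>R projo e u \<in> S"
    "\<And>u. u \<in> S \<Longrightarrow> s (u, 0) = 1"
proof -
  define ok where "ok = (\<lambda>V d s. open V \<and> d > 0 \<and> holo_on V s \<and>
    (\<forall>z\<in>V. s z \<noteq> 0) \<and> (\<forall>z\<in>V. FD s z z = - s z) \<and>
    (\<forall>u. (u, 0) \<in> V \<longrightarrow> s (u, 0) \<in> \<real> \<and> Re (s (u, 0)) *\<^sub>R projo e u \<in> S) \<and>
    (\<forall>u \<sigma>. (u, 0) \<in> V \<longrightarrow> \<bar>\<sigma> - 1\<bar> < d \<longrightarrow> \<sigma> *\<^sub>R projo e u \<in> S \<longrightarrow> s (u, 0) = complex_of_real \<sigma>))"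
  have okD: "open V" "d > 0" "holo_on V s" "\<And>z. z \<in> V \<Longrightarrow> s z \<noteq> 0" "\<And>z. z \<in> V \<Longrightarrow> FD s z z = - s z"
    "\<And>u. (u, 0) \<in> V \<Longrightarrow> s (u, 0) \<in> \<real>" "\<And>u. (u, 0) \<in> V \<Longrightarrow> Re (s (u, 0)) *\<^sub>R projo e u \<in> S"
    "\<And>u \<sigma>. (u, 0) \<in> V \<Longrightarrow> \<bar>\<sigma> - 1\<bar> < d \<Longrightarrow> \<sigma> *\<^sub>R projo e u \<in> S \<Longrightarrow> s (u, 0) = of_real \<sigma>"
    if "ok V d s" for V d s
    using that unfolding ok_def by blast+
  have "\<exists>V d s. (p, 0) \<in> V \<and> ok V d s" if p: "p \<in> S" for p
  proof -
    obtain W f where W: "real_analytic_on W f" "defines_near (ray_tangent e) S p W f" "FD f p p \<noteq> 0"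
      using f [OF p] by blast
    show ?thesis
      by (rule local_scale [OF e p W]) (unfold ok_def, blast)
  qed
  then obtain V d s where ok0: "\<And>p. p \<in> S \<Longrightarrow> (p, 0) \<in> V p \<and> ok (V p) (d p) (s p)" by metis
  then have ok: "ok (V p) (d p) (s p)" "(p, 0) \<in> V p" if "p \<in> S" for p using that by blast+
  define K where "K = S \<times> {0::'a}"
  have K: "compact K" unfolding K_def using S by (intro compact_Times) auto
  have one: "s p (r, 0) = 1" if "p \<in> S" "r \<in> S" "(r, 0) \<in> V p" for p r
    using okD(8) [OF ok(1) [OF that(1)] that(3), of 1] okD(2) [OF ok(1) [OF that(1)]] that S
    by (auto simp: projo_id subset_iff)
  have agree: "\<forall>\<^sub>F x in nhds r. s (fst p) x = s (fst q) x"
    if K': "p \<in> K" "q \<in> K" "r \<in> K" "r \<in> V (fst p)" "r \<in> V (fst q)" for p q r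
  proof -
    obtain p' q' r' where pqr: "p = (p', 0)" "q = (q', 0)" "r = (r', 0)" "p' \<in> S" "q' \<in> S" "r' \<in> S"
      using K' by (auto simp: K_def)
    have rV: "r \<in> V p'" "r \<in> V q'" using K' pqr by auto
    note okp = okD [OF ok(1) [OF pqr(4)]] and okq = okD [OF ok(1) [OF pqr(5)]]
    have "continuous_on (V p') (s p')" by (rule smooth_on_continuous_on [OF holo_on_smooth [OF okp(3)]])
    then have "open (V p' \<inter> s p' -` ball 1 (d q'))"
      by (rule continuous_open_preimage [OF _ okp(1) open_ball])
    moreover have "r \<in> V p' \<inter> s p' -` ball 1 (d q')"
      using rV one [OF pqr(4,6)] okq(2) pqr by simp
    ultimately have "open (V p' \<inter> s p' -` ball 1 (d q') \<inter> V q')" "r \<in> V p' \<inter> s p' -` ball 1 (d q') \<inter> V q'"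
      using okq(1) rV by auto
    then obtain \<epsilon> where \<epsilon>: "\<epsilon> > 0" "ball r \<epsilon> \<subseteq> V p' \<inter> s p' -` ball 1 (d q') \<inter> V q'"
      using open_contains_ball by blast
    have "s p' z = s q' z" if z: "z \<in> ball r \<epsilon>" for z
    proof -
      have h: "holo_on (ball (r', 0) \<epsilon>) (s p')" "holo_on (ball (r', 0) \<epsilon>) (s q')"
        using \<epsilon> pqr by (auto intro: holo_on_subset [OF okp(3)] holo_on_subset [OF okq(3)])
      have "s p' (u, 0) = s q' (u, 0)" if "(u, 0 :: 'a) \<in> ball (r', 0) \<epsilon>" for u
      proof -
        have u: "(u, 0) \<in> V p'" "(u, 0) \<in> V q'" "dist (s p' (u, 0)) 1 < d q'"
          using that \<epsilon> pqr by (auto simp: subset_iff dist_commute)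
        have re: "s p' (u, 0) = of_real (Re (s p' (u, 0)))" using okp(6) [OF u(1)] by simp
        have "\<bar>Re (s p' (u, 0)) - 1\<bar> < d q'"
          using u(3) abs_Re_le_cmod [of "s p' (u, 0) - 1"] by (simp add: dist_norm)
        from okq(8) [OF u(2) this okp(7) [OF u(1)]] re show ?thesis by simp
      qed
      from holo_on_identity [OF h this, of "fst z" "snd z"] z pqr show ?thesis by simp
    qed
    then show ?thesis
      unfolding pqr fst_conv eventually_nhds_metric using \<epsilon>(1) pqr(3) by (auto simp: dist_commute)
  qed
  obtain \<sigma> where \<sigma>: "\<And>p r. p \<in> K \<Longrightarrow> r \<in> K \<Longrightarrow> r \<in> V (fst p) \<Longrightarrow> \<forall>\<^sub>F x in nhds r. \<sigma> x = s (fst p) x"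
  proof (rule glue_near_compact [OF K, of "\<lambda>p. V (fst p)" "\<lambda>p. s (fst p)"])
    show "open (V (fst p)) \<and> p \<in> V (fst p)" if "p \<in> K" for p
      using that ok(2) okD(1) [OF ok(1)] by (auto simp: K_def)
  qed (use agree in blast)+
  \<comment> \<open>On the interiors of the coincidence sets the glued function is locally one of
    the pieces, so that all local properties are inherited.\<close>
  define D where "D = (\<Union>p\<in>S. interior {z \<in> V p. \<sigma> z = s p z})"
  have oD: "open D" by (auto simp: D_def)
  have KD: "S \<times> {0} \<subseteq> D"
  proof
    fix r assume r: "r \<in> S \<times> {0::'a}"
    then obtain r' where r': "r = (r', 0)" "r' \<in> S" by auto
    have "\<forall>\<^sub>F x in nhds r. \<sigma> x = s r' x"
      using \<sigma> [of r r] r r' ok(2) by (simp add: K_def)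
    moreover have "\<forall>\<^sub>F x in nhds r. x \<in> V r'"
      using ok(2) [OF r'(2)] okD(1) [OF ok(1) [OF r'(2)]] r' by (intro eventually_nhds_in_open) auto
    ultimately have "\<forall>\<^sub>F x in nhds r. x \<in> {z \<in> V r'. \<sigma> z = s r' z}" by eventually_elim simp
    then have "r \<in> interior {z \<in> V r'. \<sigma> z = s r' z}" by (simp add: eventually_nhds_in_nhd interior_def eventually_nhds) blast
    then show "r \<in> D" using r' by (auto simp: D_def)
  qed
  have loc: "\<exists>p\<in>S. \<exists>B. open B \<and> z \<in> B \<and> B \<subseteq> V p \<and> (\<forall>x\<in>B. \<sigma> x = s p x)" if z: "z \<in> D" for z
  proof -
    obtain p where p: "p \<in> S" "z \<in> interior {z \<in> V p. \<sigma> z = s p z}" using z unfolding D_def by blast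
    then show ?thesis using interior_subset [of "{z \<in> V p. \<sigma> z = s p z}"]
      by (intro bexI [OF _ p(1)] exI [of _ "interior {z \<in> V p. \<sigma> z = s p z}"]) auto
  qed
  show thesis
  proof (rule that [of D \<sigma>])
    show "open D" "S \<times> {0} \<subseteq> D" by fact+
    show "holo_on D \<sigma>"
    proof (rule holo_on_local)
      fix z assume "z \<in> D"
      then obtain p B where p: "p \<in> S" and B: "open B" "z \<in> B" "B \<subseteq> V p" "\<forall>x\<in>B. \<sigma> x = s p x" using loc by blast
      have "holo_on B (s p)" by (rule holo_on_subset [OF okD(3) [OF ok(1) [OF p]] B(3)])
      then have "holo_on B \<sigma>" using B(4) by (intro holo_on_cong [OF B(1), of "s p" \<sigma>]) simp_all
      then show "\<exists>B. open B \<and> z \<in> B \<and> holo_on B \<sigma>" using B by blast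
    qed
    show "\<sigma> z \<noteq> 0" "FD \<sigma> z z = - \<sigma> z" if z: "z \<in> D" for z
    proof -
      obtain p B where p: "p \<in> S" and B: "open B" "z \<in> B" "B \<subseteq> V p" "\<forall>x\<in>B. \<sigma> x = s p x" using loc z by blast
      have zV: "z \<in> V p" using B by blast
      have "FD \<sigma> z = FD (s p) z" using B by (intro FD_cong [OF B(1)]) auto
      then show "\<sigma> z \<noteq> 0" "FD \<sigma> z z = - \<sigma> z"
        using okD(4,5) [OF ok(1) [OF p] zV] B by simp_all
    qed
    show "\<sigma> (u, 0) \<in> \<real> \<and> Re (\<sigma> (u, 0)) *\<^sub>R projo e u \<in> S" if u: "(u, 0) \<in> D" for u
    proof -
      obtain p B where p: "p \<in> S" and B: "(u, 0) \<in> B" "B \<subseteq> V p" "\<forall>x\<in>B. \<sigma> x = s p x" using loc u by blast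
      have "(u, 0) \<in> V p" using B by blast
      then show ?thesis using okD(6,7) [OF ok(1) [OF p], of u] B by simp
    qed
    show "\<sigma> (u, 0) = 1" if u: "u \<in> S" for u
      using eventually_nhds_x_imp_x [OF \<sigma> [of "(u, 0)" "(u, 0)"]] one [OF u u] ok(2) [OF u] u by (simp add: K_def)
  qed
qed

section \<open>The complex Funk function\<close>

text \<open>\<open>G = 1 / s\<close> is the complexified gauge of \<open>S\<close>, homogeneous of
  degree 1 and equal to 1 on \<open>S\<close>. The cone is the set where \<open>G\<close> of the
  projection equals \<i> times the coordinate along \<open>e\<close>, so over \<open>x = e\<close>,
  for \<open>y\<close> in the tangent space, the solution is \<open>c = - i G (y)\<close>: its real
  part vanishes and its imaginary part is -1 exactly on \<open>S\<close>. The differential equations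
  come from the single formula \<open>D c (h, l) = - (L l + c L h) / L x\<close>, where
  \<open>L\<close> is the differential of the cone function at \<open>y + c x\<close>.\<close>

lemma burgers_solution:
  fixes e :: "'a::euclidean_space"
  assumes e: "norm e = 1" and S: "compact S" "S \<subseteq> ray_tangent e"
    and D: "open D" "S \<times> {0} \<subseteq> D" "holo_on D s" "\<And>z. z \<in> D \<Longrightarrow> s z \<noteq> 0"
    and euler: "\<And>z. z \<in> D \<Longrightarrow> FD s z z = - s z"
    and real: "\<And>u. (u, 0) \<in> D \<Longrightarrow> s (u, 0) \<in> \<real> \<and> Re (s (u, 0)) *\<^sub>R projo e u \<in> S"
    and one: "\<And>u. u \<in> S \<Longrightarrow> s (u, 0) = 1"
  obtains N c where "open N" "{e} \<times> S \<subseteq> N" "smooth_on N c"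
    "\<And>p h. p \<in> N \<Longrightarrow> FD c p (h, 0) = c p * FD c p (0, h)"
    "\<And>x y. (x, y) \<in> N \<Longrightarrow> FD c (x, y) (0, x) = - 1"
    "\<And>x y. (x, y) \<in> N \<Longrightarrow> FD c (x, y) (0, y) = c (x, y)"
    "\<And>y. (e, y) \<in> N \<Longrightarrow> y \<in> ray_tangent e \<Longrightarrow> Re (c (e, y)) = 0 \<and> (Im (c (e, y)) = - 1 \<longleftrightarrow> y \<in> S)"
proof -
  define G where "G = (\<lambda>z. inverse (s z))"
  have sd: "s differentiable (at z)" if "z \<in> D" for z
    by (rule smooth_on_differentiable [OF holo_on_smooth [OF D(3)] that])
  have FDG: "FD G z = (\<lambda>h. - (inverse (s z) * FD s z h * inverse (s z)))" if "z \<in> D" for z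
    unfolding G_def using sd [OF that] D(4) [OF that]
    by (intro FD_eqI Deriv.has_derivative_inverse) (simp_all add: frechet_derivative_works)
  have holoG: "holo_on D G"
  proof (rule holo_onI)
    show "smooth_on D G" unfolding G_def by (rule smooth_on_inverse [OF D(1) holo_on_smooth [OF D(3)] D(4)])
    show "FD G z (Jc h) = \<i> * FD G z h" if "z \<in> D" for z h
      by (simp add: FDG [OF that] holo_on_Jc [OF D(3) that])
  qed
  have eulerG: "FD G z z = G z" if "z \<in> D" for z
    unfolding FDG [OF that] euler [OF that] using D(4) [OF that] by (simp add: G_def)
  define Z where "Z = (\<lambda>p :: ('a \<times> 'a) \<times> complex. (snd (fst p), 0) + csc (snd p) (fst (fst p), 0 :: 'a))"
  have dZ: "(Z has_derivative (\<lambda>q. (snd (fst q), 0) + (csc (snd p) (fst (fst q), 0) + csc (snd q) (fst (fst p), 0)))) (at p)" for p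
    unfolding Z_def
    by (intro has_derivative_add bounded_bilinear.FDERIV [OF bounded_bilinear_csc] bounded_linear_imp_has_derivative
        bounded_linear_snd bounded_linear_Pair bounded_linear_zero bounded_linear_fst
        bounded_linear_compose [OF bounded_linear_snd] bounded_linear_compose [OF bounded_linear_fst])
  have smZ: "smooth_on A Z" if "open A" for A
    unfolding Z_def using that
    by (intro smooth_on_csc smooth_on_add smooth_on_Pair smooth_on_const smooth_on_snd
        smooth_on_bounded_linear [OF bounded_linear_fst] smooth_on_bounded_linear [OF bounded_linear_snd] smooth_on_fst)
  define A where "A = (\<lambda>p. projoc e (Z p)) -` D"
  have smpZ: "smooth_on A (\<lambda>p. projoc e (Z p))" if "open A" for A
    by (rule smooth_on_bounded_linear [OF bounded_linear_projoc that smZ [OF that]])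
  have oA: "open A" unfolding A_def
    by (rule open_vimage [OF D(1) smooth_on_continuous_on [OF smpZ [OF open_UNIV]]])
  define F where "F = (\<lambda>p. G (projoc e (Z p)) - \<i> * zcoord e (Z p))"
  have smF: "smooth_on A F" unfolding F_def
    by (intro smooth_on_diff smooth_on_mult smooth_on_const oA
         smooth_on_compose [OF oA holo_on_smooth [OF holoG] smpZ [OF oA]]
         smooth_on_bounded_linear [OF bounded_linear_zcoord oA smZ [OF oA]]) (auto simp: A_def)
  define L where "L = (\<lambda>p z. FD G (projoc e (Z p)) (projoc e z) - \<i> * zcoord e z)"
  have Gd: "G differentiable (at z)" if "z \<in> D" for z
    by (rule smooth_on_differentiable [OF holo_on_smooth [OF holoG] that])
  have L_add: "L p (z + w) = L p z + L p w" and L_csc: "L p (csc k z) = k * L p z" if "p \<in> A" for p z w k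
  proof -
    have m: "projoc e (Z p) \<in> D" using that by (simp add: A_def)
    show "L p (z + w) = L p z + L p w"
      by (simp add: L_def linear_add [OF bounded_linear.linear [OF bounded_linear_projoc]]
          linear_add [OF bounded_linear.linear [OF bounded_linear_zcoord]] FD_linear [OF Gd [OF m]] algebra_simps)
    show "L p (csc k z) = k * L p z"
      by (simp add: L_def projoc_csc FD_csc [OF holoG m] zcoord_csc algebra_simps)
  qed
  have FDF: "FD F p q = L p (snd (fst q), 0) + (snd p * L p (fst (fst q), 0) + snd q * L p (fst (fst p), 0))"
    if "p \<in> A" for p q
  proof -
    have m: "projoc e (Z p) \<in> D" using that by (simp add: A_def)
    let ?q = "(snd (fst q), 0) + (csc (snd p) (fst (fst q), 0) + csc (snd q) (fst (fst p), 0))"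
    have dpZ: "((\<lambda>p. projoc e (Z p)) has_derivative (\<lambda>q. projoc e ((snd (fst q), 0) + (csc (snd p) (fst (fst q), 0) + csc (snd q) (fst (fst p), 0))))) (at p)"
      by (rule bounded_linear.has_derivative [OF bounded_linear_projoc dZ])
    have "(G has_derivative FD G (projoc e (Z p))) (at (projoc e (Z p)))"
      using Gd [OF m] by (simp add: frechet_derivative_works)
    from has_derivative_diff [OF has_derivative_compose [OF dpZ this]
        has_derivative_mult_right [OF bounded_linear.has_derivative [OF bounded_linear_zcoord dZ], of \<i> e p]]
    have "(F has_derivative (\<lambda>q. L p ((snd (fst q), 0) + (csc (snd p) (fst (fst q), 0) + csc (snd q) (fst (fst p), 0))))) (at p)"
      unfolding F_def L_def .
    from FD_eqI [OF this] show ?thesis by (simp add: L_add [OF that] L_csc [OF that])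
  qed
  let ?a = "\<lambda>p. L p (fst (fst p), 0)"
  define K where "K = {e} \<times> S"
  have K: "compact K" unfolding K_def using S by (intro compact_Times) auto
  have pe: "projo e e = 0" using e by (simp add: projo_def dot_square_norm)
  have p0: "projo e 0 = 0" by (simp add: projo_def)
  have ee: "e \<bullet> e = 1" using e by (simp add: dot_square_norm)
  have x0: "(x, - \<i>) \<in> A \<and> F (x, - \<i>) = 0 \<and> ?a (x, - \<i>) \<noteq> 0" if xK: "x \<in> K" for x
  proof -
    obtain y where y: "x = (e, y)" "y \<in> S" using xK by (auto simp: K_def)
    then have yT: "y \<in> ray_tangent e" using S by auto
    have Zx: "Z (x, - \<i>) = (y, - e)" by (simp add: Z_def y csc_def Jc_def)
    have pZ: "projoc e (Z (x, - \<i>)) = (y, 0)"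
      by (simp add: Zx projoc_def projo_id [OF yT]) (simp add: projo_def ee)
    have zc: "zcoord e (Z (x, - \<i>)) = - \<i>"
      using yT ee by (simp add: Zx zcoord_def ray_tangent_def inner_commute complex_eq_iff)
    have yD: "(y, 0) \<in> D" using D(2) y by auto
    have pz: "projoc e (e, 0) = 0" by (simp add: projoc_def pe p0 zero_prod_def)
    have zc1: "zcoord e (e, 0) = 1" by (simp add: zcoord_def ee complex_eq_iff)
    have "L (x, - \<i>) (e, 0) = - \<i>"
      unfolding L_def pZ pz zc1 by (simp add: FD_linear [OF Gd [OF yD]])
    then show ?thesis using yD pZ zc one [OF y(2)] by (simp add: A_def F_def G_def y)
  qed
  obtain V d c where V: "open V" "K \<subseteq> V" "d > 0" "smooth_on V c"
    and c: "\<And>x. x \<in> V \<Longrightarrow> dist (c x) (- \<i>) < d \<and> F (x, c x) = 0 \<and> ?a (x, c x) \<noteq> 0"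
      "\<And>x t. x \<in> V \<Longrightarrow> dist t (- \<i>) < d \<Longrightarrow> (x, t) \<in> A"
      "\<And>x h. x \<in> V \<Longrightarrow> FD c x h = - FD F (x, c x) (h, 0) / ?a (x, c x)"
  proof (rule implicit_function_compact [OF K oA smF, of "- \<i>" ?a])
    show "(x, - \<i>) \<in> A \<and> F (x, - \<i>) = 0 \<and> ?a (x, - \<i>) \<noteq> 0" if "x \<in> K" for x by (rule x0 [OF that])
    show "FD F p (0, k) = ?a p * k" if "p \<in> A" for p k
    proof -
      have "L p (0, 0) = L p (csc 0 (0, 0))" by (simp add: csc_def zero_prod_def)
      then have "L p (0, 0) = 0" by (simp only: L_csc [OF that]) simp
      then show ?thesis using FDF [OF that, of "(0, k)"] by simp
    qed
  qed (rule that)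
  have cA: "(p, c p) \<in> A" if "p \<in> V" for p using c(1,2) [OF that] by blast
  have L0: "L p (0, 0) = 0" if "p \<in> A" for p
  proof -
    have "L p (0, 0) = L p (csc 0 (0, 0))" by (simp add: csc_def zero_prod_def)
    then show ?thesis by (simp only: L_csc [OF that]) simp
  qed
  have FDc: "FD c (x, y) (h, l) = - (L ((x, y), c (x, y)) (l, 0) + c (x, y) * L ((x, y), c (x, y)) (h, 0)) / L ((x, y), c (x, y)) (x, 0)"
    if "(x, y) \<in> V" for x y h l
    using c(3) [OF that, of "(h, l)"] FDF [OF cA [OF that], of "((h, l), 0)"] by simp
  show thesis
  proof (rule that [of V c])
    show "open V" "smooth_on V c" by fact+
    show "{e} \<times> S \<subseteq> V" using V(2) by (simp add: K_def)
    show "FD c p (h, 0) = c p * FD c p (0, h)" if "p \<in> V" for p h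
    proof -
      obtain x y where p: "p = (x, y)" by (cases p)
      show ?thesis using that unfolding p by (simp add: FDc L0 [OF cA])
    qed
    show "FD c (x, y) (0, x) = - 1" if "(x, y) \<in> V" for x y
      using c(1) [OF that] by (simp add: FDc [OF that] L0 [OF cA [OF that]])
    show "FD c (x, y) (0, y) = c (x, y)" if V': "(x, y) \<in> V" for x y
    proof -
      let ?p = "((x, y), c (x, y))"
      have m: "projoc e (Z ?p) \<in> D" using cA [OF V'] by (simp add: A_def)
      \<comment> \<open>Euler's identity for the homogeneous cone function, evaluated at one of its
        zeros.\<close>
      have "L ?p (y, 0) + c (x, y) * L ?p (x, 0) = L ?p (Z ?p)"
        by (simp add: Z_def L_add [OF cA [OF V']] L_csc [OF cA [OF V']])
      also have "\<dots> = F ?p" by (simp add: L_def F_def eulerG [OF m])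
      also have "\<dots> = 0" using c(1) [OF V'] by simp
      finally have "L ?p (y, 0) = - c (x, y) * L ?p (x, 0)" by (simp add: eq_neg_iff_add_eq_0)
      then show ?thesis using c(1) [OF V'] by (simp add: FDc [OF V'] L0 [OF cA [OF V']])
    qed
    show "Re (c (e, y)) = 0 \<and> (Im (c (e, y)) = - 1 \<longleftrightarrow> y \<in> S)" if V': "(e, y) \<in> V" and yT: "y \<in> ray_tangent e" for y
    proof -
      let ?c = "c (e, y)"
      have Z1: "Z ((e, y), ?c) = (y + Re ?c *\<^sub>R e, Im ?c *\<^sub>R e)" by (simp add: Z_def csc_def Jc_def)
      have pZ: "projoc e (Z ((e, y), ?c)) = (y, 0)"
        using projo_id [OF yT] by (simp add: Z1 projoc_def projo_def ee algebra_simps)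
      have zc: "zcoord e (Z ((e, y), ?c)) = ?c"
        using yT ee by (simp add: Z1 zcoord_def ray_tangent_def inner_simps inner_commute)
      have yD: "(y, 0) \<in> D" using cA [OF V'] pZ by (simp add: A_def)
      obtain r where r: "s (y, 0) = of_real r" using real [OF yD] by (auto elim: Reals_cases)
      have rS: "r *\<^sub>R y \<in> S" using real [OF yD] r projo_id [OF yT] by simp
      have r0: "r \<noteq> 0" using D(4) [OF yD] r by auto
      have "G (y, 0) - \<i> * ?c = 0" using c(1) [OF V'] by (simp add: F_def pZ zc)
      then have "of_real (inverse r) = \<i> * ?c" by (simp add: G_def r)
      then have "Re (complex_of_real (inverse r)) = Re (\<i> * ?c)" "Im (complex_of_real (inverse r)) = Im (\<i> * ?c)"
        by (simp_all only:)
      then have "?c = Complex 0 (- inverse r)"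
        unfolding Re_complex_of_real Im_complex_of_real by (simp add: complex_eq_iff)
      moreover have "inverse r = 1 \<longleftrightarrow> y \<in> S"
      proof
        assume "inverse r = 1"
        then have "r = 1" using r0 by (simp add: field_simps)
        then show "y \<in> S" using rS by simp
      next
        assume "y \<in> S"
        then show "inverse r = 1" using one [of y] r by simp
      qed
      ultimately show ?thesis by simp
    qed
  qed
qed

section \<open>Families of linear maps and differential forms\<close>

lemma linear_family_expand:
  fixes L :: "'a::euclidean_space \<Rightarrow> 'c::real_vector"
  assumes "linear L"
  shows "L h = (\<Sum>b\<in>Basis. (h \<bullet> b) *\<^sub>R L b)"
proof -
  have "L h = L (\<Sum>b\<in>Basis. (h \<bullet> b) *\<^sub>R b)" by (simp add: euclidean_representation)
  then show ?thesis by (simp add: linear_sum [OF assms] linear_scale [OF assms])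
qed

lemma FD_sum:
  assumes "\<And>i. i \<in> I \<Longrightarrow> f i differentiable (at x)"
  shows "FD (\<lambda>x. \<Sum>i\<in>I. f i x) x h = (\<Sum>i\<in>I. FD (f i) x h)"
proof -
  have "((\<lambda>x. \<Sum>i\<in>I. f i x) has_derivative (\<lambda>h. \<Sum>i\<in>I. FD (f i) x h)) (at x)"
    using assms by (intro has_derivative_sum) (simp add: frechet_derivative_works)
  then show ?thesis by (simp add: FD_eqI)
qed

lemma FD_scaleR:
  assumes "f differentiable (at x)" "g differentiable (at x)"
  shows "FD (\<lambda>x. f x *\<^sub>R g x) x h = f x *\<^sub>R FD g x h + FD f x h *\<^sub>R g x"
proof -
  have "((\<lambda>x. f x *\<^sub>R g x) has_derivative (\<lambda>h. f x *\<^sub>R FD g x h + FD f x h *\<^sub>R g x)) (at x)"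
    using assms by (intro has_derivative_scaleR) (simp_all add: frechet_derivative_works)
  then show ?thesis by (simp add: FD_eqI)
qed

text \<open>A product rule for a linear map and an argument that both vary with the point; expansion
  in a basis leaves only fixed arguments. Through it the moving frames enter \<mu>, \<open>b\<close>
  and \<epsilon>.\<close>

lemma linear_family:
  fixes L :: "'p::real_normed_vector \<Rightarrow> 'a::euclidean_space \<Rightarrow> 'c::real_normed_vector"
  assumes A: "open A" and lin: "\<And>z. z \<in> A \<Longrightarrow> linear (L z)" and sm: "\<And>h. smooth_on A (\<lambda>z. L z h)"
    and h: "smooth_on A h"
  shows "smooth_on A (\<lambda>z. L z (h z))"
    and "p \<in> A \<Longrightarrow> FD (\<lambda>z. L z (h z)) p X = FD (\<lambda>z. L z (h p)) p X + L p (FD h p X)"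
    and "p \<in> A \<Longrightarrow> linear (\<lambda>k. FD (\<lambda>z. L z k) p X)"
proof -
  have e: "(\<Sum>b\<in>Basis. (k \<bullet> b) *\<^sub>R L z b) = L z k" if "z \<in> A" for z k
    using linear_family_expand [OF lin [OF that], of k] by simp
  have "smooth_on A (\<lambda>z. \<Sum>b\<in>Basis. (h z \<bullet> b) *\<^sub>R L z b)"
    by (intro smooth_on_sum smooth_on_scaleR smooth_on_inner smooth_on_const A h sm)
  then show "smooth_on A (\<lambda>z. L z (h z))" by (rule smooth_on_cong [OF A e, rotated])
  assume p: "p \<in> A"
  have dL: "(\<lambda>z. L z b) differentiable (at p)" for b by (rule smooth_on_differentiable [OF sm p])
  have dh: "h differentiable (at p)" by (rule smooth_on_differentiable [OF h p])
  have dhb: "(\<lambda>z. h z \<bullet> b) differentiable (at p)" for b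
    by (rule smooth_on_differentiable [OF smooth_on_inner [OF A h smooth_on_const] p])
  have c: "FD (\<lambda>z. L z k) p X = (\<Sum>b\<in>Basis. (k \<bullet> b) *\<^sub>R FD (\<lambda>z. L z b) p X)" for k
  proof -
    have "FD (\<lambda>z. L z k) p X = FD (\<lambda>z. \<Sum>b\<in>Basis. (k \<bullet> b) *\<^sub>R L z b) p X"
      using FD_cong [OF A p, of "\<lambda>z. L z k" "\<lambda>z. \<Sum>b\<in>Basis. (k \<bullet> b) *\<^sub>R L z b"] e by simp
    also have "\<dots> = (\<Sum>b\<in>Basis. FD (\<lambda>z. (k \<bullet> b) *\<^sub>R L z b) p X)"
      by (rule FD_sum) (intro dL differentiable_scaleR differentiable_const)
    also have "\<dots> = (\<Sum>b\<in>Basis. (k \<bullet> b) *\<^sub>R FD (\<lambda>z. L z b) p X)"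
      by (rule sum.cong) (simp_all add: FD_scaleR [OF differentiable_const dL])
    finally show ?thesis .
  qed
  have "FD (\<lambda>z. L z (h z)) p X = FD (\<lambda>z. \<Sum>b\<in>Basis. (h z \<bullet> b) *\<^sub>R L z b) p X"
    using FD_cong [OF A p, of "\<lambda>z. L z (h z)" "\<lambda>z. \<Sum>b\<in>Basis. (h z \<bullet> b) *\<^sub>R L z b"] e by simp
  also have "\<dots> = (\<Sum>b\<in>Basis. FD (\<lambda>z. (h z \<bullet> b) *\<^sub>R L z b) p X)"
    by (rule FD_sum) (intro dL dhb differentiable_scaleR)
  also have "\<dots> = (\<Sum>b\<in>Basis. (h p \<bullet> b) *\<^sub>R FD (\<lambda>z. L z b) p X + (FD h p X \<bullet> b) *\<^sub>R L p b)"
    by (rule sum.cong) (simp_all add: FD_scaleR [OF dhb dL] FD_bounded_linear [OF bounded_linear_inner_left dh])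
  also have "\<dots> = FD (\<lambda>z. L z (h p)) p X + L p (FD h p X)"
    by (simp add: sum.distrib c [of "h p"] e [OF p])
  finally show "FD (\<lambda>z. L z (h z)) p X = FD (\<lambda>z. L z (h p)) p X + L p (FD h p X)" .
  show "linear (\<lambda>k. FD (\<lambda>z. L z k) p X)"
  proof -
    have "linear (\<lambda>k. \<Sum>b\<in>Basis. (k \<bullet> b) *\<^sub>R D b)" for D :: "'a \<Rightarrow> 'c"
      by (auto intro!: linearI simp: inner_simps algebra_simps sum.distrib scaleR_sum_right)
    moreover have "(\<lambda>k. FD (\<lambda>z. L z k) p X) = (\<lambda>k. \<Sum>b\<in>Basis. (k \<bullet> b) *\<^sub>R FD (\<lambda>z. L z b) p X)"
      by (rule ext) (rule c)
    ultimately show ?thesis by simp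
  qed
qed

text \<open>The forms of the coframing are first given by explicit formulas
  \<open>\<phi> p X\<close>. The expansion over the basis packs them into bounded functionals whose
  smoothness can be tested on finitely many fixed vectors.\<close>

definition form :: "('b::euclidean_space \<Rightarrow> 'b \<Rightarrow> real) \<Rightarrow> 'b one_form" where
  "form \<phi> p = (\<Sum>b\<in>Basis. \<phi> p b *\<^sub>R blinfun_inner_right b)"

lemma form_apply:
  assumes "linear (\<phi> p)"
  shows "blinfun_apply (form \<phi> p) X = \<phi> p X"
  using linear_family_expand [OF assms, of X]
  by (simp add: form_def blinfun.sum_left blinfun.scaleR_left inner_commute mult.commute)

lemma smooth_on_form:
  assumes "open A" "\<And>b. smooth_on A (\<lambda>p. \<phi> p b)"
  shows "smooth_on A (form \<phi>)"
proof -
  have "smooth_on A (\<lambda>p. form \<phi> p)"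
    unfolding form_def by (intro smooth_on_sum smooth_on_scaleR smooth_on_const assms)
  then show ?thesis by simp
qed

lemma ext_deriv_form:
  assumes "open A" "\<And>z. z \<in> A \<Longrightarrow> linear (\<phi> z)" "\<And>b. smooth_on A (\<lambda>p. \<phi> p b)" "p \<in> A"
  shows "ext_deriv (form \<phi>) p X Y = FD (\<lambda>z. \<phi> z Y) p X - FD (\<lambda>z. \<phi> z X) p Y"
proof -
  have "blinfun_apply (FD (form \<phi>) p X) Y = FD (\<lambda>z. \<phi> z Y) p X" for X Y
  proof -
    have "FD (\<lambda>z. \<phi> z Y) p = FD (\<lambda>z. blinfun_apply (form \<phi> z) Y) p"
      by (rule FD_cong [OF assms(1,4)]) (simp add: form_apply [OF assms(2)])
    moreover have "form \<phi> differentiable (at p)"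
      by (rule smooth_on_differentiable [OF smooth_on_form [OF assms(1,3)] assms(4)])
    ultimately show ?thesis
      using FD_bounded_linear [OF bounded_bilinear.bounded_linear_left [OF bounded_bilinear_blinfun_apply, of Y],
          of "form \<phi>" p X] by simp
  qed
  then show ?thesis by (simp add: ext_deriv_def)
qed

section \<open>The geometry of a complex Funk function\<close>

text \<open>The last two assumptions are the infinitesimal versions of \<open>c (x, y + r x) = c (x, y) - r\<close> and of
  the homogeneity of \<open>c\<close> in \<open>y\<close>.\<close>

locale funk =
  fixes N :: "('a::euclidean_space \<times> 'a) set" and c :: "'a \<times> 'a \<Rightarrow> complex"
  assumes open_N: "open N" and smooth_c: "smooth_on N c"
    and burgers: "\<And>p h. p \<in> N \<Longrightarrow> FD c p (h, 0) = c p * FD c p (0, h)"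
    and base: "\<And>x y. (x, y) \<in> N \<Longrightarrow> FD c (x, y) (0, x) = - 1"
    and euler: "\<And>x y. (x, y) \<in> N \<Longrightarrow> FD c (x, y) (0, y) = c (x, y)"
begin

definition \<mu> :: "'a \<times> 'a \<Rightarrow> 'a \<Rightarrow> complex" where
  "\<mu> p h = - FD c p (0, h)"

text \<open>Since \<open>c = P - i F\<close>, the imaginary part of \<open>b\<close> is the vertical
  Hessian of \<open>F\<close>, which strict convexity makes positive on the kernel of \<mu>.\<close>

definition b :: "'a \<times> 'a \<Rightarrow> 'a \<Rightarrow> 'a \<Rightarrow> complex" where
  "b p h k = FD (\<lambda>z. \<mu> z h) p (0, k)"

definition t :: "'a \<times> 'a \<Rightarrow> 'a \<Rightarrow> 'a \<Rightarrow> 'a \<Rightarrow> complex" where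
  "t p h k l = FD (\<lambda>z. b z h k) p (0, l)"

definition q :: "'a \<times> 'a \<Rightarrow> 'a" where
  "q p = snd p + Re (c p) *\<^sub>R fst p"

definition \<Sigma> :: "('a \<times> 'a) set" where
  "\<Sigma> = {p \<in> N. norm (fst p) = 1 \<and> fst p \<bullet> snd p = 0 \<and> Im (c p) = - 1}"

lemma \<Sigma>_N: "p \<in> \<Sigma> \<Longrightarrow> p \<in> N"
  by (simp add: \<Sigma>_def)

lemma c_diff: "p \<in> N \<Longrightarrow> c differentiable (at p)"
  by (rule smooth_on_differentiable [OF smooth_c])

lemma smooth_\<mu>: "smooth_on N (\<lambda>p. \<mu> p h)"
  unfolding \<mu>_def by (intro smooth_on_minus open_N smooth_on_FD smooth_c)

lemma smooth_b: "smooth_on N (\<lambda>p. b p h k)"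
  unfolding b_def by (rule smooth_on_FD [OF smooth_\<mu>])

lemma linear_\<mu>: "p \<in> N \<Longrightarrow> linear (\<mu> p)"
proof (rule linearI)
  assume p: "p \<in> N"
  show "\<mu> p (h + k) = \<mu> p h + \<mu> p k" for h k
    using FD_linear(1) [OF c_diff [OF p], of "(0, h)" "(0, k)"] by (simp add: \<mu>_def)
  show "\<mu> p (r *\<^sub>R h) = r *\<^sub>R \<mu> p h" for r h
    using FD_linear(4) [OF c_diff [OF p], of r "(0, h)"] by (simp add: \<mu>_def)
qed

lemma FD_c: "p \<in> N \<Longrightarrow> FD c p (h, l) = - (\<mu> p l + c p * \<mu> p h)"
  using FD_linear(1) [OF c_diff, of p "(h, 0)" "(0, l)"] burgers [of p h] by (simp add: \<mu>_def)

lemma \<mu>_fst: "p \<in> N \<Longrightarrow> \<mu> p (fst p) = 1"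
  using base [of "fst p" "snd p"] by (simp add: \<mu>_def)

lemma \<mu>_snd: "p \<in> N \<Longrightarrow> \<mu> p (snd p) = - c p"
  using euler [of "fst p" "snd p"] by (simp add: \<mu>_def)

lemma \<mu>_q: "p \<in> N \<Longrightarrow> \<mu> p (q p) = - \<i> * Im (c p)"
  by (simp add: q_def linear_add [OF linear_\<mu>] linear_scale [OF linear_\<mu>] \<mu>_fst \<mu>_snd complex_eq_iff)

lemma FD_\<mu>_eq: "p \<in> N \<Longrightarrow> FD (\<lambda>z. \<mu> z h) p X = - FD (\<lambda>z. FD c z (0, h)) p X"
  unfolding \<mu>_def
  using FD_bounded_linear [OF bounded_linear_minus [OF bounded_linear_ident]
      smooth_on_differentiable [OF smooth_on_FD [OF smooth_c]]] by blast

lemma b_sym: "p \<in> N \<Longrightarrow> b p h k = b p k h"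
  unfolding b_def FD_\<mu>_eq using second_derivative_symmetric [OF open_N smooth_c] by (simp add: FD_\<mu>_eq)

lemma linear_b: "p \<in> N \<Longrightarrow> linear (b p h)"
proof (rule linearI)
  assume p: "p \<in> N"
  note d = smooth_on_differentiable [OF smooth_\<mu> p, of h]
  show "b p h (k + l) = b p h k + b p h l" for k l
    using FD_linear(1) [OF d, of "(0, k)" "(0, l)"] by (simp add: b_def)
  show "b p h (r *\<^sub>R k) = r *\<^sub>R b p h k" for r k
    using FD_linear(4) [OF d, of r "(0, k)"] by (simp add: b_def)
qed

lemma linear_b': "p \<in> N \<Longrightarrow> linear (\<lambda>h. b p h k)"
proof -
  assume p: "p \<in> N"
  have "(\<lambda>h. b p h k) = b p k" by (rule ext) (rule b_sym [OF p])
  then show ?thesis using linear_b [OF p, of k] by simp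
qed

lemma linear_t: "p \<in> N \<Longrightarrow> linear (t p h k)"
proof (rule linearI)
  assume p: "p \<in> N"
  note d = smooth_on_differentiable [OF smooth_b p, of h k]
  show "t p h k (l + m) = t p h k l + t p h k m" for l m
    using FD_linear(1) [OF d, of "(0, l)" "(0, m)"] by (simp add: t_def)
  show "t p h k (r *\<^sub>R l) = r *\<^sub>R t p h k l" for r l
    using FD_linear(4) [OF d, of r "(0, l)"] by (simp add: t_def)
qed

lemma t_sym12: "p \<in> N \<Longrightarrow> t p h k l = t p k h l"
  unfolding t_def using FD_cong [OF open_N, of p "\<lambda>z. b z h k" "\<lambda>z. b z k h"] b_sym by simp

lemma t_sym23: "p \<in> N \<Longrightarrow> t p h k l = t p h l k"
  unfolding t_def b_def using second_derivative_symmetric [OF open_N smooth_\<mu>] by blast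

lemma FD_\<mu>_apply:
  assumes "p \<in> N" "open A" "A \<subseteq> N" "p \<in> A" "smooth_on A h"
  shows "FD (\<lambda>z. \<mu> z (h z)) p X = FD (\<lambda>z. \<mu> z (h p)) p X + \<mu> p (FD h p X)"
  using assms linear_\<mu> smooth_on_subset [OF smooth_\<mu>]
  by (intro linear_family(2) [of A \<mu> h p X]) auto

text \<open>The vertical derivative of \<open>\<mu> (x) = 1\<close>. The corresponding statements
  for \<open>y\<close>, and those for \<open>t\<close>, arise in the same way from the preceding
  identity; in the end \<open>b\<close> annihilates both \<open>x\<close> and
  \<open>q\<close>.\<close>

lemma b_fst: "p \<in> N \<Longrightarrow> b p h (fst p) = 0"
proof -
  assume p: "p \<in> N"
  have "FD (\<lambda>z. \<mu> z (fst z)) p (0, h) = FD (\<lambda>z. \<mu> z (fst p)) p (0, h) + \<mu> p (FD fst p (0, h))"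
    by (rule FD_\<mu>_apply [OF p open_N order.refl p smooth_on_fst])
  moreover have "FD (\<lambda>z. \<mu> z (fst z)) p = FD (\<lambda>z. 1) p"
    by (rule FD_cong [OF open_N p]) (rule \<mu>_fst)
  moreover have "FD fst p (0, h) = (0::'a)"
    by (simp add: FD_eqI [OF bounded_linear_imp_has_derivative [OF bounded_linear_fst]])
  ultimately have "b p (fst p) h = 0" using linear_0 [OF linear_\<mu> [OF p]] by (simp add: b_def)
  then show ?thesis using b_sym [OF p] by simp
qed

lemma b_snd: "p \<in> N \<Longrightarrow> b p h (snd p) = 0"
proof -
  assume p: "p \<in> N"
  have "FD (\<lambda>z. \<mu> z (snd z)) p (0, h) = FD (\<lambda>z. \<mu> z (snd p)) p (0, h) + \<mu> p (FD snd p (0, h))"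
    by (rule FD_\<mu>_apply [OF p open_N order.refl p smooth_on_snd])
  moreover have "FD (\<lambda>z. \<mu> z (snd z)) p = FD (\<lambda>z. - c z) p"
    by (rule FD_cong [OF open_N p]) (rule \<mu>_snd)
  moreover have "FD (\<lambda>z. - c z) p (0, h) = \<mu> p h"
    by (simp add: FD_bounded_linear [OF bounded_linear_minus [OF bounded_linear_ident] c_diff [OF p]] \<mu>_def)
  moreover have "FD snd p (0, h) = h"
    by (simp add: FD_eqI [OF bounded_linear_imp_has_derivative [OF bounded_linear_snd]])
  ultimately have "b p (snd p) h = 0" by (simp add: b_def)
  then show ?thesis using b_sym [OF p] by simp
qed

lemma b_q: "p \<in> N \<Longrightarrow> b p h (q p) = 0"
  by (simp add: q_def linear_add [OF linear_b] linear_scale [OF linear_b] b_fst b_snd)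

lemma FD_b_apply:
  assumes "open A" "A \<subseteq> N" "p \<in> A" "smooth_on A k"
  shows "FD (\<lambda>z. b z h (k z)) p X = FD (\<lambda>z. b z h (k p)) p X + b p h (FD k p X)"
  using assms linear_b smooth_on_subset [OF smooth_b]
  by (intro linear_family(2) [of A "\<lambda>z. b z h" k p X]) auto

lemma t_fst: "p \<in> N \<Longrightarrow> t p h k (fst p) = 0"
proof -
  assume p: "p \<in> N"
  have "FD (\<lambda>z. b z h (fst z)) p (0, k) = FD (\<lambda>z. b z h (fst p)) p (0, k) + b p h (FD fst p (0, k))"
    by (rule FD_b_apply [OF open_N order.refl p smooth_on_fst])
  moreover have "FD (\<lambda>z. b z h (fst z)) p = FD (\<lambda>z. 0) p"
    by (rule FD_cong [OF open_N p]) (rule b_fst)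
  moreover have "FD fst p (0, k) = (0::'a)"
    by (simp add: FD_eqI [OF bounded_linear_imp_has_derivative [OF bounded_linear_fst]])
  ultimately have "t p h (fst p) k = 0" using linear_0 [OF linear_b [OF p]] by (simp add: t_def)
  then show ?thesis using t_sym23 [OF p] by simp
qed

lemma t_snd: "p \<in> N \<Longrightarrow> t p h k (snd p) = - b p h k"
proof -
  assume p: "p \<in> N"
  have "FD (\<lambda>z. b z h (snd z)) p (0, k) = FD (\<lambda>z. b z h (snd p)) p (0, k) + b p h (FD snd p (0, k))"
    by (rule FD_b_apply [OF open_N order.refl p smooth_on_snd])
  moreover have "FD (\<lambda>z. b z h (snd z)) p = FD (\<lambda>z. 0) p"
    by (rule FD_cong [OF open_N p]) (rule b_snd)
  moreover have "FD snd p (0, k) = k"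
    by (simp add: FD_eqI [OF bounded_linear_imp_has_derivative [OF bounded_linear_snd]])
  ultimately have "t p h (snd p) k + b p h k = 0" by (simp add: t_def)
  then show ?thesis using t_sym23 [OF p] by (simp add: eq_neg_iff_add_eq_0)
qed

lemma t_q: "p \<in> N \<Longrightarrow> t p h k (q p) = - b p h k"
  by (simp add: q_def linear_add [OF linear_t] linear_scale [OF linear_t] t_fst t_snd)

text \<open>Mixed derivatives commute, so the horizontal derivative of the vertical derivative of
  \<open>c\<close> is the vertical derivative of the Burgers equation. Every derivative of \<mu> is
  thus expressed by \<mu> and \<open>b\<close>.\<close>

lemma FD_\<mu>:
  assumes p: "p \<in> N"
  shows "FD (\<lambda>z. \<mu> z h) p (k, l) = b p h l + c p * b p h k - \<mu> p h * \<mu> p k"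
proof -
  have "FD (\<lambda>z. FD c z (0, h)) p (k, 0) = FD (\<lambda>z. FD c z (k, 0)) p (0, h)"
    by (rule second_derivative_symmetric [OF open_N smooth_c p])
  also have "\<dots> = FD (\<lambda>z. - (c z * \<mu> z k)) p (0, h)"
    using FD_cong [OF open_N p, of "\<lambda>z. FD c z (k, 0)" "\<lambda>z. - (c z * \<mu> z k)"] by (simp add: burgers \<mu>_def)
  also have "\<dots> = - (c p * b p k h + FD c p (0, h) * \<mu> p k)"
    by (simp add: FD_bounded_linear [OF bounded_linear_minus [OF bounded_linear_ident]]
        FD_mult [OF c_diff [OF p] smooth_on_differentiable [OF smooth_\<mu> p]] b_def
        smooth_on_differentiable [OF smooth_on_mult [OF open_N smooth_c smooth_\<mu>] p])
  finally have "FD (\<lambda>z. \<mu> z h) p (k, 0) = c p * b p h k - \<mu> p h * \<mu> p k"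
    by (simp add: FD_\<mu>_eq [OF p] b_sym [OF p, of k] \<mu>_def [of p h])
  moreover have "FD (\<lambda>z. \<mu> z h) p ((k, 0) + (0, l)) = FD (\<lambda>z. \<mu> z h) p (k, 0) + b p h l"
    by (simp only: FD_linear [OF smooth_on_differentiable [OF smooth_\<mu> p]] b_def)
  ultimately show ?thesis by simp
qed

text \<open>The Burgers equation once more, one order higher. Restricting \<open>h\<close> and
  \<open>k\<close> to the kernel of \<mu> removes the terms in which \<mu> is applied to
  them.\<close>

lemma FD_b:
  assumes p: "p \<in> N" and hk: "\<mu> p h = 0" "\<mu> p k = 0"
  shows "FD (\<lambda>z. b z h k) p (X, Y) = t p h k Y + c p * t p h k X - b p h k * \<mu> p X"
proof -
  have d: "(\<lambda>z. \<mu> z h) differentiable (at p)" "(\<lambda>z. b z h k) differentiable (at p)" for h k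
    by (rule smooth_on_differentiable [OF smooth_\<mu> p] smooth_on_differentiable [OF smooth_b p])+
  have "FD (\<lambda>z. b z h k) p (X, 0) = FD (\<lambda>z. FD (\<lambda>z. \<mu> z h) z (X, 0)) p (0, k)"
    unfolding b_def by (rule second_derivative_symmetric [OF open_N smooth_\<mu> p])
  also have "\<dots> = FD (\<lambda>z. c z * b z h X - \<mu> z h * \<mu> z X) p (0, k)"
    using FD_cong [OF open_N p, of "\<lambda>z. FD (\<lambda>z. \<mu> z h) z (X, 0)" "\<lambda>z. c z * b z h X - \<mu> z h * \<mu> z X"]
      linear_0 [OF linear_b] by (simp add: FD_\<mu>)
  also have "\<dots> = FD (\<lambda>z. c z * b z h X) p (0, k) - FD (\<lambda>z. \<mu> z h * \<mu> z X) p (0, k)"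
  proof -
    have "((\<lambda>z. c z * b z h X - \<mu> z h * \<mu> z X) has_derivative
        (\<lambda>u. FD (\<lambda>z. c z * b z h X) p u - FD (\<lambda>z. \<mu> z h * \<mu> z X) p u)) (at p)"
      by (intro has_derivative_diff smooth_on_has_derivative [OF _ p] smooth_on_mult open_N smooth_c smooth_b smooth_\<mu>)
    then show ?thesis by (simp add: FD_eqI)
  qed
  also have "\<dots> = c p * t p h k X - b p h k * \<mu> p X"
    using hk by (simp add: FD_mult [OF c_diff [OF p] d(2)] FD_mult [OF d(1) d(1)] b_def [symmetric] t_def [symmetric]
        t_sym23 [OF p, of h X] \<mu>_def [of p k])
  finally have "FD (\<lambda>z. b z h k) p (X, 0) = c p * t p h k X - b p h k * \<mu> p X" .
  moreover have "FD (\<lambda>z. b z h k) p ((X, 0) + (0, Y)) = FD (\<lambda>z. b z h k) p (X, 0) + t p h k Y"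
    by (simp only: FD_linear [OF d(2)] t_def)
  ultimately show ?thesis by simp
qed

lemma smooth_q: "smooth_on N q"
proof -
  have "smooth_on N (\<lambda>p. snd p + Re (c p) *\<^sub>R fst p)"
    by (intro smooth_on_intros open_N smooth_c)
  then show ?thesis by (simp add: q_def [abs_def])
qed

lemma FD_q: "p \<in> N \<Longrightarrow> FD q p X = snd X + Re (c p) *\<^sub>R fst X + Re (FD c p X) *\<^sub>R fst p"
proof -
  assume p: "p \<in> N"
  have "((\<lambda>p. snd p + Re (c p) *\<^sub>R fst p) has_derivative
      (\<lambda>X. snd X + (Re (c p) *\<^sub>R fst X + Re (FD c p X) *\<^sub>R fst p))) (at p)"
    by (intro has_derivative_add has_derivative_scaleR bounded_linear_imp_has_derivative bounded_linear_fst bounded_linear_snd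
        bounded_linear.has_derivative [OF bounded_linear_Re] smooth_on_has_derivative [OF smooth_c p])
  then show ?thesis by (simp add: q_def [abs_def] FD_eqI)
qed

text \<open>By Euler's relation \<open>c (x, s w) / s\<close> has zero derivative in
  \<open>s\<close>. As \<open>N\<close> need not be a cone, the argument runs along the segment
  between the two vectors.\<close>

lemma homogeneous:
  assumes r: "r > 0" and seg: "\<And>s. s \<in> closed_segment 1 r \<Longrightarrow> (x, s *\<^sub>R w) \<in> N"
  shows "c (x, r *\<^sub>R w) = r *\<^sub>R c (x, w)"
proof -
  define \<phi> where "\<phi> = (\<lambda>s::real. inverse s *\<^sub>R c (x, s *\<^sub>R w))"
  have pos: "s > 0" if "s \<in> closed_segment 1 r" for s
    using that r by (auto simp: closed_segment_eq_real_ivl split: if_splits)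
  have "\<exists>k. \<forall>s\<in>closed_segment 1 r. \<phi> s = k"
  proof (rule has_derivative_zero_constant)
    show "convex (closed_segment 1 r)" by simp
    fix s assume s: "s \<in> closed_segment 1 r"
    note sN = seg [OF s] and s0 = pos [OF s]
    have i: "((\<lambda>s. (x, s *\<^sub>R w)) has_derivative (\<lambda>u. (0, u *\<^sub>R w))) (at s)"
      by (auto intro!: derivative_eq_intros)
    have 1: "((\<lambda>s. c (x, s *\<^sub>R w)) has_derivative (\<lambda>u. FD c (x, s *\<^sub>R w) (0, u *\<^sub>R w))) (at s)"
      by (rule has_derivative_compose [OF i smooth_on_has_derivative [OF smooth_c sN]])
    have 2: "(inverse has_derivative (\<lambda>u. - (inverse s * u * inverse s))) (at s)"
      using s0 by (intro has_derivative_inverse') simp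
    have 3: "(\<phi> has_derivative (\<lambda>u. inverse s *\<^sub>R FD c (x, s *\<^sub>R w) (0, u *\<^sub>R w) +
        (- (inverse s * u * inverse s)) *\<^sub>R c (x, s *\<^sub>R w))) (at s)"
      unfolding \<phi>_def by (rule has_derivative_scaleR [OF 2 1])
    define D where "D = FD c (x, s *\<^sub>R w) (0, w)"
    have ce: "c (x, s *\<^sub>R w) = s *\<^sub>R D"
      using FD_linear(4) [OF c_diff [OF sN], of s "(0, w)"] euler [OF sN] by (simp add: D_def)
    have de: "FD c (x, s *\<^sub>R w) (0, u *\<^sub>R w) = u *\<^sub>R D" for u
      using FD_linear(4) [OF c_diff [OF sN], of u "(0, w)"] by (simp add: D_def)
    have "inverse s *\<^sub>R u *\<^sub>R D + (- (inverse s * u * inverse s)) *\<^sub>R s *\<^sub>R D = 0" for u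
      using s0 by (simp add: mult_ac)
    then have "(\<lambda>u. inverse s *\<^sub>R FD c (x, s *\<^sub>R w) (0, u *\<^sub>R w) +
        (- (inverse s * u * inverse s)) *\<^sub>R c (x, s *\<^sub>R w)) = (\<lambda>u. 0)"
      by (simp only: ce de)
    then have "(\<phi> has_derivative (\<lambda>u. 0)) (at s)" using 3 by simp
    then show "(\<phi> has_derivative (\<lambda>u. 0)) (at s within closed_segment 1 r)"
      by (rule has_derivative_at_withinI)
  qed
  then have "\<phi> r = \<phi> 1" by auto
  then show ?thesis using r by (simp add: \<phi>_def) (metis less_irrefl right_inverse scaleR_one scaleR_scaleR)
qed

text \<open>The map normalizes \<open>x\<close>, projects \<open>y\<close> to the orthogonal
  complement of \<open>x\<close>, and then, \<open>c\<close> being homogeneous of degree 1, divides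
  \<open>y\<close> by \<open>- Im c\<close>. A unit vector \<open>x\<close> is left alone, so fibres
  are retracted too. The first-order effect of each of the three stages is a multiple of one vector,
  and each of the three linear equations on \<open>X\<close> makes one of these multiples
  vanish.\<close>

lemma retraction:
  assumes p: "p \<in> \<Sigma>"
  obtains M R where "smooth_retract \<Sigma> M R" "p \<in> M"
    "\<And>u. u \<in> M \<Longrightarrow> norm (fst u) = 1 \<Longrightarrow> fst (R u) = fst u"
    "\<And>X. FD R p X = X \<longleftrightarrow> fst p \<bullet> fst X = 0 \<and> fst X \<bullet> snd p + fst p \<bullet> snd X = 0 \<and> Im (FD c p X) = 0"
proof -
  obtain x y where pxy: "p = (x, y)" by (cases p)
  have pN: "p \<in> N" and x1: "norm x = 1" and xy: "x \<bullet> y = 0" and Fp: "Im (c p) = - 1"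
    using p by (auto simp: \<Sigma>_def pxy)
  have fp: "fst p = x" "snd p = y" by (simp_all add: pxy)
  obtain \<epsilon> where \<epsilon>: "\<epsilon> > 0" "ball p \<epsilon> \<subseteq> N" using open_N pN open_contains_ball by blast
  define B where "B = ball p \<epsilon>"
  have oB: "open B" and pB: "p \<in> B" and BN: "B \<subseteq> N" using \<epsilon> by (auto simp: B_def)
  define O0 where "O0 = {u::'a \<times> 'a. fst u \<noteq> 0}"
  have oO0: "open O0"
    unfolding O0_def by (intro open_Collect_neq continuous_intros)
  define a where "a = (\<lambda>u::'a \<times> 'a. inverse (norm (fst u)))"
  define x' where "x' = (\<lambda>u. a u *\<^sub>R fst u)"
  define m where "m = (\<lambda>u. x' u \<bullet> snd u)"
  define w where "w = (\<lambda>u. snd u - m u *\<^sub>R x' u)"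
  define G1 where "G1 = (\<lambda>u. (x' u, w u))"
  have sma: "smooth_on O0 a" unfolding a_def
    by (intro smooth_on_inverse smooth_on_norm oO0 smooth_on_fst) (auto simp: O0_def)
  have smx: "smooth_on O0 x'" unfolding x'_def by (intro smooth_on_scaleR oO0 sma smooth_on_fst)
  have smm: "smooth_on O0 m" unfolding m_def by (intro smooth_on_inner oO0 smx smooth_on_snd)
  have smw: "smooth_on O0 w" unfolding w_def by (intro smooth_on_diff smooth_on_scaleR oO0 smm smx smooth_on_snd)
  have smG1: "smooth_on O0 G1" unfolding G1_def by (intro smooth_on_Pair oO0 smx smw)
  have x'x': "x' u \<bullet> x' u = 1" and wx': "x' u \<bullet> w u = 0" if "u \<in> O0" for u
  proof -
    show 1: "x' u \<bullet> x' u = 1" using that by (simp add: x'_def a_def O0_def dot_square_norm power2_eq_square)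
    show "x' u \<bullet> w u = 0" using 1 by (simp add: w_def m_def inner_diff_right)
  qed
  have x'id: "x' u = fst u" if "norm (fst u) = 1" for u using that by (simp add: x'_def a_def)
  have wid: "w u = snd u" if "norm (fst u) = 1" "fst u \<bullet> snd u = 0" for u
    using that x'id [OF that(1)] by (simp add: w_def m_def)
  define B1 where "B1 = B \<inter> {u. Im (c u) < 0}"
  have oB1: "open B1"
  proof -
    have "open (B \<inter> (\<lambda>u. Im (c u)) -` {..<0})"
      by (intro continuous_open_preimage oB smooth_on_continuous_on smooth_on_Im smooth_on_subset [OF smooth_c BN]) auto
    then show ?thesis by (simp add: B1_def vimage_def)
  qed
  define O1 where "O1 = O0 \<inter> G1 -` B1"
  have oO1: "open O1" unfolding O1_def
    by (rule continuous_open_preimage [OF smooth_on_continuous_on [OF smG1] oO0 oB1])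
  have O10: "O1 \<subseteq> O0" by (simp add: O1_def)
  define s where "s = (\<lambda>u. inverse (- Im (c (G1 u))))"
  have sms: "smooth_on O1 s" unfolding s_def
    by (intro smooth_on_inverse smooth_on_minus smooth_on_Im oO1
         smooth_on_compose [OF oO1 smooth_on_subset [OF smooth_c BN] smooth_on_subset [OF smG1 O10]])
       (auto simp: O1_def B1_def)
  define R where "R = (\<lambda>u. (x' u, s u *\<^sub>R w u))"
  have smR: "smooth_on O1 R" unfolding R_def
    by (intro smooth_on_Pair smooth_on_scaleR oO1 sms smooth_on_subset [OF smx O10] smooth_on_subset [OF smw O10])
  define M where "M = O1 \<inter> R -` B"
  have oM: "open M" unfolding M_def
    by (rule continuous_open_preimage [OF smooth_on_continuous_on [OF smR] oO1 oB])
  have MO: "M \<subseteq> O1" by (simp add: M_def)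
  have Rin: "R u \<in> \<Sigma>" if u: "u \<in> M" for u
  proof -
    have u0: "u \<in> O0" "G1 u \<in> B" "Im (c (G1 u)) < 0" "R u \<in> B" using u by (auto simp: M_def O1_def B1_def)
    have s0: "s u > 0" using u0 by (simp add: s_def)
    have "c (x' u, s u *\<^sub>R w u) = s u *\<^sub>R c (x' u, w u)"
    proof (rule homogeneous [OF s0])
      fix r assume "r \<in> closed_segment 1 (s u)"
      then obtain l where l: "0 \<le> l" "l \<le> 1" "r = (1 - l) * 1 + l * s u"
        by (auto simp: closed_segment_def)
      \<comment> \<open>\<open>B\<close> is a ball, so the segment from \<open>G1 u\<close> to
        \<open>R u\<close> stays in it; only the second component moves along it, and only by a
        positive factor.\<close>
      have "(1 - l) *\<^sub>R G1 u + l *\<^sub>R R u \<in> B"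
        using convexD_alt [OF convex_ball, of "G1 u" p \<epsilon> "R u" l] u0 l by (simp add: B_def)
      moreover have "(1 - l) *\<^sub>R G1 u + l *\<^sub>R R u = (x' u, r *\<^sub>R w u)"
        by (simp add: G1_def R_def l(3) scaleR_add_left [symmetric])
      ultimately show "(x' u, r *\<^sub>R w u) \<in> N" using BN by auto
    qed
    then have "Im (c (R u)) = s u * Im (c (G1 u))" by (simp add: R_def G1_def)
    also have "\<dots> = - 1" using u0(3) by (simp add: s_def)
    finally have "Im (c (R u)) = - 1" .
    moreover have "norm (x' u) = 1" using x'x' [OF u0(1)] by (simp add: norm_eq_sqrt_inner)
    ultimately show ?thesis using u0(4) BN wx' [OF u0(1)] by (auto simp: \<Sigma>_def R_def)
  qed
  have Gid: "G1 u = u" "R u = u" if "u \<in> \<Sigma>" for u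
    using that x'id [of u] wid [of u] by (simp_all add: G1_def R_def \<Sigma>_def s_def)
  have pM: "p \<in> M"
    using Gid [OF p] pB Fp x1 by (auto simp: M_def O1_def B1_def O0_def fp)
  interpret r: smooth_retract \<Sigma> M R
    by unfold_locales (use oM Rin Gid in \<open>auto intro: smooth_on_subset [OF smR MO]\<close>)
  have pO: "p \<in> O0" "p \<in> O1" using pM MO O10 by auto
  have R_p: "R p = p" by (rule Gid(2) [OF p])
  have dR: "(R has_derivative FD R p) (at p)" by (rule smooth_on_has_derivative [OF r.smooth_R pM])
  have zero: "(\<lambda>X. D X) = (\<lambda>X. 0)"
    if "(k has_derivative D) (at p)" "\<And>u. u \<in> M \<Longrightarrow> k u = k0" for k :: "'a \<times> 'a \<Rightarrow> real" and D k0
  proof -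
    have "(k has_derivative (\<lambda>X. 0)) (at p)"
      by (rule has_derivative_transform_within_open [OF has_derivative_const [of k0] oM pM]) (use that(2) in auto)
    with that(1) show ?thesis by (metis has_derivative_unique)
  qed
  have dfR: "((\<lambda>u. fst (R u)) has_derivative (\<lambda>X. fst (FD R p X))) (at p)"
    "((\<lambda>u. snd (R u)) has_derivative (\<lambda>X. snd (FD R p X))) (at p)"
    by (rule has_derivative_fst [OF dR] has_derivative_snd [OF dR])+
  have con1: "x \<bullet> fst (FD R p X) = 0" for X
  proof -
    have "((\<lambda>u. fst (R u) \<bullet> fst (R u)) has_derivative (\<lambda>X. fst (R p) \<bullet> fst (FD R p X) + fst (FD R p X) \<bullet> fst (R p))) (at p)"
      by (rule has_derivative_inner [OF dfR(1) dfR(1)])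
    from zero [OF this, of 1] Rin have "fst (R p) \<bullet> fst (FD R p X) + fst (FD R p X) \<bullet> fst (R p) = 0"
      by (force simp: \<Sigma>_def dot_square_norm dest: fun_cong)
    then show ?thesis by (simp add: R_p fp inner_commute)
  qed
  have con2: "fst (FD R p X) \<bullet> y + x \<bullet> snd (FD R p X) = 0" for X
  proof -
    have "((\<lambda>u. fst (R u) \<bullet> snd (R u)) has_derivative (\<lambda>X. fst (R p) \<bullet> snd (FD R p X) + fst (FD R p X) \<bullet> snd (R p))) (at p)"
      by (rule has_derivative_inner [OF dfR])
    from zero [OF this, of 0] Rin have "fst (R p) \<bullet> snd (FD R p X) + fst (FD R p X) \<bullet> snd (R p) = 0"
      by (force simp: \<Sigma>_def dest: fun_cong)
    then show ?thesis by (simp add: R_p fp)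
  qed
  have con3: "Im (FD c p (FD R p X)) = 0" for X
  proof -
    have "(c has_derivative FD c p) (at (R p))" using smooth_on_has_derivative [OF smooth_c pN] R_p by simp
    then have "((\<lambda>u. Im (c (R u))) has_derivative (\<lambda>X. Im (FD c p (FD R p X)))) (at p)"
      by (intro bounded_linear.has_derivative [OF bounded_linear_Im] has_derivative_compose [OF dR])
    from zero [OF this, of "-1"] Rin show ?thesis
      by (force simp: \<Sigma>_def dest: fun_cong)
  qed
  have d: "a differentiable (at p)" "m differentiable (at p)" "s differentiable (at p)"
    "x' differentiable (at p)" "w differentiable (at p)"
    using smooth_on_differentiable sma smm sms smx smw pO by blast+
  have Rfst: "fst (FD R p X) = FD x' p X" and Rsnd: "snd (FD R p X) = s p *\<^sub>R FD w p X + FD s p X *\<^sub>R w p" for X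
  proof -
    have "(x' has_derivative (\<lambda>X. fst (FD R p X))) (at p)" using dfR(1) by (simp add: R_def)
    from FD_eqI [OF this] show "fst (FD R p X) = FD x' p X" by simp
    have "((\<lambda>u. s u *\<^sub>R w u) has_derivative (\<lambda>X. snd (FD R p X))) (at p)" using dfR(2) by (simp add: R_def)
    from FD_eqI [OF this] FD_scaleR [OF d(3,5)] show "snd (FD R p X) = s p *\<^sub>R FD w p X + FD s p X *\<^sub>R w p" by simp
  qed
  have hfst: "(fst has_derivative fst) (at p)"
    by (rule bounded_linear_imp_has_derivative [OF bounded_linear_fst])
  have hsnd: "(snd has_derivative snd) (at p)"
    by (rule bounded_linear_imp_has_derivative [OF bounded_linear_snd])
  note dfst = differentiableI [OF hfst] differentiableI [OF hsnd] FD_eqI [OF hfst] FD_eqI [OF hsnd]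
  have FDx': "FD x' p X = fst X + FD a p X *\<^sub>R x" for X
    using FD_scaleR [OF d(1) dfst(1), of X] x1 by (simp add: x'_def [abs_def] dfst a_def fp)
  have mp: "m p = 0" using xy x'id [of p] x1 by (simp add: m_def fp)
  have FDw: "FD w p X = snd X - FD m p X *\<^sub>R x" for X
  proof -
    have "(w has_derivative (\<lambda>X. snd X - FD (\<lambda>u. m u *\<^sub>R x' u) p X)) (at p)"
      unfolding w_def
      by (intro has_derivative_diff hsnd) (simp add: d frechet_derivative_works [symmetric])
    from FD_eqI [OF this] show ?thesis
      using x'id [of p] x1 by (simp add: FD_scaleR [OF d(2,4)] mp fp)
  qed
  have sp: "s p = 1" "w p = y" using Gid(1) [OF p] Fp wid [of p] x1 xy by (simp_all add: s_def fp)
  show thesis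
  proof (rule that [of M R])
    show "smooth_retract \<Sigma> M R" by (rule r.smooth_retract_axioms)
    show "p \<in> M" by fact
    show "fst (R u) = fst u" if "u \<in> M" "norm (fst u) = 1" for u using x'id that by (simp add: R_def)
    show "FD R p X = X \<longleftrightarrow> fst p \<bullet> fst X = 0 \<and> fst X \<bullet> snd p + fst p \<bullet> snd X = 0 \<and> Im (FD c p X) = 0" for X
    proof
      assume "FD R p X = X"
      then show "fst p \<bullet> fst X = 0 \<and> fst X \<bullet> snd p + fst p \<bullet> snd X = 0 \<and> Im (FD c p X) = 0"
        using con1 [of X] con2 [of X] con3 [of X] by (simp add: fp)
    next
      assume "fst p \<bullet> fst X = 0 \<and> fst X \<bullet> snd p + fst p \<bullet> snd X = 0 \<and> Im (FD c p X) = 0"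
      then have X: "x \<bullet> fst X = 0" "fst X \<bullet> y + x \<bullet> snd X = 0" "Im (FD c p X) = 0" by (simp_all add: fp)
      have xx: "x \<bullet> x = 1" using x1 by (simp add: dot_square_norm)
      have "FD a p X = 0" using con1 [of X] X(1) xx by (simp add: Rfst FDx' inner_simps)
      then have 1: "fst (FD R p X) = fst X" by (simp add: Rfst FDx')
      have "FD m p X = 0"
        using con2 [of X] X(2) xx xy by (simp add: 1 Rsnd FDw sp inner_simps)
      then have 2: "snd (FD R p X) = snd X + FD s p X *\<^sub>R y" by (simp add: Rsnd FDw sp)
      have "FD R p X = X + FD s p X *\<^sub>R (0, y)" using 1 2 by (simp add: prod_eq_iff)
      then have "Im (FD c p X + FD s p X *\<^sub>R FD c p (0, y)) = 0"
        using con3 [of X] FD_linear [OF c_diff [OF pN]] by (simp only:)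
      then have "FD s p X = 0" using X(3) euler [of x y] pN Fp by (simp add: pxy [symmetric])
      then show "FD R p X = X" using 1 2 by (simp add: prod_eq_iff)
    qed
  qed
qed

end

context funk
begin

lemma tangent:
  assumes "p \<in> \<Sigma>"
  shows "tangent_vectors \<Sigma> p =
    {X. fst p \<bullet> fst X = 0 \<and> fst X \<bullet> snd p + fst p \<bullet> snd X = 0 \<and> Im (FD c p X) = 0}"
proof -
  obtain M R where MR: "smooth_retract \<Sigma> M R" "p \<in> M"
    and R: "\<And>X. FD R p X = X \<longleftrightarrow> fst p \<bullet> fst X = 0 \<and> fst X \<bullet> snd p + fst p \<bullet> snd X = 0 \<and> Im (FD c p X) = 0"
    by (rule retraction [OF assms]) (rule that; assumption)
  then show ?thesis using smooth_retract.tangent_vectors_eq [OF MR(1), of p] assms by simp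
qed

text \<open>The retraction keeps the base point when that is a unit vector, so its second component
  retracts a neighbourhood in the fibre direction.\<close>

lemma tangent_fibre:
  assumes p: "(x, y) \<in> \<Sigma>"
  shows "tangent_vectors (fibre \<Sigma> x) y = {w. x \<bullet> w = 0 \<and> Im (\<mu> (x, y) w) = 0}"
proof -
  obtain M R where MR: "smooth_retract \<Sigma> M R" "(x, y) \<in> M"
    and Rf: "\<And>u. u \<in> M \<Longrightarrow> norm (fst u) = 1 \<Longrightarrow> fst (R u) = fst u"
    and R: "\<And>X. FD R (x, y) X = X \<longleftrightarrow> fst (x, y) \<bullet> fst X = 0 \<and> fst X \<bullet> snd (x, y) + fst (x, y) \<bullet> snd X = 0 \<and> Im (FD c (x, y) X) = 0"
    by (rule retraction [OF p]) (rule that; assumption)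
  interpret r: smooth_retract \<Sigma> M R by fact
  have x1: "norm x = 1" using p by (simp add: \<Sigma>_def)
  define M' where "M' = (\<lambda>y. (x, y)) -` M"
  define R' where "R' = (\<lambda>y. snd (R (x, y)))"
  have oM': "open M'" unfolding M'_def by (intro open_vimage r.open_N continuous_intros)
  have smP: "smooth_on M' (\<lambda>y. (x, y))" by (intro smooth_on_Pair oM' smooth_on_const smooth_on_ident)
  interpret f: smooth_retract "fibre \<Sigma> x" M' R'
  proof
    show "open M'" by fact
    show "smooth_on M' R'" unfolding R'_def
      by (intro smooth_on_bounded_linear [OF bounded_linear_snd] oM' smooth_on_compose [OF oM' r.smooth_R smP])
         (auto simp: M'_def)
    show "R' ` M' \<subseteq> fibre \<Sigma> x"
    proof
      fix w assume "w \<in> R' ` M'"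
      then obtain z where z: "(x, z) \<in> M" "w = snd (R (x, z))" by (auto simp: M'_def R'_def)
      have "R (x, z) = (x, w)" using Rf [OF z(1)] x1 z(2) by (simp add: prod_eq_iff)
      then show "w \<in> fibre \<Sigma> x" using z r.R_into by (force simp: fibre_def)
    qed
    show "R' z = z" if "z \<in> fibre \<Sigma> x \<inter> M'" for z
      using r.R_fix [of "(x, z)"] that by (simp add: R'_def fibre_def M'_def)
  qed
  have yM: "y \<in> fibre \<Sigma> x \<inter> M'" using p MR by (simp add: fibre_def M'_def)
  have dP: "((\<lambda>y. (x, y)) has_derivative (\<lambda>w. (0, w))) (at y)" by (auto intro!: derivative_eq_intros)
  have dR: "((\<lambda>y. R (x, y)) has_derivative (\<lambda>w. FD R (x, y) (0, w))) (at y)"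
    by (rule has_derivative_compose [OF dP smooth_on_has_derivative [OF r.smooth_R MR(2)]])
  have 1: "FD R' y w = snd (FD R (x, y) (0, w))" for w
    unfolding R'_def using FD_eqI [OF has_derivative_snd [OF dR]] by simp
  have 2: "fst (FD R (x, y) (0, w)) = 0" for w
  proof -
    have "((\<lambda>y. fst (R (x, y))) has_derivative (\<lambda>w. 0)) (at y)"
      by (rule has_derivative_transform_within_open [OF has_derivative_const [of x] oM'])
         (use yM Rf x1 in \<open>auto simp: M'_def\<close>)
    from has_derivative_unique [OF has_derivative_fst [OF dR] this] show ?thesis by (rule fun_cong)
  qed
  have "FD R' y w = w \<longleftrightarrow> FD R (x, y) (0, w) = (0, w)" for w using 1 2 by (auto simp: prod_eq_iff)
  also have "\<dots> w \<longleftrightarrow> x \<bullet> w = 0 \<and> Im (\<mu> (x, y) w) = 0" for w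
    unfolding R by (simp add: \<mu>_def)
  finally show ?thesis using f.tangent_vectors_eq [OF yM] by simp
qed

text \<open>A covector is determined by its values on \<open>x\<close>, on \<open>y\<close> and on
  the tangent hyperplane of the fibre, which together span the space. \<open>Im \<mu>\<close> has
  the prescribed values because \<open>\<mu> (x) = 1\<close> and
  \<open>\<mu> (y) = - c\<close>.\<close>

lemma hilbert:
  assumes p: "p \<in> \<Sigma>"
  shows "hilbert_form \<Sigma> p X = Im (\<mu> p (fst X))"
proof -
  obtain x y where pxy: "p = (x, y)" by (cases p)
  have pN: "(x, y) \<in> N" and x1: "x \<bullet> x = 1" and xy: "x \<bullet> y = 0" and Fp: "Im (c (x, y)) = - 1"
    using p by (auto simp: \<Sigma>_def pxy dot_square_norm)
  have tan: "tangent_vectors (fibre \<Sigma> x) y = {w. x \<bullet> w = 0 \<and> Im (\<mu> (x, y) w) = 0}"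
    by (rule tangent_fibre [OF p [unfolded pxy]])
  have bl: "bounded_linear (\<lambda>h. Im (\<mu> (x, y) h))"
    using bounded_linear_compose [OF bounded_linear_Im linear_conv_bounded_linear [THEN iffD1, OF linear_\<mu> [OF pN]]]
    by (simp add: o_def)
  define \<xi> where "\<xi> = Blinfun (\<lambda>h. Im (\<mu> (x, y) h))"
  have \<xi>: "blinfun_apply \<xi> h = Im (\<mu> (x, y) h)" for h
    unfolding \<xi>_def by (simp add: bounded_linear_Blinfun_apply [OF bl])
  let ?P = "\<lambda>\<xi> :: 'a \<Rightarrow>\<^sub>L real. blinfun_apply \<xi> x = 0 \<and> blinfun_apply \<xi> y = 1 \<and>
     {w \<in> ray_tangent x. blinfun_apply \<xi> w = 0} = tangent_vectors (fibre \<Sigma> x) y"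
  have P: "?P \<xi>"
    using \<mu>_fst [OF pN] \<mu>_snd [OF pN] Fp unfolding tan by (auto simp: \<xi> ray_tangent_def)
  have "(THE \<xi>. ?P \<xi>) = \<xi>"
  proof (rule the_equality [where P = ?P, OF P])
    fix \<xi>' assume P': "?P \<xi>'"
    show "\<xi>' = \<xi>"
    proof (rule blinfun_eqI)
      fix h
      define w where "w = h - blinfun_apply \<xi> h *\<^sub>R y - (x \<bullet> h) *\<^sub>R x"
      have "w \<in> ray_tangent x" using x1 xy by (simp add: w_def ray_tangent_def inner_simps)
      moreover have "blinfun_apply \<xi> w = 0" using P by (simp add: w_def blinfun.diff_right blinfun.scaleR_right)
      ultimately have "w \<in> tangent_vectors (fibre \<Sigma> x) y" using P by blast
      then have "blinfun_apply \<xi>' w = 0" using P' by blast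
      then show "blinfun_apply \<xi>' h = blinfun_apply \<xi> h"
        using P' by (simp add: w_def blinfun.diff_right blinfun.scaleR_right)
    qed
  qed
  then have "dual_covector \<Sigma> (x, y) = \<xi>" by (simp add: dual_covector_def)
  then show ?thesis by (simp add: hilbert_form_def pxy \<xi>)
qed

text \<open>The infinitesimal form of the statement that \<open>q - i x\<close> moves inside the
  cone. The hypothesis on \<open>X\<close> says that \<open>F\<close> is constant along
  \<open>X\<close>, so \<open>FD c p X\<close> is real and is exactly the variation of
  \<open>P\<close> that enters the derivative of \<open>q\<close>.\<close>

lemma \<mu>_FD_q:
  assumes p: "p \<in> \<Sigma>" and X: "Im (FD c p X) = 0"
  shows "\<mu> p (FD q p X) = \<i> * \<mu> p (fst X)"
proof -
  have pN: "p \<in> N" and Fp: "Im (c p) = - 1" using p by (auto simp: \<Sigma>_def)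
  have e: "FD c p X = - (\<mu> p (snd X) + c p * \<mu> p (fst X))" using FD_c [OF pN, of "fst X" "snd X"] by simp
  have "\<mu> p (FD q p X) = \<mu> p (snd X) + of_real (Re (c p)) * \<mu> p (fst X) + of_real (Re (FD c p X))"
    by (simp add: FD_q [OF pN] linear_add [OF linear_\<mu> [OF pN]] linear_scale [OF linear_\<mu> [OF pN]] \<mu>_fst [OF pN]
        scaleR_conv_of_real)
  also have "of_real (Re (FD c p X)) = FD c p X" using X by (simp add: complex_eq_iff)
  also have "\<mu> p (snd X) + of_real (Re (c p)) * \<mu> p (fst X) + FD c p X = (of_real (Re (c p)) - c p) * \<mu> p (fst X)"
    by (simp add: e algebra_simps)
  also have "of_real (Re (c p)) - c p = \<i>" using Fp by (simp add: complex_eq_iff)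
  finally show ?thesis .
qed

text \<open>As \<open>b\<close> annihilates \<open>x\<close> and \<open>c = P - i\<close> at
  \<open>p\<close>, the vertical and horizontal contributions in \<open>FD_\<mu>\<close> combine
  into \<open>b\<close> applied to the variation of \<open>q - i x\<close>.\<close>

lemma FD_\<mu>_tangent:
  assumes p: "p \<in> \<Sigma>"
  shows "FD (\<lambda>z. \<mu> z h) p X = b p h (FD q p X) - \<i> * b p h (fst X) - \<mu> p h * \<mu> p (fst X)"
proof -
  have pN: "p \<in> N" and Fp: "Im (c p) = - 1" using p by (auto simp: \<Sigma>_def)
  have "b p h (FD q p X) = b p h (snd X) + of_real (Re (c p)) * b p h (fst X)"
    by (simp add: FD_q [OF pN] linear_add [OF linear_b [OF pN]] linear_scale [OF linear_b [OF pN]] b_fst [OF pN]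
        scaleR_conv_of_real)
  moreover have "c p = of_real (Re (c p)) - \<i>" using Fp by (simp add: complex_eq_iff)
  ultimately show ?thesis
    using FD_\<mu> [OF pN, of h "fst X" "snd X"] by (simp add: algebra_simps) (metis add.commute distrib_right mult.commute diff_add_cancel)
qed

end

section \<open>Adapted moving frames and their structure equations\<close>

lemma linear_Im: "linear f \<Longrightarrow> linear (\<lambda>x. Im (f x))"
  using linear_compose [of f Im] bounded_linear.linear [OF bounded_linear_Im] by (simp add: o_def)

text \<open>Symmetric coefficients against wedge products. This removes \<open>J\<close> from the
  differential of \<omega> i and \<open>I\<close> from that of \<theta> 0 i.\<close>

lemma antisym_sum_zero:
  fixes L :: "nat \<Rightarrow> nat \<Rightarrow> real"
  assumes "\<And>j k. j \<in> S \<Longrightarrow> k \<in> S \<Longrightarrow> L j k = L k j"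
  shows "(\<Sum>j\<in>S. \<Sum>k\<in>S. L j k * (a k * a' j - a' k * a j)) = 0"
proof -
  have "(\<Sum>j\<in>S. \<Sum>k\<in>S. L j k * (a k * a' j)) = (\<Sum>j\<in>S. \<Sum>k\<in>S. L j k * (a' k * a j))"
    by (subst sum.swap) (intro sum.cong refl, use assms in \<open>simp add: mult_ac\<close>)
  then show ?thesis by (simp add: right_diff_distrib sum_subtractf)
qed

locale funk_frame = funk +
  fixes W :: "('a \<times> 'a) set" and e :: "nat \<Rightarrow> 'a \<times> 'a \<Rightarrow> 'a" and n :: nat
  assumes open_W: "open W" and WN: "W \<subseteq> N"
    and smooth_e: "\<And>i. i \<in> {1..n} \<Longrightarrow> smooth_on W (e i)"
    and \<mu>_e: "\<And>i p. i \<in> {1..n} \<Longrightarrow> p \<in> W \<Longrightarrow> \<mu> p (e i p) = 0"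
    and orthonormal: "\<And>i j p. i \<in> {1..n} \<Longrightarrow> j \<in> {1..n} \<Longrightarrow> p \<in> W \<Longrightarrow>
      Im (b p (e i p) (e j p)) = (if i = j then 1 else 0)"
    and complete: "\<And>p h. p \<in> W \<Longrightarrow> \<mu> p h = 0 \<Longrightarrow> h = (\<Sum>i=1..n. Im (b p (e i p) h) *\<^sub>R e i p)"
begin

text \<open>The coframe dual to \<open>e\<close>; it is defined on all vectors and annihilates
  \<open>x\<close> and \<open>q\<close> because \<open>b\<close> does.\<close>

definition \<epsilon> :: "nat \<Rightarrow> 'a \<times> 'a \<Rightarrow> 'a \<Rightarrow> real" where
  "\<epsilon> i p h = Im (b p (e i p) h)"

lemma W_N: "p \<in> W \<Longrightarrow> p \<in> N" using WN by blast

lemma linear_\<epsilon>: "p \<in> W \<Longrightarrow> linear (\<epsilon> i p)"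
  unfolding \<epsilon>_def by (intro linear_Im linear_b W_N)

lemma smooth_\<epsilon>: "i \<in> {1..n} \<Longrightarrow> smooth_on W (\<lambda>p. \<epsilon> i p h)"
  unfolding \<epsilon>_def
  by (intro smooth_on_Im open_W linear_family(1) [of W "\<lambda>z k. b z k h" "e i"] linear_b' W_N smooth_e
      smooth_on_subset [OF smooth_b WN])

lemma smooth_\<epsilon>_apply: "i \<in> {1..n} \<Longrightarrow> smooth_on W h \<Longrightarrow> smooth_on W (\<lambda>p. \<epsilon> i p (h p))"
  by (rule linear_family(1) [of W "\<epsilon> i" h]) (simp_all add: open_W linear_\<epsilon> smooth_\<epsilon>)

lemma \<epsilon>_fst: "p \<in> W \<Longrightarrow> \<epsilon> i p (fst p) = 0"
  by (simp add: \<epsilon>_def b_fst W_N)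

lemma \<epsilon>_q: "p \<in> W \<Longrightarrow> \<epsilon> i p (q p) = 0"
  by (simp add: \<epsilon>_def b_q W_N)

lemma \<epsilon>_e: "i \<in> {1..n} \<Longrightarrow> j \<in> {1..n} \<Longrightarrow> p \<in> W \<Longrightarrow> \<epsilon> i p (e j p) = (if i = j then 1 else 0)"
  by (simp add: \<epsilon>_def orthonormal)

text \<open>On \<Sigma> one has \<open>\<mu> (x) = 1\<close> and \<open>\<mu> (q) = i\<close>, so
  \<open>x\<close> and \<open>q\<close> span a real complement of the kernel of \<mu>, on which
  \<mu> reads off the coordinates.\<close>

lemma expand:
  assumes p: "p \<in> \<Sigma> \<inter> W"
  shows "h = Re (\<mu> p h) *\<^sub>R fst p + Im (\<mu> p h) *\<^sub>R q p + (\<Sum>i=1..n. \<epsilon> i p h *\<^sub>R e i p)"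
proof -
  have pW: "p \<in> W" and pN: "p \<in> N" and Fp: "Im (c p) = - 1" using p by (auto simp: \<Sigma>_def)
  define k where "k = h - Re (\<mu> p h) *\<^sub>R fst p - Im (\<mu> p h) *\<^sub>R q p"
  have "\<mu> p k = 0"
    by (simp add: k_def linear_diff [OF linear_\<mu> [OF pN]] linear_scale [OF linear_\<mu> [OF pN]] \<mu>_fst [OF pN] \<mu>_q [OF pN] Fp
        complex_eq_iff)
  from complete [OF pW this] have "k = (\<Sum>i=1..n. \<epsilon> i p k *\<^sub>R e i p)" by (simp add: \<epsilon>_def)
  moreover have "\<epsilon> i p k = \<epsilon> i p h" for i
    by (simp add: k_def linear_diff [OF linear_\<epsilon> [OF pW]] linear_scale [OF linear_\<epsilon> [OF pW]] \<epsilon>_fst [OF pW] \<epsilon>_q [OF pW])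
  ultimately have "k = (\<Sum>i=1..n. \<epsilon> i p h *\<^sub>R e i p)" by simp
  then show ?thesis by (simp add: k_def algebra_simps)
qed

lemma linear_expand:
  assumes p: "p \<in> \<Sigma> \<inter> W" and L: "linear (L :: 'a \<Rightarrow> 'c::real_vector)"
  shows "L h = Re (\<mu> p h) *\<^sub>R L (fst p) + Im (\<mu> p h) *\<^sub>R L (q p) + (\<Sum>i=1..n. \<epsilon> i p h *\<^sub>R L (e i p))"
  by (subst expand [OF p, of h]) (simp only: linear_add [OF L] linear_scale [OF L] linear_sum [OF L])

lemma g_expand:
  assumes p: "p \<in> \<Sigma> \<inter> W"
  shows "Im (b p h k) = (\<Sum>i=1..n. \<epsilon> i p h * \<epsilon> i p k)"
proof -
  have pN: "p \<in> N" using p WN by blast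
  have l: "linear (\<lambda>h. Im (b p h k))"
    by (rule linear_Im [OF linear_b' [OF pN]])
  show ?thesis
    using linear_expand [OF p l, of h] b_sym [OF pN] b_fst [OF pN] b_q [OF pN] by (simp add: \<epsilon>_def)
qed

definition \<psi> :: "nat \<Rightarrow> nat \<Rightarrow> 'a \<times> 'a \<Rightarrow> 'a \<times> 'a \<Rightarrow> real" where
  "\<psi> i j p X = \<epsilon> i p (FD (e j) p X)"

definition om :: "nat \<Rightarrow> 'a \<times> 'a \<Rightarrow> 'a \<times> 'a \<Rightarrow> real" where
  "om i p X = (if i = 0 then Im (\<mu> p (fst X)) else \<epsilon> i p (fst X))"

text \<open>The first index 0 is reserved for \<theta> 0 j. For the other indices only the
  antisymmetric part of \<psi> is taken as connection; its symmetric part is computed in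
  \<open>\<psi>_sym\<close> and supplies \<open>I\<close> and \<open>J\<close>.\<close>

definition th :: "nat \<Rightarrow> nat \<Rightarrow> 'a \<times> 'a \<Rightarrow> 'a \<times> 'a \<Rightarrow> real" where
  "th i j p X = (if i = 0 then - \<epsilon> j p (FD q p X) else (\<psi> i j p X - \<psi> j i p X) / 2)"

lemma FD_lin: "f differentiable (at p) \<Longrightarrow> linear (FD f p)"
  by (rule linear_frechet_derivative)

lemma e_diff: "i \<in> {1..n} \<Longrightarrow> p \<in> W \<Longrightarrow> e i differentiable (at p)"
  using smooth_on_differentiable [OF smooth_e] .

lemma q_diff: "p \<in> N \<Longrightarrow> q differentiable (at p)"
  using smooth_on_differentiable [OF smooth_q] .

lemma linear_om: "p \<in> W \<Longrightarrow> linear (om i p)"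
  using linear_\<epsilon> [of p i] linear_\<mu> [OF W_N, of p]
  by (intro linearI) (simp_all add: om_def linear_add linear_scale)

lemma linear_\<psi>: "j \<in> {1..n} \<Longrightarrow> p \<in> W \<Longrightarrow> linear (\<psi> i j p)"
  using linear_compose [OF FD_lin [OF e_diff [of j p]] linear_\<epsilon> [of p i]] by (simp add: \<psi>_def [abs_def] o_def)

lemma linear_th: "i \<in> {0..n} \<Longrightarrow> j \<in> {1..n} \<Longrightarrow> p \<in> W \<Longrightarrow> linear (th i j p)"
proof (cases "i = 0")
  case True
  assume *: "j \<in> {1..n}" "p \<in> W"
  then have "linear (\<lambda>X. \<epsilon> j p (FD q p X))"
    using linear_compose [OF FD_lin [OF q_diff [OF W_N [of p]]] linear_\<epsilon> [of p j]] by (simp add: o_def)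
  from linear_compose_neg [OF this] show ?thesis using True
    by (simp add: th_def [abs_def])
next
  case False
  assume *: "i \<in> {0..n}" "j \<in> {1..n}" "p \<in> W"
  then have "linear (\<psi> i j p)" "linear (\<psi> j i p)" using False by (auto intro: linear_\<psi>)
  then show ?thesis using False
    by (intro linearI) (simp_all add: th_def linear_add linear_scale algebra_simps diff_divide_distrib add_divide_distrib)
qed

lemma smooth_om: "i \<in> {0..n} \<Longrightarrow> smooth_on W (\<lambda>p. om i p X)"
  using smooth_\<epsilon> [of i "fst X"] smooth_on_Im [OF open_W smooth_on_subset [OF smooth_\<mu> WN], of "fst X"]
  by (cases "i = 0") (simp_all add: om_def)

lemma smooth_\<psi>: "i \<in> {1..n} \<Longrightarrow> j \<in> {1..n} \<Longrightarrow> smooth_on W (\<lambda>p. \<psi> i j p X)"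
  unfolding \<psi>_def by (intro smooth_\<epsilon>_apply smooth_on_FD smooth_e)

lemma smooth_th: "i \<in> {0..n} \<Longrightarrow> j \<in> {1..n} \<Longrightarrow> smooth_on W (\<lambda>p. th i j p X)"
proof (cases "i = 0")
  case True
  assume "j \<in> {1..n}"
  then have "smooth_on W (\<lambda>p. - \<epsilon> j p (FD q p X))"
    by (intro smooth_on_minus open_W smooth_\<epsilon>_apply smooth_on_FD smooth_on_subset [OF smooth_q WN])
  then show ?thesis using True by (simp add: th_def)
next
  case False
  assume "i \<in> {0..n}" "j \<in> {1..n}"
  then have "smooth_on W (\<lambda>p. (\<psi> i j p X - \<psi> j i p X) / 2)" using False
    by (intro smooth_on_divide smooth_on_diff open_W smooth_\<psi> smooth_on_const) auto
  then show ?thesis using False by (simp add: th_def)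
qed

lemma FD_\<epsilon>:
  assumes i: "i \<in> {1..n}" and p: "p \<in> W"
  shows "linear (\<lambda>h. FD (\<lambda>z. \<epsilon> i z h) p X)"
    and "smooth_on W h \<Longrightarrow> FD (\<lambda>z. \<epsilon> i z (h z)) p X = FD (\<lambda>z. \<epsilon> i z (h p)) p X + \<epsilon> i p (FD h p X)"
  using linear_family(3) [of W "\<epsilon> i" "\<lambda>z. 0" p X] linear_family(2) [of W "\<epsilon> i" h p X]
    open_W linear_\<epsilon> smooth_\<epsilon> [OF i] p smooth_on_const by blast+

lemma FD_\<epsilon>_const:
  assumes i: "i \<in> {1..n}" and p: "p \<in> W" and h: "smooth_on W h" and k: "\<And>z. z \<in> W \<Longrightarrow> \<epsilon> i z (h z) = k"
  shows "FD (\<lambda>z. \<epsilon> i z (h p)) p X = - \<epsilon> i p (FD h p X)"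
proof -
  have "FD (\<lambda>z. \<epsilon> i z (h z)) p = FD (\<lambda>z. k) p" by (rule FD_cong [OF open_W p k])
  then show ?thesis using FD_\<epsilon>(2) [OF i p h, of X] by simp
qed

text \<open>The functions \<open>\<epsilon> i\<close> applied to \<open>x\<close>, to
  \<open>q\<close> and to \<open>e j\<close> are constant, so differentiating them shifts the
  derivative from the coframe to the vectors; the rest is linear expansion of
  \<open>h\<close>.\<close>

lemma FD_\<epsilon>_expand:
  assumes i: "i \<in> {1..n}" and p: "p \<in> \<Sigma> \<inter> W"
  shows "FD (\<lambda>z. \<epsilon> i z h) p X = - Re (\<mu> p h) * om i p X + Im (\<mu> p h) * th 0 i p X - (\<Sum>j=1..n. \<epsilon> j p h * \<psi> i j p X)"
proof -
  have pW: "p \<in> W" using p by blast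
  have ff: "FD fst p X = fst X" by (simp add: FD_eqI [OF bounded_linear_imp_has_derivative [OF bounded_linear_fst]])
  have "FD (\<lambda>z. \<epsilon> i z (fst p)) p X = - \<epsilon> i p (fst X)"
    using FD_\<epsilon>_const [OF i pW smooth_on_fst, of 0 X] ff \<epsilon>_fst by simp
  moreover have "FD (\<lambda>z. \<epsilon> i z (q p)) p X = - \<epsilon> i p (FD q p X)"
    using FD_\<epsilon>_const [OF i pW smooth_on_subset [OF smooth_q WN], of 0 X] \<epsilon>_q by simp
  moreover have "FD (\<lambda>z. \<epsilon> i z (e j p)) p X = - \<psi> i j p X" if "j \<in> {1..n}" for j
    using FD_\<epsilon>_const [OF i pW smooth_e [OF that], of "if i = j then 1 else 0" X] \<epsilon>_e [OF i that] by (simp add: \<psi>_def)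
  ultimately show ?thesis
    using linear_expand [OF p FD_\<epsilon>(1) [OF i pW, of X], of h] i
    by (simp add: om_def th_def sum_negf)
qed

text \<open>The derivative of the orthonormality relations. On the kernel of \<mu> the derivative of
  \<open>b\<close> is \<open>t\<close> in the direction of the variation of \<open>q - i x\<close>,
  minus a multiple of \<open>b\<close>. Expanding that direction along \<open>x\<close>,
  \<open>q\<close> and the frame, \<open>t\<close> vanishes along \<open>x\<close> and returns
  \<open>- b\<close> along \<open>q\<close>, which leaves the real part of \<mu> and the third
  derivatives along the frame.\<close>

lemma \<psi>_sym:
  assumes i: "i \<in> {1..n}" and j: "j \<in> {1..n}" and p: "p \<in> \<Sigma> \<inter> W" and X: "Im (FD c p X) = 0"
  shows "\<psi> i j p X + \<psi> j i p X = (if i = j then 2 * Re (\<mu> p (fst X)) else 0) +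
    (\<Sum>k=1..n. Im (t p (e i p) (e j p) (e k p)) * th 0 k p X + Re (t p (e i p) (e j p) (e k p)) * om k p X)"
proof -
  have pW: "p \<in> W" and pN: "p \<in> N" and Fp: "Im (c p) = - 1" using p WN by (auto simp: \<Sigma>_def)
  let ?b = "b p (e i p) (e j p)" and ?t = "t p (e i p) (e j p)"
  define \<mu>X where "\<mu>X = \<mu> p (fst X)"
  have "FD (\<lambda>z. \<epsilon> i z (e j p)) p X = FD (\<lambda>z. Im (b z (e i z) (e j p))) p X"
    by (simp add: \<epsilon>_def)
  also have "\<dots> = Im (FD (\<lambda>z. b z (e i z) (e j p)) p X)"
  proof (rule FD_bounded_linear [OF bounded_linear_Im])
    have "smooth_on W (\<lambda>z. b z (e i z) (e j p))"
      by (intro linear_family(1) [of W "\<lambda>z k. b z k (e j p)" "e i"] open_W linear_b' W_N smooth_e i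
          smooth_on_subset [OF smooth_b WN])
    then show "(\<lambda>z. b z (e i z) (e j p)) differentiable (at p)" by (rule smooth_on_differentiable [OF _ pW])
  qed
  also have "FD (\<lambda>z. b z (e i z) (e j p)) p X = FD (\<lambda>z. b z (e i p) (e j p)) p X + b p (FD (e i) p X) (e j p)"
    by (intro linear_family(2) [of W "\<lambda>z k. b z k (e j p)" "e i"] open_W linear_b' W_N smooth_e i
          smooth_on_subset [OF smooth_b WN] pW)
  finally have "FD (\<lambda>z. \<epsilon> i z (e j p)) p X = Im (FD (\<lambda>z. b z (e i p) (e j p)) p X) + \<psi> j i p X"
    by (simp add: \<psi>_def \<epsilon>_def b_sym [OF pN, of "e j p"])
  moreover have "FD (\<lambda>z. \<epsilon> i z (e j p)) p X = - \<psi> i j p X"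
    using FD_\<epsilon>_const [OF i pW smooth_e [OF j], of "if i = j then 1 else 0" X] \<epsilon>_e [OF i j] by (simp add: \<psi>_def)
  ultimately have 1: "\<psi> i j p X + \<psi> j i p X = - Im (FD (\<lambda>z. b z (e i p) (e j p)) p X)" by linarith
  have lt: "linear ?t" by (rule linear_t [OF pN])
  have tx: "?t (fst X) = - of_real (Im \<mu>X) * ?b + (\<Sum>k=1..n. om k p X *\<^sub>R ?t (e k p))"
    using linear_expand [OF p lt, of "fst X"]
    by (simp add: t_fst [OF pN] t_q [OF pN] \<mu>X_def om_def scaleR_conv_of_real cong: sum.cong_simp)
  have \<mu>Q: "\<mu> p (FD q p X) = \<i> * \<mu>X" using \<mu>_FD_q [OF _ X] p by (simp add: \<mu>X_def)
  have tq: "?t (FD q p X) = - of_real (Re \<mu>X) * ?b - (\<Sum>k=1..n. th 0 k p X *\<^sub>R ?t (e k p))"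
    using linear_expand [OF p lt, of "FD q p X"] \<mu>Q
    by (simp add: t_fst [OF pN] t_q [OF pN] th_def scaleR_conv_of_real sum_negf)
  have "?t (FD q p X) = ?t (snd X) + of_real (Re (c p)) * ?t (fst X)"
    by (simp add: FD_q [OF pN] linear_add [OF lt] linear_scale [OF lt] t_fst [OF pN] scaleR_conv_of_real)
  moreover have cp: "c p = of_real (Re (c p)) - \<i>" using Fp by (simp add: complex_eq_iff)
  moreover have "FD (\<lambda>z. b z (e i p) (e j p)) p X = ?t (snd X) + c p * ?t (fst X) - ?b * \<mu>X"
    using FD_b [OF pN \<mu>_e [OF i pW] \<mu>_e [OF j pW], of "fst X" "snd X"] by (simp add: \<mu>X_def)
  ultimately have "FD (\<lambda>z. b z (e i p) (e j p)) p X = ?t (FD q p X) - \<i> * ?t (fst X) - ?b * \<mu>X"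
    by (metis (no_types, lifting) add_diff_eq left_diff_distrib)
  \<comment> \<open>The contributions of the imaginary part of \<mu>X cancel, while those of the
    real part add up to the factor 2.\<close>
  also have "\<dots> = - 2 * of_real (Re \<mu>X) * ?b - (\<Sum>k=1..n. th 0 k p X *\<^sub>R ?t (e k p)) - \<i> * (\<Sum>k=1..n. om k p X *\<^sub>R ?t (e k p))"
  proof -
    have "\<mu>X = of_real (Re \<mu>X) + \<i> * of_real (Im \<mu>X)" by (rule complex_eq)
    then have "?b * \<mu>X = of_real (Re \<mu>X) * ?b + \<i> * of_real (Im \<mu>X) * ?b" by (metis distrib_left mult.commute)
    then show ?thesis unfolding tx tq by (simp add: algebra_simps)
  qed
  finally have "Im (FD (\<lambda>z. b z (e i p) (e j p)) p X) =
     - 2 * Re \<mu>X * Im ?b - (\<Sum>k=1..n. th 0 k p X * Im (?t (e k p))) - (\<Sum>k=1..n. om k p X * Re (?t (e k p)))"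
    by simp
  then show ?thesis unfolding 1 using orthonormal [OF i j pW]
    by (simp add: \<mu>X_def sum.distrib mult.commute)
qed

definition I :: "'a \<times> 'a \<Rightarrow> nat \<Rightarrow> nat \<Rightarrow> nat \<Rightarrow> real" where
  "I p i j k = Im (t p (e i p) (e j p) (e k p)) / 2"

definition J :: "'a \<times> 'a \<Rightarrow> nat \<Rightarrow> nat \<Rightarrow> nat \<Rightarrow> real" where
  "J p i j k = Re (t p (e i p) (e j p) (e k p)) / 2"

lemma IJ_sym: "p \<in> N \<Longrightarrow> I p i j k = I p j i k" "p \<in> N \<Longrightarrow> I p i j k = I p i k j"
  "p \<in> N \<Longrightarrow> J p i j k = J p j i k" "p \<in> N \<Longrightarrow> J p i j k = J p i k j"
  unfolding I_def J_def using t_sym12 t_sym23 by metis+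

lemma \<psi>_eq:
  assumes i: "i \<in> {1..n}" and j: "j \<in> {1..n}" and p: "p \<in> \<Sigma> \<inter> W" and X: "Im (FD c p X) = 0"
  shows "\<psi> i j p X = th i j p X + (if i = j then Re (\<mu> p (fst X)) else 0) +
    (\<Sum>k=1..n. I p i j k * th 0 k p X) + (\<Sum>k=1..n. J p i j k * om k p X)"
proof -
  have "\<psi> i j p X = th i j p X + (\<psi> i j p X + \<psi> j i p X) / 2" using i by (simp add: th_def field_simps)
  then show ?thesis unfolding \<psi>_sym [OF assms] I_def J_def
    by (simp add: sum.distrib add_divide_distrib sum_divide_distrib)
qed

text \<open>Kept general in \<alpha> because it is applied to \<open>om\<close> for the differential
  of \<omega> i and to \<open>th 0\<close> for that of \<theta> 0 i.\<close>

lemma \<psi>_wedge: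
  assumes i: "i \<in> {1..n}" and p: "p \<in> \<Sigma> \<inter> W" and X: "Im (FD c p X) = 0" and Y: "Im (FD c p Y) = 0"
  shows "(\<Sum>j=1..n. \<psi> i j p X * \<alpha> j Y - \<psi> i j p Y * \<alpha> j X) =
     (\<Sum>j=1..n. th i j p X * \<alpha> j Y - th i j p Y * \<alpha> j X)
     + (Re (\<mu> p (fst X)) * \<alpha> i Y - Re (\<mu> p (fst Y)) * \<alpha> i X)
     + (\<Sum>j=1..n. \<Sum>k=1..n. I p i j k * (th 0 k p X * \<alpha> j Y - th 0 k p Y * \<alpha> j X))
     + (\<Sum>j=1..n. \<Sum>k=1..n. J p i j k * (om k p X * \<alpha> j Y - om k p Y * \<alpha> j X))"
proof -
  have "(\<Sum>j=1..n. \<psi> i j p X * \<alpha> j Y - \<psi> i j p Y * \<alpha> j X) =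
    (\<Sum>j=1..n. (th i j p X * \<alpha> j Y - th i j p Y * \<alpha> j X)
      + (if i = j then Re (\<mu> p (fst X)) * \<alpha> j Y - Re (\<mu> p (fst Y)) * \<alpha> j X else 0)
      + (\<Sum>k=1..n. I p i j k * (th 0 k p X * \<alpha> j Y - th 0 k p Y * \<alpha> j X))
      + (\<Sum>k=1..n. J p i j k * (om k p X * \<alpha> j Y - om k p Y * \<alpha> j X)))"
  proof (rule sum.cong [OF refl])
    fix j assume j: "j \<in> {1..n}"
    have r: "(\<Sum>k=1..n. f k * (u k * a - v k * a')) = (\<Sum>k=1..n. f k * u k) * a - (\<Sum>k=1..n. f k * v k) * a'"
      for f u v :: "nat \<Rightarrow> real" and a a' :: real
      by (simp add: sum_distrib_right right_diff_distrib sum_subtractf mult.assoc)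
    show "\<psi> i j p X * \<alpha> j Y - \<psi> i j p Y * \<alpha> j X = (th i j p X * \<alpha> j Y - th i j p Y * \<alpha> j X)
      + (if i = j then Re (\<mu> p (fst X)) * \<alpha> j Y - Re (\<mu> p (fst Y)) * \<alpha> j X else 0)
      + (\<Sum>k=1..n. I p i j k * (th 0 k p X * \<alpha> j Y - th 0 k p Y * \<alpha> j X))
      + (\<Sum>k=1..n. J p i j k * (om k p X * \<alpha> j Y - om k p Y * \<alpha> j X))"
      unfolding \<psi>_eq [OF i j p X] \<psi>_eq [OF i j p Y] r by (simp add: algebra_simps)
  qed
  also have "\<dots> = (\<Sum>j=1..n. th i j p X * \<alpha> j Y - th i j p Y * \<alpha> j X)
     + (\<Sum>j=1..n. if i = j then Re (\<mu> p (fst X)) * \<alpha> j Y - Re (\<mu> p (fst Y)) * \<alpha> j X else 0)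
     + (\<Sum>j=1..n. \<Sum>k=1..n. I p i j k * (th 0 k p X * \<alpha> j Y - th 0 k p Y * \<alpha> j X))
     + (\<Sum>j=1..n. \<Sum>k=1..n. J p i j k * (om k p X * \<alpha> j Y - om k p Y * \<alpha> j X))"
    by (simp only: sum.distrib)
  also have "(\<Sum>j=1..n. if i = j then Re (\<mu> p (fst X)) * \<alpha> j Y - Re (\<mu> p (fst Y)) * \<alpha> j X else 0)
    = Re (\<mu> p (fst X)) * \<alpha> i Y - Re (\<mu> p (fst Y)) * \<alpha> i X"
    using i by (subst sum.delta') auto
  finally show ?thesis .
qed

abbreviation "\<omega> i \<equiv> form (om i)"
abbreviation "\<theta> i j \<equiv> form (th i j)"

lemma \<omega>_apply: "p \<in> W \<Longrightarrow> blinfun_apply (\<omega> i p) X = om i p X"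
  by (rule form_apply [OF linear_om])

lemma \<theta>_apply: "i \<in> {0..n} \<Longrightarrow> j \<in> {1..n} \<Longrightarrow> p \<in> W \<Longrightarrow> blinfun_apply (\<theta> i j p) X = th i j p X"
  by (rule form_apply [OF linear_th])

lemma ext_\<omega>: "i \<in> {0..n} \<Longrightarrow> p \<in> W \<Longrightarrow> ext_deriv (\<omega> i) p X Y = FD (\<lambda>z. om i z Y) p X - FD (\<lambda>z. om i z X) p Y"
  by (rule ext_deriv_form [OF open_W linear_om smooth_om])

lemma ext_\<theta>: "i \<in> {0..n} \<Longrightarrow> j \<in> {1..n} \<Longrightarrow> p \<in> W \<Longrightarrow> ext_deriv (\<theta> i j) p X Y = FD (\<lambda>z. th i j z Y) p X - FD (\<lambda>z. th i j z X) p Y"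
  by (rule ext_deriv_form [OF open_W linear_th smooth_th])

text \<open>In the antisymmetrization of \<open>FD_\<mu>_tangent\<close> the terms with
  \<open>b\<close> at the two base variations and with the product of two values of \<mu> are
  symmetric and cancel. What remains is the Hessian of \<open>F\<close> paired with the variation of
  \<open>q\<close>, expanded in the orthonormal frame.\<close>

lemma d_\<omega>0:
  assumes p: "p \<in> \<Sigma> \<inter> W"
  shows "ext_deriv (\<omega> 0) p X Y = - (\<Sum>j=1..n. wedge (\<theta> 0 j p) (\<omega> j p) X Y)"
proof -
  have pS: "p \<in> \<Sigma>" and pW: "p \<in> W" and pN: "p \<in> N" using p WN by auto
  have "FD (\<lambda>z. om 0 z Y) p X = Im (FD (\<lambda>z. \<mu> z (fst Y)) p X)" for X Y
    using FD_bounded_linear [OF bounded_linear_Im smooth_on_differentiable [OF smooth_\<mu> pN]] by (simp add: om_def)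
  then have "ext_deriv (\<omega> 0) p X Y = Im (b p (fst Y) (FD q p X)) - Im (b p (fst X) (FD q p Y))"
    by (simp add: ext_\<omega> [OF _ pW] FD_\<mu>_tangent [OF pS] b_sym [OF pN, of "fst Y" "fst X"] mult.commute)
  also have "\<dots> = (\<Sum>j=1..n. \<epsilon> j p (fst Y) * \<epsilon> j p (FD q p X) - \<epsilon> j p (fst X) * \<epsilon> j p (FD q p Y))"
    by (simp add: g_expand [OF p] sum_subtractf)
  also have "\<dots> = - (\<Sum>j=1..n. wedge (\<theta> 0 j p) (\<omega> j p) X Y)"
    unfolding sum_negf [symmetric]
    by (rule sum.cong) (simp_all add: wedge_def \<theta>_apply [OF _ _ pW] \<omega>_apply [OF pW] th_def om_def)
  finally show ?thesis .
qed

text \<open>The terms with \<open>Re \<mu>\<close> from the coframe cancel those from the diagonal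
  part of \<psi>, and the \<open>J\<close> terms disappear because \<open>J\<close> is symmetric in
  its last two indices.\<close>

lemma d_\<omega>:
  assumes i: "i \<in> {1..n}" and p: "p \<in> \<Sigma> \<inter> W" and X: "Im (FD c p X) = 0" and Y: "Im (FD c p Y) = 0"
  shows "ext_deriv (\<omega> i) p X Y = wedge (\<theta> 0 i p) (\<omega> 0 p) X Y
              - (\<Sum>j=1..n. wedge (\<theta> i j p) (\<omega> j p) X Y)
              - (\<Sum>j=1..n. \<Sum>k=1..n. I p i j k * wedge (\<theta> 0 k p) (\<omega> j p) X Y)"
proof -
  have pW: "p \<in> W" and pN: "p \<in> N" using p WN by auto
  have i0: "i \<noteq> 0" using i by auto
  have "ext_deriv (\<omega> i) p X Y = FD (\<lambda>z. \<epsilon> i z (fst Y)) p X - FD (\<lambda>z. \<epsilon> i z (fst X)) p Y"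
    using i by (simp add: ext_\<omega> [OF _ pW] om_def)
  also have "\<dots> = (Re (\<mu> p (fst X)) * om i p Y - Re (\<mu> p (fst Y)) * om i p X)
     + (th 0 i p X * om 0 p Y - th 0 i p Y * om 0 p X)
     - (\<Sum>j=1..n. \<psi> i j p X * om j p Y - \<psi> i j p Y * om j p X)"
  proof -
    have "(\<Sum>j=1..n. \<epsilon> j p (fst Y) * \<psi> i j p X) = (\<Sum>j=1..n. \<psi> i j p X * om j p Y)" for X Y
      by (rule sum.cong) (simp_all add: om_def)
    then show ?thesis
      unfolding FD_\<epsilon>_expand [OF i p] sum_subtractf by (simp add: om_def [of 0] algebra_simps)
  qed
  also have "\<dots> = (th 0 i p X * om 0 p Y - th 0 i p Y * om 0 p X)
     - (\<Sum>j=1..n. th i j p X * om j p Y - th i j p Y * om j p X)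
     - (\<Sum>j=1..n. \<Sum>k=1..n. I p i j k * (th 0 k p X * om j p Y - th 0 k p Y * om j p X))"
    unfolding \<psi>_wedge [OF i p X Y, of "\<lambda>j. om j p"] using antisym_sum_zero [of "{1..n}" "J p i" "\<lambda>j. om j p X" "\<lambda>j. om j p Y"] IJ_sym(4) [OF pN]
    by simp
  also have "\<dots> = wedge (\<theta> 0 i p) (\<omega> 0 p) X Y
              - (\<Sum>j=1..n. wedge (\<theta> i j p) (\<omega> j p) X Y)
              - (\<Sum>j=1..n. \<Sum>k=1..n. I p i j k * wedge (\<theta> 0 k p) (\<omega> j p) X Y)"
    using i by (simp add: wedge_def \<theta>_apply [OF _ _ pW] \<omega>_apply [OF pW] cong: sum.cong_simp)
  finally show ?thesis .
qed

text \<open>The variation of \<open>q\<close> takes the place of that of \<open>x\<close>, and the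
  second derivatives of \<open>q\<close> cancel. Since \<open>\<mu> (dq) = i \<mu> (dx)\<close>, the
  real part of \<open>\<mu> (dq)\<close> is \<open>- \<omega> 0\<close>, and its product with
  \<omega> i is the curvature term with coefficient 1. Now \<open>I\<close> cancels and
  \<open>J\<close> survives; products of two forms \<omega> j, \<omega> k with positive indices do
  not arise.\<close>

lemma d_\<theta>:
  assumes i: "i \<in> {1..n}" and p: "p \<in> \<Sigma> \<inter> W" and X: "Im (FD c p X) = 0" and Y: "Im (FD c p Y) = 0"
  shows "ext_deriv (\<theta> 0 i) p X Y = - (\<Sum>j=1..n. wedge (\<theta> 0 j p) (\<theta> j i p) X Y)
     + wedge (\<omega> 0 p) (\<omega> i p) X Y
     + (\<Sum>j=1..n. \<Sum>k=1..n. J p i j k * wedge (\<theta> 0 k p) (\<omega> j p) X Y)"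
proof -
  have pS: "p \<in> \<Sigma>" and pW: "p \<in> W" and pN: "p \<in> N" using p WN by auto
  have i0: "i \<noteq> 0" using i by auto
  have F: "FD (\<lambda>z. th 0 i z Y) p X = - (FD (\<lambda>z. \<epsilon> i z (FD q p Y)) p X + \<epsilon> i p (FD (\<lambda>z. FD q z Y) p X))" for X Y
  proof -
    have sm: "smooth_on W (\<lambda>z. FD q z Y)" by (rule smooth_on_FD [OF smooth_on_subset [OF smooth_q WN]])
    have "FD (\<lambda>z. - \<epsilon> i z (FD q z Y)) p X = - FD (\<lambda>z. \<epsilon> i z (FD q z Y)) p X"
      by (rule FD_bounded_linear [OF bounded_linear_minus [OF bounded_linear_ident]
            smooth_on_differentiable [OF smooth_\<epsilon>_apply [OF i sm] pW]])
    then show ?thesis using FD_\<epsilon>(2) [OF i pW sm, of X] by (simp add: th_def)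
  qed
  have "ext_deriv (\<theta> 0 i) p X Y = FD (\<lambda>z. \<epsilon> i z (FD q p X)) p Y - FD (\<lambda>z. \<epsilon> i z (FD q p Y)) p X"
    using i second_derivative_symmetric [OF open_N smooth_q pN, of X Y]
    by (simp add: ext_\<theta> [OF _ _ pW] F)
  also have "\<dots> = (Re (\<mu> p (fst X)) * th 0 i p Y - Re (\<mu> p (fst Y)) * th 0 i p X)
     + (om 0 p X * om i p Y - om 0 p Y * om i p X)
     - (\<Sum>j=1..n. \<psi> i j p X * th 0 j p Y - \<psi> i j p Y * th 0 j p X)"
  proof -
    have "(\<Sum>j=1..n. \<epsilon> j p (FD q p Y) * \<psi> i j p X) = - (\<Sum>j=1..n. \<psi> i j p X * th 0 j p Y)" for X Y
      unfolding sum_negf [symmetric] by (rule sum.cong) (simp_all add: th_def)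
    then show ?thesis
      unfolding FD_\<epsilon>_expand [OF i p] sum_subtractf \<mu>_FD_q [OF pS X] \<mu>_FD_q [OF pS Y]
      by (simp add: om_def [of 0] algebra_simps)
  qed
  also have "\<dots> = (om 0 p X * om i p Y - om 0 p Y * om i p X)
     - (\<Sum>j=1..n. th i j p X * th 0 j p Y - th i j p Y * th 0 j p X)
     - (\<Sum>j=1..n. \<Sum>k=1..n. J p i j k * (om k p X * th 0 j p Y - om k p Y * th 0 j p X))"
    unfolding \<psi>_wedge [OF i p X Y, of "\<lambda>j. th 0 j p"]
    using antisym_sum_zero [of "{1..n}" "I p i" "\<lambda>j. th 0 j p X" "\<lambda>j. th 0 j p Y"] IJ_sym(2) [OF pN]
    by simp
  also have "(\<Sum>j=1..n. \<Sum>k=1..n. J p i j k * (om k p X * th 0 j p Y - om k p Y * th 0 j p X))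
    = - (\<Sum>j=1..n. \<Sum>k=1..n. J p i j k * (th 0 k p X * om j p Y - th 0 k p Y * om j p X))"
    unfolding sum_negf [symmetric]
    by (subst sum.swap) (intro sum.cong refl, simp add: IJ_sym(4) [OF pN, of i] algebra_simps)
  also have "(\<Sum>j=1..n. th i j p X * th 0 j p Y - th i j p Y * th 0 j p X)
    = (\<Sum>j=1..n. wedge (\<theta> 0 j p) (\<theta> j i p) X Y)"
  proof (rule sum.cong [OF refl])
    fix j assume j: "j \<in> {1..n}"
    have "th i j p Z = - th j i p Z" for Z using i j by (simp add: th_def field_simps)
    then show "th i j p X * th 0 j p Y - th i j p Y * th 0 j p X = wedge (\<theta> 0 j p) (\<theta> j i p) X Y"
      using i j by (simp add: wedge_def \<theta>_apply [OF _ _ pW])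
  qed
  finally show ?thesis
    using i by (simp add: wedge_def \<theta>_apply [OF _ _ pW] \<omega>_apply [OF pW] cong: sum.cong_simp)
qed

end

section \<open>The coframing, its curvature, and the Reeb field\<close>

context funk_frame
begin

lemma tangent_D:
  assumes "p \<in> \<Sigma>" "X \<in> tangent_vectors \<Sigma> p"
  shows "fst p \<bullet> fst X = 0" "fst X \<bullet> snd p + fst p \<bullet> snd X = 0" "Im (FD c p X) = 0"
  using assms unfolding tangent [OF assms(1)] by auto

lemma coframe:
  assumes p: "p \<in> \<Sigma> \<inter> W"
  shows "\<exists>!X. X \<in> tangent_vectors \<Sigma> p \<and> om 0 p X = a \<and>
    (\<forall>i\<in>{1..n}. om i p X = \<beta> i \<and> th 0 i p X = \<gamma> i)"
proof -
  have pS: "p \<in> \<Sigma>" and pW: "p \<in> W" and pN: "p \<in> N" using p WN by auto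
  have Fp: "Im (c p) = - 1" and x1: "fst p \<bullet> fst p = 1" and xy: "fst p \<bullet> snd p = 0"
    using pS by (auto simp: \<Sigma>_def dot_square_norm)
  note \<mu>add = linear_add [OF linear_\<mu> [OF pN]] and \<mu>sc = linear_scale [OF linear_\<mu> [OF pN]]
    and \<mu>diff = linear_diff [OF linear_\<mu> [OF pN]] and \<mu>sum = linear_sum [OF linear_\<mu> [OF pN]]
  note \<epsilon>add = linear_add [OF linear_\<epsilon> [OF pW]] and \<epsilon>sc = linear_scale [OF linear_\<epsilon> [OF pW]]
    and \<epsilon>diff = linear_diff [OF linear_\<epsilon> [OF pW]] and \<epsilon>sum = linear_sum [OF linear_\<epsilon> [OF pW]]
  have \<mu>q: "\<mu> p (q p) = \<i>" using \<mu>_q [OF pN] Fp by simp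
  have \<mu>E: "\<mu> p (\<Sum>i=1..n. u i *\<^sub>R e i p) = 0" for u :: "nat \<Rightarrow> real"
    by (simp add: \<mu>sum \<mu>sc \<mu>_e pW)
  have \<epsilon>E: "\<epsilon> j p (\<Sum>i=1..n. u i *\<^sub>R e i p) = u j" if "j \<in> {1..n}" for u :: "nat \<Rightarrow> real" and j
  proof -
    have "\<epsilon> j p (\<Sum>i=1..n. u i *\<^sub>R e i p) = (\<Sum>i=1..n. if i = j then u i else 0)"
      unfolding \<epsilon>sum by (rule sum.cong) (auto simp: \<epsilon>sc \<epsilon>_e [OF that _ pW])
    then show ?thesis using that by simp
  qed
  let ?B = "\<Sum>i=1..n. \<beta> i *\<^sub>R e i p" and ?C = "\<Sum>i=1..n. \<gamma> i *\<^sub>R e i p"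
  \<comment> \<open>\<open>X1\<close> and \<open>Q\<close> are to be the variations of
    \<open>x\<close> and \<open>q\<close>. The multiple \<rho> of \<open>x\<close> makes
    \<open>X1\<close> orthogonal to \<open>x\<close>; the coefficients of \<open>x\<close> and
    \<open>q\<close> in \<open>Q\<close> are forced by \<open>\<mu> (Q) = i \<mu> (X1)\<close>; and
    \<kappa>, which turns out to be the variation of \<open>P\<close>, is fixed by differentiating
    \<open>x \<bullet> y = 0\<close>.\<close>
  define \<rho> where "\<rho> = - (fst p \<bullet> (a *\<^sub>R q p + ?B))"
  define X1 where "X1 = \<rho> *\<^sub>R fst p + a *\<^sub>R q p + ?B"
  define Q where "Q = (- a) *\<^sub>R fst p + \<rho> *\<^sub>R q p - ?C"
  define \<kappa> where "\<kappa> = fst p \<bullet> (Q - Re (c p) *\<^sub>R X1) + X1 \<bullet> snd p"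
  define X2 where "X2 = Q - Re (c p) *\<^sub>R X1 - \<kappa> *\<^sub>R fst p"
  have \<mu>X1: "\<mu> p X1 = Complex \<rho> a"
    by (simp only: X1_def \<mu>add \<mu>sc \<mu>E \<mu>_fst [OF pN] \<mu>q) (simp add: complex_eq_iff)
  have \<mu>Q: "\<mu> p Q = Complex (- a) \<rho>"
    by (simp only: Q_def \<mu>add \<mu>diff \<mu>sc \<mu>E \<mu>_fst [OF pN] \<mu>q) (simp add: complex_eq_iff)
  have FDcX: "FD c p (X1, X2) = of_real \<kappa>"
  proof -
    have "FD c p (X1, X2) = - (\<mu> p Q - Re (c p) *\<^sub>R \<mu> p X1 - of_real \<kappa> + c p * \<mu> p X1)"
      using FD_c [OF pN, of X1 X2] by (simp add: X2_def \<mu>diff \<mu>sc \<mu>_fst [OF pN] scaleR_conv_of_real)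
    then show ?thesis using Fp by (simp add: \<mu>X1 \<mu>Q complex_eq_iff)
  qed
  have QX: "FD q p (X1, X2) = Q" unfolding FD_q [OF pN] FDcX by (simp add: X2_def)
  have "fst p \<bullet> X1 = 0" using x1 by (simp add: X1_def \<rho>_def inner_add_right)
  moreover have "X1 \<bullet> snd p + fst p \<bullet> X2 = 0" using x1 by (simp add: X2_def \<kappa>_def inner_simps)
  ultimately have T: "(X1, X2) \<in> tangent_vectors \<Sigma> p" unfolding tangent [OF pS] by (simp add: FDcX)
  have om0: "om 0 p (X1, X2) = a" by (simp add: om_def \<mu>X1)
  have omi: "om i p (X1, X2) = \<beta> i" and thi: "th 0 i p (X1, X2) = \<gamma> i" if i: "i \<in> {1..n}" for i
  proof -
    have "\<epsilon> i p X1 = \<beta> i"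
      by (simp only: X1_def \<epsilon>add \<epsilon>sc \<epsilon>E [OF i] \<epsilon>_fst [OF pW] \<epsilon>_q [OF pW]) simp
    then show "om i p (X1, X2) = \<beta> i" using i by (simp add: om_def)
    have "\<epsilon> i p Q = - \<gamma> i"
      by (simp only: Q_def \<epsilon>add \<epsilon>diff \<epsilon>sc \<epsilon>E [OF i] \<epsilon>_fst [OF pW] \<epsilon>_q [OF pW]) simp
    then show "th 0 i p (X1, X2) = \<gamma> i" by (simp add: th_def QX)
  qed
  show ?thesis
  proof (rule ex1I [of _ "(X1, X2)"])
    show "(X1, X2) \<in> tangent_vectors \<Sigma> p \<and> om 0 p (X1, X2) = a \<and>
      (\<forall>i\<in>{1..n}. om i p (X1, X2) = \<beta> i \<and> th 0 i p (X1, X2) = \<gamma> i)"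
      using T om0 omi thi by blast
    fix Y assume Y: "Y \<in> tangent_vectors \<Sigma> p \<and> om 0 p Y = a \<and>
      (\<forall>i\<in>{1..n}. om i p Y = \<beta> i \<and> th 0 i p Y = \<gamma> i)"
    then have YT: "Y \<in> tangent_vectors \<Sigma> p" by blast
    define D where "D = Y - (X1, X2)"
    have lc: "linear (FD c p)" using linear_frechet_derivative [OF c_diff [OF pN]] .
    have D: "fst p \<bullet> fst D = 0" "fst D \<bullet> snd p + fst p \<bullet> snd D = 0" "Im (FD c p D) = 0"
      using tangent_D [OF pS YT] tangent_D [OF pS T] by (simp_all add: D_def inner_simps linear_diff [OF lc])
    have om: "om i p D = 0" if "i \<in> {0..n}" for i
    proof (cases "i = 0")
      case True
      then show ?thesis using Y om0 by (simp add: D_def linear_diff [OF linear_om [OF pW]])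
    next
      case False
      then have "i \<in> {1..n}" using that by simp
      then show ?thesis using Y omi [of i] by (simp add: D_def linear_diff [OF linear_om [OF pW]])
    qed
    have th: "th 0 i p D = 0" if "i \<in> {1..n}" for i
      using Y thi [OF that] that by (simp add: D_def linear_diff [OF linear_th [OF _ that pW]])
    define r where "r = Re (\<mu> p (fst D))"
    have e1: "fst D = r *\<^sub>R fst p"
    proof -
      have "(\<Sum>i=1..n. \<epsilon> i p (fst D) *\<^sub>R e i p) = 0"
      proof (rule sum.neutral, rule ballI)
        fix i assume "i \<in> {1..n}"
        then show "\<epsilon> i p (fst D) *\<^sub>R e i p = 0" using om [of i] by (simp add: om_def)
      qed
      then show ?thesis using expand [OF p, of "fst D"] om [of 0] by (simp add: om_def r_def)
    qed
    then have "r = 0" using D(1) x1 by simp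
    then have d1: "fst D = 0" using e1 by simp
    have "\<mu> p (FD q p D) = 0" using \<mu>_FD_q [OF pS D(3)] linear_0 [OF linear_\<mu> [OF pN]] d1 by simp
    moreover have "(\<Sum>i=1..n. \<epsilon> i p (FD q p D) *\<^sub>R e i p) = 0"
    proof (rule sum.neutral, rule ballI)
      fix i assume "i \<in> {1..n}"
      then show "\<epsilon> i p (FD q p D) *\<^sub>R e i p = 0" using th [of i] by (simp add: th_def)
    qed
    ultimately have "FD q p D = 0" using expand [OF p, of "FD q p D"] by simp
    then have e2: "snd D = - Re (FD c p D) *\<^sub>R fst p"
      using FD_q [OF pN, of D] d1 by (simp add: eq_neg_iff_add_eq_0)
    then have "Re (FD c p D) = 0" using D(2) d1 x1 by simp
    then have "snd D = 0" using e2 by simp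
    then show "Y = (X1, X2)" using d1 by (simp add: D_def prod_eq_iff)
  qed
qed

lemma coframing: "finsler_coframing n \<Sigma> W \<omega> \<theta>"
  unfolding finsler_coframing_def represents_hilbert_form_def
proof (intro conjI ballI allI)
  show "open W" by (rule open_W)
  show "smooth_on W (\<omega> 0)" by (rule smooth_on_form [OF open_W smooth_om]) simp
  show "blinfun_apply (\<omega> 0 p) X = hilbert_form \<Sigma> p X" if "p \<in> \<Sigma> \<inter> W" for p X
    using that hilbert [of p X] by (simp add: \<omega>_apply om_def)
  show "smooth_on W (\<omega> i)" "smooth_on W (\<theta> 0 i)" if "i \<in> {1..n}" for i
    using that by (auto intro!: smooth_on_form open_W smooth_om smooth_th)
  show "\<exists>!X. X \<in> tangent_vectors \<Sigma> p \<and> blinfun_apply (\<omega> 0 p) X = a \<and>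
      (\<forall>i\<in>{1..n}. blinfun_apply (\<omega> i p) X = \<beta> i \<and> blinfun_apply (\<theta> 0 i p) X = \<gamma> i)"
    if p: "p \<in> \<Sigma> \<inter> W" for p a \<beta> \<gamma>
  proof -
    have "p \<in> W" using p by blast
    then have "(X \<in> tangent_vectors \<Sigma> p \<and> blinfun_apply (\<omega> 0 p) X = a \<and>
      (\<forall>i\<in>{1..n}. blinfun_apply (\<omega> i p) X = \<beta> i \<and> blinfun_apply (\<theta> 0 i p) X = \<gamma> i)) \<longleftrightarrow>
      (X \<in> tangent_vectors \<Sigma> p \<and> om 0 p X = a \<and> (\<forall>i\<in>{1..n}. om i p X = \<beta> i \<and> th 0 i p X = \<gamma> i))" for X
      by (simp add: \<omega>_apply \<theta>_apply)
    then show ?thesis using coframe [OF p, of a \<beta> \<gamma>] by simp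
  qed
  show "case p of (x, y) \<Rightarrow> \<forall>i\<in>{0..n}. \<forall>w\<in>tangent_vectors (fibre \<Sigma> x) y. blinfun_apply (\<omega> i (x, y)) (0, w) = 0"
    if p: "p \<in> \<Sigma> \<inter> W" for p
  proof -
    have pW: "p \<in> W" using p by blast
    have "om i p (0, w) = 0" for i w
      using linear_0 [OF linear_\<mu> [OF W_N [OF pW]]] linear_0 [OF linear_\<epsilon> [OF pW]] by (simp add: om_def)
    then show ?thesis using \<omega>_apply [OF pW] by (auto split: prod.split)
  qed
qed

lemma connection: "finsler_connection n \<Sigma> W \<omega> \<theta> I"
  unfolding finsler_connection_def
proof (intro conjI ballI)
  show "smooth_on W (\<theta> i j)" if "i \<in> {1..n}" "j \<in> {1..n}" for i j
    using that by (auto intro!: smooth_on_form open_W smooth_th)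
  fix p assume p: "p \<in> \<Sigma> \<inter> W"
  then have pS: "p \<in> \<Sigma>" and pW: "p \<in> W" and pN: "p \<in> N" using WN by auto
  show "blinfun_apply (\<theta> i j p) X = - blinfun_apply (\<theta> j i p) X" if "i \<in> {1..n}" "j \<in> {1..n}" for i j X
    using that by (simp add: \<theta>_apply [OF _ _ pW] th_def field_simps)
  show "I p i j k = I p j i k" "I p i j k = I p i k j" for i j k using IJ_sym [OF pN] by blast+
  fix X Y assume "X \<in> tangent_vectors \<Sigma> p" "Y \<in> tangent_vectors \<Sigma> p"
  then have XY: "Im (FD c p X) = 0" "Im (FD c p Y) = 0" using tangent_D [OF pS] by blast+
  show "ext_deriv (\<omega> 0) p X Y = - (\<Sum>j=1..n. wedge (\<theta> 0 j p) (\<omega> j p) X Y)" by (rule d_\<omega>0 [OF p])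
  show "ext_deriv (\<omega> i) p X Y = wedge (\<theta> 0 i p) (\<omega> 0 p) X Y
              - (\<Sum>j=1..n. wedge (\<theta> i j p) (\<omega> j p) X Y)
              - (\<Sum>j=1..n. \<Sum>k=1..n. I p i j k * wedge (\<theta> 0 k p) (\<omega> j p) X Y)" if "i \<in> {1..n}" for i
    by (rule d_\<omega> [OF that p XY])
qed

text \<open>One formula covers both families of coefficients: with third index 0 it gives the
  identity matrix, and with positive third index it gives 0, matching the absence of such terms in
  \<open>d_\<theta>\<close>.\<close>

lemma curvature:
  "finsler_curvature n \<Sigma> W \<omega> \<theta> (\<lambda>p h i j k. if j = 0 \<and> i = k then 1 else 0) J"
  unfolding finsler_curvature_def
proof (intro conjI ballI)
  fix p assume p: "p \<in> \<Sigma> \<inter> W"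
  then have pS: "p \<in> \<Sigma>" and pN: "p \<in> N" using WN by auto
  show "J p i j k = J p j i k" for i j k using IJ_sym(3) [OF pN] .
  fix X Y i assume XY: "X \<in> tangent_vectors \<Sigma> p" "Y \<in> tangent_vectors \<Sigma> p" and i: "i \<in> {1..n}"
  have "(\<Sum>j=1..n. (if 0 = (0::nat) \<and> i = j then 1 else 0) * wedge (\<omega> 0 p) (\<omega> j p) X Y)
      = (\<Sum>j=1..n. if i = j then wedge (\<omega> 0 p) (\<omega> j p) X Y else 0)"
    by (rule sum.cong) auto
  also have "\<dots> = wedge (\<omega> 0 p) (\<omega> i p) X Y" using i by (subst sum.delta') auto
  finally have 1: "(\<Sum>j=1..n. (if 0 = (0::nat) \<and> i = j then 1 else 0) * wedge (\<omega> 0 p) (\<omega> j p) X Y)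
      = wedge (\<omega> 0 p) (\<omega> i p) X Y" .
  have 2: "(\<Sum>j=1..n. \<Sum>k=1..n. (if j = 0 \<and> i = k then 1 else 0) * wedge (\<omega> j p) (\<omega> k p) X Y) = 0"
    by (intro sum.neutral ballI) auto
  show "ext_deriv (\<theta> 0 i) p X Y = - (\<Sum>j=1..n. wedge (\<theta> 0 j p) (\<theta> j i p) X Y)
     + (\<Sum>j=1..n. (if 0 = (0::nat) \<and> i = j then 1 else 0) * wedge (\<omega> 0 p) (\<omega> j p) X Y)
     + 1/2 * (\<Sum>j=1..n. \<Sum>k=1..n. (if j = 0 \<and> i = k then 1 else 0) * wedge (\<omega> j p) (\<omega> k p) X Y)
     + (\<Sum>j=1..n. \<Sum>k=1..n. J p i j k * wedge (\<theta> 0 k p) (\<omega> j p) X Y)"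
    unfolding 1 2 using d_\<theta> [OF i p] tangent_D(3) [OF pS] XY by simp
qed auto

text \<open>Contraction with the differential of \<omega> 0 pairs the \<theta> components of the
  vector with \<omega> and conversely, so testing against the dual vectors from
  \<open>coframe\<close> makes all of them vanish. The variations of \<open>x\<close> and
  \<open>q\<close> are then left with components along \<open>x\<close> and \<open>q\<close>, which
  \<mu> determines.\<close>

lemma reeb:
  assumes p: "p \<in> \<Sigma> \<inter> W" and X: "reeb_vector \<Sigma> p X"
  shows "fst X = Re (\<mu> p (fst X)) *\<^sub>R fst p + q p"
    and "FD q p X = - fst p + Re (\<mu> p (fst X)) *\<^sub>R q p"
proof -
  have pS: "p \<in> \<Sigma>" and pW: "p \<in> W" and pN: "p \<in> N" using p WN by auto
  obtain W' \<alpha> where XT: "X \<in> tangent_vectors \<Sigma> p" and X1: "hilbert_form \<Sigma> p X = 1"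
    and W': "p \<in> W'" "represents_hilbert_form \<Sigma> W' \<alpha>"
    and z: "\<And>Y. Y \<in> tangent_vectors \<Sigma> p \<Longrightarrow> ext_deriv \<alpha> p X Y = 0"
    using X unfolding reeb_vector_def by blast
  have W'o: "open W'" "smooth_on W' \<alpha>"
    and W'h: "\<And>z Y. z \<in> \<Sigma> \<inter> W' \<Longrightarrow> Y \<in> tangent_vectors \<Sigma> z \<Longrightarrow> blinfun_apply (\<alpha> z) Y = hilbert_form \<Sigma> z Y"
    using W'(2) unfolding represents_hilbert_form_def by blast+
  obtain M R where MR: "smooth_retract \<Sigma> M R" "p \<in> M" by (rule retraction [OF pS]) (rule that; assumption)
  have sm: "smooth_on (W' \<inter> W) \<alpha>" "smooth_on (W' \<inter> W) (\<omega> 0)"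
    by (rule smooth_on_subset [OF W'o(2)], blast)
       (rule smooth_on_subset [OF smooth_on_form [OF open_W smooth_om]], auto)
  \<comment> \<open>The definition of a Reeb vector admits any ambient form \<alpha> that restricts
    to the Hilbert form; on tangent vectors its exterior derivative is that of \<omega> 0.\<close>
  have "ext_deriv \<alpha> p X Y = ext_deriv (\<omega> 0) p X Y" if "Y \<in> tangent_vectors \<Sigma> p" for Y
  proof (rule smooth_retract.ext_deriv_cong [OF MR(1) _ _ _ sm _ XT that])
    show "blinfun_apply (\<alpha> z) Y = blinfun_apply (\<omega> 0 z) Y"
      if "z \<in> \<Sigma> \<inter> (W' \<inter> W)" "Y \<in> tangent_vectors \<Sigma> z" for z Y
      using W'h [of z Y] that hilbert [of z Y] \<omega>_apply [of z 0 Y] by (simp add: om_def)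
  qed (use pS MR(2) W'o W' open_W pW in auto)
  then have d0: "(\<Sum>j=1..n. th 0 j p X * om j p Y - th 0 j p Y * om j p X) = 0"
    if "Y \<in> tangent_vectors \<Sigma> p" for Y
    using z [OF that] that d_\<omega>0 [OF p, of X Y]
    by (simp add: wedge_def \<theta>_apply [OF _ _ pW] \<omega>_apply [OF pW] cong: sum.cong_simp)
  have th: "th 0 k p X = 0" if k: "k \<in> {1..n}" for k
  proof -
    obtain Y where Y: "Y \<in> tangent_vectors \<Sigma> p"
        "\<forall>i\<in>{1..n}. om i p Y = (if i = k then 1 else 0) \<and> th 0 i p Y = 0"
      using ex1_implies_ex [OF coframe [OF p, of 0 "\<lambda>i. if i = k then 1 else 0" "\<lambda>i. 0"]] by blast
    have "(\<Sum>j=1..n. th 0 j p X * om j p Y - th 0 j p Y * om j p X) = (\<Sum>j=1..n. if j = k then th 0 j p X else 0)"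
      using Y(2) by (intro sum.cong) auto
    then show ?thesis using d0 [OF Y(1)] k by simp
  qed
  have om: "om k p X = 0" if k: "k \<in> {1..n}" for k
  proof -
    obtain Y where Y: "Y \<in> tangent_vectors \<Sigma> p"
        "\<forall>i\<in>{1..n}. om i p Y = 0 \<and> th 0 i p Y = (if i = k then 1 else 0)"
      using ex1_implies_ex [OF coframe [OF p, of 0 "\<lambda>i. 0" "\<lambda>i. if i = k then 1 else 0"]] by blast
    have "(\<Sum>j=1..n. th 0 j p X * om j p Y - th 0 j p Y * om j p X) = (\<Sum>j=1..n. if j = k then - om j p X else 0)"
      using Y(2) by (intro sum.cong) auto
    then show ?thesis using d0 [OF Y(1)] k by simp
  qed
  have i1: "Im (\<mu> p (fst X)) = 1" using X1 hilbert [OF pS] by simp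
  have "(\<Sum>i=1..n. \<epsilon> i p (fst X) *\<^sub>R e i p) = 0"
    by (intro sum.neutral ballI) (use om in \<open>force simp: om_def\<close>)
  then show "fst X = Re (\<mu> p (fst X)) *\<^sub>R fst p + q p" using expand [OF p, of "fst X"] i1 by simp
  have "(\<Sum>i=1..n. \<epsilon> i p (FD q p X) *\<^sub>R e i p) = 0"
    by (intro sum.neutral ballI) (use th in \<open>force simp: th_def\<close>)
  then show "FD q p X = - fst p + Re (\<mu> p (fst X)) *\<^sub>R q p"
    using expand [OF p, of "FD q p X"] \<mu>_FD_q [OF pS tangent_D(3) [OF pS XT]] i1 by simp
qed

end

section \<open>Existence of adapted frames\<close>

context funk
begin

text \<open>Gram-Schmidt orthonormalization with respect to the vertical Hessian. A vector to be added to
  the frame is a common zero of fewer than \<open>DIM('a)\<close> linear functionals.\<close>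

lemma partial_frame:
  assumes p0: "p0 \<in> N" and Fp0: "Im (c p0) \<noteq> 0" and dim: "DIM('a) = n + 2"
    and pos: "\<And>h. \<mu> p0 h = 0 \<Longrightarrow> h \<noteq> 0 \<Longrightarrow> Im (b p0 h h) > 0" and k: "k \<le> n"
  shows "\<exists>W e. open W \<and> p0 \<in> W \<and> W \<subseteq> N \<and> (\<forall>i\<in>{1..k}. smooth_on W (e i)) \<and>
    (\<forall>p\<in>W. Im (c p) \<noteq> 0 \<and> (\<forall>i\<in>{1..k}. \<mu> p (e i p) = 0 \<and>
      (\<forall>j\<in>{1..k}. Im (b p (e i p) (e j p)) = (if i = j then 1 else 0))))"
  using k
proof (induction k)
  case 0
  have "open (N \<inter> (\<lambda>p. Im (c p)) -` (- {0}))"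
    by (intro continuous_open_preimage smooth_on_continuous_on smooth_on_Im smooth_c open_N) auto
  then show ?case using p0 Fp0
    by (intro exI [of _ "N \<inter> (\<lambda>p. Im (c p)) -` (- {0})"] exI [of _ "\<lambda>i p. 0"]) auto
next
  case (Suc k)
  from Suc.IH [OF Suc_leD [OF Suc.prems]]
  obtain W e where W: "open W" "p0 \<in> W" "W \<subseteq> N"
    and sm: "\<And>i. i \<in> {1..k} \<Longrightarrow> smooth_on W (e i)"
    and Fp: "\<And>p. p \<in> W \<Longrightarrow> Im (c p) \<noteq> 0"
    and \<mu>e: "\<And>i p. i \<in> {1..k} \<Longrightarrow> p \<in> W \<Longrightarrow> \<mu> p (e i p) = 0"
    and on: "\<And>i j p. i \<in> {1..k} \<Longrightarrow> j \<in> {1..k} \<Longrightarrow> p \<in> W \<Longrightarrow> Im (b p (e i p) (e j p)) = (if i = j then 1 else 0)"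
    by blast
  have WN: "p \<in> N" if "p \<in> W" for p using that W by blast
  obtain f where f: "bij_betw f {..<n + 2} (Basis :: 'a set)"
    using ex_bij_betw_nat_finite [OF finite_Basis, where 'a1 = 'a] dim by (auto simp: atLeast0LessThan)
  have fB: "f i \<in> Basis" if "i < n + 2" for i using f that by (auto simp: bij_betw_def)
  have ff: "f i \<bullet> f j = (if i = j then 1 else 0)" if "i < n + 2" "j < n + 2" for i j
    using that inj_onD [OF bij_betw_imp_inj_on [OF f], of i j] by (auto simp: inner_Basis fB)
  \<comment> \<open>The functionals that the new vector has to annihilate, attached to distinct
    basis vectors. As \<open>Suc k \<le> n\<close>, the vector \<open>f (Suc k)\<close> is not among
    these, so \<open>A\<close> is not onto and has a nonzero kernel vector \<open>r\<close>.\<close>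
  define A where "A = (\<lambda>h. Re (\<mu> p0 h) *\<^sub>R f 0 + Im (\<mu> p0 h) *\<^sub>R f (Suc n) + (\<Sum>i=1..k. Im (b p0 (e i p0) h) *\<^sub>R f i))"
  have linA: "linear A"
    unfolding A_def using linear_\<mu> [OF p0] linear_b [OF p0]
    by (intro linearI) (simp_all add: linear_add linear_scale algebra_simps sum.distrib scaleR_sum_right)
  have "\<not> surj A"
  proof
    assume "surj A"
    then obtain h where "f (Suc k) = A h" by (metis surjD)
    then have "1 = A h \<bullet> f (Suc k)" using ff [of "Suc k" "Suc k"] Suc.prems by simp
    also have "\<dots> = 0"
      using Suc.prems by (simp add: A_def inner_simps inner_sum_left ff)
    finally show False by simp
  qed
  then have "\<not> inj A" using linear_injective_imp_surjective [OF linA] by blast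
  then obtain r where r: "A r = 0" "r \<noteq> 0" using linear_injective_0 [OF linA] by blast
  have r0: "A r \<bullet> f j = 0" for j using r by simp
  have \<mu>r: "\<mu> p0 r = 0"
    using r0 [of 0] r0 [of "Suc n"] Suc.prems
    by (simp add: A_def inner_simps inner_sum_left ff complex_eq_iff)
  have br: "Im (b p0 (e i p0) r) = 0" if "i \<in> {1..k}" for i
  proof -
    have "(\<Sum>j=1..k. Im (b p0 (e j p0) r) * (f j \<bullet> f i)) = (\<Sum>j=1..k. if j = i then Im (b p0 (e j p0) r) else 0)"
      using that Suc.prems by (intro sum.cong) (auto simp: ff)
    then show ?thesis using r0 [of i] that Suc.prems by (simp add: A_def inner_simps inner_sum_left ff)
  qed
  \<comment> \<open>Projects \<open>r\<close> along \<open>x\<close> and \<open>y\<close> to the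
    kernel of \<mu> at \<open>p\<close>; the coefficients come from \<open>\<mu> (x) = 1\<close>,
    \<open>\<mu> (y) = - c\<close> and \<open>Im c \<noteq> 0\<close>. At \<open>p0\<close> nothing
    changes, so positivity at \<open>r\<close> persists nearby.\<close>
  define \<pi> where "\<pi> = (\<lambda>p. r - (Re (\<mu> p r) - Im (\<mu> p r) / Im (c p) * Re (c p)) *\<^sub>R fst p + (Im (\<mu> p r) / Im (c p)) *\<^sub>R snd p)"
  define u where "u = (\<lambda>p. \<pi> p - (\<Sum>i=1..k. Im (b p (e i p) (\<pi> p)) *\<^sub>R e i p))"
  define g where "g = (\<lambda>p. Im (b p (u p) (u p)))"
  have smc: "smooth_on W c" and sm\<mu>: "smooth_on W (\<lambda>p. \<mu> p h)" and smb: "smooth_on W (\<lambda>p. b p h l)" for h l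
    using smooth_on_subset [OF smooth_c W(3)] smooth_on_subset [OF smooth_\<mu> W(3)] smooth_on_subset [OF smooth_b W(3)] by blast+
  have sm\<pi>: "smooth_on W \<pi>" unfolding \<pi>_def
    by (intro smooth_on_add smooth_on_diff smooth_on_scaleR smooth_on_const smooth_on_fst smooth_on_snd
        smooth_on_mult smooth_on_divide smooth_on_Re smooth_on_Im W(1) smc sm\<mu> Fp)
  have smbb: "smooth_on W (\<lambda>p. Im (b p (h p) (l p)))" if "smooth_on W h" "smooth_on W l" for h l
  proof -
    have "smooth_on W (\<lambda>z. b z m (l z))" for m
      by (rule linear_family(1) [of W "\<lambda>z. b z m" l]) (use W that WN smb linear_b in auto)
    moreover have "linear (\<lambda>m. b z m (l z))" if "z \<in> W" for z by (rule linear_b' [OF WN [OF that]])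
    ultimately have "smooth_on W (\<lambda>z. b z (h z) (l z))"
      using linear_family(1) [of W "\<lambda>z m. b z m (l z)" h] W(1) that by blast
    then show ?thesis by (rule smooth_on_Im [OF W(1)])
  qed
  have smu: "smooth_on W u" unfolding u_def
    by (intro smooth_on_diff smooth_on_sum smooth_on_scaleR W(1) sm sm\<pi> smbb)
  have smg: "smooth_on W g" unfolding g_def by (rule smbb [OF smu smu])
  have \<mu>\<pi>: "\<mu> p (\<pi> p) = 0" if "p \<in> W" for p
    using Fp [OF that]
    by (simp add: \<pi>_def linear_add [OF linear_\<mu> [OF WN [OF that]]] linear_diff [OF linear_\<mu> [OF WN [OF that]]]
        linear_scale [OF linear_\<mu> [OF WN [OF that]]] \<mu>_fst [OF WN [OF that]] \<mu>_snd [OF WN [OF that]] complex_eq_iff)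
  have \<mu>u: "\<mu> p (u p) = 0" if "p \<in> W" for p
    by (simp add: u_def \<mu>\<pi> [OF that] linear_diff [OF linear_\<mu> [OF WN [OF that]]] linear_sum [OF linear_\<mu> [OF WN [OF that]]]
        linear_scale [OF linear_\<mu> [OF WN [OF that]]] \<mu>e [OF _ that])
  have bu: "Im (b p (e j p) (u p)) = 0" if "j \<in> {1..k}" "p \<in> W" for j p
  proof -
    have "(\<Sum>i=1..k. Im (b p (e i p) (\<pi> p)) * Im (b p (e j p) (e i p))) = (\<Sum>i=1..k. if i = j then Im (b p (e i p) (\<pi> p)) else 0)"
      using on [OF that(1) _ that(2)] by (intro sum.cong) auto
    then show ?thesis using that(1)
      by (simp add: u_def linear_diff [OF linear_b [OF WN [OF that(2)]]] linear_sum [OF linear_b [OF WN [OF that(2)]]]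
        linear_scale [OF linear_b [OF WN [OF that(2)]]])
  qed
  have up0: "u p0 = r"
  proof -
    have "\<pi> p0 = r" by (simp add: \<pi>_def \<mu>r)
    then show ?thesis by (simp add: u_def br)
  qed
  define V where "V = W \<inter> g -` {0<..}"
  have oV: "open V" unfolding V_def
    by (rule continuous_open_preimage [OF smooth_on_continuous_on [OF smg] W(1)]) auto
  have VW: "V \<subseteq> W" by (auto simp: V_def)
  have gV: "g p > 0" if "p \<in> V" for p using that by (simp add: V_def)
  have p0V: "p0 \<in> V" using W(2) pos [OF \<mu>r r(2)] up0 by (simp add: V_def g_def)
  define e' where "e' = e(Suc k := (\<lambda>p. inverse (sqrt (g p)) *\<^sub>R u p))"
  have e'S: "e' (Suc k) p = inverse (sqrt (g p)) *\<^sub>R u p" and e'i: "i \<in> {1..k} \<Longrightarrow> e' i p = e i p" for i p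
    by (auto simp: e'_def)
  have "smooth_on V (e' i)" if "i \<in> {1..Suc k}" for i
  proof (cases "i = Suc k")
    case True
    have "smooth_on V (\<lambda>p. inverse (sqrt (g p)) *\<^sub>R u p)"
      using gV by (intro smooth_on_scaleR smooth_on_inverse smooth_on_sqrt oV smooth_on_subset [OF smg VW]
          smooth_on_subset [OF smu VW]) (auto simp: less_imp_neq dest: gV)
    then show ?thesis using True by (simp add: e'_def)
  next
    case False
    then have "i \<in> {1..k}" using that by auto
    then show ?thesis using smooth_on_subset [OF sm VW] False by (simp add: e'_def)
  qed
  moreover have "\<mu> p (e' i p) = 0" if "i \<in> {1..Suc k}" "p \<in> V" for i p
  proof -
    have pW: "p \<in> W" using that VW by blast
    show ?thesis
    proof (cases "i = Suc k")
      case True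
      then show ?thesis using \<mu>u [OF pW] by (simp add: e'S linear_scale [OF linear_\<mu> [OF WN [OF pW]]])
    next
      case False
      then show ?thesis using \<mu>e [OF _ pW, of i] that e'i [of i p] by simp
    qed
  qed
  moreover have "Im (b p (e' i p) (e' j p)) = (if i = j then 1 else 0)"
    if "i \<in> {1..Suc k}" "j \<in> {1..Suc k}" "p \<in> V" for i j p
  proof -
    have pW: "p \<in> W" and pN: "p \<in> N" using that VW WN by blast+
    have 1: "Im (b p (e' i p) (e' (Suc k) p)) = 0" if "i \<in> {1..k}" for i
      using bu [OF that pW] e'i [OF that] by (simp add: e'S linear_scale [OF linear_b [OF pN]])
    have 2: "Im (b p (e' (Suc k) p) (e' (Suc k) p)) = 1"
    proof -
      have "Im (b p (e' (Suc k) p) (e' (Suc k) p)) = inverse (sqrt (g p)) * (inverse (sqrt (g p)) * g p)"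
        by (simp add: e'S linear_scale [OF linear_b [OF pN]] linear_scale [OF linear_b' [OF pN]] g_def)
      also have "\<dots> = 1"
        using gV [OF that(3)] by (simp add: field_simps)
      finally show ?thesis .
    qed
    have 3: "Im (b p (e' (Suc k) p) (e' i p)) = 0" if "i \<in> {1..k}" for i
      using 1 [OF that] b_sym [OF pN] by simp
    show ?thesis
    proof (cases "i = Suc k")
      case True
      then show ?thesis using 2 3 [of j] that by (cases "j = Suc k") auto
    next
      case False
      then have i: "i \<in> {1..k}" using that by auto
      show ?thesis
      proof (cases "j = Suc k")
        case True
        then show ?thesis using 1 [OF i] False by simp
      next
        case False
        then have j: "j \<in> {1..k}" using that by auto
        show ?thesis unfolding e'i [OF i] e'i [OF j] by (rule on [OF i j pW])
      qed
    qed
  qed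
  ultimately show ?case using oV p0V VW W(3) Fp
    by (intro exI [of _ V] exI [of _ e']) blast
qed

text \<open>Since \<open>Im c \<noteq> 0\<close>, \<mu> maps \<open>x\<close> and \<open>y\<close>
  to independent complex numbers, so \<open>x\<close>, \<open>y\<close> and \<open>n\<close>
  orthonormal vectors of the kernel are independent. In dimension \<open>n + 2\<close> they span,
  and hence the frame spans the kernel.\<close>

lemma frame_exists:
  assumes p0: "p0 \<in> N" and Fp0: "Im (c p0) \<noteq> 0" and dim: "DIM('a) = n + 2"
    and pos: "\<And>h. \<mu> p0 h = 0 \<Longrightarrow> h \<noteq> 0 \<Longrightarrow> Im (b p0 h h) > 0"
  obtains W e where "p0 \<in> W" "funk_frame N c W e n"
proof -
  have "\<exists>W e. open W \<and> p0 \<in> W \<and> W \<subseteq> N \<and> (\<forall>i\<in>{1..n}. smooth_on W (e i)) \<and>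
    (\<forall>p\<in>W. Im (c p) \<noteq> 0 \<and> (\<forall>i\<in>{1..n}. \<mu> p (e i p) = 0 \<and>
      (\<forall>j\<in>{1..n}. Im (b p (e i p) (e j p)) = (if i = j then 1 else 0))))"
    by (rule partial_frame [OF p0 Fp0 dim _ order.refl]) (rule pos)
  then obtain W e where W: "open W" "p0 \<in> W" "W \<subseteq> N"
    and sm: "\<And>i. i \<in> {1..n} \<Longrightarrow> smooth_on W (e i)"
    and Fp: "\<And>p. p \<in> W \<Longrightarrow> Im (c p) \<noteq> 0"
    and \<mu>e: "\<And>i p. i \<in> {1..n} \<Longrightarrow> p \<in> W \<Longrightarrow> \<mu> p (e i p) = 0"
    and on: "\<And>i j p. i \<in> {1..n} \<Longrightarrow> j \<in> {1..n} \<Longrightarrow> p \<in> W \<Longrightarrow> Im (b p (e i p) (e j p)) = (if i = j then 1 else 0)"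
    by blast
  obtain f where f: "bij_betw f {..<n + 2} (Basis :: 'a set)"
    using ex_bij_betw_nat_finite [OF finite_Basis, where 'a1 = 'a] dim by (auto simp: atLeast0LessThan)
  have complete: "h = (\<Sum>i=1..n. Im (b p (e i p) h) *\<^sub>R e i p)" if p: "p \<in> W" and h: "\<mu> p h = 0" for p h
  proof -
    have pN: "p \<in> N" using p W by blast
    define A where "A = (\<lambda>h. (h \<bullet> f 0) *\<^sub>R fst p + (h \<bullet> f (Suc n)) *\<^sub>R snd p + (\<Sum>i=1..n. (h \<bullet> f i) *\<^sub>R e i p))"
    have linA: "linear A"
      unfolding A_def by (intro linearI) (simp_all add: inner_simps algebra_simps sum.distrib scaleR_sum_right)
    have \<mu>A: "\<mu> p (A h) = of_real (h \<bullet> f 0) - of_real (h \<bullet> f (Suc n)) * c p" for h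
      by (simp add: A_def linear_add [OF linear_\<mu> [OF pN]] linear_scale [OF linear_\<mu> [OF pN]] linear_sum [OF linear_\<mu> [OF pN]]
          \<mu>_fst [OF pN] \<mu>_snd [OF pN] \<mu>e [OF _ p] scaleR_conv_of_real)
    have bA: "Im (b p (e j p) (A h)) = h \<bullet> f j" if "j \<in> {1..n}" for j h
    proof -
      have "(\<Sum>i=1..n. (h \<bullet> f i) * Im (b p (e j p) (e i p))) = (\<Sum>i=1..n. if i = j then h \<bullet> f i else 0)"
        using on [OF that _ p] by (intro sum.cong) auto
      then show ?thesis using that
        by (simp add: A_def linear_add [OF linear_b [OF pN]] linear_scale [OF linear_b [OF pN]] linear_sum [OF linear_b [OF pN]]
          b_fst [OF pN] b_snd [OF pN])
    qed
    have \<mu>A0: "h \<bullet> f 0 = 0 \<and> h \<bullet> f (Suc n) = 0" if "\<mu> p (A h) = 0" for h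
      using that Fp [OF p] unfolding \<mu>A by (simp add: complex_eq_iff)
    have "inj A"
      unfolding linear_injective_0 [OF linA]
    proof (intro allI impI)
      fix h assume h: "A h = 0"
      then have 0: "h \<bullet> f 0 = 0" "h \<bullet> f (Suc n) = 0" using \<mu>A0 [of h] linear_0 [OF linear_\<mu> [OF pN]] by auto
      have 1: "h \<bullet> f j = 0" if "j \<in> {1..n}" for j using bA [OF that, of h] h linear_0 [OF linear_b [OF pN]] by simp
      have "h \<bullet> f j = 0" if "j < n + 2" for j
      proof -
        have "j = 0 \<or> j = Suc n \<or> j \<in> {1..n}" using that by auto
        then show ?thesis using 0 1 by auto
      qed
      then have "h \<bullet> b = 0" if "b \<in> Basis" for b
        using f that by (auto simp: bij_betw_def image_iff) (metis imageE lessThan_iff)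
      then show "h = 0" by (metis euclidean_all_zero_iff)
    qed
    then have "surj A" by (rule linear_injective_imp_surjective [OF linA]) simp
    then obtain g where g: "h = A g" by (metis surjD)
    have "g \<bullet> f 0 = 0" "g \<bullet> f (Suc n) = 0" using \<mu>A0 [of g] h g by auto
    then have "h = (\<Sum>i=1..n. (g \<bullet> f i) *\<^sub>R e i p)" by (simp add: g A_def)
    also have "\<dots> = (\<Sum>i=1..n. Im (b p (e i p) h) *\<^sub>R e i p)"
      using bA by (intro sum.cong) (auto simp: g)
    finally show ?thesis .
  qed
  have "funk_frame N c W e n"
    by unfold_locales (use W sm \<mu>e on complete in blast)+
  with W(2) show thesis by (rule that)
qed

end

section \<open>Curvature and geodesics under convexity\<close>

locale convex_funk = funk +
  fixes n :: nat
  assumes dim: "DIM('a) = n + 2"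
    and pos: "\<And>p h. p \<in> \<Sigma> \<Longrightarrow> \<mu> p h = 0 \<Longrightarrow> h \<noteq> 0 \<Longrightarrow> Im (b p h h) > 0"
begin

lemma frame:
  assumes "p \<in> \<Sigma>"
  obtains W e where "p \<in> W" "funk_frame N c W e n"
proof (rule frame_exists [OF \<Sigma>_N [OF assms] _ dim])
  show "Im (c p) \<noteq> 0" using assms by (simp add: \<Sigma>_def)
qed (use pos [OF assms] that in blast)+

lemma curvature_one: "constant_flag_curvature n \<Sigma> 1"
  unfolding constant_flag_curvature_def
proof
  fix p assume "p \<in> \<Sigma>"
  then obtain W e where W: "p \<in> W" "funk_frame N c W e n" by (rule frame)
  interpret f: funk_frame N c W e n by fact
  show "\<exists>W \<omega> \<theta> I R J. p \<in> W \<and> finsler_coframing n \<Sigma> W \<omega> \<theta> \<and>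
        finsler_connection n \<Sigma> W \<omega> \<theta> I \<and> finsler_curvature n \<Sigma> W \<omega> \<theta> R J \<and>
        (\<forall>q\<in>\<Sigma> \<inter> W. \<forall>i\<in>{1..n}. \<forall>j\<in>{1..n}. R q 0 i 0 j = (if i = j then 1 else 0))"
    by (intro exI conjI, rule W(1), rule f.coframing, rule f.connection, rule f.curvature) simp
qed

lemma reeb_vector_eqs:
  assumes X: "reeb_vector \<Sigma> p X"
  shows "fst X = Re (\<mu> p (fst X)) *\<^sub>R fst p + q p"
    and "FD q p X = - fst p + Re (\<mu> p (fst X)) *\<^sub>R q p"
proof -
  have p: "p \<in> \<Sigma>" using X by (simp add: reeb_vector_def)
  then obtain W e where W: "p \<in> W" "funk_frame N c W e n" by (rule frame)
  interpret f: funk_frame N c W e n by fact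
  show "fst X = Re (\<mu> p (fst X)) *\<^sub>R fst p + q p" "FD q p X = - fst p + Re (\<mu> p (fst X)) *\<^sub>R q p"
    using f.reeb [of p X] p W X by auto
qed

text \<open>Along a geodesic, \<open>x\<close> and \<open>q\<close> rotate into each other up to a common rescaling, so the
  rotated frame \<open>A, B\<close> has constant directions.\<close>

lemma rectilinear: "rectilinear \<Sigma>"
  unfolding rectilinear_def
proof (intro allI impI)
  fix J \<gamma> assume geo: "geodesic_on \<Sigma> J \<gamma>"
  then obtain \<gamma>' where J: "open J" "is_interval J" "J \<noteq> {}"
    and g: "\<And>t. t \<in> J \<Longrightarrow> (\<gamma> has_vector_derivative \<gamma>' t) (at t) \<and>
        (\<exists>X. reeb_vector \<Sigma> (\<gamma> t, \<gamma>' t) X \<and> ((\<lambda>s. (\<gamma> s, \<gamma>' s)) has_vector_derivative X) (at t))"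
    unfolding geodesic_on_def by blast
  define P where "P = (\<lambda>t. Re (c (\<gamma> t, \<gamma>' t)))"
  define Q where "Q = (\<lambda>t. q (\<gamma> t, \<gamma>' t))"
  have inS: "(\<gamma> t, \<gamma>' t) \<in> \<Sigma>" if "t \<in> J" for t using g [OF that] by (auto simp: reeb_vector_def)
  have d\<gamma>: "(\<gamma> has_vector_derivative (Q t - P t *\<^sub>R \<gamma> t)) (at t)"
    and dQ: "(Q has_vector_derivative (- \<gamma> t - P t *\<^sub>R Q t)) (at t)" if t: "t \<in> J" for t
  proof -
    let ?p = "(\<gamma> t, \<gamma>' t)"
    obtain X where X: "reeb_vector \<Sigma> ?p X" "((\<lambda>s. (\<gamma> s, \<gamma>' s)) has_vector_derivative X) (at t)"
      using g [OF t] by blast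
    have d1: "(\<gamma> has_vector_derivative \<gamma>' t) (at t)" using g [OF t] by blast
    have pN: "?p \<in> N" using \<Sigma>_N inS [OF t] by blast
    have x1: "\<gamma> t \<noteq> 0" using inS [OF t] by (auto simp: \<Sigma>_def)
    have "((\<lambda>s. fst (\<gamma> s, \<gamma>' s)) has_vector_derivative fst X) (at t)"
      using X(2) bounded_linear.has_vector_derivative [OF bounded_linear_fst] by blast
    then have fX: "fst X = \<gamma>' t" using d1 vector_derivative_unique_at by auto
    have q: "q ?p = \<gamma>' t + P t *\<^sub>R \<gamma> t" by (simp add: q_def P_def)
    \<comment> \<open>Here \<open>fst X = \<gamma>'\<close> and
      \<open>q = \<gamma>' + P \<gamma>\<close>, so the first Reeb equation only leaves a multiple
      of \<gamma>, and its coefficient must vanish.\<close>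
    have "(Re (\<mu> ?p (fst X)) + P t) *\<^sub>R \<gamma> t = 0"
      using reeb_vector_eqs(1) [OF X(1)] unfolding q fX by (simp add: algebra_simps)
    then have \<rho>: "Re (\<mu> ?p (fst X)) = - P t" using x1 by (simp add: eq_neg_iff_add_eq_0)
    show "(\<gamma> has_vector_derivative (Q t - P t *\<^sub>R \<gamma> t)) (at t)" using d1 q by (simp add: Q_def)
    have "(Q has_derivative (\<lambda>u. FD q ?p (u *\<^sub>R X))) (at t)"
      unfolding Q_def
      using has_derivative_compose [OF X(2) [unfolded has_vector_derivative_def], of q "FD q ?p"]
        smooth_on_has_derivative [OF smooth_q pN] by simp
    then have "(Q has_vector_derivative FD q ?p X) (at t)"
      using FD_linear(4) [OF smooth_on_differentiable [OF smooth_q pN], of _ X] by (simp add: has_vector_derivative_def)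
    then show "(Q has_vector_derivative (- \<gamma> t - P t *\<^sub>R Q t)) (at t)"
      using reeb_vector_eqs(2) [OF X(1)] \<rho> by (simp add: Q_def)
  qed
  define A where "A = (\<lambda>t. cos t *\<^sub>R \<gamma> t - sin t *\<^sub>R Q t)"
  define B where "B = (\<lambda>t. sin t *\<^sub>R \<gamma> t + cos t *\<^sub>R Q t)"
  have dA: "(A has_vector_derivative (- P t) *\<^sub>R A t) (at t)"
    and dB: "(B has_vector_derivative (- P t) *\<^sub>R B t) (at t)" if "t \<in> J" for t
  proof -
    have sc: "((\<lambda>t. sin t) has_vector_derivative cos t) (at t)" "((\<lambda>t. cos t) has_vector_derivative - sin t) (at t)"
      by (auto intro!: derivative_eq_intros simp: has_real_derivative_iff_has_vector_derivative [symmetric])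
    have sr: "((\<lambda>t. f t *\<^sub>R h t) has_vector_derivative f t *\<^sub>R h' + f' *\<^sub>R h t) (at t)"
      if "(f has_vector_derivative f') (at t)" "(h has_vector_derivative h') (at t)"
      for f :: "real \<Rightarrow> real" and h :: "real \<Rightarrow> 'a" and f' h'
      using has_vector_derivative_scaleR [of f f' t UNIV h h'] that
      by (simp add: has_real_derivative_iff_has_vector_derivative)
    have "(A has_vector_derivative (cos t *\<^sub>R (Q t - P t *\<^sub>R \<gamma> t) + (- sin t) *\<^sub>R \<gamma> t) -
        (sin t *\<^sub>R (- \<gamma> t - P t *\<^sub>R Q t) + cos t *\<^sub>R Q t)) (at t)"
      unfolding A_def by (intro has_vector_derivative_diff sr sc d\<gamma> [OF that] dQ [OF that])
    then show "(A has_vector_derivative (- P t) *\<^sub>R A t) (at t)" by (simp add: A_def algebra_simps)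
    have "(B has_vector_derivative (sin t *\<^sub>R (Q t - P t *\<^sub>R \<gamma> t) + cos t *\<^sub>R \<gamma> t) +
        (cos t *\<^sub>R (- \<gamma> t - P t *\<^sub>R Q t) + (- sin t) *\<^sub>R Q t)) (at t)"
      unfolding B_def by (intro has_vector_derivative_add sr sc d\<gamma> [OF that] dQ [OF that])
    then show "(B has_vector_derivative (- P t) *\<^sub>R B t) (at t)" by (simp add: B_def algebra_simps)
  qed
  have indep: "\<alpha> = 0 \<and> \<beta> = 0" if "\<alpha> *\<^sub>R A t + \<beta> *\<^sub>R B t = 0" "t \<in> J" for \<alpha> \<beta> t
  proof -
    let ?p = "(\<gamma> t, \<gamma>' t)"
    have pN: "?p \<in> N" and Fp: "Im (c ?p) = - 1" using \<Sigma>_N inS [OF that(2)] by (auto simp: \<Sigma>_def)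
    have \<mu>: "\<mu> ?p (\<gamma> t) = 1" "\<mu> ?p (Q t) = \<i>"
      using \<mu>_fst [OF pN] \<mu>_q [OF pN] Fp by (simp_all add: Q_def)
    \<comment> \<open>\<mu> identifies the plane of \<open>x\<close> and \<open>q\<close> with the
      complex numbers; the frame becomes \<open>1, i\<close> rotated by the angle
      \<open>- t\<close>.\<close>
    have "\<mu> ?p (\<alpha> *\<^sub>R A t + \<beta> *\<^sub>R B t) = Complex \<alpha> \<beta> * Complex (cos t) (- sin t)"
      by (simp add: A_def B_def linear_add [OF linear_\<mu> [OF pN]] linear_diff [OF linear_\<mu> [OF pN]]
          linear_scale [OF linear_\<mu> [OF pN]] \<mu> complex_eq_iff algebra_simps)
    then have "Complex \<alpha> \<beta> * Complex (cos t) (- sin t) = 0"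
      using that(1) linear_0 [OF linear_\<mu> [OF pN]] by simp
    moreover have "Complex (cos t) (- sin t) \<noteq> 0"
      using sin_zero_abs_cos_one [of t] by (auto simp: complex_eq_iff)
    ultimately have "Complex \<alpha> \<beta> = 0" unfolding mult_eq_0_iff by blast
    then show ?thesis by (simp add: complex_eq_iff)
  qed
  have A0: "A t \<noteq> 0" if "t \<in> J" for t using indep [of 1 t 0] that by auto
  \<comment> \<open>\<open>C\<close> and \<open>norm A\<close> both satisfy the equation
    \<open>u' = - P u\<close>, so their quotient is constant on the interval.\<close>
  have const: "\<exists>v. \<forall>t\<in>J. inverse (norm (A t)) *\<^sub>R C t = v"
    if dC: "\<And>t. t \<in> J \<Longrightarrow> (C has_vector_derivative (- P t) *\<^sub>R C t) (at t)" for C :: "real \<Rightarrow> 'a"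
  proof -
    have "((\<lambda>t. inverse (norm (A t)) *\<^sub>R C t) has_derivative (\<lambda>u. 0)) (at t)" if t: "t \<in> J" for t
    proof -
      have dA': "(A has_derivative (\<lambda>u. u *\<^sub>R (- P t) *\<^sub>R A t)) (at t)" using dA [OF t] by (simp add: has_vector_derivative_def)
      have "((\<lambda>t. norm (A t)) has_derivative (\<lambda>u. (u *\<^sub>R (- P t) *\<^sub>R A t) \<bullet> sgn (A t))) (at t)"
        by (rule has_derivative_compose [OF dA' has_derivative_norm [OF A0 [OF t]]])
      moreover have "A t \<bullet> sgn (A t) = norm (A t)"
        using A0 [OF t] by (simp add: sgn_div_norm dot_square_norm power2_eq_square)
      ultimately have "((\<lambda>t. norm (A t)) has_derivative (\<lambda>u. - (u * P t * norm (A t)))) (at t)"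
        by (simp add: mult.assoc)
      from Deriv.has_derivative_inverse [OF _ this]
      have i: "((\<lambda>t. inverse (norm (A t))) has_derivative (\<lambda>u. - (inverse (norm (A t)) * - (u * P t * norm (A t)) * inverse (norm (A t))))) (at t)"
        using A0 [OF t] by simp
      have "((\<lambda>t. inverse (norm (A t)) *\<^sub>R C t) has_derivative
          (\<lambda>u. inverse (norm (A t)) *\<^sub>R (u *\<^sub>R (- P t) *\<^sub>R C t) +
            (- (inverse (norm (A t)) * - (u * P t * norm (A t)) * inverse (norm (A t)))) *\<^sub>R C t)) (at t)"
        by (rule has_derivative_scaleR [OF i]) (use dC [OF t] in \<open>simp add: has_vector_derivative_def\<close>)
      then show ?thesis using A0 [OF t] by (simp add: field_simps)
    qed
    then show ?thesis
      using has_derivative_zero_constant [OF is_interval_convex [OF J(2)], of "\<lambda>t. inverse (norm (A t)) *\<^sub>R C t"]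
      by (metis has_derivative_at_withinI)
  qed
  obtain v where v: "\<And>t. t \<in> J \<Longrightarrow> inverse (norm (A t)) *\<^sub>R A t = v" using const [OF dA] by blast
  obtain w where w: "\<And>t. t \<in> J \<Longrightarrow> inverse (norm (A t)) *\<^sub>R B t = w" using const [OF dB] by blast
  obtain t0 where t0: "t0 \<in> J" using J(3) by blast
  have ind: "\<alpha> = 0 \<and> \<beta> = 0" if "\<alpha> *\<^sub>R v + \<beta> *\<^sub>R w = 0" for \<alpha> \<beta>
  proof -
    let ?r = "inverse (norm (A t0))"
    have "(\<alpha> * ?r) *\<^sub>R A t0 + (\<beta> * ?r) *\<^sub>R B t0 = 0"
      using that unfolding v [OF t0, symmetric] w [OF t0, symmetric] by simp
    from indep [OF this t0] show ?thesis using A0 [OF t0] by simp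
  qed
  have vw: "v \<noteq> w" using ind [of 1 "-1"] by auto
  have w0: "w \<noteq> 0" using ind [of 0 1] by auto
  have "v \<notin> span {w}"
  proof
    assume "v \<in> span {w}"
    then obtain k where "v = k *\<^sub>R w" by (auto simp: span_singleton)
    then show False using ind [of 1 "-k"] by simp
  qed
  then have indep_vw: "independent {v, w}" using w0 by (simp add: independent_insert)
  \<comment> \<open>Rotating \<open>A\<close> and \<open>B\<close> forward again recovers \<gamma>;
    the angle is the Reeb parameter itself, so \<sigma> is the identity.\<close>
  have line: "\<gamma> t = ray (cos t *\<^sub>R v + sin t *\<^sub>R w)" if t: "t \<in> J" for t
  proof -
    let ?r = "inverse (norm (A t))"
    have "cos t *\<^sub>R A t + sin t *\<^sub>R B t = (cos t * cos t) *\<^sub>R \<gamma> t + (sin t * sin t) *\<^sub>R \<gamma> t"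
      by (simp add: A_def B_def algebra_simps)
    also have "\<dots> = (cos t * cos t + sin t * sin t) *\<^sub>R \<gamma> t" by (rule scaleR_left_distrib [symmetric])
    also have "cos t * cos t + sin t * sin t = 1" by (rule sin_cos_squared_add3)
    finally have "cos t *\<^sub>R A t + sin t *\<^sub>R B t = \<gamma> t" by simp
    then have "cos t *\<^sub>R v + sin t *\<^sub>R w = ?r *\<^sub>R \<gamma> t"
      unfolding v [OF t, symmetric] w [OF t, symmetric] by (metis scaleR_add_right scaleR_left_commute)
    moreover have "norm (\<gamma> t) = 1" using inS [OF t] by (simp add: \<Sigma>_def)
    moreover have "?r > 0" using A0 [OF t] by simp
    ultimately show ?thesis by (simp add: ray_def)
  qed
  show "\<exists>v w. v \<noteq> w \<and> independent {v, w} \<and>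
           (\<exists>\<sigma> :: real \<Rightarrow> real. smooth_on J \<sigma> \<and> (\<forall>t\<in>J. deriv \<sigma> t > 0) \<and>
              (\<forall>t\<in>J. \<gamma> t = ray (cos (\<sigma> t) *\<^sub>R v + sin (\<sigma> t) *\<^sub>R w)))"
    using vw indep_vw line smooth_on_ident
    by (intro exI [of _ v] exI [of _ w] conjI exI [of _ "\<lambda>t. t"]) auto
qed

end

section \<open>Construction of the structure\<close>

text \<open>\<open>- Im c - 1\<close> defines the bundle and, for fixed \<open>x\<close>, the fibre.
  By Euler's relation its derivative along \<open>y\<close> is 1 on \<Sigma>, which gives regularity
  and the outward normalization, and its vertical Hessian is \<open>Im b\<close>.\<close>

lemma (in funk) finsler_structure_I:
  assumes U: "\<And>x. x \<in> U \<Longrightarrow> norm x = 1" "\<And>x y. (x, y) \<in> N \<Longrightarrow> norm x = 1 \<Longrightarrow> x \<in> U"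
    "\<And>x y. (x, y) \<in> \<Sigma> \<Longrightarrow> x \<in> U"
    and pos: "\<And>p h. p \<in> \<Sigma> \<Longrightarrow> \<mu> p h = 0 \<Longrightarrow> h \<noteq> 0 \<Longrightarrow> Im (b p h h) > 0"
    and fib: "\<And>x. x \<in> U \<Longrightarrow> compact (fibre \<Sigma> x) \<and> fibre \<Sigma> x \<noteq> {}"
  shows "finsler_structure U \<Sigma>"
proof -
  define F where "F = (\<lambda>p. - Im (c p) - 1)"
  have smF: "smooth_on N F" unfolding F_def
    by (intro smooth_on_diff smooth_on_minus smooth_on_Im smooth_on_const open_N smooth_c)
  have FDF: "FD F p X = - Im (FD c p X)" if "p \<in> N" for p X
  proof -
    have "(F has_derivative (\<lambda>X. - Im (FD c p X) - 0)) (at p)"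
      unfolding F_def
      by (intro has_derivative_diff has_derivative_minus has_derivative_const
          bounded_linear.has_derivative [OF bounded_linear_Im] smooth_on_has_derivative [OF smooth_c that])
    from FD_eqI [OF this] show ?thesis by simp
  qed
  define Nf where "Nf = (\<lambda>x. (\<lambda>y. (x, y)) -` N)"
  have oNf: "open (Nf x)" for x unfolding Nf_def by (intro open_vimage open_N continuous_intros)
  define Ff where "Ff = (\<lambda>x y. F (x, y))"
  have smFf: "smooth_on (Nf x) (Ff x)" for x
    unfolding Ff_def
    by (intro smooth_on_compose [OF oNf smF] smooth_on_Pair oNf smooth_on_const smooth_on_ident) (auto simp: Nf_def)
  have FDFf: "FD (Ff x) y w = Im (\<mu> (x, y) w)" if "y \<in> Nf x" for x y w
  proof -
    have i: "((\<lambda>y. (x, y)) has_derivative (\<lambda>w. (0, w))) (at y)" by (auto intro!: derivative_eq_intros)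
    have xy: "(x, y) \<in> N" using that by (simp add: Nf_def)
    have "(Ff x has_derivative (\<lambda>w. FD F (x, y) (0, w))) (at y)"
      unfolding Ff_def by (rule has_derivative_compose [OF i smooth_on_has_derivative [OF smF xy]])
    from FD_eqI [OF this] show ?thesis by (simp add: FDF [OF xy] \<mu>_def)
  qed
  have def_f: "defines_near (ray_tangent x) (fibre \<Sigma> x) y (Nf x) (Ff x)" if "y \<in> fibre \<Sigma> x" "norm x = 1" for x y
    using that oNf [of x]
    by (auto simp: defines_near_def fibre_def \<Sigma>_def Nf_def Ff_def F_def ray_tangent_def)
  have one: "FD (Ff x) y y = 1" if "y \<in> fibre \<Sigma> x" for x y
  proof -
    have "(x, y) \<in> N" "Im (c (x, y)) = - 1" using that by (auto simp: fibre_def \<Sigma>_def)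
    then show ?thesis using FDFf [of y x y] \<mu>_snd [of "(x, y)"] by (simp add: Nf_def)
  qed
  have key: "x \<in> U \<longleftrightarrow> norm x = 1" if "(x, y) \<in> N" for x y using U(1) U(2) [OF that] by blast
  have fT: "fibre \<Sigma> x \<subseteq> ray_tangent x" for x by (auto simp: fibre_def \<Sigma>_def ray_tangent_def)
  show ?thesis
    unfolding finsler_structure_def
  proof (intro conjI)
    show "\<Sigma> \<subseteq> tangent_bundle U"
      using U(3) by (auto simp: tangent_bundle_def ray_tangent_def \<Sigma>_def)
    show "\<forall>(x, y)\<in>\<Sigma>. \<exists>W f. smooth_on W f \<and> defines_near (tangent_bundle U) \<Sigma> (x, y) W f \<and>
        (\<exists>w\<in>ray_tangent x. FD f (x, y) (0, w) \<noteq> 0)"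
    proof (clarify)
      fix x y assume p: "(x, y) \<in> \<Sigma>"
      then have pN: "(x, y) \<in> N" by (rule \<Sigma>_N)
      have "defines_near (tangent_bundle U) \<Sigma> (x, y) N F"
        using pN open_N key by (auto simp: defines_near_def \<Sigma>_def tangent_bundle_def ray_tangent_def F_def)
      moreover have "FD F (x, y) (0, y) \<noteq> 0"
        using p by (simp add: FDF [OF pN] euler [OF pN] \<Sigma>_def)
      moreover have "y \<in> ray_tangent x" using p by (auto simp: \<Sigma>_def ray_tangent_def)
      ultimately show "\<exists>W f. smooth_on W f \<and> defines_near (tangent_bundle U) \<Sigma> (x, y) W f \<and>
          (\<exists>w\<in>ray_tangent x. FD f (x, y) (0, w) \<noteq> 0)"
        using smF by blast
    qed
    show "\<forall>x\<in>U. compact (fibre \<Sigma> x) \<and> hypersurface smooth_on (ray_tangent x) (fibre \<Sigma> x) \<and>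
        strictly_convex_towards_origin (ray_tangent x) (fibre \<Sigma> x)"
    proof (intro ballI conjI)
      fix x assume x: "x \<in> U"
      then have x1: "norm x = 1" by (rule U(1))
      show "compact (fibre \<Sigma> x)" using fib [OF x] by blast
      show "hypersurface smooth_on (ray_tangent x) (fibre \<Sigma> x)"
        unfolding hypersurface_def
      proof (intro conjI ballI)
        show "fibre \<Sigma> x \<noteq> {}" using fib [OF x] by blast
        show "fibre \<Sigma> x \<subseteq> ray_tangent x" by (rule fT)
        fix y assume y: "y \<in> fibre \<Sigma> x"
        then have "y \<in> ray_tangent x" "FD (Ff x) y y \<noteq> 0" using fT one [OF y] by auto
        then show "\<exists>W f. smooth_on W f \<and> defines_near (ray_tangent x) (fibre \<Sigma> x) y W f \<and>
            (\<exists>w\<in>ray_tangent x. FD f y w \<noteq> 0)"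
          using smFf def_f [OF y x1] by blast
      qed
      show "strictly_convex_towards_origin (ray_tangent x) (fibre \<Sigma> x)"
        unfolding strictly_convex_towards_origin_def
      proof
        fix y assume y: "y \<in> fibre \<Sigma> x"
        then have p: "(x, y) \<in> \<Sigma>" by (simp add: fibre_def)
        have pN: "(x, y) \<in> N" by (rule \<Sigma>_N [OF p])
        have yN: "y \<in> Nf x" using pN by (simp add: Nf_def)
        have "FD (\<lambda>z. FD (Ff x) z w) y w > 0" if w: "w \<in> ray_tangent x" "w \<noteq> 0" "FD (Ff x) y w = 0" for w
        proof -
          have "FD (\<lambda>z. FD (Ff x) z w) y = FD (\<lambda>z. Im (\<mu> (x, z) w)) y"
            by (rule FD_cong [OF oNf yN]) (rule FDFf)
          moreover have "FD (\<lambda>z. Im (\<mu> (x, z) w)) y k = Im (b (x, y) w k)" for k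
          proof -
            have i: "((\<lambda>y. (x, y)) has_derivative (\<lambda>w. (0, w))) (at y)" by (auto intro!: derivative_eq_intros)
            have "((\<lambda>z. \<mu> (x, z) w) has_derivative (\<lambda>k. FD (\<lambda>p. \<mu> p w) (x, y) (0, k))) (at y)"
              by (rule has_derivative_compose [OF i smooth_on_has_derivative [OF smooth_\<mu> pN]])
            from FD_eqI [OF bounded_linear.has_derivative [OF bounded_linear_Im this]] show ?thesis by (simp add: b_def)
          qed
          moreover have "Im (b (x, y) w w) > 0"
          proof -
            \<comment> \<open>A tangent vector of the fibre has \<open>Im \<mu> = 0\<close> but
              possibly \<open>Re \<mu> \<noteq> 0\<close>. Subtracting a multiple of
              \<open>x\<close> moves it to the kernel of \<mu> without changing its values under
              \<open>b\<close>, which annihilates \<open>x\<close>.\<close>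
            define r where "r = Re (\<mu> (x, y) w)"
            define h where "h = w - r *\<^sub>R x"
            have Imw: "Im (\<mu> (x, y) w) = 0" using w(3) FDFf [OF yN] by simp
            have \<mu>h: "\<mu> (x, y) h = 0"
              using Imw \<mu>_fst [OF pN]
              by (simp add: h_def linear_diff [OF linear_\<mu> [OF pN]] linear_scale [OF linear_\<mu> [OF pN]] r_def complex_eq_iff)
            have "h \<noteq> 0"
            proof
              assume "h = 0"
              then have "w = r *\<^sub>R x" by (simp add: h_def)
              then show False using w(1,2) x1 by (auto simp: ray_tangent_def dot_square_norm)
            qed
            from pos [OF p \<mu>h this] have "Im (b (x, y) h h) > 0" .
            moreover have "b (x, y) h k = b (x, y) w k" "b (x, y) k h = b (x, y) k w" for k
              using b_fst [OF pN, of k] b_sym [OF pN, of x k]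
              by (simp_all add: h_def linear_diff [OF linear_b [OF pN]] linear_scale [OF linear_b [OF pN]]
                  linear_diff [OF linear_b' [OF pN]] linear_scale [OF linear_b' [OF pN]])
            ultimately show ?thesis by simp
          qed
          ultimately show ?thesis by simp
        qed
        then show "\<exists>W f. smooth_on W f \<and> defines_near (ray_tangent x) (fibre \<Sigma> x) y W f \<and> 0 < FD f y y \<and>
          (\<forall>w\<in>ray_tangent x. w \<noteq> 0 \<and> FD f y w = 0 \<longrightarrow> 0 < FD (\<lambda>z. FD f z w) y w)"
          using smFf def_f [OF y x1] one [OF y] by (intro exI [of _ "Nf x"] exI [of _ "Ff x"]) auto
      qed
    qed
  qed
qed

text \<open>The kernel of \<mu> moves with the point, so positivity is phrased as avoiding the
  closed condition \<open>\<mu> = 0\<close> and \<open>Im b \<le> 0\<close> on the unit sphere.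
  Compactness of the sphere gives a uniform neighbourhood, and scaling covers the other
  vectors.\<close>

lemma (in funk) pos_eventually:
  assumes p0: "p0 \<in> N" and pos: "\<And>h. \<mu> p0 h = 0 \<Longrightarrow> h \<noteq> 0 \<Longrightarrow> Im (b p0 h h) > 0"
  obtains V where "open V" "p0 \<in> V" "V \<subseteq> N"
    "\<And>p h. p \<in> V \<Longrightarrow> \<mu> p h = 0 \<Longrightarrow> h \<noteq> 0 \<Longrightarrow> Im (b p h h) > 0"
proof -
  let ?D = "N \<times> (UNIV :: 'a set)"
  have oD: "open ?D" by (intro open_Times open_N open_UNIV)
  have smfst: "smooth_on ?D (\<lambda>u. f (fst u))" if "smooth_on N f" for f :: "'a \<times> 'a \<Rightarrow> complex"
    by (rule smooth_on_compose [OF oD that smooth_on_fst]) auto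
  have 1: "smooth_on ?D (\<lambda>u. \<mu> (fst u) (snd u))"
    by (rule linear_family(1) [of ?D "\<lambda>u. \<mu> (fst u)" snd])
       (use oD linear_\<mu> smfst [OF smooth_\<mu>] smooth_on_snd in auto)
  have "smooth_on ?D (\<lambda>u. b (fst u) h (snd u))" for h
    by (rule linear_family(1) [of ?D "\<lambda>u. b (fst u) h" snd])
       (use oD linear_b smfst [OF smooth_b] smooth_on_snd in auto)
  then have 2: "smooth_on ?D (\<lambda>u. b (fst u) (snd u) (snd u))"
    by (intro linear_family(1) [of ?D "\<lambda>u h. b (fst u) h (snd u)" snd])
       (use oD linear_b' smooth_on_snd in auto)
  define G where "G = (\<lambda>u. (\<mu> (fst u) (snd u), Im (b (fst u) (snd u) (snd u))))"
  have "smooth_on ?D G" unfolding G_def by (intro smooth_on_Pair smooth_on_Im oD 1 2)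
  then have cG: "continuous_on ?D G" by (rule smooth_on_continuous_on)
  define W where "W = ?D \<inter> G -` (- ({0} \<times> {..0}))"
  have oW: "open W" unfolding W_def
    by (rule continuous_open_preimage [OF cG oD]) (intro open_Compl closed_Times closed_singleton closed_atMost)
  have sub: "{p0} \<times> sphere 0 1 \<subseteq> W"
  proof
    fix u assume "u \<in> {p0} \<times> sphere (0::'a) 1"
    then obtain h where u: "u = (p0, h)" "norm h = 1" by auto
    then have "h \<noteq> 0" by auto
    then show "u \<in> W" using pos [of h] p0 u by (auto simp: W_def G_def)
  qed
  obtain X0 where X0: "p0 \<in> X0" "open X0" "X0 \<times> sphere 0 1 \<subseteq> W"
    using Elementary_Topology.tube_lemma [OF compact_sphere oW sub] by blast
  show thesis
  proof (rule that [of "X0 \<inter> N"])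
    show "open (X0 \<inter> N)" "p0 \<in> X0 \<inter> N" "X0 \<inter> N \<subseteq> N" using X0 open_N p0 by auto
    fix p h assume p: "p \<in> X0 \<inter> N" and h: "\<mu> p h = 0" "h \<noteq> 0"
    have pN: "p \<in> N" using p by blast
    define k where "k = inverse (norm h) *\<^sub>R h"
    have k1: "norm k = 1" using h by (simp add: k_def)
    have hk: "h = norm h *\<^sub>R k" using h by (simp add: k_def)
    have "(p, k) \<in> W" using X0 p k1 by auto
    moreover have "\<mu> p k = 0" using h by (simp add: k_def linear_scale [OF linear_\<mu> [OF pN]])
    ultimately have "Im (b p k k) > 0" by (auto simp: W_def G_def)
    moreover have "Im (b p h h) = norm h * (norm h * Im (b p k k))"
      by (subst (1 2) hk) (simp add: linear_scale [OF linear_b [OF pN]] linear_scale [OF linear_b' [OF pN]])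
    ultimately show "Im (b p h h) > 0" using h by simp
  qed
qed

lemma real_analytic_smooth:
  fixes f :: "'b::euclidean_space \<Rightarrow> real"
  assumes "real_analytic_on W f" "p \<in> W"
  obtains r where "r > 0" "smooth_on (ball p r) f"
proof -
  obtain r g where r: "r > 0" and g: "holo_on (ball (p, 0) r) g"
    and gf: "\<And>u. u \<in> ball p r \<Longrightarrow> g (u, 0) = of_real (f u)"
    by (rule complexify [OF assms]) (rule that; assumption)
  have "smooth_on (ball p r) (\<lambda>u. Re (g (u, 0)))"
    by (intro smooth_on_Re open_ball smooth_on_compose [OF open_ball holo_on_smooth [OF g]]
        smooth_on_Pair smooth_on_ident smooth_on_const) (auto simp: dist_Pair_Pair)
  then have "smooth_on (ball p r) f"
    by (rule smooth_on_cong [OF open_ball, rotated]) (simp add: gf)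
  with r show thesis by (rule that)
qed

lemma defines_near_subset:
  assumes "defines_near T S y W f" "open V" "y \<in> V" "V \<subseteq> W"
  shows "defines_near T S y V f"
proof -
  have "S \<inter> W = {z \<in> T \<inter> W. f z = 0}" using assms(1) by (simp add: defines_near_def)
  then have "S \<inter> V = {z \<in> T \<inter> V. f z = 0}" using assms(4) by blast
  then show ?thesis using assms by (simp add: defines_near_def)
qed

theorem proposition4:
  fixes n :: nat and v :: "'a::euclidean_space" and S :: "'a set"
  assumes "DIM('a) = n + 2"
    and "v \<noteq> 0"
    and "compact S"
    and "hypersurface real_analytic_on (ray_tangent (ray v)) S"
    and "strictly_convex_towards_origin (ray_tangent (ray v)) S"
  shows "\<exists>U \<Sigma>. openin (top_of_set ray_space) U \<and> ray v \<in> U \<and>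
           finsler_structure U \<Sigma> \<and> {ray v} \<times> S \<subseteq> \<Sigma> \<and>
           rectilinear \<Sigma> \<and> constant_flag_curvature n \<Sigma> 1"
proof -
  define e where "e = ray v"
  have e1: "norm e = 1" using assms(2) by (simp add: e_def ray_def)
  have ee: "e \<bullet> e = 1" using e1 by (simp add: dot_square_norm)
  let ?T = "ray_tangent e"
  have S0: "S \<noteq> {}" "S \<subseteq> ?T" using assms(4) by (auto simp: hypersurface_def e_def)
  have convex: "\<exists>W g. smooth_on W g \<and> defines_near ?T S y W g \<and> FD g y y > 0 \<and>
        (\<forall>w\<in>?T. w \<noteq> 0 \<and> FD g y w = 0 \<longrightarrow> FD (\<lambda>z. FD g z w) y w > 0)" if "y \<in> S" for y
    using assms(5) that unfolding strictly_convex_towards_origin_def e_def by blast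
  \<comment> \<open>The analytic defining function is only known to be regular in some direction,
    but the witness of convexity increases radially, and proportionality of the derivatives
    transfers radial regularity.\<close>
  have an: "\<exists>W f. real_analytic_on W f \<and> defines_near ?T S p W f \<and> FD f p p \<noteq> 0" if p: "p \<in> S" for p
  proof -
    obtain W f w where f: "real_analytic_on W f" "defines_near ?T S p W f" and w: "w \<in> ?T" "FD f p w \<noteq> 0"
      using assms(4) p unfolding hypersurface_def e_def by blast
    obtain W' g where g: "smooth_on W' g" "defines_near ?T S p W' g" "FD g p p > 0" using convex [OF p] by blast
    have W: "open W" "p \<in> W" using f(2) by (auto simp: defines_near_def)
    obtain r where r: "r > 0" "smooth_on (ball p r) f" by (rule real_analytic_smooth [OF f(1) W(2)])
    have "smooth_on (ball p r \<inter> W) f" by (rule smooth_on_subset [OF r(2)]) blast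
    moreover have "defines_near ?T S p (ball p r \<inter> W) f"
      by (rule defines_near_subset [OF f(2)]) (use W r in auto)
    ultimately obtain \<kappa> where "\<And>w. w \<in> ?T \<Longrightarrow> FD g p w = \<kappa> * FD f p w"
      "\<And>w. w \<in> ?T \<Longrightarrow> FD f p w = 0 \<Longrightarrow> FD (\<lambda>z. FD g z w) p w = \<kappa> * FD (\<lambda>z. FD f z w) p w"
      by (rule defining_function_transfer [OF subspace_ray_tangent p _ _ g(1,2) w]) (rule that; assumption)
    then have "FD g p p = \<kappa> * FD f p p" using p S0 by blast
    then have "FD f p p \<noteq> 0" using g(3) by auto
    then show ?thesis using f by blast
  qed
  obtain D s where D: "open D" "S \<times> {0} \<subseteq> D" "holo_on D s" "\<And>z. z \<in> D \<Longrightarrow> s z \<noteq> 0"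
    "\<And>z. z \<in> D \<Longrightarrow> FD s z z = - s z"
    "\<And>u. (u, 0) \<in> D \<Longrightarrow> s (u, 0) \<in> \<real> \<and> Re (s (u, 0)) *\<^sub>R projo e u \<in> S"
    "\<And>u. u \<in> S \<Longrightarrow> s (u, 0) = 1"
  proof (rule global_scale [OF e1 assms(3) S0(2)])
    show "\<exists>W f. real_analytic_on W f \<and> defines_near ?T S p W f \<and> FD f p p \<noteq> 0" if "p \<in> S" for p
      by (rule an [OF that])
  qed (rule that; assumption)
  obtain N0 c where N0: "open N0" "{e} \<times> S \<subseteq> N0" "smooth_on N0 c"
    and bu: "\<And>p h. p \<in> N0 \<Longrightarrow> FD c p (h, 0) = c p * FD c p (0, h)"
    and ba: "\<And>x y. (x, y) \<in> N0 \<Longrightarrow> FD c (x, y) (0, x) = - 1"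
    and eu: "\<And>x y. (x, y) \<in> N0 \<Longrightarrow> FD c (x, y) (0, y) = c (x, y)"
    and init: "\<And>y. (e, y) \<in> N0 \<Longrightarrow> y \<in> ?T \<Longrightarrow> Re (c (e, y)) = 0 \<and> (Im (c (e, y)) = - 1 \<longleftrightarrow> y \<in> S)"
  proof (rule burgers_solution [OF e1 assms(3) S0(2) D(1,2,3)])
    show "s z \<noteq> 0" "FD s z z = - s z" if "z \<in> D" for z using D(4,5) [OF that] by blast+
    show "s (u, 0) \<in> \<real> \<and> Re (s (u, 0)) *\<^sub>R projo e u \<in> S" if "(u, 0) \<in> D" for u by (rule D(6) [OF that])
    show "s (u, 0) = 1" if "u \<in> S" for u by (rule D(7) [OF that])
  qed (rule that; assumption)
  interpret f0: funk N0 c by unfold_locales (use N0 bu ba eu in blast)+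
  \<comment> \<open>Over the base point \<open>Re c\<close> vanishes on the tangent space, hence so
    does \<open>Re \<mu>\<close>. As \<open>\<mu> (e) = 1\<close>, the kernel of \<mu> lies in the
    tangent space and consists of tangent vectors of \<open>S\<close>, on which \<open>Im b\<close>
    is the Hessian of the defining function \<open>- Im c - 1\<close> of \<open>S\<close>.\<close>
  have pos0: "Im (f0.b (e, y) h h) > 0" if y: "y \<in> S" and h: "f0.\<mu> (e, y) h = 0" "h \<noteq> 0" for y h
  proof -
    have pN: "(e, y) \<in> N0" using N0 y by auto
    have yT: "y \<in> ?T" using y S0 by blast
    define W where "W = (\<lambda>z. (e, z)) -` N0"
    have oW: "open W" and yW: "y \<in> W" unfolding W_def using pN by (auto intro!: open_vimage N0 continuous_intros)
    have smP: "smooth_on W (\<lambda>z. (e, z))" by (intro smooth_on_Pair oW smooth_on_const smooth_on_ident)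
    have i: "((\<lambda>z. (e, z)) has_derivative (\<lambda>w. (0, w))) (at z)" for z by (auto intro!: derivative_eq_intros)
    have smc: "smooth_on W (\<lambda>z. c (e, z))" by (rule smooth_on_compose [OF oW N0(3) smP]) (auto simp: W_def)
    have dc: "((\<lambda>z. c (e, z)) has_derivative (\<lambda>w. - f0.\<mu> (e, z) w)) (at z)" if "z \<in> W" for z
      using has_derivative_compose [OF i smooth_on_has_derivative [OF N0(3)], of z] that by (simp add: W_def f0.\<mu>_def)
    define f where "f = (\<lambda>z. - Im (c (e, z)) - 1)"
    have smf: "smooth_on W f" unfolding f_def by (intro smooth_on_diff smooth_on_minus smooth_on_Im smooth_on_const oW smc)
    have deff: "defines_near ?T S y W f"
      using oW yW init S0(2) by (auto simp: defines_near_def f_def W_def)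
    have FDf: "FD f z w = Im (f0.\<mu> (e, z) w)" if "z \<in> W" for z w
    proof -
      have "(f has_derivative (\<lambda>w. - Im (- f0.\<mu> (e, z) w) - 0)) (at z)"
        unfolding f_def
        by (intro has_derivative_diff has_derivative_minus has_derivative_const
            bounded_linear.has_derivative [OF bounded_linear_Im] dc [OF that])
      from FD_eqI [OF this] show ?thesis by simp
    qed
    have fy: "FD f y y = 1" using FDf [OF yW] f0.\<mu>_snd [OF pN] init [OF pN yT] y by simp
    obtain W' g where g: "smooth_on W' g" "defines_near ?T S y W' g" "FD g y y > 0"
      and gh: "\<And>w. w \<in> ?T \<Longrightarrow> w \<noteq> 0 \<Longrightarrow> FD g y w = 0 \<Longrightarrow> FD (\<lambda>z. FD g z w) y w > 0"
      using convex [OF y] by blast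
    obtain \<kappa> where \<kappa>: "\<And>w. w \<in> ?T \<Longrightarrow> FD g y w = \<kappa> * FD f y w"
      "\<And>w. w \<in> ?T \<Longrightarrow> FD f y w = 0 \<Longrightarrow> FD (\<lambda>z. FD g z w) y w = \<kappa> * FD (\<lambda>z. FD f z w) y w"
      by (rule defining_function_transfer [OF subspace_ray_tangent y smf deff g(1,2) yT])
         (simp add: fy, (rule that; assumption))
    have \<kappa>0: "\<kappa> > 0" using \<kappa>(1) [OF yT] g(3) fy by simp
    have Re0: "Re (f0.\<mu> (e, y) w) = 0" if w: "w \<in> ?T" for w
    proof -
      define k where "k = (\<lambda>t::real. Re (c (e, y + t *\<^sub>R w)))"
      have j: "((\<lambda>t::real. y + t *\<^sub>R w) has_derivative (\<lambda>t. t *\<^sub>R w)) (at 0)" by (auto intro!: derivative_eq_intros)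
      have "(k has_derivative (\<lambda>t. Re (- f0.\<mu> (e, y) (t *\<^sub>R w)))) (at 0)"
        unfolding k_def
        by (intro bounded_linear.has_derivative [OF bounded_linear_Re] has_derivative_compose [OF j])
           (simp add: dc [OF yW])
      moreover have "(k has_derivative (\<lambda>t. 0)) (at 0)"
      proof (rule has_derivative_transform_within_open [OF has_derivative_const [of 0]])
        show "open ((\<lambda>t::real. y + t *\<^sub>R w) -` W)" by (intro open_vimage oW continuous_intros)
        show "0 \<in> (\<lambda>t::real. y + t *\<^sub>R w) -` W" using yW by simp
        show "0 = k t" if "t \<in> (\<lambda>t::real. y + t *\<^sub>R w) -` W" for t
          using init [of "y + t *\<^sub>R w"] that w yT
          by (simp add: k_def W_def subspace_add [OF subspace_ray_tangent] subspace_scale [OF subspace_ray_tangent])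
      qed
      ultimately have "(\<lambda>t::real. Re (- f0.\<mu> (e, y) (t *\<^sub>R w))) = (\<lambda>t. 0)" by (rule has_derivative_unique)
      from fun_cong [OF this, of 1] show ?thesis by simp
    qed
    have hT: "h \<in> ?T"
    proof -
      have "h = (e \<bullet> h) *\<^sub>R e + projo e h" by (simp add: projo_def)
      then have "f0.\<mu> (e, y) h = (e \<bullet> h) *\<^sub>R f0.\<mu> (e, y) e + f0.\<mu> (e, y) (projo e h)"
        by (metis linear_add [OF f0.linear_\<mu> [OF pN]] linear_scale [OF f0.linear_\<mu> [OF pN]])
      then have "e \<bullet> h = 0"
        using h Re0 [OF projo_tangent [OF e1]] f0.\<mu>_fst [OF pN] by (simp add: complex_eq_iff)
      then show ?thesis by (simp add: ray_tangent_def)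
    qed
    have f0h: "FD f y h = 0" using FDf [OF yW] h by simp
    then have "FD g y h = 0" using \<kappa>(1) [OF hT] by simp
    then have "\<kappa> * FD (\<lambda>z. FD f z h) y h > 0" using gh [OF hT h(2)] \<kappa>(2) [OF hT f0h] by simp
    then have "FD (\<lambda>z. FD f z h) y h > 0" using \<kappa>0 by (simp add: zero_less_mult_iff)
    moreover have "FD (\<lambda>z. FD f z h) y = FD (\<lambda>z. Im (f0.\<mu> (e, z) h)) y"
      by (rule FD_cong [OF oW yW]) (rule FDf)
    moreover have "FD (\<lambda>z. Im (f0.\<mu> (e, z) h)) y h = Im (f0.b (e, y) h h)"
      using FD_eqI [OF bounded_linear.has_derivative [OF bounded_linear_Im
            has_derivative_compose [OF i smooth_on_has_derivative [OF f0.smooth_\<mu> pN]]], of h]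
      by (simp add: f0.b_def)
    ultimately show ?thesis by simp
  qed
  have "\<exists>V. open V \<and> (e, y) \<in> V \<and> V \<subseteq> N0 \<and> (\<forall>p\<in>V. \<forall>h. f0.\<mu> p h = 0 \<longrightarrow> h \<noteq> 0 \<longrightarrow> Im (f0.b p h h) > 0)"
    if y: "y \<in> S" for y
  proof -
    have pN: "(e, y) \<in> N0" using N0 y by auto
    show ?thesis by (rule f0.pos_eventually [OF pN pos0 [OF y]]) blast+
  qed
  then obtain V where V: "\<And>y. y \<in> S \<Longrightarrow> open (V y) \<and> (e, y) \<in> V y \<and> V y \<subseteq> N0 \<and>
      (\<forall>p\<in>V y. \<forall>h. f0.\<mu> p h = 0 \<longrightarrow> h \<noteq> 0 \<longrightarrow> Im (f0.b p h h) > 0)"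
    by metis
  define N1 where "N1 = (\<Union>y\<in>S. V y)"
  have N1: "open N1" "{e} \<times> S \<subseteq> N1" "N1 \<subseteq> N0" using V unfolding N1_def by blast+
  have pos1: "Im (f0.b p h h) > 0" if "p \<in> N1" "f0.\<mu> p h = 0" "h \<noteq> 0" for p h
    using V that unfolding N1_def by blast
  have "compact ({e} \<times> S)" by (intro compact_Times assms(3)) auto
  then obtain r where r: "r > 0" "(\<Union>p\<in>{e} \<times> S. ball p r) \<subseteq> N1"
    using compact_subset_open_imp_ball_epsilon_subset [OF _ N1(1,2)] by blast
  \<comment> \<open>Distance below \<open>r / 2\<close> in \<open>x\<close> and at most
    \<open>r / 4\<close> in \<open>y\<close> stays within \<open>r\<close> of the base fibre, so
    that also the boundary of the tube around \<open>S\<close> remains in \<open>N1\<close>.\<close>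
  define \<epsilon> where "\<epsilon> = r / 4"
  have \<epsilon>: "\<epsilon> > 0" using r by (simp add: \<epsilon>_def)
  have box: "(x, y) \<in> N1" if "dist e x < 2 * \<epsilon>" "infdist y S \<le> \<epsilon>" for x y
  proof -
    obtain p where p: "p \<in> S" "infdist y S = dist y p"
      using infdist_attains_inf [OF compact_imp_closed [OF assms(3)] S0(1)] by blast
    have "dist (e, p) (x, y) \<le> dist e x + dist p y"
      unfolding dist_Pair_Pair by (rule sqrt_sum_squares_le_sum) auto
    also have "\<dots> < r"
    proof -
      have "dist p y \<le> r / 4" "dist e x < r / 2" using that p by (simp_all add: \<epsilon>_def dist_commute)
      then show ?thesis using r(1) by linarith
    qed
    finally show ?thesis using r(2) p by (force simp: subset_iff)
  qed
  \<comment> \<open>The vector component is confined to an open tube around \<open>S\<close>. Fibres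
    inside it are compact once they avoid the boundary of the tube, which is achieved by shrinking
    the base.\<close>
  define nS where "nS = {y. infdist y S < \<epsilon>}"
  have nS_iff: "y \<in> nS \<longleftrightarrow> infdist y S < \<epsilon>" for y by (simp add: nS_def)
  have onS: "open nS" unfolding nS_def by (intro open_Collect_less continuous_intros)
  have SnS: "S \<subseteq> nS" using \<epsilon> by (auto simp: nS_iff)
  have sub_funk: "funk (ball e \<delta> \<times> nS) c" if "\<delta> \<le> 2 * \<epsilon>" for \<delta>
  proof -
    have "ball e \<delta> \<times> nS \<subseteq> N1" using box that by (auto simp: nS_iff)
    then have sub: "ball e \<delta> \<times> nS \<subseteq> N0" using N1 by blast
    show ?thesis
    proof
      show "open (ball e \<delta> \<times> nS)" by (intro open_Times open_ball onS)
      show "smooth_on (ball e \<delta> \<times> nS) c" by (rule smooth_on_subset [OF N0(3) sub])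
    qed (use sub bu ba eu in blast)+
  qed
  \<comment> \<open>An auxiliary structure over a larger ball. Its retraction moves
    \<open>(x, p)\<close>, for \<open>x\<close> a unit vector near \<open>e\<close>, into the fibre
    over \<open>x\<close>, which shows that nearby fibres are not empty.\<close>
  interpret f2: funk "ball e (2 * \<epsilon>) \<times> nS" c by (rule sub_funk) simp
  obtain p where p: "p \<in> S" using S0 by blast
  have pS: "(e, p) \<in> f2.\<Sigma>"
  proof -
    have "(e, p) \<in> N0" "p \<in> ?T" using p S0 N0 by auto
    then show ?thesis using init [of p] p SnS \<epsilon> e1 by (auto simp: f2.\<Sigma>_def ray_tangent_def)
  qed
  obtain M R where MR: "smooth_retract f2.\<Sigma> M R" "(e, p) \<in> M"
    and Rf: "\<And>u. u \<in> M \<Longrightarrow> norm (fst u) = 1 \<Longrightarrow> fst (R u) = fst u"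
    by (rule f2.retraction [OF pS]) (rule that; assumption)
  interpret R: smooth_retract f2.\<Sigma> M R by fact
  obtain \<delta>1 where \<delta>1: "\<delta>1 > 0" "\<And>x. dist e x < \<delta>1 \<Longrightarrow> (x, p) \<in> M"
  proof -
    have "open ((\<lambda>x. (x, p)) -` M)" by (intro open_vimage R.open_N continuous_intros)
    then obtain d where "d > 0" "ball e d \<subseteq> (\<lambda>x. (x, p)) -` M"
      using MR(2) open_contains_ball by (metis vimageI)
    then show thesis by (intro that [of d]) (auto simp: subset_iff)
  qed
  define C where "C = {y. infdist y S = \<epsilon>}"
  have cC: "compact C"
  proof -
    have "compact {y. infdist y S \<le> \<epsilon>}" using compact_infdist_le [OF S0(1) assms(3) \<epsilon>] .
    moreover have "closed C" unfolding C_def by (intro closed_Collect_eq continuous_intros)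
    moreover have "C \<subseteq> {y. infdist y S \<le> \<epsilon>}" by (auto simp: C_def)
    ultimately show ?thesis by (metis compact_Int_closed inf.absorb_iff2 inf_commute)
  qed
  \<comment> \<open>Over \<open>e\<close> the two equations of the fibre hold only on
    \<open>S\<close>, hence nowhere on the boundary \<open>C\<close> of the tube. As
    \<open>C\<close> is compact, this persists for \<open>x\<close> near \<open>e\<close>.\<close>
  obtain \<delta>2 where \<delta>2: "\<delta>2 > 0"
    "\<And>x y. dist e x < \<delta>2 \<Longrightarrow> infdist y S = \<epsilon> \<Longrightarrow> x \<bullet> y = 0 \<Longrightarrow> Im (c (x, y)) = - 1 \<Longrightarrow> False"
  proof -
    define W where "W = N1 \<inter> (\<lambda>q. (fst q \<bullet> snd q, Im (c q))) -` (- {(0, - 1)})"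
    have oW: "open W" unfolding W_def
      by (intro continuous_open_preimage N1(1) continuous_intros smooth_on_continuous_on
          smooth_on_subset [OF N0(3) N1(3)])
    have sub: "{e} \<times> C \<subseteq> W"
    proof
      fix q assume "q \<in> {e} \<times> C"
      then obtain y where q: "q = (e, y)" "infdist y S = \<epsilon>" by (auto simp: C_def)
      have yN: "(e, y) \<in> N1" using box [of e y] q \<epsilon> by simp
      have "y \<notin> S" using q(2) \<epsilon> by auto
      then have "\<not> (e \<bullet> y = 0 \<and> Im (c (e, y)) = - 1)"
        using init [OF subsetD [OF N1(3) yN]] by (auto simp: ray_tangent_def)
      then show "q \<in> W" using yN q(1) by (auto simp: W_def)
    qed
    obtain X0 where X0: "e \<in> X0" "open X0" "X0 \<times> C \<subseteq> W"
      using Elementary_Topology.tube_lemma [OF cC oW sub] by blast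
    obtain d where d: "d > 0" "ball e d \<subseteq> X0" using X0(1,2) open_contains_ball by blast
    show thesis
    proof (rule that [OF d(1)])
      fix x y assume xy: "dist e x < d" "infdist y S = \<epsilon>" "x \<bullet> y = 0" "Im (c (x, y)) = - 1"
      then have "(x, y) \<in> X0 \<times> C" using d(2) by (auto simp: C_def)
      then have "(x, y) \<in> W" using X0(3) by blast
      then show False using xy(3,4) by (simp add: W_def)
    qed
  qed
  define \<delta> where "\<delta> = min (2 * \<epsilon>) (min \<delta>1 \<delta>2)"
  have \<delta>: "\<delta> > 0" "\<delta> \<le> 2 * \<epsilon>" "\<delta> \<le> \<delta>1" "\<delta> \<le> \<delta>2" using \<epsilon> \<delta>1 \<delta>2 by (auto simp: \<delta>_def)
  interpret f: funk "ball e \<delta> \<times> nS" c by (rule sub_funk [OF \<delta>(2)])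
  have fN1: "q \<in> N1" if "q \<in> ball e \<delta> \<times> nS" for q
    using that box \<delta>(2) by (auto simp: nS_iff)
  have posf: "Im (f.b q h h) > 0" if "q \<in> f.\<Sigma>" "f.\<mu> q h = 0" "h \<noteq> 0" for q h
    using pos1 [OF fN1 [OF f.\<Sigma>_N [OF that(1)]], of h] that(2,3)
    by (simp add: f.b_def f0.b_def f.\<mu>_def f0.\<mu>_def)
  interpret g: convex_funk "ball e \<delta> \<times> nS" c n
    by unfold_locales (use assms(1) posf in auto)
  define U where "U = sphere 0 1 \<inter> ball e \<delta>"
  have fib: "compact (fibre f.\<Sigma> x) \<and> fibre f.\<Sigma> x \<noteq> {}" if x: "x \<in> U" for x
  proof
    have x': "norm x = 1" "dist e x < \<delta>" using x by (auto simp: U_def)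
    let ?K = "{y. infdist y S \<le> \<epsilon>}"
    have cK: "compact ?K" using compact_infdist_le [OF S0(1) assms(3) \<epsilon>] .
    have "continuous_on ?K (\<lambda>y. c (x, y))"
    proof (rule continuous_on_compose2 [OF smooth_on_continuous_on [OF N0(3)]])
      show "(\<lambda>y. (x, y)) ` ?K \<subseteq> N0" using box [of x] x' \<delta>(2) N1(3) by auto
    qed (intro continuous_intros)
    then have cl: "closed (?K \<inter> (\<lambda>y. (x \<bullet> y, Im (c (x, y)))) -` {(0, - 1)})"
      by (intro continuous_closed_preimage continuous_intros compact_imp_closed [OF cK]) auto
    \<comment> \<open>By the choice of \<delta>2 no solution lies on the boundary, so the open tube
      may be replaced by the closed one, and the fibre becomes a closed subset of a compact
      set.\<close>
    have eq: "fibre f.\<Sigma> x = ?K \<inter> (\<lambda>y. (x \<bullet> y, Im (c (x, y)))) -` {(0, - 1)}"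
    proof
      show "fibre f.\<Sigma> x \<subseteq> ?K \<inter> (\<lambda>y. (x \<bullet> y, Im (c (x, y)))) -` {(0, - 1)}"
        by (auto simp: fibre_def f.\<Sigma>_def nS_iff)
      show "?K \<inter> (\<lambda>y. (x \<bullet> y, Im (c (x, y)))) -` {(0, - 1)} \<subseteq> fibre f.\<Sigma> x"
      proof
        fix y assume y: "y \<in> ?K \<inter> (\<lambda>y. (x \<bullet> y, Im (c (x, y)))) -` {(0, - 1)}"
        then have "infdist y S \<noteq> \<epsilon>" using \<delta>2(2) [of x y] x' \<delta>(4) by auto
        then have "y \<in> nS" using y by (auto simp: nS_iff)
        then show "y \<in> fibre f.\<Sigma> x" using y x' by (auto simp: fibre_def f.\<Sigma>_def)
      qed
    qed
    show "compact (fibre f.\<Sigma> x)"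
      unfolding eq using compact_Int_closed [OF cK cl] by (simp only: Int_left_absorb)
    have "(x, p) \<in> M" using \<delta>1(2) x' \<delta>(3) by auto
    then have "R (x, p) \<in> f2.\<Sigma>" "fst (R (x, p)) = x" using R.R_into Rf x' by auto
    then have "(x, snd (R (x, p))) \<in> f2.\<Sigma>" by (metis prod.collapse)
    then have "(x, snd (R (x, p))) \<in> f.\<Sigma>" using x' by (auto simp: f.\<Sigma>_def f2.\<Sigma>_def)
    then show "fibre f.\<Sigma> x \<noteq> {}" by (auto simp: fibre_def)
  qed
  have "finsler_structure U f.\<Sigma>"
    by (rule f.finsler_structure_I) (use posf fib in \<open>auto simp: U_def f.\<Sigma>_def\<close>)
  moreover have "openin (top_of_set ray_space) U"
    unfolding U_def ray_space_eq_sphere by (rule openin_open_Int) simp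
  moreover have "ray v \<in> U" using e1 \<delta>(1) by (simp add: U_def e_def)
  moreover have "{ray v} \<times> S \<subseteq> f.\<Sigma>"
  proof
    fix q assume "q \<in> {ray v} \<times> S"
    then obtain y where q: "q = (e, y)" "y \<in> S" by (auto simp: e_def)
    then have "(e, y) \<in> N0" "y \<in> ?T" "y \<in> nS" using S0 N0 SnS by auto
    then show "q \<in> f.\<Sigma>" using init [of y] q \<delta>(1) e1 by (auto simp: f.\<Sigma>_def ray_tangent_def)
  qed
  ultimately show ?thesis using g.rectilinear g.curvature_one by blast
qed

end
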